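(* Let $X(\xi,t)$ be a solution on $\mathbb{S}^1\times[0,T]$ of $$\partial_t X=\frac{1}{|\partial_\xi X|}\,\partial_\xi\Big(\frac{\partial_\xi X}{|\partial_\xi X|}\Big)-f(L)\Big(\frac{\partial_\xi X}{|\partial_\xi X|}\Big)^{\perp},\qquad X(\xi,0)=X^0(\xi),$$ such that $X\in W^{1,\infty}([0,T],H^2(\mathbb{S}^1))$, with $K_2(X):=\|X\|_{W^{1,\infty}([0,T],H^2(\mathbb{S}^1))}<\infty$, and such that there are constants $0<C_1<C_2$ with $C_1\le|\partial_\xi X(\xi,t)|\le C_2$ for all $(\xi,t)\in\mathbb{S}^1\times[0,T]$. Assume that the partition $0=\xi_0<\xi_1<\dots<\xi_N=2\pi$ of $\mathbb{S}^1$, with $h_j=\xi_j-\xi_{j-1}$ and $h=\max_j h_j$, satisfies, for constants $c_p>0$ and $c_P$, $$\min_j h_j\ge c_p h,\qquad |h_{j+1}-h_j|\le c_P h^2,\quad 1\le j\le N.$$ Then there exists $h_0>0$ such that for all $0<h\le h_0$ there exists a unique semi-discrete solution $x_h(\xi,t)=\sum_{j=1}^N x_j(t)\varphi_j(\xi):\mathbb{S}^1\times[0,T]\to\mathbb{R}^2$, that is, a unique such function with $x_h(\xi,0)=I_hX^0$ and, for all $v_h\in V_h$, $$\int_{\mathbb{S}^1}q_h\,\partial_t x_h\cdot v_h\,d\xi+\int_{\mathbb{S}^1}\tau_h\cdot\partial_\xi v_h\,d\xi+\int_{\mathbb{S}^1}\frac{\mathbf{h}^2q_h}{6}\,\partial_\xi\partial_t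 x_h\cdot\partial_\xi v_h\,d\xi+\int_{\mathbb{S}^1}f(l_h)(\partial_\xi x_h)^\perp\cdot v_h\,d\xi=0.$$ Furthermore, the solution satisfies $$\int_0^T\|\partial_tX-\partial_tx_h\|_{L^2}^2\,dt+\sup_{t\in[0,T]}\|X-x_h\|_{H^1}^2\le Ch^2,$$ where $h_0$ and $C$ depend on $c_p,c_P,C_1,C_2,T,K_2(X)$ and $f$.
   Context: $\mathbb{S}^1=[0,2\pi]$ with endpoints identified (all functions on it are $2\pi$-periodic; indices are periodic, $a_j=a_{j\pm N}$); $(a,b)^\perp:=(-b,a)$; $X:\mathbb{S}^1\times[0,T]\to\mathbb{R}^2$ parametrizes a closed plane curve; $L=L(t)=\int_{\mathbb{S}^1}|\partial_\xi X|\,d\xi$ is its perimeter; $f$ is a given real-valued Lipschitz function of the perimeter (a positive real variable). Norms $L^2,H^1$ are over $\mathbb{S}^1$ in $\xi$. $I_j=[\xi_{j-1},\xi_j]$. $V_h=\{v\in C(\mathbb{S}^1,\mathbb{R}^2): v|_{I_j}\text{ is a polynomial of degree}\le1\text{ for }1\le j\le N,\ v(\xi_0)=v(\xi_N)\}$; $\varphi_j$ is the periodic piecewise linear Lagrange basis function with $\varphi_j(\xi_i)=\delta_{ij}$; $I_hv=\sum_{j=1}^N v(\xi_j)\varphi_j$ is linear interpolation. For $x_h=\sum_j x_j\varphi_j$: $q_h=|\partial_\xi x_h|$, $\tau_h=\partial_\xi x_h/|\partial_\xi x_h|$ (piecewise constant), $l_h=\sum_{j=1}^N|x_j-x_{j-1}|$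 is the perimeter of the polygon with vertices $x_j$, and $\mathbf{h}=\sum_{j=1}^N h_j\chi_{I_j}$ with $\chi$ the characteristic function. *)

theory Defs
  imports "HOL-Analysis.Analysis" "HOL-Probability.Essential_Supremum"
begin

section \<open>Sobolev spaces on the circle\<close>

text \<open>
  The circle is \<open>[0, 2\<pi>]\<close> with endpoints identified. Elements of Lebesgue and Sobolev spaces are
  represented by functions on the real line of which only the values almost everywhere
  in \<open>[0, 2\<pi>]\<close> matter.
\<close>

abbreviation circle :: "real measure" where
  "circle \<equiv> lebesgue_on {0..2 * pi}"

definition periodic :: "(real \<Rightarrow> 'a) \<Rightarrow> bool" where
  "periodic v \<longleftrightarrow> (\<forall>s. v (s + 2 * pi) = v s)"

definition smooth :: "(real \<Rightarrow> real) \<Rightarrow> bool" where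
  "smooth \<phi> \<longleftrightarrow> (\<forall>n. (deriv ^^ n) \<phi> differentiable_on UNIV)"

definition L2 :: "(real \<Rightarrow> real^2) \<Rightarrow> bool" where
  "L2 u \<longleftrightarrow> u \<in> borel_measurable circle \<and> integrable circle (\<lambda>s. (norm (u s))\<^sup>2)"

definition L2_norm :: "(real \<Rightarrow> real^2) \<Rightarrow> real" where
  "L2_norm u = sqrt (LINT s|circle. (norm (u s))\<^sup>2)"

definition is_weak_deriv :: "(real \<Rightarrow> real^2) \<Rightarrow> (real \<Rightarrow> real^2) \<Rightarrow> bool" where
  "is_weak_deriv u g \<longleftrightarrow>
     (\<forall>\<phi>. smooth \<phi> \<and> periodic \<phi> \<longrightarrow>
        (LINT s|circle. deriv \<phi> s *\<^sub>R u s) = - (LINT s|circle. \<phi> s *\<^sub>R g s))"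

definition H1 :: "(real \<Rightarrow> real^2) \<Rightarrow> bool" where
  "H1 u \<longleftrightarrow> L2 u \<and> (\<exists>g. L2 g \<and> is_weak_deriv u g)"

text \<open>Some representative of the weak derivative, which is unique up to null sets.\<close>

definition weak_deriv :: "(real \<Rightarrow> real^2) \<Rightarrow> real \<Rightarrow> real^2" where
  "weak_deriv u = (SOME g. L2 g \<and> is_weak_deriv u g)"

definition H1_norm :: "(real \<Rightarrow> real^2) \<Rightarrow> real" where
  "H1_norm u = sqrt ((L2_norm u)\<^sup>2 + (L2_norm (weak_deriv u))\<^sup>2)"

definition H2 :: "(real \<Rightarrow> real^2) \<Rightarrow> bool" where
  "H2 u \<longleftrightarrow> H1 u \<and> H1 (weak_deriv u)"

definition H2_norm :: "(real \<Rightarrow> real^2) \<Rightarrow> real" where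
  "H2_norm u = sqrt ((L2_norm u)\<^sup>2 + (L2_norm (weak_deriv u))\<^sup>2
                      + (L2_norm (weak_deriv (weak_deriv u)))\<^sup>2)"


section \<open>The space \<open>W\<^sup>1\<^sup>,\<^sup>\<infinity>([0,T], H\<^sup>2)\<close>\<close>

text \<open>
  Time-dependent curves are written with the time variable first, so that \<open>X t\<close> is the curve at
  time \<open>t\<close>. Since \<open>H\<^sup>2\<close> is a set of functions with a seminorm and not a type, the Bochner integral
  of \<open>H\<^sup>2\<close>-valued functions is spelled out here, following the library's
  \<^const>\<open>has_bochner_integral\<close>.
\<close>

definition H2_simple :: "real \<Rightarrow> (real \<Rightarrow> real \<Rightarrow> real^2) \<Rightarrow> bool" where
  "H2_simple T u \<longleftrightarrow> finite (u ` {0..T}) \<and> (\<forall>t\<in>{0..T}. H2 (u t)) \<and>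
     (\<forall>w. {t \<in> {0..T}. u t = w} \<in> sets lebesgue)"

definition H2_simple_integral :: "real \<Rightarrow> (real \<Rightarrow> real \<Rightarrow> real^2) \<Rightarrow> real \<Rightarrow> real^2" where
  "H2_simple_integral T u =
     (\<lambda>s. \<Sum>w\<in>u ` {0..T}. measure lebesgue {t \<in> {0..T}. u t = w} *\<^sub>R w s)"

definition H2_measurable :: "real \<Rightarrow> (real \<Rightarrow> real \<Rightarrow> real^2) \<Rightarrow> bool" where
  "H2_measurable T u \<longleftrightarrow> (\<forall>t\<in>{0..T}. H2 (u t)) \<and>
     (\<exists>\<sigma>. (\<forall>n. H2_simple T (\<sigma> n)) \<and>
        (AE t in lebesgue_on {0..T}. (\<lambda>n. H2_norm (\<lambda>s. u t s - \<sigma> n t s)) \<longlonglongrightarrow> 0))"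

definition has_H2_integral ::
  "real \<Rightarrow> (real \<Rightarrow> real \<Rightarrow> real^2) \<Rightarrow> (real \<Rightarrow> real^2) \<Rightarrow> bool" where
  "has_H2_integral T u v \<longleftrightarrow> H2_measurable T u \<and> H2 v \<and>
     (\<exists>\<sigma>. (\<forall>n. H2_simple T (\<sigma> n)) \<and>
        (\<lambda>n. \<integral>\<^sup>+t. ennreal (H2_norm (\<lambda>s. u t s - \<sigma> n t s)) \<partial>lebesgue_on {0..T}) \<longlonglongrightarrow> 0 \<and>
        (\<lambda>n. H2_norm (\<lambda>s. H2_simple_integral T (\<sigma> n) s - v s)) \<longlonglongrightarrow> 0)"

definition Linf_H2 :: "real \<Rightarrow> (real \<Rightarrow> real \<Rightarrow> real^2) \<Rightarrow> bool" where
  "Linf_H2 T u \<longleftrightarrow> H2_measurable T u \<and>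
     esssup (lebesgue_on {0..T}) (\<lambda>t. ereal (H2_norm (u t))) < \<infinity>"

text \<open>
  Weak time derivative: \<open>\<integral> \<phi>' u dt = - \<integral> \<phi> w dt\<close> in \<open>H\<^sup>2\<close> for all test functions \<open>\<phi>\<close> with compact
  support in \<open>(0,T)\<close>; the common value of the two sides is \<open>v\<close>.
\<close>

definition is_weak_time_deriv ::
  "real \<Rightarrow> (real \<Rightarrow> real \<Rightarrow> real^2) \<Rightarrow> (real \<Rightarrow> real \<Rightarrow> real^2) \<Rightarrow> bool" where
  "is_weak_time_deriv T u w \<longleftrightarrow>
     (\<forall>\<phi>. smooth \<phi> \<and> (\<exists>a b. 0 < a \<and> b < T \<and> (\<forall>t. t \<notin> {a..b} \<longrightarrow> \<phi> t = 0)) \<longrightarrow>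
        (\<exists>v. has_H2_integral T (\<lambda>t s. deriv \<phi> t *\<^sub>R u t s) v \<and>
             has_H2_integral T (\<lambda>t s. - (\<phi> t *\<^sub>R w t s)) v))"

definition W1inf_H2 :: "real \<Rightarrow> (real \<Rightarrow> real \<Rightarrow> real^2) \<Rightarrow> bool" where
  "W1inf_H2 T u \<longleftrightarrow> Linf_H2 T u \<and> (\<exists>w. Linf_H2 T w \<and> is_weak_time_deriv T u w)"

definition time_deriv :: "real \<Rightarrow> (real \<Rightarrow> real \<Rightarrow> real^2) \<Rightarrow> real \<Rightarrow> real \<Rightarrow> real^2" where
  "time_deriv T u = (SOME w. Linf_H2 T w \<and> is_weak_time_deriv T u w)"

definition W1inf_H2_norm :: "real \<Rightarrow> (real \<Rightarrow> real \<Rightarrow> real^2) \<Rightarrow> ereal" where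
  "W1inf_H2_norm T u =
     esssup (lebesgue_on {0..T}) (\<lambda>t. ereal (H2_norm (u t) + H2_norm (time_deriv T u t)))"


section \<open>Forced curve shortening flow\<close>

definition perp :: "real^2 \<Rightarrow> real^2" where
  "perp v = vector [- (v $ 2), v $ 1]"

abbreviation dxi :: "(real \<Rightarrow> real^2) \<Rightarrow> real \<Rightarrow> real^2" where
  "dxi v s \<equiv> vector_derivative v (at s)"

definition speed :: "(real \<Rightarrow> real^2) \<Rightarrow> real \<Rightarrow> real" where
  "speed v s = norm (dxi v s)"

definition tangent :: "(real \<Rightarrow> real^2) \<Rightarrow> real \<Rightarrow> real^2" where
  "tangent v s = dxi v s /\<^sub>R norm (dxi v s)"

definition perimeter :: "(real \<Rightarrow> real^2) \<Rightarrow> real" where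
  "perimeter v = (LINT s|circle. speed v s)"

text \<open>
  A function in \<open>W\<^sup>1\<^sup>,\<^sup>\<infinity>([0,T], H\<^sup>2)\<close> has a unique jointly continuous periodic representative, whose
  curves \<open>X t\<close> are continuously differentiable, so that the classical derivative \<^const>\<open>dxi\<close>, the
  pointwise bounds on it and the initial value are meaningful. The first clause selects this
  representative. The equation involves second derivatives and holds almost everywhere.
\<close>

definition flow_solution ::
  "(real \<Rightarrow> real) \<Rightarrow> real \<Rightarrow> (real \<Rightarrow> real^2) \<Rightarrow> (real \<Rightarrow> real \<Rightarrow> real^2) \<Rightarrow> bool" where
  "flow_solution f T X0 X \<longleftrightarrow>
     continuous_on ({0..T} \<times> UNIV) (\<lambda>(t, s). X t s) \<and> (\<forall>t\<in>{0..T}. periodic (X t)) \<and>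
     W1inf_H2 T X \<and>
     X 0 = X0 \<and>
     (AE t in lebesgue_on {0..T}. H1 (tangent (X t)) \<and>
        (AE s in circle.
           time_deriv T X t s =
             (1 / speed (X t) s) *\<^sub>R weak_deriv (tangent (X t)) s
             - f (perimeter (X t)) *\<^sub>R perp (tangent (X t) s)))"


section \<open>Finite elements\<close>

definition is_partition :: "nat \<Rightarrow> (nat \<Rightarrow> real) \<Rightarrow> bool" where
  "is_partition N \<xi> \<longleftrightarrow> \<xi> 0 = 0 \<and> \<xi> N = 2 * pi \<and> (\<forall>j\<in>{1..N}. \<xi> (j - 1) < \<xi> j)"

definition mesh_step :: "(nat \<Rightarrow> real) \<Rightarrow> nat \<Rightarrow> real" where
  "mesh_step \<xi> j = \<xi> j - \<xi> (j - 1)"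

definition mesh_size :: "nat \<Rightarrow> (nat \<Rightarrow> real) \<Rightarrow> real" where
  "mesh_size N \<xi> = Max (mesh_step \<xi> ` {1..N})"

text \<open>For \<open>j = N\<close> the neighbouring step is the first one, by periodicity of the indices.\<close>

definition regular_mesh :: "real \<Rightarrow> real \<Rightarrow> nat \<Rightarrow> (nat \<Rightarrow> real) \<Rightarrow> bool" where
  "regular_mesh c\<^sub>p c\<^sub>P N \<xi> \<longleftrightarrow>
     Min (mesh_step \<xi> ` {1..N}) \<ge> c\<^sub>p * mesh_size N \<xi> \<and>
     (\<forall>j\<in>{1..N}. \<bar>mesh_step \<xi> (if j = N then 1 else j + 1) - mesh_step \<xi> j\<bar>
        \<le> c\<^sub>P * (mesh_size N \<xi>)\<^sup>2)"

definition pw_linear :: "nat \<Rightarrow> (nat \<Rightarrow> real) \<Rightarrow> (real \<Rightarrow> 'a::real_normed_vector) \<Rightarrow> bool" where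
  "pw_linear N \<xi> v \<longleftrightarrow> continuous_on UNIV v \<and> periodic v \<and>
     (\<forall>j\<in>{1..N}. \<exists>a b. \<forall>s\<in>{\<xi> (j - 1)..\<xi> j}. v s = a + s *\<^sub>R b)"

definition V\<^sub>h :: "nat \<Rightarrow> (nat \<Rightarrow> real) \<Rightarrow> (real \<Rightarrow> real^2) set" where
  "V\<^sub>h N \<xi> = {v. pw_linear N \<xi> v}"

definition hat :: "nat \<Rightarrow> (nat \<Rightarrow> real) \<Rightarrow> nat \<Rightarrow> real \<Rightarrow> real" where
  "hat N \<xi> j = (THE \<phi>. pw_linear N \<xi> \<phi> \<and> (\<forall>i\<in>{1..N}. \<phi> (\<xi> i) = (if i = j then 1 else 0)))"

text \<open>The description in \<^const>\<open>hat\<close> determines a unique function; see \<open>ex1_hat\<close> below.\<close>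

lemma partition_mono:
  assumes "is_partition N \<xi>" "i \<le> j" "j \<le> N"
  shows "\<xi> i \<le> \<xi> j"
  using assms(2,3)
proof (induction j rule: dec_induct)
  case (step k)
  have "\<forall>j\<in>{1..N}. \<xi> (j - 1) < \<xi> j"
    using assms(1) by (simp add: is_partition_def)
  from bspec[OF this, of "Suc k"] have "\<xi> k < \<xi> (Suc k)"
    using step.prems by simp
  with step show ?case by simp
qed simp

lemma partition_cover:
  assumes "is_partition N \<xi>" "0 \<le> s" "s \<le> 2 * pi"
  obtains j where "j \<in> {1..N}" "s \<in> {\<xi> (j - 1)..\<xi> j}"
proof -
  define j where "j = (LEAST j. s \<le> \<xi> j)"
  have N: "s \<le> \<xi> N" "\<xi> 0 = 0" and N0: "N > 0"
    using assms by (auto simp: is_partition_def intro!: Nat.gr0I)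
  have j: "s \<le> \<xi> j" "j \<le> N"
    using N unfolding j_def by (auto intro: LeastI Least_le)
  show ?thesis
  proof (cases "j = 0")
    case True
    then have "s = \<xi> 0" using j N assms(2) by simp
    then show ?thesis
      using that[of 1] N0 partition_mono[OF assms(1), of 0 1] by simp
  next
    case False
    then have "\<not> s \<le> \<xi> (j - 1)" unfolding j_def by (intro not_less_Least) simp
    then show ?thesis using that[of j] j False by simp
  qed
qed

lemma periodic_int:
  assumes "periodic v"
  shows "v (s + 2 * pi * of_int m) = v s"
proof -
  have n: "v (s + 2 * pi * real n) = v s" for s n
  proof (induction n)
    case (Suc n)
    have e: "s + 2 * pi * real (Suc n) = (s + 2 * pi * real n) + 2 * pi"
      by (simp only: of_nat_Suc distrib_left mult_1_right ac_simps)
    have "v ((s + 2 * pi * real n) + 2 * pi) = v (s + 2 * pi * real n)"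
      using assms unfolding periodic_def by (rule spec)
    then show ?case using Suc unfolding e by (rule trans)
  qed simp
  show ?thesis
  proof (cases "m \<ge> 0")
    case True
    then have "real (nat m) = of_int m" by simp
    then show ?thesis using n[of s "nat m"] by metis
  next
    case False
    then have "real (nat (- m)) = - of_int m" by simp
    then have "s + 2 * pi * of_int m + 2 * pi * real (nat (- m)) = s" by simp
    then show ?thesis using n[of "s + 2 * pi * of_int m" "nat (- m)"] by metis
  qed
qed

lemma ex1_hat:
  assumes P: "is_partition N \<xi>" and j: "j \<in> {1..N}"
  shows "\<exists>!\<phi>::real \<Rightarrow> real. pw_linear N \<xi> \<phi> \<and> (\<forall>i\<in>{1..N}. \<phi> (\<xi> i) = (if i = j then 1 else 0))"
proof (rule ex_ex1I)
  define y :: "nat \<Rightarrow> real" where "y i = (if i = j \<or> i = 0 \<and> j = N then 1 else 0)" for i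
  define r where "r k s = max 0 (min 1 ((s - \<xi> (k - 1)) / (\<xi> k - \<xi> (k - 1))))" for k s
  define G where "G s = (\<Sum>k=1..N. (y k - y (k - 1)) * r k s)" for s
  have \<xi>: "\<xi> 0 = 0" "\<xi> N = 2 * pi" and lt: "k \<in> {1..N} \<Longrightarrow> \<xi> (k - 1) < \<xi> k" for k
    using P by (auto simp: is_partition_def)
  have y0N: "y N = y 0" using j by (auto simp: y_def)
  have tele: "(\<Sum>k=1..m. y k - y (k - 1)) = y m - y 0" for m
    by (induction m) auto
  have r0: "r k s = 0" if "k \<in> {1..N}" "s \<le> \<xi> (k - 1)" for k s
    using lt[OF that(1)] that(2) divide_nonpos_pos[of "s - \<xi> (k - 1)" "\<xi> k - \<xi> (k - 1)"]
    by (simp add: r_def)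
  have r1: "r k s = 1" if "k \<in> {1..N}" "s \<ge> \<xi> k" for k s
  proof -
    have "1 \<le> (s - \<xi> (k - 1)) / (\<xi> k - \<xi> (k - 1))"
      using lt[OF that(1)] that(2) by (subst le_divide_eq_1_pos) auto
    then show ?thesis by (simp add: r_def)
  qed
  have Gpiece: "G s = (y (m - 1) - y 0) + (y m - y (m - 1)) * ((s - \<xi> (m - 1)) / (\<xi> m - \<xi> (m - 1)))"
    if m: "m \<in> {1..N}" and s: "s \<in> {\<xi> (m - 1)..\<xi> m}" for m s
  proof -
    have "G s = (\<Sum>k\<in>{1..N}. (if k < m then y k - y (k - 1) else 0) + (if k = m then (y k - y (k - 1)) * r k s else 0))"
      unfolding G_def
    proof (rule sum.cong[OF refl])
      fix k assume k: "k \<in> {1..N}"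
      consider "k < m" | "k = m" | "k > m" by linarith
      then show "(y k - y (k - 1)) * r k s = (if k < m then y k - y (k - 1) else 0)
          + (if k = m then (y k - y (k - 1)) * r k s else 0)"
      proof cases
        case 1
        then have "\<xi> k \<le> \<xi> (m - 1)" using m by (intro partition_mono[OF P]) auto
        then show ?thesis using 1 r1[OF k] s by simp
      next
        case 3
        then have "\<xi> m \<le> \<xi> (k - 1)" using k by (intro partition_mono[OF P]) auto
        then show ?thesis using 3 r0[OF k] s by simp
      qed simp
    qed
    also have "\<dots> = (\<Sum>k\<in>{1..N}. if k < m then y k - y (k - 1) else 0) + (y m - y (m - 1)) * r m s"
      using m by (simp add: sum.distrib)
    also have "(\<Sum>k\<in>{1..N}. if k < m then y k - y (k - 1) else 0) = (\<Sum>k=1..m-1. y k - y (k - 1))"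
      using m by (intro sum.mono_neutral_cong_right) auto
    also have "\<dots> = y (m - 1) - y 0" by (rule tele)
    also have "r m s = (s - \<xi> (m - 1)) / (\<xi> m - \<xi> (m - 1))"
    proof -
      have "0 \<le> (s - \<xi> (m - 1)) / (\<xi> m - \<xi> (m - 1))" "(s - \<xi> (m - 1)) / (\<xi> m - \<xi> (m - 1)) \<le> 1"
        using lt[OF m] s by (simp_all add: divide_le_eq_1_pos)
      then show ?thesis by (simp add: r_def)
    qed
    finally show ?thesis .
  qed
  have G0: "G s = 0" if "s \<le> 0" for s
  proof -
    have "r k s = 0" if "k \<in> {1..N}" for k
    proof (rule r0[OF that])
      have "k - 1 \<le> N" using that by auto
      then show "s \<le> \<xi> (k - 1)" using partition_mono[OF P, of 0 "k - 1"] \<open>s \<le> 0\<close> \<xi> by simp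
    qed
    then show ?thesis by (simp add: G_def)
  qed
  have G1: "G s = 0" if "s \<ge> 2 * pi" for s
  proof -
    have "r k s = 1" if "k \<in> {1..N}" for k
      using r1[OF that] partition_mono[OF P, of k N] that \<open>s \<ge> 2 * pi\<close> \<xi> by auto
    then have "G s = (\<Sum>k=1..N. y k - y (k - 1))" by (simp add: G_def)
    then show ?thesis using tele[of N] y0N by simp
  qed
  have Gc: "continuous_on UNIV G"
  proof -
    have "continuous_on UNIV (\<lambda>s. (y k - y (k - 1)) * max 0 (min 1 ((s - \<xi> (k - 1)) * inverse (\<xi> k - \<xi> (k - 1)))))" for k
      by (intro continuous_intros)
    then show ?thesis unfolding G_def r_def divide_inverse by (intro continuous_on_sum)
  qed
  define \<phi> where "\<phi> s = y 0 + G (s - 2 * pi * of_int \<lfloor>s / (2 * pi)\<rfloor>)" for s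
  have per: "periodic \<phi>"
    unfolding periodic_def
  proof
    fix s :: real
    have "(s + 2 * pi) / (2 * pi) = s / (2 * pi) + 1" by (simp add: field_simps)
    then have "\<lfloor>(s + 2 * pi) / (2 * pi)\<rfloor> = \<lfloor>s / (2 * pi)\<rfloor> + 1" by linarith
    then show "\<phi> (s + 2 * pi) = \<phi> s" by (simp add: \<phi>_def algebra_simps)
  qed
  have loc: "\<phi> s = y 0 + (G (s - 2 * pi * (of_int m - 1)) + G (s - 2 * pi * of_int m))"
    if s: "s \<in> {2 * pi * (of_int m - 1)<..<2 * pi * (of_int m + 1)}" for s and m :: int
  proof (cases "s < 2 * pi * of_int m")
    case True
    then have "\<lfloor>s / (2 * pi)\<rfloor> = m - 1" using s
      by (intro floor_unique) (auto simp: field_simps)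
    then show ?thesis using G0[of "s - 2 * pi * of_int m"] True by (simp add: \<phi>_def)
  next
    case False
    then have "\<lfloor>s / (2 * pi)\<rfloor> = m" using s
      by (intro floor_unique) (auto simp: field_simps)
    moreover have "s - 2 * pi * (of_int m - 1) \<ge> 2 * pi" using False by (simp add: algebra_simps)
    ultimately show ?thesis using G1 by (simp add: \<phi>_def)
  qed
  have cont: "continuous_on UNIV \<phi>"
  proof (rule continuous_at_imp_continuous_on, rule ballI)
    fix s0 :: real
    define m where "m = \<lfloor>s0 / (2 * pi)\<rfloor>"
    let ?U = "{2 * pi * (of_int m - 1)<..<2 * pi * (of_int m + 1)} :: real set"
    have "of_int m \<le> s0 / (2 * pi)" "s0 / (2 * pi) < of_int m + 1"
      unfolding m_def by linarith+
    then have "2 * pi * of_int m \<le> s0" "s0 < 2 * pi * (of_int m + 1)"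
      by (simp_all add: field_simps)
    then have s0: "s0 \<in> ?U" by (simp add: algebra_simps)
    have "continuous_on ?U (\<lambda>s. y 0 + (G (s - 2 * pi * (of_int m - 1)) + G (s - 2 * pi * of_int m)))"
      by (intro continuous_intros continuous_on_compose2[OF Gc]) auto
    then have "continuous_on ?U \<phi>"
      by (rule continuous_on_eq) (simp add: loc)
    then show "continuous (at s0) \<phi>"
      using s0 continuous_on_eq_continuous_at[of ?U \<phi>] by simp
  qed
  have on: "\<phi> s = y 0 + G s" if "s \<in> {0..2 * pi}" for s
  proof (cases "s = 2 * pi")
    case True
    then show ?thesis using G0[of 0] G1[of "2 * pi"] by (simp add: \<phi>_def)
  next
    case False
    then have "\<lfloor>s / (2 * pi)\<rfloor> = 0" using that by (intro floor_unique) (auto simp: field_simps)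
    then show ?thesis by (simp add: \<phi>_def)
  qed
  have sub: "s \<in> {0..2 * pi}" if "k \<in> {1..N}" "s \<in> {\<xi> (k - 1)..\<xi> k}" for k s
  proof -
    have "0 \<le> k - 1" "k - 1 \<le> N" using that by auto
    then have "0 \<le> \<xi> (k - 1)" using partition_mono[OF P, of 0 "k - 1"] \<xi> by simp
    then show ?thesis using that partition_mono[OF P, of k N] \<xi> by simp
  qed
  have "pw_linear N \<xi> \<phi>"
    unfolding pw_linear_def
  proof (intro conjI ballI cont per)
    fix k assume k: "k \<in> {1..N}"
    define d where "d = (y k - y (k - 1)) / (\<xi> k - \<xi> (k - 1))"
    have "\<phi> s = (y (k - 1) - d * \<xi> (k - 1)) + s *\<^sub>R d" if "s \<in> {\<xi> (k - 1)..\<xi> k}" for s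
    proof -
      have "\<phi> s = y (k - 1) + d * (s - \<xi> (k - 1))"
        using on[OF sub[OF k that]] Gpiece[OF k that] by (simp add: d_def)
      then show ?thesis by (simp add: algebra_simps)
    qed
    then show "\<exists>a b. \<forall>s\<in>{\<xi> (k - 1)..\<xi> k}. \<phi> s = a + s *\<^sub>R b" by blast
  qed
  moreover have "\<phi> (\<xi> i) = (if i = j then 1 else 0)" if i: "i \<in> {1..N}" for i
  proof -
    have "\<xi> i \<in> {\<xi> (i - 1)..\<xi> i}" using lt[OF i] by simp
    from on[OF sub[OF i this]] Gpiece[OF i this] have "\<phi> (\<xi> i) = y i"
      using lt[OF i] by simp
    then show ?thesis using i by (simp add: y_def)
  qed
  ultimately show "\<exists>\<phi>::real \<Rightarrow> real. pw_linear N \<xi> \<phi> \<and> (\<forall>i\<in>{1..N}. \<phi> (\<xi> i) = (if i = j then 1 else 0))"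
    by blast
next
  fix \<phi> \<psi> :: "real \<Rightarrow> real"
  assume A: "pw_linear N \<xi> \<phi> \<and> (\<forall>i\<in>{1..N}. \<phi> (\<xi> i) = (if i = j then 1 else 0))"
    and B: "pw_linear N \<xi> \<psi> \<and> (\<forall>i\<in>{1..N}. \<psi> (\<xi> i) = (if i = j then 1 else 0))"
  have \<xi>: "\<xi> 0 = 0" "\<xi> N = 2 * pi" and lt: "k \<in> {1..N} \<Longrightarrow> \<xi> (k - 1) < \<xi> k" for k
    using P by (auto simp: is_partition_def)
  have per: "periodic \<phi>" "periodic \<psi>" using A B by (auto simp: pw_linear_def)
  have node: "\<phi> (\<xi> i) = \<psi> (\<xi> i)" if "i \<le> N" for i
  proof (cases "i = 0")
    case True
    have "\<phi> (\<xi> 0) = \<phi> (\<xi> N)" "\<psi> (\<xi> 0) = \<psi> (\<xi> N)"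
      using per[unfolded periodic_def, THEN spec, of 0] by (simp_all add: \<xi>)
    then show ?thesis using True A B j by simp
  qed (use A B that in simp)
  have eq: "\<phi> s = \<psi> s" if "s \<in> {0..2 * pi}" for s
  proof -
    have "0 \<le> s" "s \<le> 2 * pi" using that by auto
    then obtain k where k: "k \<in> {1..N}" "s \<in> {\<xi> (k - 1)..\<xi> k}"
      by (rule partition_cover[OF P])
    obtain a b a' b' where ab: "\<forall>s\<in>{\<xi> (k - 1)..\<xi> k}. \<phi> s = a + s *\<^sub>R b"
      "\<forall>s\<in>{\<xi> (k - 1)..\<xi> k}. \<psi> s = a' + s *\<^sub>R b'"
      using A B k(1) unfolding pw_linear_def by blast
    have e: "a + \<xi> (k - 1) * b = a' + \<xi> (k - 1) * b'" "a + \<xi> k * b = a' + \<xi> k * b'"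
      using node[of "k - 1"] node[of k] ab k(1) lt[OF k(1)] by auto
    then have "(\<xi> k - \<xi> (k - 1)) * (b - b') = 0" by (simp add: algebra_simps)
    then have "b = b'" using lt[OF k(1)] by simp
    with e ab k show ?thesis by simp
  qed
  show "\<phi> = \<psi>"
  proof
    fix s :: real
    define m where "m = \<lfloor>s / (2 * pi)\<rfloor>"
    have "of_int m \<le> s / (2 * pi)" "s / (2 * pi) < of_int m + 1"
      unfolding m_def by linarith+
    then have "s - 2 * pi * of_int m \<in> {0..2 * pi}" by (simp add: field_simps)
    then have "\<phi> (s - 2 * pi * of_int m) = \<psi> (s - 2 * pi * of_int m)" by (rule eq)
    then show "\<phi> s = \<psi> s"
      using periodic_int[OF per(1), of "s - 2 * pi * of_int m" m]
        periodic_int[OF per(2), of "s - 2 * pi * of_int m" m] by simp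
  qed
qed

definition interpolate :: "nat \<Rightarrow> (nat \<Rightarrow> real) \<Rightarrow> (real \<Rightarrow> real^2) \<Rightarrow> real \<Rightarrow> real^2" where
  "interpolate N \<xi> v s = (\<Sum>j=1..N. hat N \<xi> j s *\<^sub>R v (\<xi> j))"

definition mesh_fun :: "nat \<Rightarrow> (nat \<Rightarrow> real) \<Rightarrow> real \<Rightarrow> real" where
  "mesh_fun N \<xi> s = (\<Sum>j=1..N. mesh_step \<xi> j * indicator {\<xi> (j - 1)..\<xi> j} s)"

definition polygon_length :: "nat \<Rightarrow> (nat \<Rightarrow> real) \<Rightarrow> (real \<Rightarrow> real^2) \<Rightarrow> real" where
  "polygon_length N \<xi> v = (\<Sum>j=1..N. norm (v (\<xi> j) - v (\<xi> (j - 1))))"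

definition dt :: "real \<Rightarrow> (real \<Rightarrow> real \<Rightarrow> real^2) \<Rightarrow> real \<Rightarrow> real \<Rightarrow> real^2" where
  "dt T x t s = vector_derivative (\<lambda>r. x r s) (at t within {0..T})"

text \<open>
  The derivatives of finite element functions are taken classically; they exist except at the
  nodes, which form a null set. Consecutive vertices are required to be distinct because
  the unit tangent of \<open>x t\<close> is otherwise undefined.
\<close>

definition semidiscrete_solution ::
  "(real \<Rightarrow> real) \<Rightarrow> real \<Rightarrow> nat \<Rightarrow> (nat \<Rightarrow> real) \<Rightarrow> (real \<Rightarrow> real^2)
     \<Rightarrow> (real \<Rightarrow> real \<Rightarrow> real^2) \<Rightarrow> bool" where
  "semidiscrete_solution f T N \<xi> X0 x \<longleftrightarrow>
     (\<exists>c. (\<forall>j\<in>{1..N}. c j differentiable_on {0..T}) \<and>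
          (\<forall>t\<in>{0..T}. \<forall>s. x t s = (\<Sum>j=1..N. hat N \<xi> j s *\<^sub>R c j t))) \<and>
     (\<forall>t\<in>{0..T}. \<forall>j\<in>{1..N}. x t (\<xi> (j - 1)) \<noteq> x t (\<xi> j)) \<and>
     x 0 = interpolate N \<xi> X0 \<and>
     (\<forall>t\<in>{0..T}. \<forall>v\<in>V\<^sub>h N \<xi>.
        (LINT s|circle. speed (x t) s * (dt T x t s \<bullet> v s))
        + (LINT s|circle. tangent (x t) s \<bullet> dxi v s)
        + (LINT s|circle. (mesh_fun N \<xi> s)\<^sup>2 * speed (x t) s / 6 * (dxi (dt T x t) s \<bullet> dxi v s))
        + (LINT s|circle. f (polygon_length N \<xi> (x t)) * (perp (dxi (x t) s) \<bullet> v s)) = 0)"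

end

theory Submission
  imports Defs
begin

text \<open>
  Let \<open>d\<^sub>j = q\<^sub>j \<tau>\<^sub>j\<close> be the edges of the polygon with vertices \<open>x\<^sub>j\<close>. Because of the term with \<open>h\<^sup>2/6\<close>,
  testing the scheme with the hat functions gives a diagonal mass matrix, so the scheme is the system
  \<open>(q\<^sub>j + q\<^sub>j\<^sub>+\<^sub>1)/2 x\<^sub>j' = \<tau>\<^sub>j\<^sub>+\<^sub>1 - \<tau>\<^sub>j - f(l) (d\<^sub>j + d\<^sub>j\<^sub>+\<^sub>1)\<^sup>\<perp>/2\<close>. With \<open>Q\<^sub>j\<close>, \<open>T\<^sub>j\<close> the lengths and directions of the
  edges spanned by the nodes of \<open>X\<close>, and \<open>A\<close> the mesh size times the sum of the squared velocity errors,
  the energy \<open>S = \<Sum>\<^sub>j (Q\<^sub>j - q\<^sub>j)\<^sup>2/h + q\<^sub>j (1 - T\<^sub>j \<bullet> \<tau>\<^sub>j)\<close> satisfies \<open>S' \<le> - c A + C (S + h\<^sup>2)\<close> as long as \<open>|Q\<^sub>j - q\<^sub>j|\<close> is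
  small against \<open>h\<close>. Gronwall's inequality makes \<open>S\<close> of order \<open>h\<^sup>2\<close>, which in turn keeps \<open>|Q\<^sub>j - q\<^sub>j|\<close> of order
  \<open>h\<^sup>3\<^sup>/\<^sup>2\<close>; hence a globally Lipschitz truncation of the system is never active and its solution exists
  on all of \<open>[0,T]\<close>. The regularity needed of \<open>X\<close> comes from the flow equation: the uniform \<open>H\<^sup>2\<close> bounds
  make the space derivatives of \<open>X\<close> and of its unit tangent jointly continuous.
\<close>

text \<open>The flow prescribes normal velocities: it diffuses directions, while edge lengths follow
  an ordinary differential equation without smoothing. Hence the edge error is split into length and
  direction, and the weight \<open>1 / h\<close> brings both parts to the scale of a squared H1
  seminorm, edges being of length about \<open>h\<close>. The rate of a length error contains the
  square of a velocity error, which has no pointwise bound. It is absorbed by the dissipation only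
  while \<open>|Q_j - q_j|\<close> is below a small multiple of \<open>h\<close>; the constant
  \<open>19200 * B^9\<close> is this threshold and the reason for a continuation argument. Since
  \<open>X\<close> is only H2 in space, the consistency defect of a cell is \<open>h^2\<close> plus
  \<open>h\<close> times the oscillation of the space derivative: its squares sum to order
  \<open>h^3\<close>, but it need not be of order \<open>h^2\<close> in each cell. That is just what
  \<open>S\<close> tolerates. The condition on neighbouring mesh steps makes neighbouring edge
  lengths agree to the same order. All bounds on the data enter one number \<open>G \<ge> 1\<close>,
  derived bounds one multiple \<open>B\<close> of a power of it, so that monomials are compared by
  their exponents.\<close>

abbreviation period_interval :: "real set" ("\<I>") where "\<I> \<equiv> {0..2 * pi}"

section \<open>Energy balance of the vertices\<close>

lemma perp_simps [simp]:
  "perp v $ 1 = - (v $ 2)" "perp v $ 2 = v $ 1" by (simp_all add: perp_def)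

lemma real2_eq_iff: "(u::real^2) = v \<longleftrightarrow> u $ 1 = v $ 1 \<and> u $ 2 = v $ 2"
  by (simp add: vec_eq_iff forall_2)

lemma inner_real2: "(u::real^2) \<bullet> v = u $ 1 * v $ 1 + u $ 2 * v $ 2"
  by (simp add: inner_vec_def sum_2)

lemma perp_add: "perp (u + v) = perp u + perp v"
  and perp_diff: "perp (u - v) = perp u - perp v" and perp_scaleR: "perp (c *\<^sub>R u) = c *\<^sub>R perp u"
  by (simp_all add: real2_eq_iff)

lemma bounded_linear_perp: "bounded_linear perp"
  using linear_conv_bounded_linear[of perp] by (auto intro!: linearI simp: perp_add perp_scaleR)

lemma inner_perp: "u \<bullet> perp u = 0" "perp u \<bullet> u = 0" "u \<bullet> perp v = - (v \<bullet> perp u)"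
  by (simp_all add: inner_real2)

lemma norm_perp [simp]: "norm (perp u) = norm u"
  by (simp add: norm_eq_sqrt_inner inner_real2)

lemma power_le_one_mono: "(1::real) \<le> B ==> m \<le> n ==> B ^ m \<le> B ^ n"
  by (rule power_increasing)

lemma abs_inner_le:
  fixes u v :: "real^2"
  assumes "norm u \<le> a" "norm v \<le> b"
  shows "\<bar>u \<bullet> v\<bar> \<le> a * b"
proof -
  have "\<bar>u \<bullet> v\<bar> \<le> norm u * norm v" by (rule Cauchy_Schwarz_ineq2)
  also have "\<dots> \<le> a * b" using assms order_trans[OF norm_ge_zero assms(1)] by (intro mult_mono) auto
  finally show ?thesis .
qed

text \<open>\<open>k\<close> is the discrete curvature vector at a vertex. For unit vectors
  \<open>tau \<bullet> (tau' - tau)\<close> equals minus half the squared length of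
  \<open>tau' - tau\<close>, so the component of \<open>v\<close> along an adjacent edge, and with
  it the rate of that edge length, has no term linear in \<open>k\<close> except the one from the
  forcing. The sign \<open>s\<close> lets one statement serve both ends of an edge:
  \<open>s = 1\<close> at its end, with \<open>tau'\<close> the following edge, and
  \<open>s = -1\<close> at its start, with \<open>tau'\<close> the preceding one.\<close>

lemma node_edge_identity:
  fixes tau tau' v k :: "real^2" and m q q' phi s :: real
  assumes "norm tau = 1" "norm tau' = 1" and s: "s = 1 \<or> s = -1" and m: "m > 0"
    and scheme: "m *\<^sub>R v = s *\<^sub>R (tau' - tau) - (phi / 2) *\<^sub>R perp (q *\<^sub>R tau + q' *\<^sub>R tau')"
    and k: "k = (s / m) *\<^sub>R (tau' - tau)"
  shows "s * (tau \<bullet> v) = - (m * (norm k)^2 + phi * q' * (tau \<bullet> perp k)) / 2"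
proof -
  have n: "tau \<bullet> tau = 1" "tau' \<bullet> tau' = 1" using assms(1,2) by (simp_all add: dot_square_norm)
  have ss: "s * s = 1" using s by auto
  have a: "m * (tau \<bullet> v) = s * (tau \<bullet> (tau' - tau)) - (phi / 2) * q' * (tau \<bullet> perp tau')"
    using arg_cong[OF scheme, of "\<lambda>z. tau \<bullet> z"]
    by (simp add: inner_diff_right perp_add perp_scaleR inner_add_right inner_perp(1,2) algebra_simps)
  have b: "m * m * (norm k)^2 = - 2 * (tau \<bullet> (tau' - tau))"
  proof -
    have "m * m * (norm k)^2 = (m * (s/m)) * (m * (s / m)) * ((tau' - tau) \<bullet> (tau' - tau))"
      unfolding power2_norm_eq_inner k by (simp add: mult_ac)
    also have "\<dots> = - 2 * (tau \<bullet> (tau' - tau))" using m ss n by (simp add: inner_diff_left inner_diff_right inner_commute)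
    finally show ?thesis .
  qed
  have c: "m * (tau \<bullet> perp k) = s * (tau \<bullet> perp tau')"
    using m by (simp add: k perp_scaleR perp_diff inner_diff_right inner_perp(1,2))
  \<comment> \<open>Both sides are compared after multiplication by \<open>m^2\<close>, because
    \<open>k\<close> carries a factor \<open>1 / m\<close> and enters quadratically.\<close>
  have "m * (m * (s * (tau \<bullet> v))) = m * (s * (m * (tau \<bullet> v)))" by simp
  also have "\<dots> = m * ((s * s) * (tau \<bullet> (tau' - tau)) - (phi / 2) * q' * (s * (tau \<bullet> perp tau')))"
    unfolding a by (simp add: algebra_simps)
  also have "\<dots> = m * (tau \<bullet> (tau' - tau)) - m * ((phi / 2) * q' * (m * (tau \<bullet> perp k)))"
    unfolding c ss by (simp add: algebra_simps)
  also have "\<dots> = - m * (m * m * (norm k)^2) / 2 - m * ((phi / 2) * q' * (m * (tau \<bullet> perp k)))"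
  proof -
    have "tau \<bullet> (tau' - tau) = - (m * m * (norm k)^2) / 2" using b by linarith
    then show ?thesis by simp
  qed
  also have "\<dots> = m * (m * (- (m * (norm k)^2 + phi * q' * (tau \<bullet> perp k)) / 2))" by (simp add: field_simps)
  finally show ?thesis using m by simp
qed

lemma abs_half_aux:
  fixes x a b c d :: real
  assumes "\<bar>a\<bar> \<le> d" "x = a + (b + c) / 2"
  shows "\<bar>x\<bar> \<le> d + (\<bar>b\<bar> + \<bar>c\<bar>) / 2"
  using assms by (simp add: abs_if field_simps split: if_splits)

text \<open>Perturbation bounds at one vertex. Capital letters belong to the smooth curve, the
  matching small ones to the polygon; \<open>t\<close> is the tangent of the curve at the node,
  \<open>Z\<close> its curvature vector, and \<open>lam\<close> measures the error of the perimeter.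
  The first bound concerns the rate of one edge length; its term in \<open>e^2\<close> stems from
  the squared curvature in \<open>node_edge_identity\<close>. The second is the difference of the
  two equations of motion and later supplies the dissipation. \<open>Y\<close> collects all errors
  that the energy or the consistency of the curve controls.\<close>

lemma node_edge:
  fixes Q q Q' q' rho rho' phi F lam h B s m M :: real
    and T tau T' tau' t V v Z k n :: "real^2"
  assumes B: "B \<ge> 1" and h: "0 < h" "h \<le> 1"
    and unit: "norm T = 1" "norm tau = 1" "norm T' = 1" "norm tau' = 1" "norm t = 1"
    and Vt: "V \<bullet> t = 0" and Z: "Z = V + F *\<^sub>R perp t" and V: "norm V \<le> B" and F: "\<bar>F\<bar> \<le> B"
    and phi: "\<bar>phi - F\<bar> \<le> B * lam" and lam: "0 \<le> lam" "lam \<le> 2 * B"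
    and Q: "h / B \<le> Q" "Q \<le> B * h" "h / B \<le> Q'" "Q' \<le> B * h"
    and p: "\<bar>Q - q\<bar> \<le> h / (2 * B)" "\<bar>Q' - q'\<bar> \<le> h / (2 * B)"
    and rho: "h^2 \<le> rho" "rho \<le> B * h" "h^2 \<le> rho'" "rho' \<le> B * h" and s: "s = 1 \<or> s = -1"
    and c1: "norm (s *\<^sub>R (t - T) - (Q / 2) *\<^sub>R Z) \<le> rho"
    and c2: "norm (s *\<^sub>R (T' - t) - (Q' / 2) *\<^sub>R Z) \<le> rho'" and c3: "\<bar>Q' - Q\<bar> \<le> rho + rho'"
    and m: "m = (q + q') / 2"
    and scheme: "m *\<^sub>R v = s *\<^sub>R (tau' - tau) - (phi / 2) *\<^sub>R perp (q *\<^sub>R tau + q' *\<^sub>R tau')"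
  defines "Y \<equiv> \<bar>Q - q\<bar> + \<bar>Q' - q'\<bar> + rho + rho' + h * norm (T - tau) + h * norm (T' - tau') + h * lam"
    and "e \<equiv> norm (V - v)"
  shows "\<bar>s * (T \<bullet> V) - s * (tau \<bullet> v)\<bar> \<le> 300 * B ^ 8 * (Y + h * e + h * e^2)"
    and "norm (s *\<^sub>R (T' - tau') - s *\<^sub>R (T - tau) - m *\<^sub>R (V - v)) \<le> 11 * B ^ 4 * Y"
proof -
  have B0: "B > 0" using B by simp
  have hB: "h / (2 * B) = h / B / 2" by simp
  have hB1: "h / B > 0" "h / B \<le> h" "h \<le> B * h" using B h B0 by (auto simp: field_simps)
  have q: "h / (2 * B) \<le> q" "q \<le> 2 * B * h" "h / (2 * B) \<le> q'" "q' \<le> 2 * B * h"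
  proof -
    define hb where "hb = h / B"
    note p' = p[unfolded hB, folded hb_def] and hB' = hB1[folded hb_def] and Q = Q[folded hb_def]
    have "2 * B * h = B * h + B * h" by simp
    then show "q \<le> 2 * B * h" "q' \<le> 2 * B * h" using Q p' hB' by linarith+
    show "h / (2 * B) \<le> q" unfolding hB hb_def[symmetric] using Q p' by linarith
    show "h / (2 * B) \<le> q'" unfolding hB hb_def[symmetric] using Q p' by linarith
  qed
  have q0: "0 < q" "0 < q'"
  proof -
    have "0 < h / (2 * B)" using h B0 by simp
    then show "0 < q" "0 < q'" using q(1,3) by (blast intro: less_le_trans)+
  qed
  have m0: "m > 0" and m2: "m \<le> 2 * B * h" using q q0 by (simp_all add: m)
  have rho0: "rho \<ge> 0" "rho' \<ge> 0" using rho zero_le_power2[of h] by linarith+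
  have nn: "0 \<le> h * norm (T - tau)" "0 \<le> h * norm (T' - tau')" "0 \<le> h * lam" using h lam by auto
  have Y0: "Y \<ge> 0" unfolding Y_def using nn rho0 by linarith
  have nZ: "norm Z \<le> 2 * B"
  proof -
    have "norm Z \<le> norm V + \<bar>F\<bar> * 1" unfolding Z using unit(5) norm_triangle_ineq[of V "F *\<^sub>R perp t"] by simp
    then show ?thesis using V F by linarith
  qed
  have QZ: "norm ((Q / 2) *\<^sub>R Z) \<le> B^2 * h" "norm ((Q' / 2) *\<^sub>R Z) \<le> B^2 * h"
  proof -
    have "a * norm Z \<le> (B * h) * (2 * B)" if "0 \<le> a" "a \<le> B * h" for a using that nZ by (intro mult_mono) (use B0 h in auto)
    from this[of Q] this[of Q'] show "norm ((Q / 2) *\<^sub>R Z) \<le> B^2 * h" "norm ((Q' / 2) *\<^sub>R Z) \<le> B^2 * h"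
      using Q hB1 by (auto simp: power2_eq_square mult_ac)
  qed
  have ns: "norm (s *\<^sub>R x) = norm x" for x :: "real^2" using s by auto
  have Tt: "norm (T - t) \<le> B^2 * h + rho" "norm (T' - t) \<le> B^2 * h + rho'"
  proof -
    show "norm (T - t) \<le> B^2 * h + rho"
      using norm_triangle_sub[of "s *\<^sub>R (t - T)" "(Q / 2) *\<^sub>R Z", unfolded ns norm_minus_commute[of t T]]
        c1 QZ(1) by linarith
    show "norm (T' - t) \<le> B^2 * h + rho'"
      using norm_triangle_sub[of "s *\<^sub>R (T' - t)" "(Q' / 2) *\<^sub>R Z", unfolded ns] c2 QZ(2) by linarith
  qed
  have BB: "B \<le> B^2" "1 \<le> B^2" using B self_le_power[of B 2] by (auto)
  have Tt2: "norm (T - t) \<le> 2 * B^2 * h" "norm (T' - t) \<le> 2 * B^2 * h"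
  proof -
    have "B * h \<le> B^2 * h" using BB h by simp
    then show "norm (T - t) \<le> 2 * B^2 * h" "norm (T' - t) \<le> 2 * B^2 * h" using Tt rho by linarith+
  qed
  define th where "th = norm (T - tau)"
  define th' where "th' = norm (T' - tau')"
  have th: "0 \<le> th" "th \<le> 2" "0 \<le> th'" "th' \<le> 2"
    using norm_triangle_ineq4[of T tau] norm_triangle_ineq4[of T' tau'] unit by (auto simp: th_def th'_def)
  have tt: "norm (tau - t) \<le> th + 2 * B^2 * h" "norm (tau' - t) \<le> th' + 2 * B^2 * h"
    using norm_triangle_ineq4[of "T - t" "T - tau"] norm_triangle_ineq4[of "T' - t" "T' - tau'"] Tt2 by (auto simp: th_def th'_def)
  \<comment> \<open>\<open>n\<close> is the normal of the polygon at the vertex, the mean of the two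
    edge normals weighted by length; \<open>phi\<close> times \<open>n\<close> is the forcing term
    of the scheme after division by the mass.\<close>
  define n where "n = (1 / (2 * m)) *\<^sub>R perp (q *\<^sub>R tau + q' *\<^sub>R tau')"
  have n1: "norm n \<le> 1"
  proof -
    have "norm (q *\<^sub>R tau + q' *\<^sub>R tau') \<le> q + q'"
      using norm_triangle_ineq[of "q *\<^sub>R tau" "q' *\<^sub>R tau'"] unit q0 by simp
    then show ?thesis using m0 unfolding n_def m by (simp add: divide_simps)
  qed
  have mn: "(2 * m) *\<^sub>R n = perp (q *\<^sub>R tau + q' *\<^sub>R tau')" using m0 by (simp add: n_def)
  have nt: "norm (n - perp t) \<le> th + th' + 4 * B^2 * h"
  proof -
    have "(2 * m) *\<^sub>R (n - perp t) = perp (q *\<^sub>R (tau - t) + q' *\<^sub>R (tau' - t))"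
      unfolding scaleR_diff_right mn by (simp add: m real2_eq_iff field_simps)
    then have "2 * m * norm (n - perp t) = norm (q *\<^sub>R (tau - t) + q' *\<^sub>R (tau' - t))"
      using m0 by (metis norm_perp norm_scaleR abs_of_pos zero_less_mult_iff zero_less_numeral)
    also have "\<dots> \<le> q * norm (tau - t) + q' * norm (tau' - t)"
      using norm_triangle_ineq[of "q *\<^sub>R (tau - t)" "q' *\<^sub>R (tau' - t)"] q0 by simp
    also have "\<dots> \<le> (q + q') * (norm (tau - t) + norm (tau' - t))" using q0 by (simp add: algebra_simps)
    also have "\<dots> = 2 * m * (norm (tau - t) + norm (tau' - t))" by (simp add: m)
    finally have "norm (n - perp t) \<le> norm (tau - t) + norm (tau' - t)" using m0 by simp
    then show ?thesis using tt by linarith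
  qed
  \<comment> \<open>\<open>u\<close> gathers the lower order errors. The summand \<open>h\<close> is
    admissible because \<open>rho \<ge> h^2\<close>, which gives \<open>h * u \<le> Y\<close>; the
    crude bound \<open>u \<le> 7 * B\<close> later turns \<open>u^2\<close> into a multiple of
    \<open>u\<close>.\<close>
  define u where "u = lam + th + th' + h"
  have u0: "u \<ge> 0" using lam th h by (simp add: u_def)
  have u7: "u \<le> 7 * B" using lam th h B by (simp add: u_def)
  have hu: "h * u \<le> Y"
  proof -
    have "h * u = h^2 + h * norm (T - tau) + h * norm (T' - tau') + h * lam"
      unfolding u_def th_def th'_def by (simp add: algebra_simps power2_eq_square)
    then show ?thesis using rho(1) rho0 unfolding Y_def by linarith
  qed
  have pw: "B ^ i \<le> B ^ j" if "i \<le> j" for i j using B that by (rule power_le_one_mono)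
  have P1: "1 \<le> B ^ i" for i using B by (simp add: one_le_power)
  \<comment> \<open>\<open>w\<close> is the error of the forcing: the curvature vector is
    \<open>v + phi *\<^sub>R n\<close> for the polygon and \<open>V + F *\<^sub>R perp t\<close> for
    the curve, so \<open>k - Z\<close> is the velocity error plus \<open>w\<close>.\<close>
  define w where "w = (phi - F) *\<^sub>R n + F *\<^sub>R (n - perp t)"
  have w: "norm w \<le> 4 * B ^ 3 * u"
  proof -
    have "norm w \<le> \<bar>phi - F\<bar> * norm n + \<bar>F\<bar> * norm (n - perp t)"
      unfolding w_def by (metis norm_triangle_ineq norm_scaleR)
    also have "\<dots> \<le> (B * lam) * 1 + B * (th + th' + 4 * B^2 * h)" using phi n1 F nt th B0 lam h by (intro add_mono mult_mono) auto
    also have "\<dots> = B * (lam + th + th') + 4 * B ^ 3 * h" by (simp add: algebra_simps power2_eq_square power3_eq_cube)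
    also have "\<dots> \<le> 4 * B ^ 3 * (lam + th + th') + 4 * B ^ 3 * h"
    proof -
      have "B \<le> 4 * B ^ 3" using pw[of 1 3] P1[of 3] by simp
      then show ?thesis using lam th h B0 by (intro add_mono mult_right_mono) auto
    qed
    finally show ?thesis by (simp add: u_def algebra_simps)
  qed
  define k where "k = (s / m) *\<^sub>R (tau' - tau)"
  have kv: "k = v + phi *\<^sub>R n"
  proof -
    have "m *\<^sub>R k = m *\<^sub>R (v + phi *\<^sub>R n)"
      using m0 unfolding scaleR_add_right scheme k_def mn[symmetric] by (simp add: mult_ac)
    then show ?thesis using m0 by simp
  qed
  have kZ: "k - Z = (v - V) + w" unfolding kv Z w_def by (simp add: algebra_simps)
  define g where "g = norm (k - Z)"
  have g0: "g \<ge> 0" by (simp add: g_def)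
  have e0: "e \<ge> 0" by (simp add: e_def)
  have g: "g \<le> e + 4 * B ^ 3 * u" using norm_triangle_ineq[of "v - V" w] w by (simp add: g_def kZ e_def norm_minus_commute)
  have hg: "h * g \<le> h * e + 4 * B ^ 3 * Y"
  proof -
    have "h * g \<le> h * e + 4 * B ^ 3 * (h * u)" using mult_left_mono[OF g, of h] h by (simp add: algebra_simps)
    also have "4 * B ^ 3 * (h * u) \<le> 4 * B ^ 3 * Y" using hu B0 by (intro mult_left_mono) auto
    finally show ?thesis by simp
  qed
  have hg2: "h * g^2 \<le> 2 * h * e^2 + 224 * B ^ 7 * Y"
  proof -
    have "g^2 \<le> (e + 4 * B ^ 3 * u)^2" using g g0 by (rule power_mono)
    also have "\<dots> \<le> 2 * e^2 + 2 * (4 * B ^ 3 * u)^2" using sum_squares_bound[of e "4 * B ^ 3 * u"] by (simp add: power2_sum)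
    also have "(4 * B ^ 3 * u)^2 = 16 * B ^ 6 * (u * u)" by (simp add: power_mult_distrib power2_eq_square flip: power_add)
    also have "16 * B ^ 6 * (u * u) \<le> 16 * B ^ 6 * (7 * B * u)" using u7 u0 B0 by (intro mult_left_mono mult_right_mono) auto
    also have "\<dots> = 112 * B ^ 7 * u" by (simp add: power_Suc[symmetric] eval_nat_numeral)
    finally have "g^2 \<le> 2 * e^2 + 224 * B ^ 7 * u" by simp
    from mult_left_mono[OF this, of h] h have "h * g^2 \<le> 2 * h * e^2 + 224 * B ^ 7 * (h * u)" by (simp add: algebra_simps)
    also have "224 * B ^ 7 * (h * u) \<le> 224 * B ^ 7 * Y" using hu B0 by (intro mult_left_mono) auto
    finally show ?thesis by simp
  qed
  have mQ: "\<bar>m - Q\<bar> \<le> Y" "\<bar>q' - Q\<bar> \<le> Y" "\<bar>(Q + Q') / 2 - m\<bar> \<le> Y"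
  proof -
    have "rho + rho' + \<bar>Q - q\<bar> + \<bar>Q' - q'\<bar> \<le> Y" unfolding Y_def using nn by linarith
    moreover have "\<bar>m - Q\<bar> \<le> rho + rho' + \<bar>Q - q\<bar> + \<bar>Q' - q'\<bar>" unfolding m using c3 rho0 by (simp add: abs_if field_simps split: if_splits)
    moreover have "\<bar>q' - Q\<bar> \<le> rho + rho' + \<bar>Q - q\<bar> + \<bar>Q' - q'\<bar>" using c3 rho0 by linarith
    moreover have "\<bar>(Q + Q') / 2 - m\<bar> \<le> rho + rho' + \<bar>Q - q\<bar> + \<bar>Q' - q'\<bar>" unfolding m using rho0 by (simp add: abs_if field_simps split: if_splits)
    ultimately show "\<bar>m - Q\<bar> \<le> Y" "\<bar>q' - Q\<bar> \<le> Y" "\<bar>(Q + Q') / 2 - m\<bar> \<le> Y" by (blast intro: order_trans)+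
  qed
  have Qabs: "\<bar>Q\<bar> \<le> B * h" "Q > 0"
  proof -
    show "Q > 0" using Q(1) hB1(1) by (rule less_le_trans[rotated])
    then show "\<bar>Q\<bar> \<le> B * h" using Q(2) by simp
  qed
  have kb: "norm k \<le> 2 * B + g" using norm_triangle_sub[of k Z] nZ by (simp add: g_def)
  have k0: "0 \<le> 2 * B + g" using B0 g0 by simp
  show "norm (s *\<^sub>R (T' - tau') - s *\<^sub>R (T - tau) - m *\<^sub>R (V - v)) \<le> 11 * B ^ 4 * Y"
  proof -
    \<comment> \<open>The two consistency relations at the node, one for each adjacent edge, add up
      to an equation for the curve of the same form as the scheme, with mass \<open>M\<close> and
      defect \<open>r\<close>.\<close>
    define M where "M = (Q + Q') / 2"
    define r where "r = (s *\<^sub>R (t - T) - (Q / 2) *\<^sub>R Z) + (s *\<^sub>R (T' - t) - (Q' / 2) *\<^sub>R Z)"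
    have r: "norm r \<le> rho + rho'" unfolding r_def using c1 c2 by (rule norm_triangle_mono)
    have TT: "s *\<^sub>R (T' - T) = M *\<^sub>R Z + r" unfolding r_def M_def by (simp add: algebra_simps add_divide_distrib)
    have tt': "s *\<^sub>R (tau' - tau) = m *\<^sub>R (v + phi *\<^sub>R n)" unfolding kv[symmetric] k_def using m0 by simp
    have "s *\<^sub>R (T' - tau') - s *\<^sub>R (T - tau) - m *\<^sub>R (V - v)
        = s *\<^sub>R (T' - T) - s *\<^sub>R (tau' - tau) - m *\<^sub>R (V - v)" by (simp add: algebra_simps)
    also have "\<dots> = (M - m) *\<^sub>R Z - m *\<^sub>R w + r" unfolding TT tt' Z w_def by (simp add: algebra_simps)
    finally have "norm (s *\<^sub>R (T' - tau') - s *\<^sub>R (T - tau) - m *\<^sub>R (V - v))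
        \<le> \<bar>M - m\<bar> * norm Z + m * norm w + norm r" using norm_triangle_ineq[of "(M - m) *\<^sub>R Z - m *\<^sub>R w" r]
        norm_triangle_ineq4[of "(M - m) *\<^sub>R Z" "m *\<^sub>R w"] m0 by simp
    also have "\<dots> \<le> Y * (2 * B) + (2 * B * h) * (4 * B ^ 3 * u) + Y"
    proof (intro add_mono mult_mono mQ(3)[folded M_def])
      have "rho + rho' \<le> Y" unfolding Y_def using nn by linarith
      then show "norm r \<le> Y" using r by linarith
    qed (use nZ m2 w m0 Y0 B0 h u0 in auto)
    also have "(2 * B * h) * (4 * B ^ 3 * u) = 8 * B ^ 4 * (h * u)" by (simp add: eval_nat_numeral)
    also have "8 * B ^ 4 * (h * u) \<le> 8 * B ^ 4 * Y" using hu B0 by (intro mult_left_mono) auto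
    also have "Y * (2 * B) + 8 * B ^ 4 * Y + Y = (2 * B + 8 * B ^ 4 + 1) * Y" by (simp add: algebra_simps)
    also have "\<dots> \<le> 11 * B ^ 4 * Y" using pw[of 1 4] P1[of 4] Y0 by (intro mult_right_mono) auto
    finally show ?thesis by simp
  qed
  \<comment> \<open>Testing a consistency relation with \<open>V\<close>, which is orthogonal to
    \<open>t\<close>, removes the tangent. Writing \<open>Z \<bullet> V\<close> as the square of
    \<open>norm Z\<close> plus a forcing term reproduces the shape of \<open>disc\<close>, so that
    the two rates can be compared term by term.\<close>
  have ref: "\<bar>s * (T \<bullet> V) + Q * ((norm Z)^2 + F * (t \<bullet> perp Z)) / 2\<bar> \<le> B * Y"
  proof -
    have ZV: "Z \<bullet> V = (norm Z)^2 + F * (t \<bullet> perp Z)"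
    proof -
      have "Z \<bullet> V = Z \<bullet> (Z - F *\<^sub>R perp t)" by (simp add: Z)
      also have "\<dots> = (norm Z)^2 + F * (t \<bullet> perp Z)" by (simp add: inner_diff_right power2_norm_eq_inner inner_perp(3)[of t Z])
      finally show ?thesis .
    qed
    have "s * (T \<bullet> V) + Q * (Z \<bullet> V) / 2 = - ((s *\<^sub>R (t - T) - (Q / 2) *\<^sub>R Z) \<bullet> V)"
      using Vt by (simp add: inner_diff_left inner_commute algebra_simps)
    moreover have "\<bar>(s *\<^sub>R (t - T) - (Q / 2) *\<^sub>R Z) \<bullet> V\<bar> \<le> rho * B" using c1 V by (rule abs_inner_le)
    moreover have "rho * B \<le> B * Y" using B0 rho0 nn by (simp add: Y_def)
    ultimately show ?thesis unfolding ZV by simp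
  qed
  have disc: "s * (tau \<bullet> v) = - (m * (norm k)^2 + phi * q' * (tau \<bullet> perp k)) / 2"
    using unit s m0 scheme k_def by (intro node_edge_identity) auto
  \<comment> \<open>The difference of squares is factored. Since \<open>norm k\<close> is bounded
    only by \<open>2 * B + g\<close>, a term \<open>g^2\<close> is unavoidable; it is the origin of
    \<open>e^2\<close> in the conclusion.\<close>
  have E1: "\<bar>m * (norm k)^2 - Q * (norm Z)^2\<bar> \<le> 2 * B * (h * g^2) + 8 * B^2 * (h * g) + 4 * B^2 * Y"
  proof -
    have d: "\<bar>(norm k)^2 - (norm Z)^2\<bar> \<le> g^2 + 4 * B * g"
    proof -
      have "\<bar>norm k - norm Z\<bar> \<le> g" unfolding g_def by (rule norm_triangle_ineq3)
      moreover have "norm k + norm Z \<le> g + 4 * B" using kb nZ by linarith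
      ultimately have "\<bar>norm k - norm Z\<bar> * (norm k + norm Z) \<le> g * (g + 4 * B)" using g0 by (intro mult_mono) auto
      moreover have "(norm k)^2 - (norm Z)^2 = (norm k - norm Z) * (norm k + norm Z)" by (simp add: power2_eq_square algebra_simps)
      ultimately have "\<bar>(norm k)^2 - (norm Z)^2\<bar> \<le> g * (g + 4 * B)" by (simp only: abs_mult) simp
      then show ?thesis by (simp add: power2_eq_square algebra_simps)
    qed
    have "m * (norm k)^2 - Q * (norm Z)^2 = m * ((norm k)^2 - (norm Z)^2) + (m - Q) * (norm Z)^2" by (simp add: algebra_simps)
    also have "\<bar>\<dots>\<bar> \<le> m * \<bar>(norm k)^2 - (norm Z)^2\<bar> + \<bar>m - Q\<bar> * (norm Z)^2"
      using m0 abs_triangle_ineq[of "m * ((norm k)^2 - (norm Z)^2)" "(m - Q) * (norm Z)^2"] by (simp add: abs_mult)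
    also have "\<dots> \<le> (2 * B * h) * (g^2 + 4 * B * g) + Y * (2 * B)^2"
      using m2 d mQ(1) Y0 m0 B0 h nZ by (intro add_mono mult_mono power_mono) auto
    finally show ?thesis by (simp add: algebra_simps power2_eq_square)
  qed
  have pk: "\<bar>x \<bullet> perp k\<bar> \<le> norm x * (2 * B + g)" for x :: "real^2" using kb by (intro abs_inner_le) auto
  \<comment> \<open>The factors of the product are exchanged one at a time: \<open>phi\<close>,
    \<open>q'\<close>, \<open>tau\<close> and finally \<open>k\<close>.\<close>
  have E2: "\<bar>phi * q' * (tau \<bullet> perp k) - F * Q * (t \<bullet> perp Z)\<bar> \<le> 10 * B ^ 5 * Y + 12 * B ^ 4 * (h * g)"
  proof -
    have 1: "\<bar>(phi - F) * q' * (tau \<bullet> perp k)\<bar> \<le> 4 * B ^ 3 * Y + 4 * B ^ 3 * (h * g)"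
    proof -
      have "\<bar>(phi - F) * q' * (tau \<bullet> perp k)\<bar> \<le> (B * lam) * (2 * B * h) * (2 * B + g)"
        unfolding abs_mult using phi q q0 pk[of tau] unit B0 lam h k0 by (intro mult_mono) auto
      also have "\<dots> = 4 * B ^ 3 * (h * lam) + 2 * B^2 * (h * g) * lam" by (simp add: algebra_simps power2_eq_square power3_eq_cube)
      also have "\<dots> \<le> 4 * B ^ 3 * Y + 2 * B^2 * (h * g) * (2 * B)"
        using lam B0 h g0 nn rho0 by (intro add_mono mult_left_mono) (auto simp: Y_def)
      also have "\<dots> = 4 * B ^ 3 * Y + 4 * B ^ 3 * (h * g)" by (simp add: eval_nat_numeral)
      finally show ?thesis .
    qed
    have 2: "\<bar>F * (q' - Q) * (tau \<bullet> perp k)\<bar> \<le> 2 * B^2 * Y + 3 * B^2 * (h * g)"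
    proof -
      have "\<bar>F * (q' - Q) * (tau \<bullet> perp k)\<bar> \<le> B * \<bar>q' - Q\<bar> * (2 * B + g)"
        unfolding abs_mult using F pk[of tau] unit B0 k0 by (intro mult_mono) auto
      also have "\<dots> = 2 * B^2 * \<bar>q' - Q\<bar> + B * g * \<bar>q' - Q\<bar>" by (simp add: algebra_simps power2_eq_square)
      also have "\<dots> \<le> 2 * B^2 * Y + B * g * (3 * B * h)"
      proof (intro add_mono mult_left_mono mQ)
        show "\<bar>q' - Q\<bar> \<le> 3 * B * h" using q Q q0 hB1 by linarith
      qed (use B0 g0 in auto)
      finally show ?thesis by (simp add: algebra_simps power2_eq_square)
    qed
    have 3: "\<bar>F * Q * ((tau - t) \<bullet> perp k)\<bar> \<le> 4 * B ^ 5 * Y + 4 * B ^ 4 * (h * g)"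
    proof -
      have "\<bar>F * Q * ((tau - t) \<bullet> perp k)\<bar> \<le> B * (B * h) * ((th + 2 * B^2 * h) * (2 * B + g))" unfolding abs_mult
      proof (intro mult_mono F)
        show "\<bar>Q\<bar> \<le> B * h" by (rule Qabs)
        show "\<bar>(tau - t) \<bullet> perp k\<bar> \<le> (th + 2 * B^2 * h) * (2 * B + g)" using tt(1) kb by (intro abs_inner_le) auto
      qed (use B0 h in auto)
      also have "\<dots> = 2 * B ^ 3 * (h * th + 2 * B^2 * h^2) + B^2 * (th + 2 * B^2 * h) * (h * g)"
        by (simp add: algebra_simps power2_eq_square power3_eq_cube)
      also have "\<dots> \<le> 2 * B ^ 3 * (2 * B^2 * Y) + B^2 * (4 * B^2) * (h * g)"
      proof (intro add_mono mult_left_mono mult_right_mono)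
        have hth: "h * th \<ge> 0" using h th by simp
        have "h * th \<le> B^2 * (h * th)" using mult_right_mono[OF BB(2) hth] by simp
        moreover have "h * th + h^2 \<le> Y" using rho(1) nn rho0 unfolding Y_def th_def by linarith
        moreover from this have "B^2 * (h * th + h^2) \<le> B^2 * Y" by (intro mult_left_mono) auto
        moreover have "B^2 * (h * th) \<ge> 0" using hth by simp
        ultimately show "h * th + 2 * B^2 * h^2 \<le> 2 * B^2 * Y" by (simp add: distrib_left)
        have "B^2 * h \<le> B^2" using h by (simp add: mult_left_le)
        then show "th + 2 * B^2 * h \<le> 4 * B^2" using th BB by linarith
      qed (use B0 h g0 in auto)
      also have "\<dots> = 4 * B ^ 5 * Y + 4 * B ^ 4 * (h * g)" by (simp add: eval_nat_numeral)
      finally show ?thesis .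
    qed
    have 4: "\<bar>F * Q * (t \<bullet> perp (k - Z))\<bar> \<le> B^2 * (h * g)"
    proof -
      have "\<bar>t \<bullet> perp (k - Z)\<bar> \<le> 1 * g" using unit by (intro abs_inner_le) (auto simp: g_def)
      then have "\<bar>F * Q * (t \<bullet> perp (k - Z))\<bar> \<le> B * (B * h) * (1 * g)"
        unfolding abs_mult using F Qabs B0 h by (intro mult_mono) auto
      then show ?thesis by (simp add: algebra_simps power2_eq_square)
    qed
    have "phi * q' * (tau \<bullet> perp k) - F * Q * (t \<bullet> perp Z) =
       (phi - F) * q' * (tau \<bullet> perp k) + F * (q' - Q) * (tau \<bullet> perp k)
       + F * Q * ((tau - t) \<bullet> perp k) + F * Q * (t \<bullet> perp (k - Z))"
      by (simp add: algebra_simps perp_diff inner_diff_left inner_diff_right)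
    then have "\<bar>phi * q' * (tau \<bullet> perp k) - F * Q * (t \<bullet> perp Z)\<bar> \<le>
       (4 * B ^ 3 * Y + 4 * B ^ 3 * (h * g)) + (2 * B^2 * Y + 3 * B^2 * (h * g)) +
       (4 * B ^ 5 * Y + 4 * B ^ 4 * (h * g)) + B^2 * (h * g)" using 1 2 3 4 by linarith
    also have "\<dots> = (4 * B ^ 3 + 2 * B^2 + 4 * B ^ 5) * Y + (4 * B ^ 3 + 4 * B^2 + 4 * B ^ 4) * (h * g)" by (simp add: algebra_simps)
    also have "\<dots> \<le> 10 * B ^ 5 * Y + 12 * B ^ 4 * (h * g)"
      using pw[of 3 5] pw[of 2 5] pw[of 3 4] pw[of 2 4] Y0 g0 h by (intro add_mono mult_right_mono) auto
    finally show ?thesis .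
  qed
  have "\<bar>s * (T \<bullet> V) - s * (tau \<bullet> v)\<bar> \<le> B * Y + (\<bar>m * (norm k)^2 - Q * (norm Z)^2\<bar> +
        \<bar>phi * q' * (tau \<bullet> perp k) - F * Q * (t \<bullet> perp Z)\<bar>) / 2"
  proof -
    have "s * (T \<bullet> V) - s * (tau \<bullet> v) = (s * (T \<bullet> V) + Q * ((norm Z)^2 + F * (t \<bullet> perp Z)) / 2)
       + ((m * (norm k)^2 - Q * (norm Z)^2) + (phi * q' * (tau \<bullet> perp k) - F * Q * (t \<bullet> perp Z))) / 2"
      unfolding disc by (simp add: algebra_simps add_divide_distrib diff_divide_distrib)
    with ref show ?thesis by (rule abs_half_aux)
  qed
  also have "\<dots> \<le> B * Y + ((2 * B * (h * g^2) + 8 * B^2 * (h * g) + 4 * B^2 * Y)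
       + (10 * B ^ 5 * Y + 12 * B ^ 4 * (h * g))) / 2" using E1 E2 by simp
  also have "\<dots> = (B + 2 * B^2 + 5 * B ^ 5) * Y + B * (h * g^2) + (4 * B^2 + 6 * B ^ 4) * (h * g)"
    by (simp add: algebra_simps add_divide_distrib)
  also have "\<dots> \<le> (8 * B ^ 5) * Y + B * (2 * h * e^2 + 224 * B ^ 7 * Y) + (10 * B ^ 4) * (h * e + 4 * B ^ 3 * Y)"
    using pw[of 1 5] pw[of 2 5] pw[of 2 4] Y0 hg hg2 g0 h B0 by (intro add_mono mult_mono) auto
  also have "\<dots> = (8 * B ^ 5 + 224 * B ^ 8 + 40 * B ^ 7) * Y + 10 * B ^ 4 * (h * e) + 2 * B * (h * e^2)"
    by (simp add: algebra_simps eval_nat_numeral)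
  \<comment> \<open>All monomials are raised to the largest exponent, which \<open>B \<ge> 1\<close>
    permits; 300 exceeds 8 + 224 + 40.\<close>
  also have "\<dots> \<le> 300 * B ^ 8 * Y + 300 * B ^ 8 * (h * e) + 300 * B ^ 8 * (h * e^2)"
    using pw[of 5 8] pw[of 7 8] pw[of 4 8] pw[of 1 8] P1[of 8] Y0 e0 h by (intro add_mono mult_right_mono) auto
  finally show "\<bar>s * (T \<bullet> V) - s * (tau \<bullet> v)\<bar> \<le> 300 * B ^ 8 * (Y + h * e + h * e^2)"
    by (simp add: algebra_simps)
qed

section \<open>Summation of the vertex errors around the polygon\<close>

lemma young_ineq:
  fixes a b k :: real
  assumes "k > 0"
  shows "a * b \<le> k * a^2 + b^2 / (4 * k)"
proof -
  have "0 \<le> (2 * k * a - b)^2 / (4 * k)" using assms by simp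
  also have "\<dots> = k * a^2 + b^2 / (4 * k) - a * b" using assms by (simp add: power2_eq_square field_simps)
  finally show ?thesis by simp
qed

lemma square_add2_le: "((a::real) + b)^2 \<le> 2 * (a^2 + b^2)"
  using sum_squares_bound[of a b] by (simp add: power2_sum)

lemma square_add3_le: "((a::real) + b + c)^2 \<le> 3 * (a^2 + b^2 + c^2)"
  using sum_squares_bound[of a b] sum_squares_bound[of a c] sum_squares_bound[of b c] by (simp add: power2_eq_square algebra_simps)

lemma sum_squared_le_card:
  fixes f :: "'a \<Rightarrow> real"
  assumes "finite J"
  shows "(\<Sum>j\<in>J. f j)^2 \<le> card J * (\<Sum>j\<in>J. (f j)^2)"
  using sum_squared_le_sum_of_squares[of f J] by (simp add: mult.commute)

text \<open>The vertex indices of a closed polygon, reduced to a finite set with mutually inverse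
  successor and predecessor maps; summation by parts then has no boundary terms.\<close>

locale cyclic =
  fixes J :: "nat set" and nx pv :: "nat \<Rightarrow> nat"
  assumes finJ: "finite J"
    and nxJ: "\<And>j. j \<in> J ==> nx j \<in> J" and pvJ: "\<And>j. j \<in> J ==> pv j \<in> J"
    and nxpv: "\<And>j. j \<in> J ==> nx (pv j) = j" and pvnx: "\<And>j. j \<in> J ==> pv (nx j) = j"
begin

lemma sum_nx: "(\<Sum>j\<in>J. g (nx j)) = (\<Sum>j\<in>J. g j)"
  by (rule sum.reindex_bij_witness[of _ pv nx]) (auto simp: nxJ pvJ nxpv pvnx)

lemma sum_pv: "(\<Sum>j\<in>J. g (pv j)) = (\<Sum>j\<in>J. g j)"
  by (rule sum.reindex_bij_witness[of _ nx pv]) (auto simp: nxJ pvJ nxpv pvnx)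

text \<open>With \<open>dQ\<close> and \<open>dq\<close> the rates of the edge lengths, the sum on
  the left is the time derivative of \<open>S\<close>; time is frozen here and only the algebra of
  one instant is used. Its four summands are bounded separately: the rate of the length errors, the
  coupling of direction errors with velocity errors, the change of the lengths \<open>Q\<close>, and
  the rotation of the directions \<open>T\<close>.\<close>

lemma static_estimate:
  fixes Q q rho :: "nat \<Rightarrow> real" and phi F lam h B :: real
    and T tau t V v Z :: "nat \<Rightarrow> real^2"
  assumes B: "B \<ge> 1" and h: "0 < h" "h \<le> 1" and N: "real (card J) * h \<le> B"
    and unit: "\<And>j. j \<in> J ==> norm (T j) = 1" "\<And>j. j \<in> J ==> norm (tau j) = 1" "\<And>j. j \<in> J ==> norm (t j) = 1"
    and Vt: "\<And>j. j \<in> J ==> V j \<bullet> t j = 0" and Z: "\<And>j. j \<in> J ==> Z j = V j + F *\<^sub>R perp (t j)"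
    and V: "\<And>j. j \<in> J ==> norm (V j) \<le> B" "\<And>j. j \<in> J ==> norm (V j - V (pv j)) \<le> B * h"
    and F: "\<bar>F\<bar> \<le> B" and phi: "\<bar>phi - F\<bar> \<le> B * lam"
    and lam: "0 \<le> lam" "lam \<le> B * h + (\<Sum>j\<in>J. \<bar>Q j - q j\<bar>)"
    and Q: "\<And>j. j \<in> J ==> h / B \<le> Q j" "\<And>j. j \<in> J ==> Q j \<le> B * h"
    and p: "\<And>j. j \<in> J ==> \<bar>Q j - q j\<bar> \<le> h / (19200 * B ^ 9)"
    and rho: "\<And>j. j \<in> J ==> h^2 \<le> rho j" "\<And>j. j \<in> J ==> rho j \<le> B * h"
      "(\<Sum>j\<in>J. (rho j)^2) \<le> B * h ^ 3"
    and c1: "\<And>j. j \<in> J ==> norm (t j - T j - (Q j / 2) *\<^sub>R Z j) \<le> rho j"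
    and c2: "\<And>j. j \<in> J ==> norm (T j - t (pv j) - (Q j / 2) *\<^sub>R Z (pv j)) \<le> rho j"
    and c3: "\<And>j. j \<in> J ==> \<bar>Q (nx j) - Q j\<bar> \<le> rho j + rho (nx j)"
    and scheme: "\<And>j. j \<in> J ==> ((q j + q (nx j)) / 2) *\<^sub>R v j = tau (nx j) - tau j
        - (phi / 2) *\<^sub>R perp (q j *\<^sub>R tau j + q (nx j) *\<^sub>R tau (nx j))"
  defines "S \<equiv> \<Sum>j\<in>J. (Q j - q j)^2 / h + q j * (norm (T j - tau j))^2 / 2"
    and "dQ \<equiv> \<lambda>j. T j \<bullet> (V j - V (pv j))" and "dq \<equiv> \<lambda>j. tau j \<bullet> (v j - v (pv j))"
  shows "(\<Sum>j\<in>J. 2 * (Q j - q j) * (dQ j - dq j) / h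
        + (T j - tau j) \<bullet> ((V j - v j) - (V (pv j) - v (pv j)))
        - dQ j * (norm (T j - tau j))^2 / 2
        + (Q j - q j) * (tau j \<bullet> ((V j - V (pv j) - dQ j *\<^sub>R T j) /\<^sub>R Q j)))
      \<le> - (h / (4 * B)) * (\<Sum>j\<in>J. (norm (V j - v j))^2) + 6000000 * B ^ 17 * (S + h^2)"
proof -
  have B0: "B > 0" using B by simp
  have pw: "B ^ i \<le> B ^ j" if "i \<le> j" for i j using B that by (rule power_le_one_mono)
  define C1 where "C1 = 300 * B ^ 8"
  have C10: "C1 > 0" using B0 by (simp add: C1_def)
  define P where "P j = Q j - q j" for j
  define th where "th j = norm (T j - tau j)" for j
  define e where "e j = norm (V j - v j)" for j
  define y where "y j = \<bar>P j\<bar> + rho j + h * th j" for j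
  define Y where "Y j = y j + y (nx j) + h * lam" for j
  \<comment> \<open>Chosen so that \<open>2 * C1 * eps = 1 / (32 * B)\<close>: the quadratic
    velocity error in the rate of a length, multiplied by \<open>\<bar>P j\<bar>\<close>, then
    consumes only a fixed part of the dissipation.\<close>
  define eps where "eps = 1 / (64 * B * C1)"
  have th0: "th j \<ge> 0" for j by (simp add: th_def)
  have Peps: "\<bar>P j\<bar> \<le> eps * h" if "j \<in> J" for j
  proof -
    have "64 * B * C1 = 19200 * B ^ 9" by (simp add: C1_def eval_nat_numeral)
    then have "eps * h = h / (19200 * B ^ 9)" unfolding eps_def by (simp only: times_divide_eq_left mult_1)
    then show ?thesis using p[OF that] by (simp only: P_def)
  qed
  have P2: "\<bar>P j\<bar> \<le> h / (2 * B)" if "j \<in> J" for j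
  proof -
    have "h / (19200 * B ^ 9) \<le> h / (2 * B)" using pw[of 1 9] B0 h by (intro divide_left_mono) auto
    then show ?thesis using p[OF that] by (simp add: P_def)
  qed
  have hB: "h / B = 2 * (h / (2 * B))" by simp
  have q: "h / (2 * B) \<le> q j" if "j \<in> J" for j using Q(1)[OF that] P2[OF that] unfolding hB P_def by linarith
  have hB0: "h / (2 * B) > 0" using h B0 by simp
  have q0: "q j > 0" if "j \<in> J" for j using q[OF that] hB0 by linarith
  have rho0: "rho j \<ge> 0" if "j \<in> J" for j using rho(1)[OF that] zero_le_power2[of h] by linarith
  have y0: "y j \<ge> 0" if "j \<in> J" for j using rho0[OF that] th0[of j] h by (simp add: y_def)
  have lam2: "lam \<le> 2 * B"
  proof -
    have "(\<Sum>j\<in>J. \<bar>P j\<bar>) \<le> (\<Sum>j\<in>J. h)"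
    proof (rule sum_mono)
      fix j assume j: "j \<in> J"
      have "h / (2 * B) \<le> h" using h B by (simp add: field_simps)
      then show "\<bar>P j\<bar> \<le> h" using P2[OF j] by linarith
    qed
    then have "(\<Sum>j\<in>J. \<bar>P j\<bar>) \<le> B" using N by simp
    moreover have "B * h \<le> B" using h B0 by simp
    ultimately show ?thesis using lam(2) unfolding P_def by linarith
  qed
  have edge_nx: "\<bar>T j \<bullet> V j - tau j \<bullet> v j\<bar> \<le> C1 * (Y j + h * e j + h * (e j)^2)"
    and mom: "norm ((T (nx j) - tau (nx j)) - (T j - tau j) - ((q j + q (nx j)) / 2) *\<^sub>R (V j - v j)) \<le> 11 * B ^ 4 * Y j"
    if j: "j \<in> J" for j
  proof -
    note n = nxJ[OF j]
    have Yj: "Y j = \<bar>Q j - q j\<bar> + \<bar>Q (nx j) - q (nx j)\<bar> + rho j + rho (nx j) + h * norm (T j - tau j)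
         + h * norm (T (nx j) - tau (nx j)) + h * lam" by (simp add: Y_def y_def P_def th_def)
    have a: "norm (1 *\<^sub>R (t j - T j) - (Q j / 2) *\<^sub>R Z j) \<le> rho j" using c1[OF j] by simp
    have b: "norm (1 *\<^sub>R (T (nx j) - t j) - (Q (nx j) / 2) *\<^sub>R Z j) \<le> rho (nx j)" using c2[OF n] by (simp add: pvnx[OF j])
    have c: "((q j + q (nx j)) / 2) *\<^sub>R v j = 1 *\<^sub>R (tau (nx j) - tau j)
        - (phi / 2) *\<^sub>R perp (q j *\<^sub>R tau j + q (nx j) *\<^sub>R tau (nx j))" using scheme[OF j] by simp
    note R = node_edge[where s = 1, OF B h unit(1)[OF j] unit(2)[OF j] unit(1)[OF n] unit(2)[OF n] unit(3)[OF j]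
        Vt[OF j] Z[OF j] V(1)[OF j] F phi lam(1) lam2 Q[OF j] Q[OF n] P2[OF j, unfolded P_def] P2[OF n, unfolded P_def]
        rho(1,2)[OF j] rho(1,2)[OF n] _ a b c3[OF j] refl c, folded Yj e_def]
    show "\<bar>T j \<bullet> V j - tau j \<bullet> v j\<bar> \<le> C1 * (Y j + h * e j + h * (e j)^2)" using R(1) by (simp add: C1_def)
    show "norm ((T (nx j) - tau (nx j)) - (T j - tau j) - ((q j + q (nx j)) / 2) *\<^sub>R (V j - v j)) \<le> 11 * B ^ 4 * Y j"
      using R(2) by simp
  qed
  \<comment> \<open>The same bound at the start of edge \<open>j\<close>: the vertex is
    \<open>pv j\<close>, the orientation is reversed and \<open>s = -1\<close>.\<close>
  have edge_pv: "\<bar>T j \<bullet> V (pv j) - tau j \<bullet> v (pv j)\<bar> \<le> C1 * (Y (pv j) + h * e (pv j) + h * (e (pv j))^2)"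
    if j: "j \<in> J" for j
  proof -
    note n = pvJ[OF j]
    have Yj: "Y (pv j) = \<bar>Q j - q j\<bar> + \<bar>Q (pv j) - q (pv j)\<bar> + rho j + rho (pv j) + h * norm (T j - tau j)
         + h * norm (T (pv j) - tau (pv j)) + h * lam" by (simp add: Y_def y_def P_def th_def nxpv[OF j])
    have a: "norm ((-1) *\<^sub>R (t (pv j) - T j) - (Q j / 2) *\<^sub>R Z (pv j)) \<le> rho j" using c2[OF j] by simp
    have b: "norm ((-1) *\<^sub>R (T (pv j) - t (pv j)) - (Q (pv j) / 2) *\<^sub>R Z (pv j)) \<le> rho (pv j)" using c1[OF n] by simp
    have c: "((q j + q (pv j)) / 2) *\<^sub>R v (pv j) = (-1) *\<^sub>R (tau (pv j) - tau j)
        - (phi / 2) *\<^sub>R perp (q j *\<^sub>R tau j + q (pv j) *\<^sub>R tau (pv j))"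
      using scheme[OF n] by (simp add: nxpv[OF j] add.commute)
    have d: "\<bar>Q (pv j) - Q j\<bar> \<le> rho j + rho (pv j)" using c3[OF n] by (simp add: nxpv[OF j] abs_minus_commute add.commute)
    note R = node_edge(1)[where s = "-1", OF B h unit(1)[OF j] unit(2)[OF j] unit(1)[OF n] unit(2)[OF n] unit(3)[OF n]
        Vt[OF n] Z[OF n] V(1)[OF n] F phi lam(1) lam2 Q[OF j] Q[OF n] P2[OF j, unfolded P_def] P2[OF n, unfolded P_def]
        rho(1,2)[OF j] rho(1,2)[OF n] _ a b d refl c, folded Yj e_def]
    show ?thesis using R by (simp add: C1_def abs_minus_commute)
  qed
  let ?E = "\<Sum>j\<in>J. (e j)^2"
  have sumP: "(\<Sum>j\<in>J. (P j)^2) \<le> h * S" and sumth: "h * (\<Sum>j\<in>J. (th j)^2) \<le> 4 * B * S" and S0: "S \<ge> 0"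
  proof -
    have S: "S = (\<Sum>j\<in>J. (P j)^2) / h + (\<Sum>j\<in>J. q j * (th j)^2 / 2)"
      unfolding S_def P_def th_def by (simp add: sum.distrib sum_divide_distrib)
    have a: "(\<Sum>j\<in>J. q j * (th j)^2 / 2) \<ge> 0" using q0 by (intro sum_nonneg) (simp add: less_imp_le)
    have b: "(\<Sum>j\<in>J. (P j)^2) / h \<ge> 0" using h by (simp add: sum_nonneg)
    show "S \<ge> 0" using S a b by simp
    have "(\<Sum>j\<in>J. (P j)^2) / h \<le> S" using S a by simp
    then show "(\<Sum>j\<in>J. (P j)^2) \<le> h * S" using h by (simp add: field_simps)
    have "h * (\<Sum>j\<in>J. (th j)^2) = 4 * B * (\<Sum>j\<in>J. (h / (2 * B)) * (th j)^2 / 2)" using B0 by (simp add: sum_distrib_left)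
    also have "\<dots> \<le> 4 * B * (\<Sum>j\<in>J. q j * (th j)^2 / 2)"
      using q B0 by (intro mult_left_mono sum_mono divide_right_mono mult_right_mono) auto
    also have "\<dots> \<le> 4 * B * S" using S b B0 by (intro mult_left_mono) auto
    finally show "h * (\<Sum>j\<in>J. (th j)^2) \<le> 4 * B * S" .
  qed
  have sumy: "(\<Sum>j\<in>J. (y j)^2) \<le> 15 * B * (h * (S + h^2))"
  proof -
    have "(\<Sum>j\<in>J. (y j)^2) \<le> (\<Sum>j\<in>J. 3 * ((P j)^2 + (rho j)^2 + h * (h * (th j)^2)))"
    proof (rule sum_mono)
      fix j show "(y j)^2 \<le> 3 * ((P j)^2 + (rho j)^2 + h * (h * (th j)^2))"
        using square_add3_le[of "\<bar>P j\<bar>" "rho j" "h * th j"] by (simp add: y_def power_mult_distrib power2_eq_square mult_ac)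
    qed
    also have "\<dots> = 3 * ((\<Sum>j\<in>J. (P j)^2) + (\<Sum>j\<in>J. (rho j)^2) + h * (h * (\<Sum>j\<in>J. (th j)^2)))"
      by (simp add: sum.distrib sum_distrib_left)
    also have "\<dots> \<le> 3 * (h * S + B * h ^ 3 + h * (4 * B * S))" using sumP sumth rho(3) h by (intro mult_left_mono add_mono) auto
    also have "\<dots> = (3 + 12 * B) * (h * S) + 3 * B * (h * h^2)" by (simp add: algebra_simps power3_eq_cube power2_eq_square)
    also have "\<dots> \<le> 15 * B * (h * S) + 15 * B * (h * h^2)" using B h S0 by (intro add_mono mult_right_mono) auto
    finally show ?thesis by (simp add: algebra_simps)
  qed
  \<comment> \<open>Cauchy's inequality for the sum of length errors costs a factor
    \<open>card J\<close>, which \<open>card J * h \<le> B\<close> compensates.\<close>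
  have lam_sq: "lam^2 \<le> 2 * B^2 * (S + h^2)"
  proof -
    have "(\<Sum>j\<in>J. \<bar>P j\<bar>)^2 \<le> card J * (\<Sum>j\<in>J. \<bar>P j\<bar>^2)" by (rule sum_squared_le_card[OF finJ])
    also have "\<dots> \<le> card J * (h * S)" using sumP by (intro mult_left_mono) auto
    also have "\<dots> \<le> B * S" using mult_right_mono[OF N S0] by (simp add: mult.assoc)
    also have "\<dots> \<le> B^2 * S" using S0 B by (intro mult_right_mono) (auto simp: self_le_power)
    finally have a: "(\<Sum>j\<in>J. \<bar>P j\<bar>)^2 \<le> B^2 * S" .
    have "lam^2 \<le> (B * h + (\<Sum>j\<in>J. \<bar>P j\<bar>))^2" using lam by (intro power_mono) (auto simp: P_def)
    also have "\<dots> \<le> 2 * ((B * h)^2 + (\<Sum>j\<in>J. \<bar>P j\<bar>)^2)" by (rule square_add2_le)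
    also have "\<dots> \<le> 2 * ((B * h)^2 + B^2 * S)" using a by simp
    finally show ?thesis by (simp add: algebra_simps power_mult_distrib)
  qed
  have sumY: "(\<Sum>j\<in>J. (Y j)^2) \<le> 96 * B ^ 3 * (h * (S + h^2))"
  proof -
    have "(\<Sum>j\<in>J. (Y j)^2) \<le> (\<Sum>j\<in>J. 3 * ((y j)^2 + (y (nx j))^2 + (h * lam)^2))"
      unfolding Y_def by (intro sum_mono square_add3_le)
    also have "\<dots> = 3 * ((\<Sum>j\<in>J. (y j)^2) + (\<Sum>j\<in>J. (y (nx j))^2) + real (card J) * (h * lam)^2)"
      by (simp add: sum.distrib sum_distrib_left)
    also have "(\<Sum>j\<in>J. (y (nx j))^2) = (\<Sum>j\<in>J. (y j)^2)" by (rule sum_nx)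
    also have "real (card J) * (h * lam)^2 = (real (card J) * h) * (h * lam^2)" by (simp add: power2_eq_square)
    also have "\<dots> \<le> B * (h * (2 * B^2 * (S + h^2)))" using N lam_sq h B0 by (intro mult_mono) auto
    also have "\<dots> = 2 * B ^ 3 * (h * (S + h^2))" by (simp add: eval_nat_numeral)
    also have "3 * ((\<Sum>j\<in>J. (y j)^2) + (\<Sum>j\<in>J. (y j)^2) + 2 * B ^ 3 * (h * (S + h^2)))
        \<le> 90 * B * (h * (S + h^2)) + 6 * B ^ 3 * (h * (S + h^2))" using sumy by simp
    also have "\<dots> \<le> 90 * B ^ 3 * (h * (S + h^2)) + 6 * B ^ 3 * (h * (S + h^2))"
      using pw[of 1 3] S0 h B0 by (intro add_mono mult_right_mono) auto
    also have "\<dots> = (90 * B ^ 3 + 6 * B ^ 3) * (h * (S + h^2))" by (simp only: distrib_right)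
    finally show ?thesis by simp
  qed
  have sumYh: "(\<Sum>j\<in>J. (Y j)^2) / h \<le> 96 * B ^ 3 * (S + h^2)" using sumY h by (simp add: field_simps)
  have dQb: "\<bar>dQ j\<bar> \<le> B * h" if "j \<in> J" for j
    using abs_inner_le[of "T j" 1 "V j - V (pv j)" "B * h"] unit(1)[OF that] V(2)[OF that] by (simp add: dQ_def)
  \<comment> \<open>Products of a length error with a velocity error are split by Young's inequality
    with weight \<open>h / (32 * B)\<close>, and the quadratic velocity term is bounded by the
    choice of \<open>eps\<close> with the same weight. After both ends of every edge are summed,
    \<open>h / (8 * B)\<close> of the dissipation is spent.\<close>
  have A1: "2 * P j * (dQ j - dq j) / h \<le> (C1 + 64 * B * C1^2) * ((P j)^2 / h)
       + 2 * C1 * (((Y j)^2 + (Y (pv j))^2) / h) + h / (16 * B) * ((e j)^2 + (e (pv j))^2)" if j: "j \<in> J" for j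
  proof -
    define a where "a = \<bar>P j\<bar>"
    define U where "U = Y j + Y (pv j)"
    define e1 where "e1 = e j"
    define e2 where "e2 = e (pv j)"
    have a0: "a \<ge> 0" "a \<le> eps * h" using Peps[OF j] by (auto simp: a_def)
    have "\<bar>dQ j - dq j\<bar> \<le> \<bar>T j \<bullet> V j - tau j \<bullet> v j\<bar> + \<bar>T j \<bullet> V (pv j) - tau j \<bullet> v (pv j)\<bar>"
      by (simp add: dQ_def dq_def inner_diff_right)
    also have "\<dots> \<le> C1 * (Y j + h * e j + h * (e j)^2) + C1 * (Y (pv j) + h * e (pv j) + h * (e (pv j))^2)"
      by (rule add_mono[OF edge_nx[OF j] edge_pv[OF j]])
    also have "\<dots> = C1 * (U + h * (e1 + e2) + h * (e1^2 + e2^2))" by (simp add: algebra_simps e1_def e2_def U_def)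
    finally have d: "\<bar>dQ j - dq j\<bar> \<le> C1 * (U + h * (e1 + e2) + h * (e1^2 + e2^2))" .
    have "2 * P j * (dQ j - dq j) / h \<le> 2 * a * \<bar>dQ j - dq j\<bar> / h"
      using h by (intro divide_right_mono) (auto simp: a_def simp flip: abs_mult)
    also have "\<dots> \<le> 2 * a * (C1 * (U + h * (e1 + e2) + h * (e1^2 + e2^2))) / h"
      using d a0 h by (intro divide_right_mono mult_left_mono) auto
    also have "\<dots> = C1 * (2 * a * U / h) + e1 * (2 * C1 * a) + e2 * (2 * C1 * a) + 2 * C1 * a * (e1^2 + e2^2)"
      using h by (simp add: field_simps)
    also have "\<dots> \<le> C1 * (a^2 / h + 2 * (((Y j)^2 + (Y (pv j))^2) / h))
        + (h / (32 * B) * e1^2 + 32 * B * C1^2 * (a^2 / h)) + (h / (32 * B) * e2^2 + 32 * B * C1^2 * (a^2 / h))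
        + h / (32 * B) * (e1^2 + e2^2)"
    proof (intro add_mono mult_left_mono)
      have "2 * a * U \<le> a^2 + U^2" using sum_squares_bound[of a U] by simp
      also have "U^2 \<le> 2 * ((Y j)^2 + (Y (pv j))^2)" unfolding U_def by (rule square_add2_le)
      finally have "2 * a * U / h \<le> (a^2 + 2 * ((Y j)^2 + (Y (pv j))^2)) / h" using h by (intro divide_right_mono) auto
      then show "2 * a * U / h \<le> a^2 / h + 2 * (((Y j)^2 + (Y (pv j))^2) / h)" by (simp add: add_divide_distrib)
      have yy: "x * (2 * C1 * a) \<le> h / (32 * B) * x^2 + 32 * B * C1^2 * (a^2 / h)" for x
      proof -
        have "x * (2 * C1 * a) \<le> h / (32 * B) * x^2 + (2 * C1 * a)^2 / (4 * (h / (32 * B)))" using h B0 by (intro young_ineq) auto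
        also have "(2 * C1 * a)^2 / (4 * (h / (32 * B))) = 32 * B * C1^2 * (a^2 / h)" using h B0 by (simp add: power_mult_distrib)
        finally show ?thesis .
      qed
      show "e1 * (2 * C1 * a) \<le> h / (32 * B) * e1^2 + 32 * B * C1^2 * (a^2 / h)" by (rule yy)
      show "e2 * (2 * C1 * a) \<le> h / (32 * B) * e2^2 + 32 * B * C1^2 * (a^2 / h)" by (rule yy)
      have "2 * C1 * a \<le> 2 * C1 * (eps * h)" using a0 C10 by (intro mult_left_mono) auto
      also have "\<dots> = h / (32 * B)" using C10 B0 by (simp add: eps_def field_simps)
      finally show "2 * C1 * a * (e1^2 + e2^2) \<le> h / (32 * B) * (e1^2 + e2^2)" by (rule mult_right_mono) simp
    qed (use C10 in auto)
    also have "\<dots> = (C1 + 64 * B * C1^2) * (a^2 / h)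
       + 2 * C1 * (((Y j)^2 + (Y (pv j))^2) / h) + h / (16 * B) * (e1^2 + e2^2)"
    proof -
      define r where "r = h / (32 * B)"
      have "h / (16 * B) = 2 * r" by (simp add: r_def)
      then show ?thesis unfolding r_def[symmetric] by (simp add: algebra_simps)
    qed
    finally show ?thesis by (simp add: a_def e1_def e2_def)
  qed
  have sumA1: "(\<Sum>j\<in>J. 2 * P j * (dQ j - dq j) / h) \<le> (C1 + 64 * B * C1^2) * S
       + 4 * C1 * (96 * B ^ 3 * (S + h^2)) + h / (8 * B) * ?E"
  proof -
    have "(\<Sum>j\<in>J. 2 * P j * (dQ j - dq j) / h) \<le> (\<Sum>j\<in>J. (C1 + 64 * B * C1^2) * ((P j)^2 / h)
       + 2 * C1 * (((Y j)^2 + (Y (pv j))^2) / h) + h / (16 * B) * ((e j)^2 + (e (pv j))^2))" by (intro sum_mono A1)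
    also have "\<dots> = (C1 + 64 * B * C1^2) * ((\<Sum>j\<in>J. (P j)^2) / h)
       + 2 * C1 * (((\<Sum>j\<in>J. (Y j)^2) + (\<Sum>j\<in>J. (Y (pv j))^2)) / h) + h / (16 * B) * (?E + (\<Sum>j\<in>J. (e (pv j))^2))"
      by (simp only: sum.distrib sum_distrib_left[symmetric] sum_divide_distrib[symmetric])
    also have "(\<Sum>j\<in>J. (Y (pv j))^2) = (\<Sum>j\<in>J. (Y j)^2)" by (rule sum_pv)
    also have "(\<Sum>j\<in>J. (e (pv j))^2) = ?E" by (rule sum_pv)
    also have "(C1 + 64 * B * C1^2) * ((\<Sum>j\<in>J. (P j)^2) / h)
       + 2 * C1 * (((\<Sum>j\<in>J. (Y j)^2) + (\<Sum>j\<in>J. (Y j)^2)) / h) + h / (16 * B) * (?E + ?E)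
       = (C1 + 64 * B * C1^2) * ((\<Sum>j\<in>J. (P j)^2) / h) + 4 * C1 * ((\<Sum>j\<in>J. (Y j)^2) / h) + h / (8 * B) * ?E"
      using h B0 by (simp add: field_simps)
    also have "\<dots> \<le> (C1 + 64 * B * C1^2) * S + 4 * C1 * (96 * B ^ 3 * (S + h^2)) + h / (8 * B) * ?E"
      using sumP sumYh C10 B0 h by (intro add_mono mult_left_mono) (auto simp: field_simps)
    finally show ?thesis .
  qed
  \<comment> \<open>Summation by parts moves the difference from the velocities to the directions,
    and \<open>mom\<close> replaces the difference of direction errors by mass times velocity error.
    This is the only source of dissipation: it yields \<open>h / (2 * B)\<close>, of which
    \<open>h / (8 * B)\<close> is given back to absorb the remainder of \<open>mom\<close>.\<close>
  have sumA2: "(\<Sum>j\<in>J. (T j - tau j) \<bullet> ((V j - v j) - (V (pv j) - v (pv j))))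
     \<le> - (h / (2 * B)) * ?E + h / (8 * B) * ?E + 242 * B ^ 9 * (96 * B ^ 3 * (S + h^2))"
  proof -
    have "(\<Sum>j\<in>J. (T j - tau j) \<bullet> ((V j - v j) - (V (pv j) - v (pv j))))
        = (\<Sum>j\<in>J. (T j - tau j) \<bullet> (V j - v j)) - (\<Sum>j\<in>J. (T j - tau j) \<bullet> (V (pv j) - v (pv j)))"
      by (simp add: inner_diff_right sum_subtractf)
    also have "(\<Sum>j\<in>J. (T j - tau j) \<bullet> (V (pv j) - v (pv j)))
        = (\<Sum>j\<in>J. (T (nx j) - tau (nx j)) \<bullet> (V (pv (nx j)) - v (pv (nx j))))" by (rule sum_nx[symmetric])
    also have "\<dots> = (\<Sum>j\<in>J. (T (nx j) - tau (nx j)) \<bullet> (V j - v j))" by (intro sum.cong refl) (simp add: pvnx)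
    also have "(\<Sum>j\<in>J. (T j - tau j) \<bullet> (V j - v j)) - \<dots>
        = (\<Sum>j\<in>J. - (((T (nx j) - tau (nx j)) - (T j - tau j)) \<bullet> (V j - v j)))"
      by (simp add: inner_diff_left sum_subtractf sum_negf)
    also have "\<dots> \<le> (\<Sum>j\<in>J. - (h / (2 * B)) * (e j)^2 + (h / (8 * B) * (e j)^2 + 242 * B ^ 9 * ((Y j)^2 / h)))"
    proof (rule sum_mono)
      fix j assume j: "j \<in> J"
      define m where "m = (q j + q (nx j)) / 2"
      define W where "W = V j - v j"
      define b where "b = (T (nx j) - tau (nx j)) - (T j - tau j) - m *\<^sub>R W"
      have m: "m \<ge> h / (2 * B)" using add_mono[OF q[OF j] q[OF nxJ[OF j]]] unfolding m_def by simp
      have b: "norm b \<le> 11 * B ^ 4 * Y j" using mom[OF j] by (simp add: b_def m_def W_def)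
      have "- (((T (nx j) - tau (nx j)) - (T j - tau j)) \<bullet> W) = - (m * (W \<bullet> W)) - b \<bullet> W"
        by (simp add: b_def inner_diff_left)
      also have "\<dots> \<le> - ((h / (2 * B)) * (e j)^2) + e j * (11 * B ^ 4 * Y j)"
      proof -
        have "(h / (2 * B)) * (e j)^2 \<le> m * (W \<bullet> W)"
          using mult_right_mono[OF m inner_ge_zero[of W]] by (simp add: e_def W_def power2_norm_eq_inner)
        moreover have "\<bar>b \<bullet> W\<bar> \<le> (11 * B ^ 4 * Y j) * e j" using b by (rule abs_inner_le) (simp add: e_def W_def)
        ultimately show ?thesis by (simp add: mult.commute)
      qed
      also have "e j * (11 * B ^ 4 * Y j) \<le> h / (8 * B) * (e j)^2 + (11 * B ^ 4 * Y j)^2 / (4 * (h / (8 * B)))"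
        using h B0 by (intro young_ineq) auto
      also have "(11 * B ^ 4 * Y j)^2 / (4 * (h / (8 * B))) = 242 * B ^ 9 * ((Y j)^2 / h)"
      proof -
        have "(B ^ 4)^2 * B = B ^ 9" by (simp add: power_mult[symmetric] eval_nat_numeral)
        then show ?thesis using h B0 by (simp add: power_mult_distrib)
      qed
      finally show "- (((T (nx j) - tau (nx j)) - (T j - tau j)) \<bullet> (V j - v j))
         \<le> - (h / (2 * B)) * (e j)^2 + (h / (8 * B) * (e j)^2 + 242 * B ^ 9 * ((Y j)^2 / h))" by (simp add: W_def)
    qed
    also have "\<dots> = - (h / (2 * B)) * ?E + (h / (8 * B) * ?E + 242 * B ^ 9 * ((\<Sum>j\<in>J. (Y j)^2) / h))"
      by (simp only: sum.distrib sum_distrib_left sum_divide_distrib)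
    also have "\<dots> \<le> - (h / (2 * B)) * ?E + (h / (8 * B) * ?E + 242 * B ^ 9 * (96 * B ^ 3 * (S + h^2)))"
      using sumYh B0 by (intro add_left_mono mult_left_mono) auto
    finally show ?thesis by simp
  qed
  have sumA3: "(\<Sum>j\<in>J. - (dQ j * (th j)^2 / 2)) \<le> 2 * B^2 * S"
  proof -
    have "(\<Sum>j\<in>J. - (dQ j * (th j)^2 / 2)) \<le> (\<Sum>j\<in>J. B / 2 * (h * (th j)^2))"
    proof (rule sum_mono)
      fix j assume j: "j \<in> J"
      have "- dQ j * (th j)^2 \<le> (B * h) * (th j)^2" using dQb[OF j] by (intro mult_right_mono) auto
      then show "- (dQ j * (th j)^2 / 2) \<le> B / 2 * (h * (th j)^2)" by simp
    qed
    also have "\<dots> = B / 2 * (h * (\<Sum>j\<in>J. (th j)^2))" by (simp add: sum_distrib_left)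
    also have "\<dots> \<le> B / 2 * (4 * B * S)" using sumth B0 by (intro mult_left_mono) auto
    finally show ?thesis by (simp add: power2_eq_square)
  qed
  \<comment> \<open>The vector tested with \<open>tau j\<close> is the rate of the unit vector
    \<open>T j\<close> and therefore orthogonal to it. Hence \<open>tau j\<close> may be replaced by
    \<open>tau j - T j\<close>, which makes the term quadratic in the errors.\<close>
  have sumA4: "(\<Sum>j\<in>J. P j * (tau j \<bullet> ((V j - V (pv j) - dQ j *\<^sub>R T j) /\<^sub>R Q j))) \<le> 5 * B ^ 3 * S"
  proof -
    have "(\<Sum>j\<in>J. P j * (tau j \<bullet> ((V j - V (pv j) - dQ j *\<^sub>R T j) /\<^sub>R Q j)))
       \<le> (\<Sum>j\<in>J. B^2 * ((P j)^2 / h) + B^2 * (h * (th j)^2))"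
    proof (rule sum_mono)
      fix j assume j: "j \<in> J"
      define w where "w = (V j - V (pv j) - dQ j *\<^sub>R T j) /\<^sub>R Q j"
      have Qj: "Q j \<ge> h / B" "h / B > 0" using Q(1)[OF j] h B0 by auto
      have "norm (V j - V (pv j) - dQ j *\<^sub>R T j) \<le> 2 * B * h"
        using norm_triangle_ineq4[of "V j - V (pv j)" "dQ j *\<^sub>R T j"] V(2)[OF j] dQb[OF j] unit(1)[OF j] by simp
      then have "norm w \<le> (2 * B * h) / Q j" using Qj unfolding w_def by (simp add: divide_inverse mult.commute mult_right_mono)
      also have "\<dots> \<le> (2 * B * h) / (h / B)" using Qj B0 h less_le_trans[OF Qj(2,1)] by (intro divide_left_mono mult_pos_pos) auto
      also have "\<dots> = 2 * B^2" using h by (simp add: power2_eq_square)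
      finally have w: "norm w \<le> 2 * B^2" .
      have "T j \<bullet> T j = 1" using unit(1)[OF j] by (simp add: dot_square_norm)
      then have "T j \<bullet> w = 0" unfolding w_def by (simp add: inner_diff_right dQ_def)
      then have "tau j \<bullet> w = - ((T j - tau j) \<bullet> w)" by (simp add: inner_diff_left)
      moreover have "\<bar>(T j - tau j) \<bullet> w\<bar> \<le> th j * (2 * B^2)" using w by (intro abs_inner_le) (auto simp: th_def)
      ultimately have "\<bar>P j * (tau j \<bullet> w)\<bar> \<le> \<bar>P j\<bar> * (th j * (2 * B^2))"
        unfolding abs_mult by (intro mult_left_mono) auto
      also have "\<dots> = B^2 * (th j * (2 * \<bar>P j\<bar>))" by simp
      also have "\<dots> \<le> B^2 * (h * (th j)^2 + (2 * \<bar>P j\<bar>)^2 / (4 * h))" using h by (intro mult_left_mono young_ineq) auto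
      also have "\<dots> = B^2 * ((P j)^2 / h) + B^2 * (h * (th j)^2)" by (simp add: power_mult_distrib algebra_simps)
      finally show "P j * (tau j \<bullet> ((V j - V (pv j) - dQ j *\<^sub>R T j) /\<^sub>R Q j)) \<le> B^2 * ((P j)^2 / h) + B^2 * (h * (th j)^2)"
        unfolding w_def by linarith
    qed
    also have "\<dots> = B^2 * ((\<Sum>j\<in>J. (P j)^2) / h) + B^2 * (h * (\<Sum>j\<in>J. (th j)^2))"
      by (simp only: sum.distrib sum_distrib_left sum_divide_distrib)
    also have "\<dots> \<le> B^2 * S + B^2 * (4 * B * S)" using sumP sumth h by (intro add_mono mult_left_mono) (auto simp: field_simps)
    also have "\<dots> = (B^2 + 4 * B ^ 3) * S" by (simp add: algebra_simps eval_nat_numeral)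
    also have "\<dots> \<le> 5 * B ^ 3 * S" using pw[of 2 3] S0 by (intro mult_right_mono) auto
    finally show ?thesis .
  qed
  let ?R = "S + h^2"
  have R: "S \<le> ?R" "?R \<ge> 0" using S0 by auto
  have "(\<Sum>j\<in>J. 2 * P j * (dQ j - dq j) / h
        + (T j - tau j) \<bullet> ((V j - v j) - (V (pv j) - v (pv j)))
        - dQ j * (th j)^2 / 2 + P j * (tau j \<bullet> ((V j - V (pv j) - dQ j *\<^sub>R T j) /\<^sub>R Q j)))
     = (\<Sum>j\<in>J. 2 * P j * (dQ j - dq j) / h)
       + (\<Sum>j\<in>J. (T j - tau j) \<bullet> ((V j - v j) - (V (pv j) - v (pv j))))
       + (\<Sum>j\<in>J. - (dQ j * (th j)^2 / 2))
       + (\<Sum>j\<in>J. P j * (tau j \<bullet> ((V j - V (pv j) - dQ j *\<^sub>R T j) /\<^sub>R Q j)))"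
    by (simp add: sum.distrib sum_subtractf sum_negf)
  also have "\<dots> \<le> ((C1 + 64 * B * C1^2) * S + 4 * C1 * (96 * B ^ 3 * ?R) + h / (8 * B) * ?E)
      + (- (h / (2 * B)) * ?E + h / (8 * B) * ?E + 242 * B ^ 9 * (96 * B ^ 3 * ?R)) + 2 * B^2 * S + 5 * B ^ 3 * S"
    using sumA1 sumA2 sumA3 sumA4 by (intro add_mono) auto
  also have "\<dots> = - (h / (4 * B)) * ?E + ((C1 + 64 * B * C1^2) + 2 * B^2 + 5 * B ^ 3) * S + (384 * C1 * B ^ 3 + 23232 * B ^ 12) * ?R"
  proof -
    define r where "r = h / (8 * B)"
    define R where "R = ?R"
    have r: "h / (8 * B) = r" "h / (2 * B) = 4 * r" "h / (4 * B) = 2 * r" by (simp_all add: r_def)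
    have "242 * B ^ 9 * (96 * B ^ 3 * R) = 23232 * B ^ 12 * R" by (simp add: eval_nat_numeral)
    then show ?thesis unfolding r R_def[symmetric] by (simp add: algebra_simps)
  qed
  \<comment> \<open>The dominating constant is \<open>64 * B * C1^2 = 5760000 * B^17\<close>. The
    surviving dissipation \<open>h / (4 * B)\<close> is \<open>h / (2 * B)\<close> minus twice
    \<open>h / (8 * B)\<close>.\<close>
  also have "\<dots> \<le> - (h / (4 * B)) * ?E + (5760307 * B ^ 17) * ?R + (138432 * B ^ 17) * ?R"
  proof -
    have c: "C1^2 * B = 90000 * B ^ 17" by (simp add: C1_def power_mult_distrib power_mult[symmetric] eval_nat_numeral)
    have c': "(C1 + 64 * B * C1^2) + 2 * B^2 + 5 * B ^ 3 \<le> 5760307 * B ^ 17"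
      using c pw[of 8 17] pw[of 2 17] pw[of 3 17] unfolding C1_def by (simp add: mult.commute)
    have d: "C1 * B ^ 3 = 300 * B ^ 11" by (simp add: C1_def eval_nat_numeral)
    have d': "384 * C1 * B ^ 3 + 23232 * B ^ 12 \<le> 138432 * B ^ 17" using d pw[of 11 17] pw[of 12 17] by (simp add: mult.assoc)
    have "((C1 + 64 * B * C1^2) + 2 * B^2 + 5 * B ^ 3) * S \<le> (5760307 * B ^ 17) * ?R" using c' R S0 B0 by (intro mult_mono) auto
    moreover have "(384 * C1 * B ^ 3 + 23232 * B ^ 12) * ?R \<le> (138432 * B ^ 17) * ?R" using d' R by (intro mult_right_mono) auto
    ultimately show ?thesis by linarith
  qed
  also have "\<dots> \<le> - (h / (4 * B)) * ?E + 6000000 * B ^ 17 * ?R"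
    using mult_right_mono[OF _ R(2), of "5898739 * B ^ 17" "6000000 * B ^ 17"] B0 by (simp add: algebra_simps)
  finally show ?thesis unfolding P_def th_def e_def .
qed

end

section \<open>Lipschitz systems\<close>

text \<open>The Lipschitz condition refers to a common bound \<open>r\<close> of finitely many
  component distances; their sum can serve as \<open>r\<close> and tends to 0.\<close>

lemma continuous_on_lipschitz_field:
  fixes F :: "(nat \<Rightarrow> 'a::real_normed_vector) \<Rightarrow> 'a" and g :: "nat \<Rightarrow> 't::metric_space \<Rightarrow> 'a"
  assumes fin: "finite I"
    and lip: "\<And>a b r. (\<And>i. i \<in> I ==> norm (a i - b i) \<le> r) ==> norm (F a - F b) \<le> L * r"
    and g: "\<And>i. i \<in> I ==> continuous_on S (g i)"
  shows "continuous_on S (\<lambda>s. F (\<lambda>i. g i s))"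
  unfolding continuous_on_def
proof
  fix x assume x: "x \<in> S"
  have "((\<lambda>s. L * (\<Sum>i\<in>I. norm (g i s - g i x))) \<longlongrightarrow> L * (\<Sum>i\<in>I. norm (g i x - g i x))) (at x within S)"
    using g x by (intro tendsto_intros) (auto simp: continuous_on_def)
  then have lim: "((\<lambda>s. L * (\<Sum>i\<in>I. norm (g i s - g i x))) \<longlongrightarrow> 0) (at x within S)" by simp
  have "((\<lambda>s. F (\<lambda>i. g i s) - F (\<lambda>i. g i x)) \<longlongrightarrow> 0) (at x within S)"
  proof (rule Lim_null_comparison[OF _ lim], rule always_eventually, rule allI)
    fix s
    show "norm (F (\<lambda>i. g i s) - F (\<lambda>i. g i x)) \<le> L * (\<Sum>i\<in>I. norm (g i s - g i x))"
    proof (rule lip)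
      fix i assume "i \<in> I"
      then show "norm (g i s - g i x) \<le> (\<Sum>i\<in>I. norm (g i s - g i x))" using fin by (intro member_le_sum) auto
    qed
  qed
  then show "((\<lambda>s. F (\<lambda>i. g i s)) \<longlongrightarrow> F (\<lambda>i. g i x)) (at x within S)" by (simp add: LIM_zero_iff)
qed

text \<open>Picard's theorem on the whole interval by a single contraction: the unknown is rescaled
  by \<open>exp (- k * t)\<close>, which outweighs the Lipschitz constant. The finite system is
  packed into one bounded continuous function on the plane, whose restriction to the line with first
  coordinate \<open>j\<close> is the component \<open>j\<close>, so that Banach's fixed point
  theorem applies in this complete space. Times outside the interval are clamped to it by
  \<open>cl\<close>.\<close>

lemma ode_exists:
  fixes F :: "nat \<Rightarrow> (nat \<Rightarrow> 'a::banach) \<Rightarrow> 'a" and x0 :: "nat \<Rightarrow> 'a"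
  assumes fin: "finite I" and L: "L > 0" and T: "T \<ge> 0"
    and bnd: "\<And>j a. j \<in> I ==> norm (F j a) \<le> Bd"
    and lip: "\<And>j a b r. j \<in> I ==> (\<And>i. i \<in> I ==> norm (a i - b i) \<le> r) ==> norm (F j a - F j b) \<le> L * r"
  obtains u where "\<And>j. j \<in> I ==> u j 0 = x0 j"
    "\<And>j t. j \<in> I ==> t \<in> {0..T} ==> (u j has_vector_derivative F j (\<lambda>i. u i t)) (at t within {0..T})"
proof -
  define cl where "cl t = max 0 (min T t)" for t :: real
  have cl: "cl t \<in> {0..T}" for t using T by (auto simp: cl_def)
  have cl_id: "cl t = t" if "t \<in> {0..T}" for t using that by (auto simp: cl_def)
  have clc: "continuous_on UNIV cl" unfolding cl_def by (intro continuous_intros)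
  \<comment> \<open>With this rate the integral operator contracts by
    \<open>card I * L / k \<le> 1 / 2\<close>; the factor \<open>card I\<close> pays for bounding
    each weight \<open>wt\<close> by 1.\<close>
  define k where "k = 2 * L * (real (card I) + 1)"
  have k: "k > 0" using L by (simp add: k_def add_nonneg_pos)
  \<comment> \<open>Tent functions, equal to 1 at their own index and to 0 at every other natural
    number: they connect the components continuously without mixing their values on the lines that
    matter.\<close>
  define wt where "wt j x = max 0 (1 - \<bar>x - real j\<bar>)" for j :: nat and x :: real
  have wt: "0 \<le> wt j x" "wt j x \<le> 1" "wt j (real i) = (if i = j then 1 else 0)" for j x i
  proof -
    have "\<bar>real i - real j\<bar> \<ge> 1" if "i \<noteq> j" using that by (cases "i < j") auto
    then show "wt j (real i) = (if i = j then 1 else 0)" by (auto simp: wt_def)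
  qed (auto simp: wt_def)
  define G where "G u j s = F j (\<lambda>i. exp (k * s) *\<^sub>R apply_bcontfun u (real i, s))" for u :: "(real \<times> real) \<Rightarrow>\<^sub>C 'a" and j s
  have uc: "continuous_on S (\<lambda>s. apply_bcontfun u (real i, s))" for u :: "(real \<times> real) \<Rightarrow>\<^sub>C 'a" and i S
  proof -
    have "continuous_on UNIV (apply_bcontfun u)" using apply_bcontfun[of u] by (simp add: bcontfun_def)
    then show ?thesis by (rule continuous_on_compose2) (auto intro!: continuous_intros)
  qed
  have Gc: "continuous_on S (G u j)" if "j \<in> I" for u j S unfolding G_def
  proof (rule continuous_on_lipschitz_field[OF fin, where L = L and F = "F j" and g = "\<lambda>i s. exp (k * s) *\<^sub>R apply_bcontfun u (real i, s)"])
    show "norm (F j a - F j b) \<le> L * r" if "\<And>i. i \<in> I ==> norm (a i - b i) \<le> r" for a b r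
      using \<open>j \<in> I\<close> that by (rule lip)
    show "continuous_on S (\<lambda>s. exp (k * s) *\<^sub>R apply_bcontfun u (real i, s))" for i by (intro continuous_intros uc)
  qed
  define H where "H u j t = exp (- k * cl t) *\<^sub>R (x0 j + integral {0..cl t} (G u j))" for u j t
  define Phi where "Phi u z = (\<Sum>j\<in>I. wt j (fst z) *\<^sub>R H u j (snd z))" for u and z :: "real \<times> real"
  have intc: "continuous_on {0..T} (\<lambda>t. integral {0..t} (G u j))" if "j \<in> I" for u j
    by (rule indefinite_integral_continuous_1) (rule integrable_continuous_real[OF Gc[OF that]])
  have Hc: "continuous_on UNIV (H u j)" if "j \<in> I" for u j
  proof -
    have "continuous_on UNIV (\<lambda>t. integral {0..cl t} (G u j))"
      by (rule continuous_on_compose2[OF intc[OF that] clc]) (use cl in auto)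
    then show ?thesis unfolding H_def by (intro continuous_intros clc)
  qed
  have Hb: "norm (H u j t) \<le> norm (x0 j) + T * \<bar>Bd\<bar>" if "j \<in> I" for u j t
  proof -
    have "norm (integral {0..cl t} (G u j)) \<le> \<bar>Bd\<bar> * (cl t - 0)"
      using cl[of t] by (intro integral_bound Gc[OF that]) (auto simp: G_def intro: order_trans[OF bnd[OF that] abs_ge_self])
    also have "\<dots> \<le> T * \<bar>Bd\<bar>" using cl[of t] by (simp add: mult.commute[of T] mult_left_mono)
    finally have "norm (x0 j + integral {0..cl t} (G u j)) \<le> norm (x0 j) + T * \<bar>Bd\<bar>"
      using norm_triangle_ineq[of "x0 j" "integral {0..cl t} (G u j)"] by linarith
    moreover have "exp (- k * cl t) \<le> 1" using cl[of t] k by simp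
    ultimately have "exp (- k * cl t) * norm (x0 j + integral {0..cl t} (G u j)) \<le> 1 * (norm (x0 j) + T * \<bar>Bd\<bar>)"
      by (intro mult_mono) auto
    then show ?thesis by (simp add: H_def)
  qed
  have PhiB: "Phi u \<in> bcontfun" for u
  proof -
    have "continuous_on UNIV (Phi u)" unfolding Phi_def wt_def by (intro continuous_intros continuous_on_compose2[OF Hc]) auto
    moreover have "norm (Phi u z) \<le> (\<Sum>j\<in>I. norm (x0 j) + T * \<bar>Bd\<bar>)" for z
    proof -
      have "norm (Phi u z) \<le> (\<Sum>j\<in>I. norm (wt j (fst z) *\<^sub>R H u j (snd z)))" unfolding Phi_def by (rule norm_sum)
      also have "\<dots> \<le> (\<Sum>j\<in>I. 1 * (norm (x0 j) + T * \<bar>Bd\<bar>))"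
        unfolding norm_scaleR using wt(1,2) Hb by (intro sum_mono mult_mono) auto
      finally show ?thesis by simp
    qed
    then have "bounded (range (Phi u))" by (auto simp: bounded_iff)
    ultimately show ?thesis by (simp add: bcontfun_def)
  qed
  define Psi where "Psi u = Bcontfun (Phi u)" for u
  have Psi: "apply_bcontfun (Psi u) = Phi u" for u by (simp add: Psi_def Bcontfun_inverse PhiB)
  have contr: "dist (Psi u) (Psi w) \<le> 1 / 2 * dist u w" for u w
  proof (rule dist_bound)
    fix z :: "real \<times> real"
    define D where "D = dist u w"
    have D: "norm (apply_bcontfun u y - apply_bcontfun w y) \<le> D" for y using dist_bounded[of u y w] by (simp add: dist_norm D_def)
    have D0: "D \<ge> 0" by (simp add: D_def)
    have Hd: "norm (H u j t - H w j t) \<le> L * D / k" if j: "j \<in> I" for j t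
    proof -
      let ?t = "cl t"
      have e: "((\<lambda>s. L * (exp (k * s) * D)) has_integral (L * D / k) * exp (k * ?t) - (L * D / k) * exp (k * 0)) {0..?t}"
        using cl[of t] k by (intro fundamental_theorem_of_calculus)
          (auto intro!: derivative_eq_intros simp flip: has_real_derivative_iff_has_vector_derivative)
      have "norm (integral {0..?t} (G u j) - integral {0..?t} (G w j)) = norm (integral {0..?t} (\<lambda>s. G u j s - G w j s))"
        by (subst Henstock_Kurzweil_Integration.integral_diff) (auto intro!: integrable_continuous_real Gc[OF j])
      also have "\<dots> \<le> integral {0..?t} (\<lambda>s. L * (exp (k * s) * D))"
      proof (rule integral_norm_bound_integral)
        show "(\<lambda>s. G u j s - G w j s) integrable_on {0..?t}" by (intro integrable_continuous_real continuous_intros Gc[OF j])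
        show "(\<lambda>s. L * (exp (k * s) * D)) integrable_on {0..?t}" using e by blast
        fix s
        show "norm (G u j s - G w j s) \<le> L * (exp (k * s) * D)" unfolding G_def
        proof (rule lip[OF j])
          fix i
          show "norm (exp (k * s) *\<^sub>R apply_bcontfun u (real i, s) - exp (k * s) *\<^sub>R apply_bcontfun w (real i, s)) \<le> exp (k * s) * D"
            using D[of "(real i, s)"] by (simp flip: scaleR_diff_right)
        qed
      qed
      also have "\<dots> \<le> (L * D / k) * exp (k * ?t)" using integral_unique[OF e] D0 L k by simp
      finally have "exp (- k * ?t) * norm (integral {0..?t} (G u j) - integral {0..?t} (G w j)) \<le> exp (- k * ?t) * ((L * D / k) * exp (k * ?t))"
        by (rule mult_left_mono) simp
      also have "\<dots> = L * D / k" by (simp add: exp_minus)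
      finally show ?thesis unfolding H_def by (simp flip: scaleR_diff_right)
    qed
    have "norm (Phi u z - Phi w z) = norm (\<Sum>j\<in>I. wt j (fst z) *\<^sub>R (H u j (snd z) - H w j (snd z)))"
      by (simp add: Phi_def sum_subtractf scaleR_diff_right)
    also have "\<dots> \<le> (\<Sum>j\<in>I. norm (wt j (fst z) *\<^sub>R (H u j (snd z) - H w j (snd z))))" by (rule norm_sum)
    also have "\<dots> \<le> (\<Sum>j\<in>I. 1 * (L * D / k))" unfolding norm_scaleR using wt(1,2) Hd by (intro sum_mono mult_mono) auto
    also have "\<dots> = real (card I) / (real (card I) + 1) * (D / 2)"
    proof -
      have "L * D / k = D / (2 * (real (card I) + 1))" using L by (simp add: k_def)
      then show ?thesis by simp
    qed
    also have "\<dots> \<le> 1 * (D / 2)" using D0 by (intro mult_right_mono) auto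
    finally show "dist (apply_bcontfun (Psi u) z) (apply_bcontfun (Psi w) z) \<le> 1 / 2 * dist u w"
      unfolding Psi dist_norm[of "Phi u z"] D_def[symmetric] by simp
  qed
  have "\<exists>!u. Psi u = u" by (rule banach_fix_type[of "1/2"]) (use contr in auto)
  then obtain u where u: "Psi u = u" by blast
  define U where "U j t = exp (k * t) *\<^sub>R apply_bcontfun u (real j, t)" for j t
  have U: "U j t = x0 j + integral {0..t} (\<lambda>s. F j (\<lambda>i. U i s))" if "j \<in> I" "t \<in> {0..T}" for j t
  proof -
    have "apply_bcontfun u (real j, t) = (\<Sum>i\<in>I. wt i (real j) *\<^sub>R H u i t)" using Psi[of u] by (simp add: u Phi_def)
    also have "\<dots> = (\<Sum>i\<in>I. if i = j then H u i t else 0)" by (intro sum.cong refl) (auto simp: wt(3))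
    also have "\<dots> = exp (- k * t) *\<^sub>R (x0 j + integral {0..t} (G u j))" using that fin by (simp add: H_def cl_id)
    finally show ?thesis by (simp add: U_def G_def[abs_def] flip: exp_add)
  qed
  show thesis
  proof (rule that[of U])
    fix j assume j: "j \<in> I"
    show "U j 0 = x0 j" using U[OF j, of 0] T by simp
    fix t assume t: "t \<in> {0..T}"
    have GU: "G u j = (\<lambda>s. F j (\<lambda>i. U i s))" by (simp add: G_def U_def fun_eq_iff)
    have "((\<lambda>t. x0 j + integral {0..t} (G u j)) has_vector_derivative (0 + G u j t)) (at t within {0..T})"
      by (intro has_vector_derivative_add has_vector_derivative_const integral_has_vector_derivative Gc[OF j] t)
    then have "((\<lambda>t. x0 j + integral {0..t} (G u j)) has_vector_derivative F j (\<lambda>i. U i t)) (at t within {0..T})"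
      by (simp add: G_def U_def)
    then show "(U j has_vector_derivative F j (\<lambda>i. U i t)) (at t within {0..T})"
      by (rule has_vector_derivative_transform[OF t, rotated]) (simp only: GU U[OF j])
  qed
qed

lemma within_nonpos_decreasing:
  fixes f :: "real \<Rightarrow> real"
  assumes "a \<le> b" and d: "\<And>t. t \<in> {a..b} ==> (f has_real_derivative f' t) (at t within {a..b})"
    and "\<And>t. t \<in> {a..b} ==> f' t \<le> 0"
  shows "f b \<le> f a"
proof (rule DERIV_nonpos_imp_decreasing_open[OF assms(1)])
  show "continuous_on {a..b} f" by (rule DERIV_continuous_on) (rule d)
  fix t assume t: "a < t" "t < b"
  then have "(f has_real_derivative f' t) (at t)" using d[of t] by (simp add: at_within_Icc_at)
  then show "\<exists>y. (f has_real_derivative y) (at t) \<and> y \<le> 0" using assms(3)[of t] t by auto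
qed

text \<open>Gronwall's inequality for the sum \<open>W\<close> of squared differences; each
  component difference is at most \<open>sqrt (W t)\<close>, which is used as the bound
  \<open>r\<close> of the Lipschitz condition.\<close>

lemma ode_unique:
  fixes u w :: "nat \<Rightarrow> real \<Rightarrow> 'a::real_inner"
  assumes fin: "finite I" and L: "L \<ge> 0"
    and lip: "\<And>j a b r. j \<in> I ==> (\<And>i. i \<in> I ==> norm (a i - b i) \<le> r) ==> norm (F j a - F j b) \<le> L * r"
    and u: "\<And>j t. j \<in> I ==> t \<in> {0..T} ==> (u j has_vector_derivative F j (\<lambda>i. u i t)) (at t within {0..T})"
    and w: "\<And>j t. j \<in> I ==> t \<in> {0..T} ==> (w j has_vector_derivative F j (\<lambda>i. w i t)) (at t within {0..T})"
    and init: "\<And>j. j \<in> I ==> u j 0 = w j 0" and j: "j \<in> I" and t: "t \<in> {0..T}"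
  shows "u j t = w j t"
proof -
  define W where "W t = (\<Sum>i\<in>I. (u i t - w i t) \<bullet> (u i t - w i t))" for t
  define W' where "W' t = (\<Sum>i\<in>I. 2 * ((u i t - w i t) \<bullet> (F i (\<lambda>k. u k t) - F i (\<lambda>k. w k t))))" for t
  define C where "C = 2 * real (card I) * L"
  have W0: "W t \<ge> 0" for t by (simp add: W_def sum_nonneg)
  have small: "norm (u i t - w i t) \<le> sqrt (W t)" if "i \<in> I" for i t
  proof (rule real_le_rsqrt)
    have "(u i t - w i t) \<bullet> (u i t - w i t) \<le> W t" unfolding W_def by (rule member_le_sum[OF that]) (use fin in auto)
    then show "(norm (u i t - w i t))^2 \<le> W t" by (simp add: power2_norm_eq_inner)
  qed
  have W'b: "W' t \<le> C * W t" for t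
  proof -
    have "W' t \<le> (\<Sum>i\<in>I. 2 * (sqrt (W t) * (L * sqrt (W t))))" unfolding W'_def
    proof (intro sum_mono mult_left_mono)
      fix i assume i: "i \<in> I"
      have "(u i t - w i t) \<bullet> (F i (\<lambda>k. u k t) - F i (\<lambda>k. w k t)) \<le> norm (u i t - w i t) * norm (F i (\<lambda>k. u k t) - F i (\<lambda>k. w k t))"
        by (rule norm_cauchy_schwarz)
      also have "\<dots> \<le> sqrt (W t) * (L * sqrt (W t))" using small i by (intro mult_mono lip) (auto simp: W0)
      finally show "(u i t - w i t) \<bullet> (F i (\<lambda>k. u k t) - F i (\<lambda>k. w k t)) \<le> sqrt (W t) * (L * sqrt (W t))" .
    qed simp
    also have "\<dots> = C * (sqrt (W t) * sqrt (W t))" by (simp add: C_def)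
    also have "sqrt (W t) * sqrt (W t) = W t" using W0 by simp
    finally show ?thesis .
  qed
  have dW: "(W has_real_derivative W' r) (at r within {0..t})" if "r \<in> {0..t}" for r
  proof -
    have r: "r \<in> {0..T}" using that t by auto
    have "((\<lambda>r. (u i r - w i r) \<bullet> (u i r - w i r)) has_real_derivative
        2 * ((u i r - w i r) \<bullet> (F i (\<lambda>k. u k r) - F i (\<lambda>k. w k r)))) (at r within {0..T})" if i: "i \<in> I" for i
    proof -
      have "((\<lambda>r. u i r - w i r) has_vector_derivative F i (\<lambda>k. u k r) - F i (\<lambda>k. w k r)) (at r within {0..T})"
        by (intro has_vector_derivative_diff u w i r)
      from bounded_bilinear.has_vector_derivative[OF bounded_bilinear_inner this this]
      show ?thesis by (simp add: has_real_derivative_iff_has_vector_derivative inner_commute)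
    qed
    then have "(W has_real_derivative W' r) (at r within {0..T})" unfolding W_def W'_def by (intro DERIV_sum) auto
    then show ?thesis by (rule DERIV_subset) (use t in auto)
  qed
  have "exp (- C * t) * W t \<le> exp (- C * 0) * W 0"
  proof (rule within_nonpos_decreasing[where f = "\<lambda>r. exp (- C * r) * W r" and a = 0 and b = t and f' = "\<lambda>r. exp (- C * r) * (W' r - C * W r)"])
    show "0 \<le> t" using t by simp
    fix r assume r: "r \<in> {0..t}"
    show "((\<lambda>r. exp (- C * r) * W r) has_real_derivative exp (- C * r) * (W' r - C * W r)) (at r within {0..t})"
      by (auto intro!: derivative_eq_intros dW[OF r] simp: algebra_simps)
    show "exp (- C * r) * (W' r - C * W r) \<le> 0" using W'b[of r] by (simp add: mult_le_0_iff)
  qed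
  also have "W 0 = 0" unfolding W_def using init by simp
  finally have "W t \<le> 0" by (simp add: mult_le_0_iff)
  then have "norm (u j t - w j t) \<le> 0" using small[OF j, of t] W0[of t] by simp
  then show ?thesis by simp
qed

section \<open>Truncation of the polygon flow\<close>

lemma scale_lip:
  fixes p p' :: "'a::real_normed_vector" and m m' c K al be :: real
  assumes "c > 0" "m \<ge> c" "m' \<ge> c" "norm p' \<le> K * m'" "norm (p - p') \<le> al" "\<bar>m - m'\<bar> \<le> be" "K \<ge> 0"
  shows "norm (p /\<^sub>R m - p' /\<^sub>R m') \<le> (al + K * be) / c"
proof -
  have m: "m > 0" "m' > 0" using assms by linarith+
  have "p /\<^sub>R m - p' /\<^sub>R m' = (p - p') /\<^sub>R m + ((m' - m) / (m * m')) *\<^sub>R p'"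
    using m by (simp add: algebra_simps diff_divide_distrib divide_inverse)
  then have "norm (p /\<^sub>R m - p' /\<^sub>R m') \<le> norm (p - p') / m + (\<bar>m' - m\<bar> / (m * m')) * norm p'"
    using norm_triangle_ineq[of "(p - p') /\<^sub>R m" "((m' - m) / (m * m')) *\<^sub>R p'"] m
    by (simp add: divide_inverse mult.commute abs_mult)
  also have "\<dots> \<le> al / m + (be / (m * m')) * (K * m')"
    using assms m by (intro add_mono divide_right_mono mult_mono) (auto simp: abs_minus_commute)
  also have "\<dots> = (al + K * be) / m" using m by (simp add: field_simps)
  also have "\<dots> \<le> (al + K * be) / c"
  proof (intro divide_left_mono)
    have "0 \<le> al" using assms(5) norm_ge_zero[of "p - p'"] by linarith
    moreover have "0 \<le> be" using assms(6) by linarith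
    ultimately show "0 \<le> al + K * be" using assms(7) by simp
  qed (use assms m in auto)
  finally show ?thesis .
qed

context cyclic
begin

definition edge :: "(nat \<Rightarrow> real^2) \<Rightarrow> nat \<Rightarrow> real^2" where
  "edge a j = a j - a (pv j)"

abbreviation perim :: "(nat \<Rightarrow> real^2) \<Rightarrow> real" where
  "perim a \<equiv> (\<Sum>j\<in>J. norm (edge a j))"

text \<open>The velocity that the scheme prescribes for a vertex once the mass matrix is diagonal.
  The perimeter is passed as the separate argument \<open>l\<close>.\<close>

definition flow_field :: "(real \<Rightarrow> real) \<Rightarrow> real \<Rightarrow> (nat \<Rightarrow> real^2) \<Rightarrow> nat \<Rightarrow> real^2" where
  "flow_field f l a j = (edge a (nx j) /\<^sub>R norm (edge a (nx j)) - edge a j /\<^sub>R norm (edge a j)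
      - (f l / 2) *\<^sub>R perp (edge a j + edge a (nx j))) /\<^sub>R ((norm (edge a j) + norm (edge a (nx j))) / 2)"

text \<open>Edge lengths are cut off from below and the perimeter from above. For positive
  \<open>c\<close> and \<open>La\<close> and a nonempty polygon, \<open>f\<close> is thus evaluated
  only at positive arguments up to \<open>La\<close>, where a Lipschitz function is bounded, and
  every denominator is at least \<open>c\<close>.\<close>

definition trunc_field :: "(real \<Rightarrow> real) \<Rightarrow> real \<Rightarrow> real \<Rightarrow> (nat \<Rightarrow> real^2) \<Rightarrow> nat \<Rightarrow> real^2" where
  "trunc_field f c La a j =
     (let q = (\<lambda>j. max c (norm (edge a j))); m = (q j + q (nx j)) / 2; l = min La (\<Sum>j\<in>J. q j) in
       (edge a (nx j) /\<^sub>R q (nx j) - edge a j /\<^sub>R q j) /\<^sub>R m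
       - f l *\<^sub>R ((1 / 2) *\<^sub>R perp (edge a j + edge a (nx j))) /\<^sub>R m)"

lemma trunc_field_eq:
  assumes j: "j \<in> J" and c: "\<And>j. j \<in> J ==> c \<le> norm (edge a j)" and La: "(perim a) \<le> La"
  shows "trunc_field f c La a j = flow_field f (perim a) a j"
proof -
  have q: "max c (norm (edge a i)) = norm (edge a i)" if "i \<in> J" for i using c[OF that] by simp
  have s: "(\<Sum>j\<in>J. max c (norm (edge a j))) = perim a" by (intro sum.cong refl q)
  show ?thesis unfolding trunc_field_def flow_field_def Let_def s q[OF j] q[OF nxJ[OF j]] min_absorb2[OF La]
    by (simp add: scaleR_diff_right)
qed

text \<open>Each quotient divides by a truncated quantity that is at least \<open>c\<close> and that
  dominates the numerator up to a constant, which is the situation of \<open>scale_lip\<close>. The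
  bound \<open>G\<close> for \<open>f\<close> is its value at \<open>La\<close> plus its possible
  variation over an interval of length \<open>La\<close>.\<close>

lemma trunc_field_lipschitz:
  assumes f: "M-lipschitz_on {0<..} f" and c: "c > 0" and La: "La > 0"
  obtains Bd L where "L > 0" "\<And>j a. j \<in> J ==> norm (trunc_field f c La a j) \<le> Bd"
    "\<And>j a b r. j \<in> J ==> (\<And>i. i \<in> J ==> norm (a i - b i) \<le> r) ==>
        norm (trunc_field f c La a j - trunc_field f c La b j) \<le> L * r"
proof -
  define qq where "qq a j = max c (norm (edge a j))" for a j
  define ll where "ll a = min La (\<Sum>j\<in>J. qq a j)" for a
  define mm where "mm a j = (qq a j + qq a (nx j)) / 2" for a j
  define nn where "nn a j = ((1 / 2) *\<^sub>R perp (edge a j + edge a (nx j))) /\<^sub>R mm a j" for a j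
  define uu where "uu a j = edge a j /\<^sub>R qq a j" for a j
  define n where "n = real (card J)"
  define G where "G = \<bar>f La\<bar> + M * La"
  have M: "M \<ge> 0" using f by (rule lipschitz_on_nonneg)
  have n0: "n \<ge> 0" by (simp add: n_def)
  have G0: "G \<ge> 0" using M La by (simp add: G_def)
  have tf: "trunc_field f c La a j = (uu a (nx j) - uu a j) /\<^sub>R mm a j - f (ll a) *\<^sub>R nn a j" for a j
    by (simp add: trunc_field_def Let_def uu_def nn_def mm_def ll_def qq_def)
  have qc: "qq a j \<ge> c" "norm (edge a j) \<le> qq a j" for a j by (simp_all add: qq_def)
  have mc: "mm a j \<ge> c" for a j using qc(1)[of a j] qc(1)[of a "nx j"] by (simp add: mm_def)
  have ll: "0 < ll a" "ll a \<le> La" if "j \<in> J" for a j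
  proof -
    have "qq a j \<le> (\<Sum>j\<in>J. qq a j)" using that finJ qc(1)[of a] c
      by (intro member_le_sum) (auto intro: order_trans[of 0 c] less_imp_le)
    then show "0 < ll a" using qc(1)[of a j] c La by (simp add: ll_def)
    show "ll a \<le> La" by (simp add: ll_def)
  qed
  have fb: "\<bar>f (ll a)\<bar> \<le> G" if "j \<in> J" for a j
  proof -
    have "dist (f (ll a)) (f La) \<le> M * dist (ll a) La" using f ll[OF that, of a] La by (intro lipschitz_onD) auto
    also have "\<dots> \<le> M * La" using ll[OF that, of a] M by (intro mult_left_mono) (auto simp: dist_real_def)
    finally show ?thesis by (simp add: G_def dist_real_def)
  qed
  have un: "norm (uu a j) \<le> 1" for a j using qc[of a j] c by (simp add: uu_def field_simps)
  have en: "norm ((1 / 2) *\<^sub>R perp (edge a j + edge a (nx j))) \<le> mm a j" for a j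
    using norm_triangle_ineq[of "edge a j" "edge a (nx j)"] qc(2)[of a j] qc(2)[of a "nx j"] by (simp add: mm_def)
  have nn: "norm (nn a j) \<le> 1" for a j using en[of a j] mc[of a j] c by (simp add: nn_def field_simps)
  define L where "L = 12 / c^2 + 2 * M * n + 4 * G / c"
  show thesis
  proof (rule that[of L "2 / c + G"])
    show "L > 0" using c M n0 G0 by (auto simp: L_def intro!: add_pos_nonneg)
  next
    fix j and a :: "nat \<Rightarrow> real^2" assume j: "j \<in> J"
    have "norm ((uu a (nx j) - uu a j) /\<^sub>R mm a j) \<le> 2 / c"
    proof -
      have "norm (uu a (nx j) - uu a j) / mm a j \<le> 2 / c"
        using un[of a j] un[of a "nx j"] norm_triangle_ineq4[of "uu a (nx j)" "uu a j"] mc[of a j] c by (intro frac_le) auto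
      then show ?thesis using mc[of a j] c by (simp add: divide_inverse mult.commute)
    qed
    moreover have "norm (f (ll a) *\<^sub>R nn a j) \<le> G * 1"
      unfolding norm_scaleR using fb[OF j, of a] nn[of a j] G0 by (intro mult_mono) auto
    ultimately show "norm (trunc_field f c La a j) \<le> 2 / c + G"
      unfolding tf using norm_triangle_ineq4[of "(uu a (nx j) - uu a j) /\<^sub>R mm a j" "f (ll a) *\<^sub>R nn a j"] by linarith
  next
    fix j and a b :: "nat \<Rightarrow> real^2" and r :: real
    assume j: "j \<in> J" and ab: "\<And>i. i \<in> J ==> norm (a i - b i) \<le> r"
    have r: "r \<ge> 0" using ab[OF j] norm_ge_zero order_trans by blast
    have e: "norm (edge a i - edge b i) \<le> 2 * r" if "i \<in> J" for i
    proof -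
      have "edge a i - edge b i = (a i - b i) - (a (pv i) - b (pv i))" by (simp add: edge_def)
      then show ?thesis using norm_triangle_ineq4[of "a i - b i" "a (pv i) - b (pv i)"] ab[OF that] ab[OF pvJ[OF that]] by simp
    qed
    have q: "\<bar>qq a i - qq b i\<bar> \<le> 2 * r" if "i \<in> J" for i
      using e[OF that] norm_triangle_ineq3[of "edge a i" "edge b i"] unfolding qq_def by linarith
    have l: "\<bar>ll a - ll b\<bar> \<le> 2 * r * n"
    proof -
      have "\<bar>(\<Sum>j\<in>J. qq a j) - (\<Sum>j\<in>J. qq b j)\<bar> \<le> (\<Sum>j\<in>J. \<bar>qq a j - qq b j\<bar>)"
        unfolding sum_subtractf[symmetric] by (rule sum_abs)
      also have "\<dots> \<le> (\<Sum>j\<in>J. 2 * r)" by (intro sum_mono q)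
      finally have "\<bar>(\<Sum>j\<in>J. qq a j) - (\<Sum>j\<in>J. qq b j)\<bar> \<le> 2 * r * n" by (simp add: n_def mult_ac)
      moreover have "\<bar>min La x - min La y\<bar> \<le> \<bar>x - y\<bar>" for x y :: real by linarith
      ultimately show ?thesis unfolding ll_def by (blast intro: order_trans)
    qed
    have m: "\<bar>mm a j - mm b j\<bar> \<le> 2 * r"
      using q[OF j] q[OF nxJ[OF j]] unfolding mm_def by (simp add: abs_if field_simps split: if_splits)
    have u: "norm (uu a i - uu b i) \<le> 4 * r / c" if "i \<in> J" for i
      unfolding uu_def using scale_lip[OF c qc(1) qc(1) _ e[OF that] q[OF that], where K = 1] qc(2) by simp
    have "norm ((uu a (nx j) - uu a j) /\<^sub>R mm a j - (uu b (nx j) - uu b j) /\<^sub>R mm b j) \<le> (8 * r / c + (2 / c) * (2 * r)) / c"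
    proof (rule scale_lip[OF c mc mc _ _ m])
      have "norm (uu b (nx j) - uu b j) \<le> 2" using norm_triangle_ineq4[of "uu b (nx j)" "uu b j"] un[of b j] un[of b "nx j"] by simp
      also have "2 \<le> 2 / c * mm b j" using mc[of b j] c by (simp add: field_simps)
      finally show "norm (uu b (nx j) - uu b j) \<le> 2 / c * mm b j" .
      have "uu a (nx j) - uu a j - (uu b (nx j) - uu b j) = (uu a (nx j) - uu b (nx j)) - (uu a j - uu b j)" by simp
      moreover have "4 * r / c + 4 * r / c = 8 * r / c" by simp
      ultimately show "norm (uu a (nx j) - uu a j - (uu b (nx j) - uu b j)) \<le> 8 * r / c"
        using order_trans[OF norm_triangle_ineq4 add_mono[OF u[OF nxJ[OF j]] u[OF j]]] by (simp only:)
    qed (use c in auto)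
    also have "(8 * r / c + (2 / c) * (2 * r)) / c = 12 / c^2 * r" using c by (simp add: field_simps power2_eq_square)
    finally have 1: "norm ((uu a (nx j) - uu a j) /\<^sub>R mm a j - (uu b (nx j) - uu b j) /\<^sub>R mm b j) \<le> 12 / c^2 * r" .
    have n1: "norm (nn a j - nn b j) \<le> (2 * r + 1 * (2 * r)) / c" unfolding nn_def
    proof (rule scale_lip[OF c mc mc _ _ m])
      have "(1 / 2) *\<^sub>R perp (edge a j + edge a (nx j)) - (1 / 2) *\<^sub>R perp (edge b j + edge b (nx j))
        = (1 / 2) *\<^sub>R perp ((edge a j - edge b j) + (edge a (nx j) - edge b (nx j)))" by (simp add: real2_eq_iff field_simps)
      then show "norm ((1 / 2) *\<^sub>R perp (edge a j + edge a (nx j)) - (1 / 2) *\<^sub>R perp (edge b j + edge b (nx j))) \<le> 2 * r"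
        using norm_triangle_ineq[of "edge a j - edge b j" "edge a (nx j) - edge b (nx j)"] e[OF j] e[OF nxJ[OF j]] by simp
    qed (use en[of b j] in auto)
    have "f (ll a) *\<^sub>R nn a j - f (ll b) *\<^sub>R nn b j = (f (ll a) - f (ll b)) *\<^sub>R nn a j + f (ll b) *\<^sub>R (nn a j - nn b j)"
      by (simp add: algebra_simps)
    then have "norm (f (ll a) *\<^sub>R nn a j - f (ll b) *\<^sub>R nn b j) \<le> \<bar>f (ll a) - f (ll b)\<bar> * norm (nn a j) + \<bar>f (ll b)\<bar> * norm (nn a j - nn b j)"
      by (metis norm_triangle_ineq norm_scaleR)
    also have "\<dots> \<le> (M * (2 * r * n)) * 1 + G * ((2 * r + 1 * (2 * r)) / c)"
    proof (intro add_mono mult_mono nn fb[OF j] n1)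
      have "dist (f (ll a)) (f (ll b)) \<le> M * dist (ll a) (ll b)" using f ll[OF j] by (intro lipschitz_onD) auto
      also have "\<dots> \<le> M * (2 * r * n)" using l M by (intro mult_left_mono) (auto simp: dist_real_def)
      finally show "\<bar>f (ll a) - f (ll b)\<bar> \<le> M * (2 * r * n)" by (simp add: dist_real_def)
    qed (use M r n0 G0 in auto)
    also have "\<dots> = (2 * M * n + 4 * G / c) * r" using c by (simp add: field_simps)
    finally have 2: "norm (f (ll a) *\<^sub>R nn a j - f (ll b) *\<^sub>R nn b j) \<le> (2 * M * n + 4 * G / c) * r" .
    have "trunc_field f c La a j - trunc_field f c La b j =
      ((uu a (nx j) - uu a j) /\<^sub>R mm a j - (uu b (nx j) - uu b j) /\<^sub>R mm b j) - (f (ll a) *\<^sub>R nn a j - f (ll b) *\<^sub>R nn b j)"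
      unfolding tf by simp
    then have "norm (trunc_field f c La a j - trunc_field f c La b j) \<le> 12 / c^2 * r + (2 * M * n + 4 * G / c) * r"
      by (simp only:) (rule order_trans[OF norm_triangle_ineq4 add_mono[OF 1 2]])
    then show "norm (trunc_field f c La a j - trunc_field f c La b j) \<le> L * r" by (simp add: L_def algebra_simps)
  qed
qed

text \<open>Along two solutions the edges stay away from zero by compactness, so both solve one truncated system.\<close>

lemma flow_field_unique:
  fixes x y :: "nat \<Rightarrow> real \<Rightarrow> real^2"
  assumes f: "M-lipschitz_on {0<..} f" and T: "T \<ge> 0"
    and x: "\<And>j t. j \<in> J ==> t \<in> {0..T} ==> (x j has_vector_derivative
        flow_field f (perim (\<lambda>k. x k t)) (\<lambda>k. x k t) j) (at t within {0..T})"
    and y: "\<And>j t. j \<in> J ==> t \<in> {0..T} ==> (y j has_vector_derivative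
        flow_field f (perim (\<lambda>k. y k t)) (\<lambda>k. y k t) j) (at t within {0..T})"
    and x0: "\<And>j t. j \<in> J ==> t \<in> {0..T} ==> edge (\<lambda>k. x k t) j \<noteq> 0"
    and y0: "\<And>j t. j \<in> J ==> t \<in> {0..T} ==> edge (\<lambda>k. y k t) j \<noteq> 0"
    and init: "\<And>j. j \<in> J ==> x j 0 = y j 0" and j: "j \<in> J" and t: "t \<in> {0..T}"
  shows "x j t = y j t"
proof -
  have bound: "\<exists>c>0. \<exists>La. \<forall>t\<in>{0..T}. (\<forall>j\<in>J. c \<le> norm (edge (\<lambda>k. z k t) j)) \<and> (perim (\<lambda>k. z k t)) \<le> La"
    if z: "\<And>j. j \<in> J ==> continuous_on {0..T} (z j)" and z0: "\<And>j t. j \<in> J ==> t \<in> {0..T} ==> edge (\<lambda>k. z k t) j \<noteq> 0"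
    for z :: "nat \<Rightarrow> real \<Rightarrow> real^2"
  proof -
    have ne: "{0..T} \<noteq> {}" using T by simp
    have ec: "continuous_on {0..T} (\<lambda>t. norm (edge (\<lambda>k. z k t) j))" if "j \<in> J" for j
      unfolding edge_def using z[OF that] z[OF pvJ[OF that]] by (intro continuous_intros)
    have "\<exists>c>0. \<forall>t\<in>{0..T}. c \<le> norm (edge (\<lambda>k. z k t) j)" if jJ: "j \<in> J" for j
    proof -
      obtain s where "s \<in> {0..T}" "\<forall>t\<in>{0..T}. norm (edge (\<lambda>k. z k s) j) \<le> norm (edge (\<lambda>k. z k t) j)"
        using continuous_attains_inf[OF compact_Icc ne ec[OF jJ]] by blast
      then show ?thesis using z0[OF jJ] by (intro exI[of _ "norm (edge (\<lambda>k. z k s) j)"]) auto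
    qed
    then obtain cc where cc: "\<And>j. j \<in> J ==> cc j > 0" "\<And>j t. j \<in> J ==> t \<in> {0..T} ==> cc j \<le> norm (edge (\<lambda>k. z k t) j)"
      by metis
    have "continuous_on {0..T} (\<lambda>t. perim (\<lambda>k. z k t))" by (intro continuous_on_sum ec)
    then obtain La where La: "\<forall>t\<in>{0..T}. (perim (\<lambda>k. z k t)) \<le> La"
      using continuous_attains_sup[OF compact_Icc ne] by blast
    have "Min (insert 1 (cc ` J)) > 0" using finJ cc(1) by (subst Min_gr_iff) auto
    moreover have "Min (insert 1 (cc ` J)) \<le> norm (edge (\<lambda>k. z k t) j)" if "j \<in> J" "t \<in> {0..T}" for j t
    proof (rule order_trans[OF Min_le cc(2)[OF that]])
      show "cc j \<in> insert 1 (cc ` J)" using that by simp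
    qed (use finJ in simp)
    ultimately show ?thesis using La by blast
  qed
  have xc: "continuous_on {0..T} (x j)" if "j \<in> J" for j by (rule continuous_on_vector_derivative[OF x[OF that]])
  have yc: "continuous_on {0..T} (y j)" if "j \<in> J" for j by (rule continuous_on_vector_derivative[OF y[OF that]])
  obtain c1 L1 where c1: "c1 > 0" "\<And>t j. t \<in> {0..T} ==> j \<in> J ==> c1 \<le> norm (edge (\<lambda>k. x k t) j)"
      "\<And>t. t \<in> {0..T} ==> (perim (\<lambda>k. x k t)) \<le> L1" using bound[of x, OF xc x0] by blast
  obtain c2 L2 where c2: "c2 > 0" "\<And>t j. t \<in> {0..T} ==> j \<in> J ==> c2 \<le> norm (edge (\<lambda>k. y k t) j)"
      "\<And>t. t \<in> {0..T} ==> (perim (\<lambda>k. y k t)) \<le> L2" using bound[of y, OF yc y0] by blast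
  define c where "c = min c1 c2"
  define La where "La = max 1 (max L1 L2)"
  have c: "c > 0" "La > 0" using c1(1) c2(1) by (auto simp: c_def La_def)
  obtain Bd L where L: "L > 0" "\<And>j a b r. j \<in> J ==> (\<And>i. i \<in> J ==> norm (a i - b i) \<le> r) ==>
        norm (trunc_field f c La a j - trunc_field f c La b j) \<le> L * r" using trunc_field_lipschitz[OF f c] by metis
  have tx: "trunc_field f c La (\<lambda>k. x k t) j = flow_field f (perim (\<lambda>k. x k t)) (\<lambda>k. x k t) j"
    if "j \<in> J" "t \<in> {0..T}" for j t
    using that c1(2,3)[OF that(2)] by (intro trunc_field_eq) (auto simp: c_def La_def min_le_iff_disj le_max_iff_disj)
  have ty: "trunc_field f c La (\<lambda>k. y k t) j = flow_field f (perim (\<lambda>k. y k t)) (\<lambda>k. y k t) j"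
    if "j \<in> J" "t \<in> {0..T}" for j t
    using that c2(2,3)[OF that(2)] by (intro trunc_field_eq) (auto simp: c_def La_def min_le_iff_disj le_max_iff_disj)
  show ?thesis
  proof (rule ode_unique[OF finJ, where F = "\<lambda>j a. trunc_field f c La a j" and L = L and T = T, OF _ _ _ _ _ j t])
    show "(x j has_vector_derivative trunc_field f c La (\<lambda>i. x i t) j) (at t within {0..T})"
      if "j \<in> J" "t \<in> {0..T}" for j t using x[OF that] tx[OF that] by simp
    show "(y j has_vector_derivative trunc_field f c La (\<lambda>i. y i t) j) (at t within {0..T})"
      if "j \<in> J" "t \<in> {0..T}" for j t using y[OF that] ty[OF that] by simp
  qed (use L init in auto)
qed

end

section \<open>Propagation of the energy\<close>

lemma norm_has_real_derivative:
  fixes g :: "real \<Rightarrow> 'a::real_inner"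
  assumes "(g has_vector_derivative g') (at t within S)" "g t \<noteq> 0"
  shows "((\<lambda>t. norm (g t)) has_real_derivative (g t /\<^sub>R norm (g t)) \<bullet> g') (at t within S)"
proof -
  have "((\<lambda>t. norm (g t)) has_derivative (\<lambda>x. (x *\<^sub>R g') \<bullet> sgn (g t))) (at t within S)"
    using has_derivative_in_compose[OF assms(1)[unfolded has_vector_derivative_def] has_derivative_at_withinI[OF has_derivative_norm[OF assms(2)]]]
    by (simp add: o_def)
  moreover have "(\<lambda>x. (x *\<^sub>R g') \<bullet> sgn (g t)) = (*) ((g t /\<^sub>R norm (g t)) \<bullet> g')"
    by (simp add: fun_eq_iff sgn_div_norm inner_commute mult_ac)
  ultimately show ?thesis by (simp only: has_field_derivative_def)
qed

lemma inner_has_real_derivative: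
  fixes g k :: "real \<Rightarrow> 'a::real_inner"
  assumes "(g has_vector_derivative g') (at t within S)" "(k has_vector_derivative k') (at t within S)"
  shows "((\<lambda>t. g t \<bullet> k t) has_real_derivative g t \<bullet> k' + g' \<bullet> k t) (at t within S)"
  using bounded_bilinear.has_vector_derivative[OF bounded_bilinear_inner assms] by (simp add: has_real_derivative_iff_has_vector_derivative)

lemma half_cancel: "a \<noteq> 0 ==> (a / 2) *\<^sub>R (w /\<^sub>R (a / 2)) = (w :: 'a::real_vector)" for a :: real
  by simp

context cyclic
begin

text \<open>Continuation argument. While \<open>good\<close> holds, meaning that the squared length
  errors sum to at most \<open>(eps * h)^2\<close>, the truncation is inactive and
  \<open>static_estimate\<close> applies; Gronwall's inequality then returns a strictly smaller
  bound, so the condition cannot fail for a first time. The hypothesis \<open>small\<close> is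
  exactly what makes the returned bound strictly smaller.\<close>

theorem semidiscrete_error:
  fixes X V tt :: "nat \<Rightarrow> real \<Rightarrow> real^2" and rho :: "nat \<Rightarrow> real \<Rightarrow> real" and Lp :: "real \<Rightarrow> real"
    and f :: "real \<Rightarrow> real" and B M T h C E :: real
  assumes f: "M-lipschitz_on {0<..} f" and M: "M \<le> B" and T: "T \<ge> 0" and J: "J \<noteq> {}"
    and B: "B \<ge> 1" and h: "0 < h" "h \<le> 1" and N: "real (card J) * h \<le> B"
    and C: "C = 6000000 * B ^ 17" and E: "E = exp (C * T)" and small: "h * E < (1 / (19200 * B ^ 9))^2"
    and X: "\<And>j t. j \<in> J ==> t \<in> {0..T} ==> (X j has_vector_derivative V j t) (at t within {0..T})"
    and Vc: "\<And>j. j \<in> J ==> continuous_on {0..T} (V j)"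
    and unit: "\<And>j t. j \<in> J ==> t \<in> {0..T} ==> norm (tt j t) = 1"
    and Vt: "\<And>j t. j \<in> J ==> t \<in> {0..T} ==> V j t \<bullet> tt j t = 0"
    and V: "\<And>j t. j \<in> J ==> t \<in> {0..T} ==> norm (V j t) \<le> B"
      "\<And>j t. j \<in> J ==> t \<in> {0..T} ==> norm (V j t - V (pv j) t) \<le> B * h"
    and Lp: "\<And>t. t \<in> {0..T} ==> Lp t > 0" "\<And>t. t \<in> {0..T} ==> \<bar>f (Lp t)\<bar> \<le> B"
      "\<And>t. t \<in> {0..T} ==> \<bar>Lp t - perim (\<lambda>k. X k t)\<bar> \<le> B * h"
    and Q: "\<And>j t. j \<in> J ==> t \<in> {0..T} ==> h / B \<le> norm (edge (\<lambda>k. X k t) j)"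
      "\<And>j t. j \<in> J ==> t \<in> {0..T} ==> norm (edge (\<lambda>k. X k t) j) \<le> B * h"
    and rho: "\<And>j t. j \<in> J ==> t \<in> {0..T} ==> h^2 \<le> rho j t" "\<And>j t. j \<in> J ==> t \<in> {0..T} ==> rho j t \<le> B * h"
      "\<And>t. t \<in> {0..T} ==> (\<Sum>j\<in>J. (rho j t)^2) \<le> B * h ^ 3"
    and c1: "\<And>j t. j \<in> J ==> t \<in> {0..T} ==>
       norm (tt j t - edge (\<lambda>k. X k t) j /\<^sub>R norm (edge (\<lambda>k. X k t) j)
         - (norm (edge (\<lambda>k. X k t) j) / 2) *\<^sub>R (V j t + f (Lp t) *\<^sub>R perp (tt j t))) \<le> rho j t"
    and c2: "\<And>j t. j \<in> J ==> t \<in> {0..T} ==>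
       norm (edge (\<lambda>k. X k t) j /\<^sub>R norm (edge (\<lambda>k. X k t) j) - tt (pv j) t
         - (norm (edge (\<lambda>k. X k t) j) / 2) *\<^sub>R (V (pv j) t + f (Lp t) *\<^sub>R perp (tt (pv j) t))) \<le> rho j t"
    and c3: "\<And>j t. j \<in> J ==> t \<in> {0..T} ==>
       \<bar>norm (edge (\<lambda>k. X k t) (nx j)) - norm (edge (\<lambda>k. X k t) j)\<bar> \<le> rho j t + rho (nx j) t"
  obtains x v where "\<And>j. j \<in> J ==> x j 0 = X j 0"
    "\<And>j t. j \<in> J ==> t \<in> {0..T} ==> (x j has_vector_derivative v j t) (at t within {0..T})"
    "\<And>j t. j \<in> J ==> t \<in> {0..T} ==> v j t = flow_field f (perim (\<lambda>k. x k t)) (\<lambda>k. x k t) j"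
    "\<And>j. j \<in> J ==> continuous_on {0..T} (v j)"
    "\<And>j t. j \<in> J ==> t \<in> {0..T} ==> edge (\<lambda>k. x k t) j \<noteq> 0"
    "\<And>t. t \<in> {0..T} ==> (\<Sum>j\<in>J. (norm (edge (\<lambda>k. X k t) j - edge (\<lambda>k. x k t) j))^2) \<le> 18 * B^2 * E * h ^ 3"
    "integral {0..T} (\<lambda>t. \<Sum>j\<in>J. (norm (V j t - v j t))^2) \<le> 4 * B * E * h"
proof -
  have B0: "B > 0" using B by simp
  define c where "c = h / (2 * B)"
  define La where "La = 2 * B^2"
  define eps where "eps = 1 / (19200 * B ^ 9)"
  have c0: "c > 0" and La0: "La > 0" and eps0: "eps > 0" using h B0 by (simp_all add: c_def La_def eps_def)
  have E1: "E \<ge> 1" using B0 T unfolding E C by simp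
  have C0: "C > 0" using B0 by (simp add: C)
  obtain Bd L where L: "L > 0" and Bd: "\<And>j a. j \<in> J ==> norm (trunc_field f c La a j) \<le> Bd"
    and lip: "\<And>j a b r. j \<in> J ==> (\<And>i. i \<in> J ==> norm (a i - b i) \<le> r) ==>
        norm (trunc_field f c La a j - trunc_field f c La b j) \<le> L * r" using trunc_field_lipschitz[OF f c0 La0] by metis
  obtain x where x0: "\<And>j. j \<in> J ==> x j 0 = X j 0"
    and x: "\<And>j t. j \<in> J ==> t \<in> {0..T} ==> (x j has_vector_derivative trunc_field f c La (\<lambda>i. x i t) j) (at t within {0..T})"
  proof (rule ode_exists[OF finJ L T, where F = "\<lambda>j a. trunc_field f c La a j" and Bd = Bd and ?x0.0 = "\<lambda>j. X j 0"])
    show "norm (trunc_field f c La a j) \<le> Bd" if "j \<in> J" for j a by (rule Bd[OF that])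
    show "norm (trunc_field f c La a j - trunc_field f c La b j) \<le> L * r"
      if "j \<in> J" "\<And>i. i \<in> J ==> norm (a i - b i) \<le> r" for j a b r using that by (rule lip)
  next
    fix u assume "\<And>j. j \<in> J ==> u j 0 = X j 0"
      "\<And>j t. j \<in> J ==> t \<in> {0..T} ==> (u j has_vector_derivative trunc_field f c La (\<lambda>i. u i t) j) (at t within {0..T})"
    then show thesis by (rule that)
  qed
  define v where "v j t = trunc_field f c La (\<lambda>i. x i t) j" for j t
  have xc: "continuous_on {0..T} (x j)" if "j \<in> J" for j by (rule continuous_on_vector_derivative[OF x[OF that]])
  have Xc: "continuous_on {0..T} (X j)" if "j \<in> J" for j by (rule continuous_on_vector_derivative[OF X[OF that]])
  have vc: "continuous_on {0..T} (v j)" if jJ: "j \<in> J" for j unfolding v_def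
  proof (rule continuous_on_lipschitz_field[OF finJ, where L = L and F = "\<lambda>a. trunc_field f c La a j" and g = x])
    show "norm (trunc_field f c La a j - trunc_field f c La b j) \<le> L * r" if "\<And>i. i \<in> J ==> norm (a i - b i) \<le> r" for a b r
      using jJ that by (rule lip)
  qed (rule xc)
  define D where "D j t = edge (\<lambda>k. X k t) j" for j t
  define d where "d j t = edge (\<lambda>k. x k t) j" for j t
  define DV where "DV j t = V j t - V (pv j) t" for j t
  define dv where "dv j t = v j t - v (pv j) t" for j t
  define P where "P j t = norm (D j t) - norm (d j t)" for j t
  define Tt where "Tt j t = D j t /\<^sub>R norm (D j t)" for j t
  define tau where "tau j t = d j t /\<^sub>R norm (d j t)" for j t
  define Zt where "Zt t = (\<Sum>j\<in>J. (P j t)^2)" for t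
  \<comment> \<open>The direction part \<open>q * (1 - T \<bullet> tau)\<close> is written in terms
    of the edge vector \<open>d\<close> itself, without division by its length.\<close>
  define S where "S t = (\<Sum>j\<in>J. (P j t)^2 / h + (norm (d j t) - (Tt j t \<bullet> d j t)))" for t
  define A where "A t = (\<Sum>j\<in>J. (norm (V j t - v j t))^2)" for t
  have Dder: "(D j has_vector_derivative DV j t) (at t within {0..T})" if "j \<in> J" "t \<in> {0..T}" for j t
    unfolding D_def DV_def edge_def using that pvJ by (intro has_vector_derivative_diff X) auto
  have dder: "(d j has_vector_derivative dv j t) (at t within {0..T})" if "j \<in> J" "t \<in> {0..T}" for j t
    unfolding d_def dv_def edge_def v_def using that pvJ by (intro has_vector_derivative_diff x) auto
  have Dc: "continuous_on {0..T} (D j)" and dc: "continuous_on {0..T} (d j)" if "j \<in> J" for j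
    unfolding D_def d_def edge_def using that pvJ by (auto intro!: continuous_intros Xc xc)
  have Ac: "continuous_on {0..T} A" unfolding A_def by (intro continuous_intros Vc vc)
  have Zc: "continuous_on {0..T} Zt" unfolding Zt_def P_def by (intro continuous_intros Dc dc)
  have Zt0: "Zt 0 = 0" unfolding Zt_def P_def D_def d_def edge_def using x0 pvJ by simp
  have QD: "h / B \<le> norm (D j t)" "norm (D j t) \<le> B * h" if "j \<in> J" "t \<in> {0..T}" for j t
    using Q[OF that] by (simp_all add: D_def)
  have Dne: "D j t \<noteq> 0" if "j \<in> J" "t \<in> {0..T}" for j t
    using QD(1)[OF that] h B0 by (metis divide_pos_pos norm_zero not_less)
  have epsB: "eps * h \<le> c"
  proof -
    have "1 \<le> B ^ 8" using B by simp
    then have "B \<le> B ^ 9" using B by (metis self_le_power zero_less_numeral)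
    then have "2 * B \<le> 19200 * B ^ 9" using B by linarith
    then have "h / (19200 * B ^ 9) \<le> h / (2 * B)" using h B0 by (intro divide_left_mono) auto
    then show ?thesis by (simp add: eps_def c_def)
  qed
  define good where "good t \<longleftrightarrow> Zt t \<le> (eps * h)^2" for t
  have goodP: "\<bar>P j t\<bar> \<le> eps * h" if "good t" "j \<in> J" for j t
  proof -
    have "(P j t)^2 \<le> Zt t" unfolding Zt_def using finJ that(2) by (intro member_le_sum) auto
    then have "(P j t)^2 \<le> (eps * h)^2" using that(1) by (simp add: good_def)
    then show ?thesis using eps0 h by (simp add: abs_le_square_iff[symmetric])
  qed
  have qb: "c \<le> norm (d j t)" "norm (d j t) \<le> 2 * B * h" if "good t" "j \<in> J" "t \<in> {0..T}" for j t
  proof -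
    have a: "h / B = c + c" by (simp add: c_def)
    have b: "\<bar>norm (D j t) - norm (d j t)\<bar> \<le> c" using goodP[OF that(1,2)] epsB unfolding P_def by linarith
    show "c \<le> norm (d j t)" using b QD(1)[OF that(2,3)] unfolding a by linarith
    have "h / B \<le> B * h" using order_trans[OF QD[OF that(2,3)]] .
    then have "c \<le> B * h" using c0 unfolding a by linarith
    then show "norm (d j t) \<le> 2 * B * h" using b QD(2)[OF that(2,3)] by linarith
  qed
  have gd0: "d j t \<noteq> 0" if "good t" "j \<in> J" "t \<in> {0..T}" for j t using qb(1)[OF that] c0 by auto
  \<comment> \<open>While \<open>good\<close> holds, edges have length at least \<open>c\<close>,
    and the perimeter is at most \<open>card J * (2 * B * h) \<le> La\<close>, so neither cutoff is
    active.\<close>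
  have vflow: "v j t = flow_field f (\<Sum>i\<in>J. norm (d i t)) (\<lambda>k. x k t) j" if "good t" "j \<in> J" "t \<in> {0..T}" for j t
    unfolding v_def d_def
  proof (rule trunc_field_eq[OF that(2)])
    show "c \<le> norm (edge (\<lambda>i. x i t) j)" if "j \<in> J" for j using qb(1)[OF \<open>good t\<close> that \<open>t \<in> {0..T}\<close>] by (simp add: d_def)
    have "(\<Sum>j\<in>J. norm (edge (\<lambda>i. x i t) j)) \<le> (\<Sum>j\<in>J. 2 * B * h)"
      using qb(2) that by (intro sum_mono) (auto simp: d_def)
    also have "\<dots> = 2 * B * (real (card J) * h)" by simp
    also have "\<dots> \<le> 2 * B * B" using N B0 by (intro mult_left_mono) auto
    finally show "(\<Sum>j\<in>J. norm (edge (\<lambda>i. x i t) j)) \<le> La" by (simp add: La_def power2_eq_square)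
  qed
  have Tunit: "norm (Tt j t) = 1" if "j \<in> J" "t \<in> {0..T}" for j t using Dne[OF that] by (simp add: Tt_def)
  have tunit: "norm (tau j t) = 1" if "good t" "j \<in> J" "t \<in> {0..T}" for j t using gd0[OF that] by (simp add: tau_def)
  have qtau: "norm (d j t) *\<^sub>R tau j t = d j t" for j t by (cases "d j t = 0") (simp_all add: tau_def)
  have Sterm: "norm (d j t) - Tt j t \<bullet> d j t = norm (d j t) * (norm (Tt j t - tau j t))^2 / 2" if "good t" "j \<in> J" "t \<in> {0..T}" for j t
  proof -
    have "(norm (Tt j t - tau j t))^2 = 2 - 2 * (Tt j t \<bullet> tau j t)" using Tunit[OF that(2,3)] tunit[OF that]
      by (simp add: power2_norm_eq_inner inner_diff_left inner_diff_right inner_commute) (simp add: dot_square_norm)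
    then have "norm (d j t) * (norm (Tt j t - tau j t))^2 / 2 = norm (d j t) - Tt j t \<bullet> (norm (d j t) *\<^sub>R tau j t)"
      by (simp only:) (simp add: field_simps)
    then show ?thesis by (simp only: qtau)
  qed
  have SZ: "Zt t \<le> h * S t" and SD: "(\<Sum>j\<in>J. norm (d j t) - Tt j t \<bullet> d j t) \<le> S t" and S0: "S t \<ge> 0" if "good t" "t \<in> {0..T}" for t
  proof -
    have a: "(\<Sum>j\<in>J. norm (d j t) - Tt j t \<bullet> d j t) \<ge> 0" using that by (intro sum_nonneg) (simp add: Sterm)
    have b: "Zt t / h \<ge> 0" unfolding Zt_def using h by (simp add: sum_nonneg)
    have s: "S t = Zt t / h + (\<Sum>j\<in>J. norm (d j t) - Tt j t \<bullet> d j t)"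
      unfolding S_def Zt_def by (simp only: sum.distrib sum_divide_distrib)
    have "Zt t / h \<le> S t" using a s by linarith
    then show "Zt t \<le> h * S t" using h by (simp add: field_simps)
    show "(\<Sum>j\<in>J. norm (d j t) - Tt j t \<bullet> d j t) \<le> S t" "S t \<ge> 0" using a b s by linarith+
  qed
  define dQ where "dQ j t = Tt j t \<bullet> DV j t" for j t
  define dq where "dq j t = tau j t \<bullet> dv j t" for j t
  define S' where "S' t = (\<Sum>j\<in>J. 2 * P j t * (dQ j t - dq j t) / h
        + (Tt j t - tau j t) \<bullet> ((V j t - v j t) - (V (pv j) t - v (pv j) t))
        - dQ j t * (norm (Tt j t - tau j t))^2 / 2
        + P j t * (tau j t \<bullet> ((DV j t - dQ j t *\<^sub>R Tt j t) /\<^sub>R norm (D j t))))" for t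
  have Sder: "(S has_real_derivative S' t) (at t within {0..T})" if g: "good t" and t: "t \<in> {0..T}" for t unfolding S_def S'_def
  proof (rule DERIV_sum)
    fix j assume j: "j \<in> J"
    have Qd: "((\<lambda>t. norm (D j t)) has_real_derivative dQ j t) (at t within {0..T})"
      unfolding dQ_def Tt_def by (rule norm_has_real_derivative[OF Dder[OF j t] Dne[OF j t]])
    have qd: "((\<lambda>t. norm (d j t)) has_real_derivative dq j t) (at t within {0..T})"
      unfolding dq_def tau_def by (rule norm_has_real_derivative[OF dder[OF j t] gd0[OF g j t]])
    have Dd: "((\<lambda>t. D j t \<bullet> d j t) has_real_derivative D j t \<bullet> dv j t + DV j t \<bullet> d j t) (at t within {0..T})"
      by (rule inner_has_real_derivative[OF Dder[OF j t] dder[OF j t]])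
    have Pd: "(P j has_real_derivative dQ j t - dq j t) (at t within {0..T})" unfolding P_def by (intro DERIV_diff Qd qd)
    define Qn where "Qn = norm (D j t)"
    define qn where "qn = norm (d j t)"
    have Qn: "Qn > 0" using Dne[OF j t] by (simp add: Qn_def)
    have Tr: "(\<lambda>t. Tt j t \<bullet> d j t) = (\<lambda>t. (D j t \<bullet> d j t) / norm (D j t))"
      by (simp add: Tt_def fun_eq_iff divide_inverse mult.commute)
    have "((\<lambda>t. Tt j t \<bullet> d j t) has_real_derivative
        ((D j t \<bullet> dv j t + DV j t \<bullet> d j t) * Qn - (D j t \<bullet> d j t) * dQ j t) / (Qn * Qn)) (at t within {0..T})"
      unfolding Tr Qn_def by (rule DERIV_divide[OF Dd Qd]) (use Dne[OF j t] in simp)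
    then have Td: "((\<lambda>t. Tt j t \<bullet> d j t) has_real_derivative
        Tt j t \<bullet> dv j t + (DV j t \<bullet> d j t - (Tt j t \<bullet> d j t) * dQ j t) / Qn) (at t within {0..T})"
      by (rule DERIV_cong) (use Qn in \<open>simp add: Tt_def Qn_def[symmetric] field_simps\<close>)
    have a: "((\<lambda>t. (P j t)^2 / h) has_real_derivative 2 * P j t * (dQ j t - dq j t) / h) (at t within {0..T})"
      by (rule DERIV_cong[OF DERIV_cdivide[OF DERIV_power[OF Pd]]]) simp
    have der: "((\<lambda>t. (P j t)^2 / h + (norm (d j t) - Tt j t \<bullet> d j t)) has_real_derivative
       2 * P j t * (dQ j t - dq j t) / h + (dq j t - (Tt j t \<bullet> dv j t + (DV j t \<bullet> d j t - (Tt j t \<bullet> d j t) * dQ j t) / Qn))) (at t within {0..T})"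
      by (intro DERIV_add DERIV_diff a qd Td)
    \<comment> \<open>With \<open>cs\<close> the cosine of the angle between the two edges, both
      sides become rational expressions in the lengths, \<open>cs\<close> and inner products. The
      last two summands come from the quotient rule for the unit vector \<open>Tt\<close>,
      rearranged so that each is visibly quadratic in the errors.\<close>
    have id: "dq j t - (Tt j t \<bullet> dv j t + (DV j t \<bullet> d j t - (Tt j t \<bullet> d j t) * dQ j t) / Qn)
      = (Tt j t - tau j t) \<bullet> (DV j t - dv j t) - dQ j t * (norm (Tt j t - tau j t))^2 / 2
        + P j t * (tau j t \<bullet> ((DV j t - dQ j t *\<^sub>R Tt j t) /\<^sub>R Qn))"
    proof -
      define cs where "cs = Tt j t \<bullet> tau j t"
      have n2: "(norm (Tt j t - tau j t))^2 / 2 = 1 - cs" using Tunit[OF j t] tunit[OF g j t] unfolding cs_def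
        by (simp add: power2_norm_eq_inner inner_diff_left inner_diff_right inner_commute) (simp add: dot_square_norm)
      have d1: "Tt j t \<bullet> d j t = qn * cs" unfolding cs_def qn_def by (subst qtau[symmetric]) simp
      have d2: "DV j t \<bullet> d j t = qn * (tau j t \<bullet> DV j t)" unfolding qn_def by (subst qtau[symmetric]) (simp add: inner_commute)
      have p: "P j t = Qn - qn" by (simp add: P_def Qn_def qn_def)
      have e: "dQ j t * (norm (Tt j t - tau j t))^2 / 2 = dQ j t * (1 - cs)" using n2 by simp
      have t1: "tau j t \<bullet> ((DV j t - dQ j t *\<^sub>R Tt j t) /\<^sub>R Qn) = (tau j t \<bullet> DV j t - dQ j t * cs) / Qn"
        by (simp add: inner_diff_right cs_def inner_commute divide_inverse mult.commute)
      have t2: "(Tt j t - tau j t) \<bullet> (DV j t - dv j t) = dQ j t - tau j t \<bullet> DV j t - Tt j t \<bullet> dv j t + dq j t"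
        by (simp add: dQ_def dq_def inner_diff_left inner_diff_right)
      show ?thesis unfolding e t1 t2 d1 d2 p using Qn by (simp add: field_simps)
    qed
    have e: "DV j t - dv j t = V j t - v j t - (V (pv j) t - v (pv j) t)" by (simp add: DV_def dv_def)
    show "((\<lambda>t. (P j t)^2 / h + (norm (d j t) - Tt j t \<bullet> d j t)) has_real_derivative
        2 * P j t * (dQ j t - dq j t) / h + (Tt j t - tau j t) \<bullet> (V j t - v j t - (V (pv j) t - v (pv j) t))
        - dQ j t * (norm (Tt j t - tau j t))^2 / 2
        + P j t * (tau j t \<bullet> ((DV j t - dQ j t *\<^sub>R Tt j t) /\<^sub>R norm (D j t)))) (at t within {0..T})"
      by (rule DERIV_cong[OF der]) (unfold id e, unfold Qn_def, simp)
  qed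
  have static: "S' t \<le> - (h / (4 * B)) * A t + C * (S t + h^2)" if g: "good t" and t: "t \<in> {0..T}" for t
  proof -
    define l where "l = (\<Sum>j\<in>J. norm (d j t))"
    have l0: "l > 0" unfolding l_def using finJ J gd0[OF g _ t] by (intro sum_pos) auto
    have phi: "\<bar>f l - f (Lp t)\<bar> \<le> B * \<bar>Lp t - l\<bar>"
    proof -
      have "dist (f l) (f (Lp t)) \<le> M * dist l (Lp t)" using l0 Lp(1)[OF t] f by (intro lipschitz_onD) auto
      also have "\<dots> \<le> B * dist l (Lp t)" using M by (intro mult_right_mono) auto
      finally show ?thesis by (simp add: dist_real_def abs_minus_commute)
    qed
    have lam: "\<bar>Lp t - l\<bar> \<le> B * h + (\<Sum>j\<in>J. \<bar>norm (D j t) - norm (d j t)\<bar>)"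
    proof -
      have "\<bar>(\<Sum>j\<in>J. norm (D j t)) - l\<bar> \<le> (\<Sum>j\<in>J. \<bar>norm (D j t) - norm (d j t)\<bar>)"
        unfolding l_def sum_subtractf[symmetric] by (rule sum_abs)
      then show ?thesis using Lp(3)[OF t] unfolding D_def[symmetric] by linarith
    qed
    have pb: "\<bar>norm (D j t) - norm (d j t)\<bar> \<le> h / (19200 * B ^ 9)" if "j \<in> J" for j
      using goodP[OF g that] by (simp add: P_def eps_def)
    have sch: "((norm (d j t) + norm (d (nx j) t)) / 2) *\<^sub>R v j t = tau (nx j) t - tau j t
        - (f l / 2) *\<^sub>R perp (norm (d j t) *\<^sub>R tau j t + norm (d (nx j) t) *\<^sub>R tau (nx j) t)" if j: "j \<in> J" for j
    proof -
      have "norm (d j t) + norm (d (nx j) t) \<noteq> 0" using gd0[OF g j t] by (metis add_nonneg_eq_0_iff norm_eq_zero norm_ge_zero)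
      then have "((norm (d j t) + norm (d (nx j) t)) / 2) *\<^sub>R v j t = d (nx j) t /\<^sub>R norm (d (nx j) t) - d j t /\<^sub>R norm (d j t)
        - (f l / 2) *\<^sub>R perp (d j t + d (nx j) t)"
        unfolding vflow[OF g j t] flow_field_def d_def[symmetric] l_def[symmetric] by (rule half_cancel)
      then show ?thesis unfolding qtau by (simp only: tau_def)
    qed
    have lam0: "0 \<le> \<bar>Lp t - l\<bar>" by simp
    note R = static_estimate[where rho = "\<lambda>j. rho j t" and t = "\<lambda>j. tt j t" and V = "\<lambda>j. V j t" and v = "\<lambda>j. v j t"
        and T = "\<lambda>j. Tt j t" and tau = "\<lambda>j. tau j t" and F = "f (Lp t)" and phi = "f l" and lam = "\<bar>Lp t - l\<bar>"
        and Q = "\<lambda>j. norm (D j t)" and q = "\<lambda>j. norm (d j t)"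
        and Z = "\<lambda>j. V j t + f (Lp t) *\<^sub>R perp (tt j t)",
        OF B h N Tunit[OF _ t] tunit[OF g _ t] unit[OF _ t] Vt[OF _ t] refl V(1)[OF _ t] V(2)[OF _ t] Lp(2)[OF t] phi lam0 lam
        QD(1)[OF _ t] QD(2)[OF _ t] pb rho(1)[OF _ t] rho(2)[OF _ t] rho(3)[OF t]
        c1[OF _ t, folded D_def, folded Tt_def] c2[OF _ t, folded D_def, folded Tt_def] c3[OF _ t, folded D_def] sch]
    have St: "S t = (\<Sum>j\<in>J. (norm (D j t) - norm (d j t))^2 / h + norm (d j t) * (norm (Tt j t - tau j t))^2 / 2)"
      unfolding S_def P_def by (intro sum.cong refl) (simp add: Sterm[OF g _ t])
    show ?thesis unfolding S'_def A_def St C P_def dQ_def dq_def DV_def dv_def using R by blast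
  qed
  have energy: "S s \<le> E * h^2" "integral {0..s} A \<le> 4 * B * E * h" if s: "s \<in> {0..T}" and g: "\<And>r. r \<in> {0..s} ==> good r" for s
  proof -
    have sT: "r \<in> {0..T}" if "r \<in> {0..s}" for r using that s by auto
    define a where "a r = exp (- C * r) * A r" for r
    have ac: "continuous_on {0..s} a" unfolding a_def using Ac s by (intro continuous_intros) (auto intro: continuous_on_subset)
    \<comment> \<open>Integrating factor for \<open>S + h^2\<close> with the dissipation carried
      along: monotonicity of \<open>y\<close> bounds \<open>S\<close> and the time integral of
      \<open>A\<close> at once.\<close>
    define y where "y r = exp (- C * r) * (S r + h^2) + h / (4 * B) * integral {0..r} a" for r
    have "y s \<le> y 0"
    proof (rule within_nonpos_decreasing[where f = y and a = 0 and b = s and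
          f' = "\<lambda>r. exp (- C * r) * (S' r - C * (S r + h^2) + h / (4 * B) * A r)"])
      show "0 \<le> s" using s by simp
      fix r assume r: "r \<in> {0..s}"
      have Sd: "(S has_real_derivative S' r) (at r within {0..s})" using Sder[OF g[OF r] sT[OF r]] by (rule DERIV_subset) (use s in auto)
      have Id: "((\<lambda>r. integral {0..r} a) has_real_derivative a r) (at r within {0..s})"
        by (rule integral_has_real_derivative[OF ac r])
      show "(y has_real_derivative exp (- C * r) * (S' r - C * (S r + h^2) + h / (4 * B) * A r)) (at r within {0..s})"
        unfolding y_def using B0 by (auto intro!: derivative_eq_intros Sd Id simp: a_def algebra_simps)
      show "exp (- C * r) * (S' r - C * (S r + h^2) + h / (4 * B) * A r) \<le> 0"
        using static[OF g[OF r] sT[OF r]] by (intro mult_nonneg_nonpos) auto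
    qed
    moreover have "y 0 = h^2"
    proof -
      have "S 0 = 0"
      proof -
        have "D j 0 = d j 0" if "j \<in> J" for j using x0[OF that] x0[OF pvJ[OF that]] by (simp add: D_def d_def edge_def)
        moreover have "D j 0 \<noteq> 0" if "j \<in> J" for j using Dne[OF that, of 0] T by simp
        ultimately show ?thesis unfolding S_def P_def Tt_def
          using B0 by (intro sum.neutral ballI) (simp add: dot_square_norm power2_eq_square)
      qed
      then show ?thesis by (simp add: y_def)
    qed
    ultimately have ys: "y s \<le> h^2" by simp
    have A0: "A r \<ge> 0" for r unfolding A_def by (simp add: sum_nonneg)
    have I0: "integral {0..s} a \<ge> 0" unfolding a_def by (rule integral_nonneg) (use ac A0 in \<open>auto simp: a_def intro: integrable_continuous_real\<close>)
    have S0s: "S s \<ge> 0" using S0[OF g s] s by auto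
    have "exp (- C * s) * (S s + h^2) \<le> h^2" using ys I0 h B0 unfolding y_def by (smt (verit) divide_nonneg_nonneg mult_nonneg_nonneg)
    then have "S s + h^2 \<le> exp (C * s) * h^2" by (simp add: exp_minus field_simps)
    also have "\<dots> \<le> E * h^2" unfolding E using s C0 by (intro mult_right_mono) auto
    finally show "S s \<le> E * h^2" using zero_le_power2[of h] by linarith
    have "h / (4 * B) * integral {0..s} a \<le> h^2" using ys S0s unfolding y_def
      by (smt (verit) exp_ge_zero mult_nonneg_nonneg zero_le_power2)
    then have ia: "integral {0..s} a \<le> 4 * B * h" using h B0 by (simp add: field_simps power2_eq_square)
    have "integral {0..s} A \<le> integral {0..s} (\<lambda>r. E * a r)"
    proof (rule integral_le)
      show "A integrable_on {0..s}" using Ac s by (intro integrable_continuous_real) (auto intro: continuous_on_subset)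
      show "(\<lambda>r. E * a r) integrable_on {0..s}" using ac by (intro integrable_continuous_real continuous_intros)
      fix r assume r: "r \<in> {0..s}"
      have "1 \<le> E * exp (- C * r)" unfolding E using sT[OF r] C0 by (simp flip: exp_add)
      then show "A r \<le> E * a r" using mult_right_mono[of 1 "E * exp (- C * r)" "A r"] A0 by (simp add: a_def mult.assoc)
    qed
    also have "\<dots> = E * integral {0..s} a" by simp
    also have "\<dots> \<le> E * (4 * B * h)" using ia E1 by (intro mult_left_mono) auto
    finally show "integral {0..s} A \<le> 4 * B * E * h" by (simp add: mult_ac)
  qed
  \<comment> \<open>\<open>Zt\<close> gains a factor \<open>h\<close> over \<open>S\<close>: it is
    at most \<open>E * h^3\<close>, which by \<open>small\<close> lies strictly below the threshold
    \<open>(eps * h)^2\<close>.\<close>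
  have strict: "Zt s < (eps * h)^2" if s: "s \<in> {0..T}" and g: "\<And>r. r \<in> {0..s} ==> good r" for s
  proof -
    have "Zt s \<le> h * S s" using SZ[OF g s] s by auto
    also have "\<dots> \<le> h * (E * h^2)" using energy(1)[OF s g] h by (intro mult_left_mono) auto
    also have "\<dots> = (h * E) * h^2" by simp
    also have "\<dots> < eps^2 * h^2" using small h by (intro mult_strict_right_mono) (auto simp: eps_def)
    finally show ?thesis by (simp add: power_mult_distrib)
  qed
  have good: "good b" if b: "b \<in> {0..T}" for b
  proof (rule ccontr)
    assume nb: "\<not> good b"
    \<comment> \<open>If \<open>good\<close> fails, the threshold is attained, and there is a first
      such time. Up to and including it all times are \<open>good\<close>, so \<open>strict\<close>
      contradicts equality there.\<close>
    define W where "W = {s \<in> {0..b}. Zt s = (eps * h)^2}"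
    have Zcb: "continuous_on {0..r} Zt" if "r \<in> {0..b}" for r using Zc by (rule continuous_on_subset) (use b that in auto)
    have ivt: "\<exists>s\<in>{0..r}. Zt s = (eps * h)^2" if "r \<in> {0..b}" "\<not> good r" for r
    proof -
      have "\<exists>s\<ge>0. s \<le> r \<and> Zt s = (eps * h)^2" by (rule IVT') (use that Zcb in \<open>auto simp: Zt0 good_def\<close>)
      then show ?thesis by auto
    qed
    have Wne: "W \<noteq> {}" using ivt[of b] nb b by (auto simp: W_def)
    have "closed W" unfolding W_def using Zcb[of b] b by (intro continuous_closed_preimage_constant) auto
    then have "compact W" unfolding W_def by (intro compact_eq_bounded_closed[THEN iffD2] conjI bounded_subset[OF bounded_closed_interval[of 0 b]]) auto
    then obtain s where s: "s \<in> W" "\<And>r. r \<in> W ==> s \<le> r" using compact_attains_inf[OF _ Wne] by blast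
    have "good r" if r: "r \<in> {0..s}" for r
    proof (rule ccontr)
      assume nr: "\<not> good r"
      have "r \<in> {0..b}" using r s(1) by (auto simp: W_def)
      from ivt[OF this nr] obtain s' where s': "s' \<in> {0..r}" "Zt s' = (eps * h)^2" by blast
      then have "s' \<in> W" using r s(1) by (auto simp: W_def)
      then have "s' = s" using s(2) s' r by fastforce
      then have "r = s" using s' r by auto
      then show False using nr s(1) by (simp add: W_def good_def)
    qed
    then have "Zt s < (eps * h)^2" using s(1) b by (intro strict) (auto simp: W_def)
    then show False using s(1) by (simp add: W_def)
  qed
  show thesis
  proof (rule that[of x v])
    show "x j 0 = X j 0" if "j \<in> J" for j by (rule x0[OF that])
    show "(x j has_vector_derivative v j t) (at t within {0..T})" if "j \<in> J" "t \<in> {0..T}" for j t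
      using x[OF that] by (simp add: v_def)
    show "v j t = flow_field f (perim (\<lambda>k. x k t)) (\<lambda>k. x k t) j" if "j \<in> J" "t \<in> {0..T}" for j t
      using vflow[OF good[OF that(2)] that] by (simp add: d_def)
    show "continuous_on {0..T} (v j)" if "j \<in> J" for j by (rule vc[OF that])
    show "edge (\<lambda>k. x k t) j \<noteq> 0" if "j \<in> J" "t \<in> {0..T}" for j t
      using gd0[OF good[OF that(2)] that] by (simp add: d_def)
    show "integral {0..T} (\<lambda>t. \<Sum>j\<in>J. (norm (V j t - v j t))^2) \<le> 4 * B * E * h"
      using energy(2)[of T] good T by (simp add: A_def[abs_def])
    fix t assume t: "t \<in> {0..T}"
    note g = good[OF t]
    have St: "S t \<le> E * h^2" using energy(1)[OF t] good t by auto
    \<comment> \<open>The edge error is its length part along \<open>Tt\<close> plus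
      \<open>norm (d j t)\<close> times a difference of unit vectors. In the square of the latter
      one factor \<open>norm (d j t) \<le> 2 * B * h\<close> is extracted, and what remains is twice
      the direction term of \<open>S\<close>.\<close>
    have "(\<Sum>j\<in>J. (norm (D j t - d j t))^2) \<le> (\<Sum>j\<in>J. 2 * (P j t)^2 + 8 * B * h * (norm (d j t) - Tt j t \<bullet> d j t))"
    proof (rule sum_mono)
      fix j assume j: "j \<in> J"
      have n: "norm (d j t) * (norm (Tt j t - tau j t))^2 = 2 * (norm (d j t) - Tt j t \<bullet> d j t)" using Sterm[OF g j t] by simp
      have "D j t - d j t = P j t *\<^sub>R Tt j t + norm (d j t) *\<^sub>R (Tt j t - tau j t)"
      proof -
        have "norm (D j t) *\<^sub>R Tt j t = D j t" using Dne[OF j t] by (simp add: Tt_def)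
        then show ?thesis unfolding scaleR_diff_right qtau P_def by (simp add: scaleR_diff_left)
      qed
      then have "norm (D j t - d j t) \<le> \<bar>P j t\<bar> + norm (d j t) * norm (Tt j t - tau j t)"
        using norm_triangle_ineq[of "P j t *\<^sub>R Tt j t" "norm (d j t) *\<^sub>R (Tt j t - tau j t)"] Tunit[OF j t] by simp
      then have "(norm (D j t - d j t))^2 \<le> (\<bar>P j t\<bar> + norm (d j t) * norm (Tt j t - tau j t))^2" by (rule power_mono) simp
      also have "\<dots> \<le> 2 * (\<bar>P j t\<bar>^2 + (norm (d j t) * norm (Tt j t - tau j t))^2)" by (rule square_add2_le)
      also have "(norm (d j t) * norm (Tt j t - tau j t))^2 = norm (d j t) * (norm (d j t) * (norm (Tt j t - tau j t))^2)"
        by (simp add: power2_eq_square)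
      also have "\<dots> \<le> (2 * B * h) * (norm (d j t) * (norm (Tt j t - tau j t))^2)"
        using qb(2)[OF g j t] by (intro mult_right_mono) auto
      also have "\<dots> = 4 * B * h * (norm (d j t) - Tt j t \<bullet> d j t)" unfolding n by simp
      finally show "(norm (D j t - d j t))^2 \<le> 2 * (P j t)^2 + 8 * B * h * (norm (d j t) - Tt j t \<bullet> d j t)" by simp
    qed
    also have "\<dots> = 2 * Zt t + 8 * B * h * (\<Sum>j\<in>J. norm (d j t) - Tt j t \<bullet> d j t)"
      unfolding Zt_def by (simp only: sum.distrib sum_distrib_left)
    also have "\<dots> \<le> 2 * (h * S t) + 8 * B * h * S t" using SZ[OF g t] SD[OF g t] B0 h by (intro add_mono mult_left_mono) auto
    also have "\<dots> = (2 + 8 * B) * (h * S t)" by (simp add: algebra_simps)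
    also have "\<dots> \<le> (18 * B^2) * (h * (E * h^2))"
    proof (intro mult_mono St)
      have "B \<le> B^2" using B by (simp add: self_le_power)
      then show "2 + 8 * B \<le> 18 * B^2" using B by linarith
    qed (use h B0 S0[OF g t] in auto)
    also have "\<dots> = 18 * B^2 * E * h ^ 3" by (simp add: power2_eq_square power3_eq_cube)
    finally show "(\<Sum>j\<in>J. (norm (edge (\<lambda>k. X k t) j - edge (\<lambda>k. x k t) j))^2) \<le> 18 * B^2 * E * h ^ 3"
      by (simp add: D_def d_def)
  qed
qed

end

section \<open>Consistency at the nodes\<close>

lemma vector_derivative_bound:
  fixes g :: "real \<Rightarrow> 'a::real_normed_vector"
  assumes "convex S" and "\<And>s. s \<in> S ==> (g has_vector_derivative g' s) (at s within S)"
    and "\<And>s. s \<in> S ==> norm (g' s) \<le> b" and "u \<in> S" "w \<in> S"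
  shows "norm (g u - g w) \<le> b * \<bar>u - w\<bar>"
proof -
  have "norm (g u - g w) \<le> b * norm (u - w)"
  proof (rule differentiable_bound[OF assms(1) _ _ assms(4,5)])
    fix s assume s: "s \<in> S"
    show "(g has_derivative (\<lambda>x. x *\<^sub>R g' s)) (at s within S)" using assms(2)[OF s] by (simp add: has_vector_derivative_def)
    have "norm (x *\<^sub>R g' s) \<le> b * norm x" for x using mult_right_mono[OF assms(3)[OF s], of "norm x"] by (simp add: mult.commute)
    then show "onorm (\<lambda>x. x *\<^sub>R g' s) \<le> b" by (rule onorm_le)
  qed
  then show ?thesis by simp
qed

lemma has_integral_norm_le:
  fixes g :: "real \<Rightarrow> 'a::real_normed_vector"
  assumes "(g has_integral i) {a..b}" "a \<le> b" "0 \<le> c" "\<And>s. s \<in> {a..b} ==> norm (g s) \<le> c"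
  shows "norm i \<le> c * (b - a)"
  using has_integral_bound_real[OF assms(3) finite.emptyI assms(1)] assms(2,4) by simp

text \<open>One cell of the curve against its chord. The equation for the derivative of
  \<open>tau\<close> makes the unit tangent Lipschitz although \<open>Y\<close> is merely
  continuous, so arc and chord differ by a relative error of order \<open>(b - a)^2\<close>. At an
  endpoint the tangent deviates from the chord direction by half the chord length times the
  curvature vector \<open>Z\<close>. In the remainder the oscillation \<open>om\<close> of
  \<open>Y\<close> is kept apart, because it is small only in the square sum over all cells.\<close>

lemma interval_consistency:
  fixes X Y Z tau :: "real \<Rightarrow> real^2" and a b G om :: real
  assumes ab: "a < b" "b - a \<le> 1" and G: "G \<ge> 1" and small: "2 * G ^ 4 * (b - a)^2 \<le> 1 / 2"
    and X: "\<And>s. s \<in> {a..b} ==> (X has_vector_derivative Y s) (at s within {a..b})" and Yc: "continuous_on {a..b} Y"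
    and Y: "\<And>s. s \<in> {a..b} ==> 1 / G \<le> norm (Y s)" "\<And>s. s \<in> {a..b} ==> norm (Y s) \<le> G"
    and tau: "\<And>s. s \<in> {a..b} ==> tau s = Y s /\<^sub>R norm (Y s)"
    and tau': "\<And>s. s \<in> {a..b} ==> (tau has_vector_derivative norm (Y s) *\<^sub>R Z s) (at s within {a..b})"
    and Z: "\<And>s. s \<in> {a..b} ==> norm (Z s) \<le> 2 * G"
      "\<And>s s'. s \<in> {a..b} ==> s' \<in> {a..b} ==> norm (Z s - Z s') \<le> 3 * G ^ 3 * \<bar>s - s'\<bar>"
    and om: "\<And>s s'. s \<in> {a..b} ==> s' \<in> {a..b} ==> norm (Y s - Y s') \<le> om"
  defines "D \<equiv> X b - X a" and "len \<equiv> integral {a..b} (\<lambda>s. norm (Y s))"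
  shows "(b - a) / (2 * G) \<le> norm D" "norm D \<le> G * (b - a)"
    "norm D \<le> len" "len - norm D \<le> 2 * G ^ 4 * (b - a)^2 * len"
    "norm (tau b - D /\<^sub>R norm D - (norm D / 2) *\<^sub>R Z b) \<le> 7 * G ^ 6 * ((b - a)^2 + (b - a) * om)"
    "norm (D /\<^sub>R norm D - tau a - (norm D / 2) *\<^sub>R Z a) \<le> 7 * G ^ 6 * ((b - a)^2 + (b - a) * om)"
    "p \<in> {a..b} ==> norm (D - (b - a) *\<^sub>R Y p) \<le> (b - a) * om"
proof -
  define k where "k = b - a"
  have k: "0 < k" "k \<le> 1" using ab by (auto simp: k_def)
  have G0: "G > 0" using G by simp
  have om0: "om \<ge> 0" using om[of a a] ab by simp
  have pw: "G ^ i \<le> G ^ j" if "i \<le> j" for i j using G that by (rule power_le_one_mono)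
  have P1: "1 \<le> G ^ i" for i using G by (simp add: one_le_power)
  have Y0: "norm (Y s) > 0" "Y s \<noteq> 0" if "s \<in> {a..b}" for s
  proof -
    have "0 < 1 / G" using G0 by simp
    then show "norm (Y s) > 0" using Y(1)[OF that] by linarith
    then show "Y s \<noteq> 0" by auto
  qed
  have taun: "norm (tau s) = 1" if "s \<in> {a..b}" for s using Y0[OF that] by (simp add: tau[OF that])
  have Ytau: "norm (Y s) *\<^sub>R tau s = Y s" if "s \<in> {a..b}" for s using Y0[OF that] by (simp add: tau[OF that])
  have DY: "(Y has_integral D) {a..b}" unfolding D_def using ab X by (intro fundamental_theorem_of_calculus) auto
  have lenI: "((\<lambda>s. norm (Y s)) has_integral len) {a..b}"
    unfolding len_def by (intro integrable_integral integrable_continuous_real continuous_intros Yc)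
  have Dlen: "norm D \<le> len" using integral_norm_bound_integral[of Y "{a..b}" "\<lambda>s. norm (Y s)"] DY lenI
    by (simp add: integral_unique has_integral_integrable)
  then show "norm D \<le> len" .
  have len_lo: "k / G \<le> len"
  proof -
    have "((\<lambda>s. 1 / G) has_integral (1 / G) * (b - a)) {a..b}"
      using has_integral_const_real[of "1 / G" a b] ab by (simp add: mult.commute)
    from has_integral_le[OF this lenI] Y(1) show ?thesis by (simp add: k_def)
  qed
  have len_hi: "len \<le> G * k"
  proof -
    have "((\<lambda>s. G) has_integral G * (b - a)) {a..b}" using has_integral_const_real[of G a b] ab by (simp add: mult.commute)
    from has_integral_le[OF lenI this] Y(2) show ?thesis by (simp add: k_def)
  qed
  have len0: "len > 0" using len_lo k G0 by (smt (verit) divide_pos_pos)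
  show "norm D \<le> G * (b - a)" using Dlen len_hi by (simp add: k_def)
  have taulip: "norm (tau s - tau s') \<le> 2 * G^2 * \<bar>s - s'\<bar>" if "s \<in> {a..b}" "s' \<in> {a..b}" for s s'
  proof (rule vector_derivative_bound[OF _ tau' _ that])
    show "norm (norm (Y s) *\<^sub>R Z s) \<le> 2 * G^2" if "s \<in> {a..b}" for s
    proof -
      have "norm (Y s) * norm (Z s) \<le> G * (2 * G)" using Y(2)[OF that] Z(1)[OF that] G0 by (intro mult_mono) auto
      then show ?thesis by (simp add: power2_eq_square)
    qed
  qed auto
  have sk: "\<bar>s - s'\<bar> \<le> k" if "s \<in> {a..b}" "s' \<in> {a..b}" for s s' using that by (auto simp: k_def)
  have taulip': "norm (tau s - tau s') \<le> 2 * G^2 * k" if "s \<in> {a..b}" "s' \<in> {a..b}" for s s'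
    by (rule order_trans[OF taulip[OF that]]) (use sk[OF that] in \<open>intro mult_left_mono, auto\<close>)
  \<comment> \<open>Projecting \<open>Y\<close> onto \<open>tau a\<close> bounds the chord from
    below. Unit vectors at distance \<open>delta\<close> have inner product
    \<open>1 - delta^2 / 2\<close>, so only the relative loss \<open>2 * G^4 * k^2\<close>
    occurs.\<close>
  have gap: "len - norm D \<le> 2 * G ^ 4 * k^2 * len"
  proof -
    have aa: "a \<in> {a..b}" using ab by simp
    have I: "((\<lambda>s. Y s \<bullet> tau a) has_integral D \<bullet> tau a) {a..b}" using has_integral_linear[OF DY bounded_linear_inner_left[of "tau a"]] by (simp add: o_def)
    have J: "((\<lambda>s. (1 - 2 * G ^ 4 * k^2) * norm (Y s)) has_integral (1 - 2 * G ^ 4 * k^2) * len) {a..b}"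
      by (rule has_integral_mult_right[OF lenI])
    have "(1 - 2 * G ^ 4 * k^2) * len \<le> D \<bullet> tau a"
    proof (rule has_integral_le[OF J I])
      fix s assume s: "s \<in> {a..b}"
      have "(norm (tau s - tau a))^2 \<le> (2 * G^2 * k)^2" using taulip'[OF s aa] by (rule power_mono) simp
      also have "\<dots> = 4 * G ^ 4 * k^2" by (simp add: power_mult_distrib eval_nat_numeral)
      finally have "(norm (tau s - tau a))^2 \<le> 4 * G ^ 4 * k^2" .
      moreover have "(norm (tau s - tau a))^2 = 2 - 2 * (tau s \<bullet> tau a)" using taun[OF s] taun[OF aa]
        by (simp add: power2_norm_eq_inner inner_diff_left inner_diff_right inner_commute) (simp add: dot_square_norm)
      ultimately have "1 - 2 * G ^ 4 * k^2 \<le> tau s \<bullet> tau a" by linarith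
      from mult_left_mono[OF this, of "norm (Y s)"] Ytau[OF s, symmetric]
      show "(1 - 2 * G ^ 4 * k^2) * norm (Y s) \<le> Y s \<bullet> tau a" by (metis inner_scaleR_left mult.commute norm_ge_zero)
    qed
    also have "D \<bullet> tau a \<le> norm D * norm (tau a)" by (rule norm_cauchy_schwarz)
    also have "\<dots> = norm D" using taun[OF aa] by simp
    finally show ?thesis by (simp add: algebra_simps)
  qed
  then show "len - norm D \<le> 2 * G ^ 4 * (b - a)^2 * len" by (simp add: k_def)
  have "2 * G ^ 4 * k^2 * len \<le> 1 / 2 * len" using small len0 by (intro mult_right_mono) (auto simp: k_def)
  then have D_lo: "len / 2 \<le> norm D" using gap by simp
  have D0: "norm D > 0" using D_lo len0 by linarith
  show "(b - a) / (2 * G) \<le> norm D"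
  proof -
    have "k / (2 * G) = (k / G) / 2" by simp
    also have "\<dots> \<le> len / 2" by (rule divide_right_mono[OF len_lo]) simp
    also have "\<dots> \<le> norm D" by (rule D_lo)
    finally show ?thesis by (simp add: k_def)
  qed
  have osc: "norm (D - k *\<^sub>R Y p) \<le> k * om" if p: "p \<in> {a..b}" for p
  proof -
    have "((\<lambda>s. Y s - Y p) has_integral D - k *\<^sub>R Y p) {a..b}"
      using has_integral_diff[OF DY has_integral_const_real[of "Y p" a b]] ab by (simp add: k_def)
    then have "norm (D - k *\<^sub>R Y p) \<le> om * (b - a)" by (rule has_integral_norm_le) (use om om0 p ab in auto)
    then show ?thesis by (simp add: k_def mult.commute)
  qed
  show "norm (D - (b - a) *\<^sub>R Y p) \<le> (b - a) * om" if "p \<in> {a..b}" using osc[OF that] by (simp add: k_def)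
  \<comment> \<open>Both endpoints in one statement: \<open>sg\<close> is 1 for \<open>p = b\<close>
    and -1 for \<open>p = a\<close>, and the integral of \<open>p - s\<close> over the cell is
    \<open>sg * k^2 / 2\<close>.\<close>
  have main: "norm (tau p - D /\<^sub>R norm D - (sg * norm D / 2) *\<^sub>R Z p) \<le> 7 * G ^ 6 * (k^2 + k * om)"
    if p: "p \<in> {a..b}" and sg: "((p - a)^2 - (p - b)^2) = sg * k^2" "\<bar>sg\<bar> = 1" for p sg
  proof -
    define y where "y = norm (Y p)"
    have y: "0 \<le> y" "y \<le> G" using Y(2)[OF p] by (auto simp: y_def)
    have lin: "norm (tau p - tau s - ((p - s) * y) *\<^sub>R Z p) \<le> k * (2 * G * om + 3 * G ^ 4 * k)" if s: "s \<in> {a..b}" for s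
    proof -
      have "norm ((tau p - (p * y) *\<^sub>R Z p) - (tau s - (s * y) *\<^sub>R Z p)) \<le> (2 * G * om + 3 * G ^ 4 * k) * \<bar>p - s\<bar>"
      proof (rule vector_derivative_bound[OF convex_real_interval(5) _ _ p s])
        fix r assume r: "r \<in> {a..b}"
        show "((\<lambda>r. tau r - (r * y) *\<^sub>R Z p) has_vector_derivative norm (Y r) *\<^sub>R Z r - y *\<^sub>R Z p) (at r within {a..b})"
          by (intro has_vector_derivative_diff tau' r) (auto intro!: derivative_eq_intros)
        have "norm (Y r) *\<^sub>R Z r - y *\<^sub>R Z p = (norm (Y r) - y) *\<^sub>R Z r + y *\<^sub>R (Z r - Z p)"
          by (simp add: algebra_simps)
        then have "norm (norm (Y r) *\<^sub>R Z r - y *\<^sub>R Z p) \<le> \<bar>norm (Y r) - y\<bar> * norm (Z r) + y * norm (Z r - Z p)"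
          using norm_triangle_ineq[of "(norm (Y r) - y) *\<^sub>R Z r" "y *\<^sub>R (Z r - Z p)"] y by simp
        also have "\<dots> \<le> om * (2 * G) + G * (3 * G ^ 3 * k)"
        proof (intro add_mono mult_mono Z(1) r y)
          show "\<bar>norm (Y r) - y\<bar> \<le> om" using om[OF r p] norm_triangle_ineq3[of "Y r" "Y p"] by (simp add: y_def)
          show "norm (Z r - Z p) \<le> 3 * G ^ 3 * k"
            by (rule order_trans[OF Z(2)[OF r p]]) (use sk[OF r p] G0 in \<open>intro mult_left_mono, auto\<close>)
        qed (use om0 G0 in auto)
        finally show "norm (norm (Y r) *\<^sub>R Z r - y *\<^sub>R Z p) \<le> 2 * G * om + 3 * G ^ 4 * k"
          by (simp add: eval_nat_numeral mult_ac)
      qed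
      also have "\<dots> \<le> (2 * G * om + 3 * G ^ 4 * k) * k" using sk[OF p s] om0 G0 k by (intro mult_left_mono) auto
      finally show ?thesis by (simp add: algebra_simps)
    qed
    \<comment> \<open>Weighting \<open>tau p - tau s\<close> with the speed makes its integral
      explicit, namely \<open>len *\<^sub>R tau p - D\<close>; the linear part of \<open>tau\<close>
      around \<open>p\<close> then supplies the curvature term.\<close>
    define W where "W s = norm (Y s) *\<^sub>R (tau p - tau s) - (p - s) *\<^sub>R (y^2 *\<^sub>R Z p)" for s
    have Wb: "norm (W s) \<le> k * (4 * G^2 * om + 3 * G ^ 5 * k)" if s: "s \<in> {a..b}" for s
    proof -
      have "W s = (norm (Y s) - y) *\<^sub>R (tau p - tau s) + y *\<^sub>R (tau p - tau s - ((p - s) * y) *\<^sub>R Z p)"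
        by (simp add: W_def algebra_simps power2_eq_square)
      then have "norm (W s) \<le> \<bar>norm (Y s) - y\<bar> * norm (tau p - tau s) + y * norm (tau p - tau s - ((p - s) * y) *\<^sub>R Z p)"
        using norm_triangle_ineq[of "(norm (Y s) - y) *\<^sub>R (tau p - tau s)" "y *\<^sub>R (tau p - tau s - ((p - s) * y) *\<^sub>R Z p)"] y by simp
      also have "\<dots> \<le> om * (2 * G^2 * k) + G * (k * (2 * G * om + 3 * G ^ 4 * k))"
      proof (intro add_mono mult_mono taulip' lin s p y)
        show "\<bar>norm (Y s) - y\<bar> \<le> om" using om[OF s p] norm_triangle_ineq3[of "Y s" "Y p"] by (simp add: y_def)
      qed (use om0 G0 k in auto)
      also have "\<dots> = k * (4 * G^2 * om + 3 * G ^ 5 * k)" by (simp add: algebra_simps eval_nat_numeral)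
      finally show ?thesis .
    qed
    have WI: "(W has_integral (len *\<^sub>R tau p - D - (sg * k^2 / 2) *\<^sub>R (y^2 *\<^sub>R Z p))) {a..b}"
    proof -
      have i1: "((\<lambda>s. norm (Y s) *\<^sub>R tau p - Y s) has_integral len *\<^sub>R tau p - D) {a..b}"
        by (intro has_integral_diff DY has_integral_scaleR_left lenI)
      have "((\<lambda>s. p - s) has_integral (- ((p - b)^2 / 2)) - (- ((p - a)^2 / 2))) {a..b}"
        using ab by (intro fundamental_theorem_of_calculus)
          (auto intro!: derivative_eq_intros simp: field_simps simp flip: has_real_derivative_iff_has_vector_derivative)
      moreover have "(- ((p - b)^2 / 2)) - (- ((p - a)^2 / 2)) = sg * k^2 / 2" using sg(1) by (simp add: field_simps)
      ultimately have "((\<lambda>s. p - s) has_integral sg * k^2 / 2) {a..b}" by (simp only:)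
      then have i2: "((\<lambda>s. (p - s) *\<^sub>R (y^2 *\<^sub>R Z p)) has_integral (sg * k^2 / 2) *\<^sub>R (y^2 *\<^sub>R Z p)) {a..b}"
        by (rule has_integral_scaleR_left)
      have Ws: "W s = norm (Y s) *\<^sub>R tau p - Y s - (p - s) *\<^sub>R (y^2 *\<^sub>R Z p)" if "s \<in> {a..b}" for s
        unfolding W_def scaleR_diff_right Ytau[OF that] ..
      show ?thesis by (rule has_integral_eq[OF _ has_integral_diff[OF i1 i2]]) (simp only: Ws)
    qed
    \<comment> \<open>The curvature term is brought into its final form in three moves:
      \<open>(y * k)^2\<close> becomes \<open>len^2\<close>, the relation is divided by
      \<open>len\<close>, and \<open>len\<close> is exchanged for \<open>norm D\<close> by means of
      \<open>gap\<close>.\<close>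
    define e1 where "e1 = len *\<^sub>R tau p - D - (sg * k^2 / 2) *\<^sub>R (y^2 *\<^sub>R Z p)"
    have e1: "norm e1 \<le> k^2 * (4 * G^2 * om + 3 * G ^ 5 * k)"
    proof -
      have "norm e1 \<le> (k * (4 * G^2 * om + 3 * G ^ 5 * k)) * (b - a)"
        by (rule has_integral_norm_le[OF WI[folded e1_def]]) (use Wb om0 G0 k ab in auto)
      then show ?thesis by (simp add: k_def power2_eq_square mult_ac)
    qed
    have lenyk: "\<bar>len - y * k\<bar> \<le> k * om"
    proof -
      have "((\<lambda>s. norm (Y s) - y) has_integral len - y * k) {a..b}"
        using has_integral_diff[OF lenI has_integral_const_real[of y a b]] ab by (simp add: k_def mult.commute)
      moreover have "norm (norm (Y s) - y) \<le> om" if "s \<in> {a..b}" for s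
        using om[OF that p] norm_triangle_ineq3[of "Y s" "Y p"] by (simp add: y_def)
      ultimately have "norm (len - y * k) \<le> om * (b - a)" using om0 ab by (intro has_integral_norm_le) auto
      then show ?thesis by (simp add: k_def mult.commute)
    qed
    have sq: "\<bar>len^2 - (y * k)^2\<bar> \<le> (k * om) * (2 * G * k)"
    proof -
      have "len^2 - (y * k)^2 = (len - y * k) * (len + y * k)" by (simp add: power2_eq_square algebra_simps)
      moreover have "\<bar>len + y * k\<bar> \<le> 2 * G * k"
      proof -
        have "y * k \<le> G * k" using y k by (intro mult_right_mono) auto
        moreover have "0 \<le> y * k" using y k by simp
        moreover have "2 * G * k = G * k + G * k" by simp
        ultimately show ?thesis using len_hi len0 by linarith
      qed
      ultimately show ?thesis using lenyk om0 k by (simp add: abs_mult mult_mono)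
    qed
    define e2 where "e2 = len *\<^sub>R tau p - D - (sg * len^2 / 2) *\<^sub>R Z p"
    have e2: "norm e2 \<le> k^2 * (6 * G^2 * om + 3 * G ^ 5 * k)"
    proof -
      have "e2 = e1 - (sg * (len^2 - (y * k)^2) / 2) *\<^sub>R Z p"
        unfolding e1_def e2_def by (simp add: algebra_simps diff_divide_distrib power_mult_distrib)
      then have "norm e2 \<le> norm e1 + \<bar>sg\<bar> * \<bar>len^2 - (y * k)^2\<bar> / 2 * norm (Z p)"
        using norm_triangle_ineq4[of e1 "(sg * (len^2 - (y * k)^2) / 2) *\<^sub>R Z p"] by (simp add: abs_mult)
      also have "\<dots> \<le> k^2 * (4 * G^2 * om + 3 * G ^ 5 * k) + 1 * ((k * om) * (2 * G * k)) / 2 * (2 * G)"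
        using e1 sq sg(2) Z(1)[OF p] k om0 G0 by (intro add_mono mult_mono divide_right_mono) auto
      also have "\<dots> = k^2 * (6 * G^2 * om + 3 * G ^ 5 * k)" by (simp add: algebra_simps power2_eq_square)
      finally show ?thesis .
    qed
    define e3 where "e3 = tau p - D /\<^sub>R len - (sg * len / 2) *\<^sub>R Z p"
    have e3: "norm e3 \<le> k * (6 * G ^ 3 * om + 3 * G ^ 6 * k)"
    proof -
      have "e2 = len *\<^sub>R e3" unfolding e2_def e3_def using len0 by (simp add: algebra_simps power2_eq_square)
      then have "norm e2 = len * norm e3" using len0 by simp
      then have "(k / G) * norm e3 \<le> k^2 * (6 * G^2 * om + 3 * G ^ 5 * k)" using mult_right_mono[OF len_lo, of "norm e3"] e2 by simp
      then have "(k / G) * norm e3 \<le> (k / G) * (k * (6 * G ^ 3 * om + 3 * G ^ 6 * k))"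
        using G0 by (simp add: field_simps eval_nat_numeral)
      then show ?thesis by (rule mult_left_le_imp_le) (use k G0 in simp)
    qed
    have gap2: "len - norm D \<le> 2 * G ^ 5 * k^2"
    proof -
      have "2 * G ^ 4 * k^2 * len \<le> 2 * G ^ 4 * k^2 * (G * 1)"
        using order_trans[OF len_hi mult_left_le[OF k(2)]] G0 by (intro mult_left_mono) auto
      also have "\<dots> = 2 * G ^ 5 * k^2" by (simp add: eval_nat_numeral)
      finally show ?thesis using gap by linarith
    qed
    have f1: "norm (D /\<^sub>R len - D /\<^sub>R norm D) \<le> 2 * G ^ 4 * k^2"
    proof -
      have "D /\<^sub>R len - D /\<^sub>R norm D = (inverse len - inverse (norm D)) *\<^sub>R D" by (simp add: scaleR_diff_left)
      then have "norm (D /\<^sub>R len - D /\<^sub>R norm D) = \<bar>inverse len - inverse (norm D)\<bar> * norm D" by simp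
      also have "\<dots> = (len - norm D) / len"
      proof -
        have "inverse len - inverse (norm D) = - ((len - norm D) / (len * norm D))" using len0 D0 by (simp add: field_simps)
        then have "\<bar>inverse len - inverse (norm D)\<bar> = (len - norm D) / (len * norm D)" using len0 D0 Dlen mult_pos_pos[OF len0 D0] by (simp del: zero_less_norm_iff)
        then show ?thesis using D0 by simp
      qed
      also have "\<dots> \<le> 2 * G ^ 4 * k^2" using gap len0 by (simp add: field_simps)
      finally show ?thesis .
    qed
    have f2: "norm ((sg * (len - norm D) / 2) *\<^sub>R Z p) \<le> 2 * G ^ 6 * k^2"
    proof -
      have "norm ((sg * (len - norm D) / 2) *\<^sub>R Z p) = (len - norm D) / 2 * norm (Z p)" using sg(2) Dlen by (simp add: abs_mult)
      also have "\<dots> \<le> (2 * G ^ 5 * k^2) / 2 * (2 * G)" using gap2 Dlen Z(1)[OF p] G0 by (intro mult_mono divide_right_mono) auto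
      also have "\<dots> = 2 * G ^ 6 * k^2" by (simp add: eval_nat_numeral)
      finally show ?thesis .
    qed
    have "tau p - D /\<^sub>R norm D - (sg * norm D / 2) *\<^sub>R Z p
        = e3 + (D /\<^sub>R len - D /\<^sub>R norm D) + (sg * (len - norm D) / 2) *\<^sub>R Z p"
      unfolding e3_def by (simp add: algebra_simps diff_divide_distrib)
    then have "norm (tau p - D /\<^sub>R norm D - (sg * norm D / 2) *\<^sub>R Z p)
       \<le> k * (6 * G ^ 3 * om + 3 * G ^ 6 * k) + 2 * G ^ 4 * k^2 + 2 * G ^ 6 * k^2" by (simp only:) (intro norm_triangle_mono e3 f1 f2)
    also have "\<dots> = 6 * G ^ 3 * (k * om) + (5 * G ^ 6 + 2 * G ^ 4) * k^2" by (simp add: algebra_simps power2_eq_square)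
    also have "\<dots> \<le> 7 * G ^ 6 * (k * om) + 7 * G ^ 6 * k^2"
      using pw[of 3 6] pw[of 4 6] P1[of 6] om0 k by (intro add_mono mult_right_mono) auto
    finally show ?thesis by (simp add: algebra_simps)
  qed
  have "b \<in> {a..b}" "a \<in> {a..b}" using ab by auto
  then show "norm (tau b - D /\<^sub>R norm D - (norm D / 2) *\<^sub>R Z b) \<le> 7 * G ^ 6 * ((b - a)^2 + (b - a) * om)"
    using main[of b 1] by (simp add: k_def)
  have "norm (tau a - D /\<^sub>R norm D - ((-1) * norm D / 2) *\<^sub>R Z a) \<le> 7 * G ^ 6 * (k^2 + k * om)"
    using \<open>a \<in> {a..b}\<close> by (intro main) (auto simp: k_def power2_eq_square algebra_simps)
  moreover have "norm (tau a - D /\<^sub>R norm D - ((-1) * norm D / 2) *\<^sub>R Z a) = norm (D /\<^sub>R norm D - tau a - (norm D / 2) *\<^sub>R Z a)"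
    by (subst norm_minus_cancel[symmetric]) (simp add: algebra_simps)
  ultimately show "norm (D /\<^sub>R norm D - tau a - (norm D / 2) *\<^sub>R Z a) \<le> 7 * G ^ 6 * ((b - a)^2 + (b - a) * om)"
    by (simp add: k_def)
qed

section \<open>Partitions of the period and the nodes of the curve\<close>

abbreviation cell :: "(nat \<Rightarrow> real) \<Rightarrow> nat \<Rightarrow> real set" where
  "cell \<xi> j \<equiv> {\<xi> (j - 1)..\<xi> j}"

text \<open>Vertices carry the indices 1 to \<open>N\<close>, so the vertex before 1 is
  \<open>N\<close>. Cells, in contrast, refer to node \<open>j - 1\<close>, which is 0 for the first
  cell; periodicity identifies the two nodes.\<close>

definition next_node :: "nat \<Rightarrow> nat \<Rightarrow> nat" where
  "next_node N j = (if j = N then 1 else j + 1)"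

definition prev_node :: "nat \<Rightarrow> nat \<Rightarrow> nat" where
  "prev_node N j = (if j = 1 then N else j - 1)"

lemma cyclic_nodes: "cyclic {1..N} (next_node N) (prev_node N)"
  by unfold_locales (auto simp: next_node_def prev_node_def)

lemma partition_pos: "is_partition N \<xi> ==> N \<ge> 1"
  by (cases N) (auto simp: is_partition_def)

lemma partition_step_pos: "is_partition N \<xi> ==> j \<in> {1..N} ==> \<xi> (j - 1) < \<xi> j"
  by (auto simp: is_partition_def)

lemma partition_cell_subset:
  assumes "is_partition N \<xi>" "j \<in> {1..N}"
  shows "(cell \<xi> j) \<subseteq> \<I>"
  using partition_mono[OF assms(1), of 0 "j - 1"] partition_mono[OF assms(1), of j N] assms by (auto simp: is_partition_def)

lemma sum_mesh_step:
  assumes "is_partition N \<xi>"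
  shows "(\<Sum>j=1..N. mesh_step \<xi> j) = 2 * pi"
proof -
  have "(\<Sum>j\<in>{1..m}. mesh_step \<xi> j) = \<xi> m - \<xi> 0" for m by (induction m) (auto simp: mesh_step_def)
  then show ?thesis using assms by (simp add: is_partition_def)
qed

lemma mesh_bounds:
  assumes P: "is_partition N \<xi>" and R: "regular_mesh cp cP N \<xi>" and cp: "cp > 0"
  shows "0 < mesh_size N \<xi>"
    "\<And>j. j \<in> {1..N} ==> mesh_step \<xi> j \<le> mesh_size N \<xi>"
    "\<And>j. j \<in> {1..N} ==> cp * mesh_size N \<xi> \<le> mesh_step \<xi> j"
    "\<And>j. j \<in> {1..N} ==> \<bar>mesh_step \<xi> (next_node N j) - mesh_step \<xi> j\<bar> \<le> cP * (mesh_size N \<xi>)^2"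
    "real N * mesh_size N \<xi> \<le> 2 * pi / cp"
proof -
  have N: "1 \<in> {1..N}" using partition_pos[OF P] by simp
  show le: "mesh_step \<xi> j \<le> mesh_size N \<xi>" if "j \<in> {1..N}" for j unfolding mesh_size_def using that by (intro Max_ge) auto
  have "0 < mesh_step \<xi> 1" using partition_step_pos[OF P N] by (simp add: mesh_step_def)
  then show pos: "0 < mesh_size N \<xi>" using le[OF N] by linarith
  show ge: "cp * mesh_size N \<xi> \<le> mesh_step \<xi> j" if "j \<in> {1..N}" for j
  proof -
    have "Min (mesh_step \<xi> ` {1..N}) \<le> mesh_step \<xi> j" using that by (intro Min_le) auto
    then show ?thesis using R by (simp add: regular_mesh_def)
  qed
  show "\<bar>mesh_step \<xi> (next_node N j) - mesh_step \<xi> j\<bar> \<le> cP * (mesh_size N \<xi>)^2" if "j \<in> {1..N}" for j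
    using R that by (auto simp: regular_mesh_def next_node_def)
  have "real N * (cp * mesh_size N \<xi>) = (\<Sum>j=1..N. cp * mesh_size N \<xi>)" by simp
  also have "\<dots> \<le> (\<Sum>j=1..N. mesh_step \<xi> j)" by (intro sum_mono ge)
  also have "\<dots> = 2 * pi" by (rule sum_mesh_step[OF P])
  finally show "real N * mesh_size N \<xi> \<le> 2 * pi / cp" using cp by (simp add: field_simps)
qed

lemma integral_partition:
  fixes g :: "real \<Rightarrow> 'a::banach"
  assumes P: "is_partition N \<xi>" and g: "g integrable_on \<I>"
  shows "integral \<I> g = (\<Sum>j=1..N. integral (cell \<xi> j) g)"
proof -
  have "m \<le> N ==> integral {0..\<xi> m} g = (\<Sum>j\<in>{1..m}. integral (cell \<xi> j) g)" for m
  proof (induction m)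
    case 0
    then show ?case using P by (simp add: is_partition_def)
  next
    case (Suc m)
    have 0: "0 \<le> \<xi> m" using partition_mono[OF P, of 0 m] P Suc.prems by (simp add: is_partition_def)
    have 1: "\<xi> m \<le> \<xi> (Suc m)" using partition_mono[OF P, of m "Suc m"] Suc.prems by simp
    have 2: "\<xi> (Suc m) \<le> 2 * pi" using partition_mono[OF P, of "Suc m" N] P Suc.prems by (simp add: is_partition_def)
    have "integral {0..\<xi> (Suc m)} g = integral {0..\<xi> m} g + integral {\<xi> m..\<xi> (Suc m)} g"
      using g 0 1 2 by (intro Henstock_Kurzweil_Integration.integral_combine[symmetric])
        (auto intro: integrable_subinterval_real)
    then show ?case using Suc by simp
  qed
  from this[of N] P show ?thesis by (simp add: is_partition_def)
qed

text \<open>All that the error analysis uses about the curve: \<open>Y\<close> and \<open>V\<close>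
  are its classical space and time derivatives, at every time. \<open>tangent_deriv\<close> is the
  flow equation solved for the derivative of the unit tangent. \<open>osc\<close> is the trace of
  the square integrable second derivative; stating it for points selected in each cell makes it
  stable under limits in time.\<close>

locale regular_flow =
  fixes f :: "real \<Rightarrow> real" and T M G :: real and X Y V :: "real \<Rightarrow> real \<Rightarrow> real^2"
  assumes f: "M-lipschitz_on {0<..} f" and MG: "M \<le> G" and T: "0 < T" and G: "1 \<le> G"
    and X_space: "\<And>t s. t \<in> {0..T} ==> s \<in> \<I> ==> (X t has_vector_derivative Y t s) (at s within \<I>)"
    and X_time: "\<And>t s. t \<in> {0..T} ==> s \<in> \<I> ==> ((\<lambda>t. X t s) has_vector_derivative V t s) (at t within {0..T})"
    and Y_cont: "continuous_on ({0..T} \<times> \<I>) (\<lambda>(t, s). Y t s)"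
    and V_cont: "continuous_on ({0..T} \<times> \<I>) (\<lambda>(t, s). V t s)"
    and Y_bound: "\<And>t s. t \<in> {0..T} ==> s \<in> \<I> ==> 1 / G \<le> norm (Y t s) \<and> norm (Y t s) \<le> G"
    and V_bound: "\<And>t s. t \<in> {0..T} ==> s \<in> \<I> ==> norm (V t s) \<le> G"
    and V_lip: "\<And>t s s'. t \<in> {0..T} ==> s \<in> \<I> ==> s' \<in> \<I> ==> norm (V t s - V t s') \<le> G * \<bar>s - s'\<bar>"
    and tangent_deriv: "\<And>t s. t \<in> {0..T} ==> s \<in> \<I> ==>
        ((\<lambda>s. Y t s /\<^sub>R norm (Y t s)) has_vector_derivative norm (Y t s) *\<^sub>R
          (V t s + f (integral \<I> (\<lambda>s. norm (Y t s))) *\<^sub>R perp (Y t s /\<^sub>R norm (Y t s)))) (at s within \<I>)"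
    and V_normal: "\<And>t s. t \<in> {0..T} ==> s \<in> \<I> ==> V t s \<bullet> Y t s = 0"
    and f_bound: "\<And>t. t \<in> {0..T} ==> \<bar>f (integral \<I> (\<lambda>s. norm (Y t s)))\<bar> \<le> G"
    and per: "\<And>t. t \<in> {0..T} ==> X t 0 = X t (2 * pi)" "\<And>t. t \<in> {0..T} ==> Y t 0 = Y t (2 * pi)"
      "\<And>t. t \<in> {0..T} ==> V t 0 = V t (2 * pi)"
    and osc: "\<And>t N \<xi> s s'. t \<in> {0..T} ==> is_partition N \<xi> ==>
        (\<And>j. j \<in> {1..N} ==> s j \<in> (cell \<xi> j) \<and> s' j \<in> (cell \<xi> j)) ==>
        (\<Sum>j=1..N. (norm (Y t (s j) - Y t (s' j)))^2) \<le> mesh_size N \<xi> * G^2"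
begin

definition tau :: "real \<Rightarrow> real \<Rightarrow> real^2" where
  "tau t s = Y t s /\<^sub>R norm (Y t s)"

definition len :: "real \<Rightarrow> real" where
  "len t = integral \<I> (\<lambda>s. norm (Y t s))"

definition Z :: "real \<Rightarrow> real \<Rightarrow> real^2" where
  "Z t s = V t s + f (len t) *\<^sub>R perp (tau t s)"

lemma G0: "G > 0" using G by simp

lemma Y_nz: "t \<in> {0..T} ==> s \<in> \<I> ==> Y t s \<noteq> 0"
  using Y_bound[of t s] G0 by (metis divide_pos_pos norm_zero not_less zero_less_one)

lemma norm_tau: "t \<in> {0..T} ==> s \<in> \<I> ==> norm (tau t s) = 1"
  using Y_nz[of t s] by (simp add: tau_def)

lemma tau_deriv:
  "t \<in> {0..T} ==> s \<in> \<I> ==> (tau t has_vector_derivative norm (Y t s) *\<^sub>R Z t s) (at s within \<I>)"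
  using tangent_deriv[of t s] by (simp add: tau_def[abs_def] Z_def len_def)

lemma Y_cont_slice:
  assumes "t \<in> {0..T}"
  shows "continuous_on \<I> (Y t)"
proof -
  have "(\<lambda>s. (t, s)) ` \<I> \<subseteq> {0..T} \<times> \<I>" using assms by auto
  from continuous_on_compose2[OF Y_cont continuous_on_Pair[OF continuous_on_const continuous_on_id] this]
  show ?thesis by simp
qed

lemma V_cont_slice:
  assumes "s \<in> \<I>"
  shows "continuous_on {0..T} (\<lambda>t. V t s)"
proof -
  have "(\<lambda>t. (t, s)) ` {0..T} \<subseteq> {0..T} \<times> \<I>" using assms by auto
  from continuous_on_compose2[OF V_cont continuous_on_Pair[OF continuous_on_id continuous_on_const] this]
  show ?thesis by simp
qed

lemma Z_bound: assumes "t \<in> {0..T}" "s \<in> \<I>" shows "norm (Z t s) \<le> 2 * G"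
proof -
  have "norm (Z t s) \<le> norm (V t s) + \<bar>f (len t)\<bar> * 1"
    unfolding Z_def using norm_triangle_ineq[of "V t s" "f (len t) *\<^sub>R perp (tau t s)"] norm_tau[OF assms] by simp
  then show ?thesis using V_bound[OF assms] f_bound[OF assms(1)] by (simp add: len_def)
qed

lemma tau_lip: assumes "t \<in> {0..T}" "s \<in> \<I>" "s' \<in> \<I>"
  shows "norm (tau t s - tau t s') \<le> 2 * G^2 * \<bar>s - s'\<bar>"
proof (rule vector_derivative_bound[OF _ tau_deriv[OF assms(1)] _ assms(2,3)])
  fix s assume s: "s \<in> \<I>"
  have "norm (Y t s) * norm (Z t s) \<le> G * (2 * G)" using Y_bound[OF assms(1) s] Z_bound[OF assms(1) s] G0 by (intro mult_mono) auto
  then show "norm (norm (Y t s) *\<^sub>R Z t s) \<le> 2 * G^2" by (simp add: power2_eq_square)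
qed auto

lemma Z_lip: assumes "t \<in> {0..T}" "s \<in> \<I>" "s' \<in> \<I>"
  shows "norm (Z t s - Z t s') \<le> 3 * G ^ 3 * \<bar>s - s'\<bar>"
proof -
  have "Z t s - Z t s' = (V t s - V t s') + f (len t) *\<^sub>R perp (tau t s - tau t s')" by (simp add: Z_def perp_diff algebra_simps)
  then have "norm (Z t s - Z t s') \<le> norm (V t s - V t s') + \<bar>f (len t)\<bar> * norm (tau t s - tau t s')"
    using norm_triangle_ineq[of "V t s - V t s'" "f (len t) *\<^sub>R perp (tau t s - tau t s')"] by simp
  also have "\<dots> \<le> G * \<bar>s - s'\<bar> + G * (2 * G^2 * \<bar>s - s'\<bar>)"
    using V_lip[OF assms] tau_lip[OF assms] f_bound[OF assms(1)] G0 by (intro add_mono mult_mono) (auto simp: len_def)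
  also have "\<dots> = (G + 2 * G ^ 3) * \<bar>s - s'\<bar>" by (simp add: algebra_simps eval_nat_numeral)
  also have "\<dots> \<le> 3 * G ^ 3 * \<bar>s - s'\<bar>" using power_le_one_mono[OF G, of 1 3] by (intro mult_right_mono) auto
  finally show ?thesis .
qed

lemma len_bounds: assumes "t \<in> {0..T}" shows "0 < len t" "len t \<le> 7 * G"
proof -
  have I: "((\<lambda>s. norm (Y t s)) has_integral len t) \<I>"
    unfolding len_def by (intro integrable_integral integrable_continuous_real continuous_intros Y_cont_slice assms)
  have "((\<lambda>s. 1 / G) has_integral (1 / G) * (2 * pi)) \<I>"
    using has_integral_const_real[of "1 / G" 0 "2 * pi"] by (simp add: mult.commute)
  from has_integral_le[OF this I] Y_bound[OF assms] have "(1 / G) * (2 * pi) \<le> len t" by simp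
  moreover have "0 < (1 / G) * (2 * pi)" using G0 pi_gt_zero by simp
  ultimately show "0 < len t" by linarith
  have "((\<lambda>s. G) has_integral G * (2 * pi)) \<I>" using has_integral_const_real[of G 0 "2 * pi"] by (simp add: mult.commute)
  from has_integral_le[OF I this] Y_bound[OF assms] have "len t \<le> G * (2 * pi)" by simp
  also have "G * (2 * pi) \<le> G * 7" using pi_less_4 pi_approx G0 by (intro mult_left_mono) auto
  finally show "len t \<le> 7 * G" by simp
qed

text \<open>By compactness each cell contains a pair of points at which the oscillation is attained,
  so the bound for selected points passes to the moduli of oscillation themselves.\<close>

lemma exists_osc:
  assumes t: "t \<in> {0..T}" and P: "is_partition N \<xi>"
  shows "\<exists>w. (\<forall>j\<in>{1..N}. 0 \<le> w j \<and> w j \<le> 2 * G \<and> (\<forall>s\<in>(cell \<xi> j). \<forall>s'\<in>(cell \<xi> j). norm (Y t s - Y t s') \<le> w j))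
     \<and> (\<Sum>j=1..N. (w j)^2) \<le> mesh_size N \<xi> * G^2"
proof -
  have "\<exists>p. p \<in> (cell \<xi> j) \<times> (cell \<xi> j) \<and> (\<forall>q\<in>(cell \<xi> j) \<times> (cell \<xi> j).
      norm (Y t (fst q) - Y t (snd q)) \<le> norm (Y t (fst p) - Y t (snd p)))" if j: "j \<in> {1..N}" for j
  proof -
    let ?I = "(cell \<xi> j)"
    have "continuous_on (?I \<times> ?I) (\<lambda>q. norm (Y t (fst q) - Y t (snd q)))" using partition_cell_subset[OF P j]
      by (intro continuous_intros continuous_on_compose2[OF Y_cont_slice[OF t]]) auto
    moreover have "compact (?I \<times> ?I)" by (intro compact_Times compact_Icc)
    moreover have "?I \<times> ?I \<noteq> {}" using partition_step_pos[OF P j] by auto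
    ultimately show ?thesis using continuous_attains_sup[of "?I \<times> ?I"] by blast
  qed
  then obtain p where p: "\<And>j. j \<in> {1..N} ==> p j \<in> (cell \<xi> j) \<times> (cell \<xi> j)"
    "\<And>j q. j \<in> {1..N} ==> q \<in> (cell \<xi> j) \<times> (cell \<xi> j) ==>
        norm (Y t (fst q) - Y t (snd q)) \<le> norm (Y t (fst (p j)) - Y t (snd (p j)))" by metis
  have p': "fst (p j) \<in> (cell \<xi> j)" "snd (p j) \<in> (cell \<xi> j)" if "j \<in> {1..N}" for j
    using p(1)[OF that] by (auto simp: mem_Times_iff)
  show ?thesis
  proof (intro exI[of _ "\<lambda>j. norm (Y t (fst (p j)) - Y t (snd (p j)))"] conjI ballI)
    show "(\<Sum>j=1..N. (norm (Y t (fst (p j)) - Y t (snd (p j))))^2) \<le> mesh_size N \<xi> * G^2" using p' by (intro osc t P) auto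
  next
    fix j assume j: "j \<in> {1..N}"
    have "norm (Y t (fst (p j))) \<le> G" "norm (Y t (snd (p j))) \<le> G"
      using Y_bound[OF t] p'[OF j] partition_cell_subset[OF P j] by auto
    then show "norm (Y t (fst (p j)) - Y t (snd (p j))) \<le> 2 * G"
      using norm_triangle_ineq4[of "Y t (fst (p j))" "Y t (snd (p j))"] by linarith
    fix s s' assume "s \<in> (cell \<xi> j)" "s' \<in> (cell \<xi> j)"
    then show "norm (Y t s - Y t s') \<le> norm (Y t (fst (p j)) - Y t (snd (p j)))" using p(2)[OF j, of "(s, s')"] by auto
  qed simp
qed

text \<open>The hypotheses of \<open>semidiscrete_error\<close> are verified for the nodal values of
  the curve. The defect \<open>rho\<close> of a cell is \<open>7 * G^6\<close> times
  \<open>h^2\<close> plus \<open>h\<close> times the oscillation of \<open>Y\<close>; its squares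
  sum to at most \<open>(686 * G^13 + 98 * G^14) * h^3\<close>, whence the constant
  \<open>784 * G^14\<close>.\<close>

theorem nodal_error:
  fixes N :: nat and \<xi> :: "nat \<Rightarrow> real" and cp cP :: real
  assumes P: "is_partition N \<xi>" and R: "regular_mesh cp cP N \<xi>" and cp: "0 < cp" "1 / cp \<le> G" and cP: "cP \<le> G"
    and B: "B = 784 * G ^ 14" and E: "E = exp (6000000 * B ^ 17 * T)" and small: "mesh_size N \<xi> * E < (1 / (19200 * B ^ 9))^2"
  obtains x v where "\<And>j. j \<in> {1..N} ==> x j 0 = X 0 (\<xi> j)"
    "\<And>j t. j \<in> {1..N} ==> t \<in> {0..T} ==> (x j has_vector_derivative v j t) (at t within {0..T})"
    "\<And>j t. j \<in> {1..N} ==> t \<in> {0..T} ==> v j t = cyclic.flow_field (next_node N) (prev_node N) f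
        (\<Sum>i=1..N. norm (x i t - x (prev_node N i) t)) (\<lambda>k. x k t) j"
    "\<And>j. j \<in> {1..N} ==> continuous_on {0..T} (v j)"
    "\<And>j t. j \<in> {1..N} ==> t \<in> {0..T} ==> x j t \<noteq> x (prev_node N j) t"
    "\<And>t. t \<in> {0..T} ==> (\<Sum>j=1..N. (norm ((X t (\<xi> j) - X t (\<xi> (j - 1))) - (x j t - x (prev_node N j) t)))^2)
        \<le> 18 * B^2 * E * (mesh_size N \<xi>) ^ 3"
    "integral {0..T} (\<lambda>t. \<Sum>j=1..N. (norm (V t (\<xi> j) - v j t))^2) \<le> 4 * B * E * mesh_size N \<xi>"
proof -
  interpret cyclic "{1..N}" "next_node N" "prev_node N" by (rule cyclic_nodes)
  define h where "h = mesh_size N \<xi>"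
  note mb = mesh_bounds[OF P R cp(1), folded h_def]
  have h0: "0 < h" by (rule mb(1))
  have pw: "G ^ i \<le> G ^ j" if "i \<le> j" for i j using G that by (rule power_le_one_mono)
  have P1: "1 \<le> G ^ i" for i using G by (simp add: one_le_power)
  have B1: "784 \<le> B" "B \<ge> 1" using P1[of 14] by (simp_all add: B)
  have E1: "1 \<le> E" using B1 T by (simp add: E)
  \<comment> \<open>The smallness demanded for the energy is far stronger than what consistency
    requires: it implies \<open>h \<le> 1 / B\<close>, and \<open>B\<close> exceeds
    \<open>2 * G^4\<close>.\<close>
  have hs: "h \<le> 1 / (2 * G ^ 4)" "h \<le> 1"
  proof -
    have BB: "1 \<le> B ^ i" for i using B1 by (simp add: one_le_power)
    have "h \<le> h * E" using E1 h0 by simp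
    also have "\<dots> \<le> (1 / (19200 * B ^ 9))^2" using small by (simp add: h_def)
    also have "\<dots> = 1 / (19200 * B ^ 9) * (1 / (19200 * B ^ 9))" by (simp add: power2_eq_square)
    also have "\<dots> \<le> 1 / B * 1"
    proof (intro mult_mono)
      have "B \<le> B ^ 9" using B1 by (simp add: self_le_power)
      then have "B \<le> 19200 * B ^ 9" using B1 by linarith
      then show "1 / (19200 * B ^ 9) \<le> 1 / B" using B1 by (intro divide_left_mono) auto
      have "1 \<le> 19200 * B ^ 9" using BB[of 9] by linarith
      moreover from this have "0 < 19200 * B ^ 9" by linarith
      ultimately show "1 / (19200 * B ^ 9) \<le> 1" by (simp only: divide_le_eq_1_pos)
    qed (use B1 in auto)
    finally have "h \<le> 1 / B" by simp
    also have "1 / B \<le> 1 / (2 * G ^ 4)" using pw[of 4 14] P1[of 4] G0 by (intro divide_left_mono) (auto simp: B)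
    finally show 1: "h \<le> 1 / (2 * G ^ 4)" .
    have "1 / (2 * G ^ 4) \<le> 1" using P1[of 4] by (simp add: divide_simps)
    with 1 show "h \<le> 1" by linarith
  qed
  have cell: "s \<in> \<I>" if "j \<in> {1..N}" "s \<in> (cell \<xi> j)" for j s using partition_cell_subset[OF P that(1)] that(2) by auto
  have nodes: "\<xi> j \<in> \<I>" "\<xi> (j - 1) \<in> \<I>" "\<xi> j \<in> (cell \<xi> j)" "\<xi> (j - 1) \<in> (cell \<xi> j)" if "j \<in> {1..N}" for j
    using cell[OF that] partition_step_pos[OF P that] by auto
  have wrap: "g (\<xi> (prev_node N j)) = g (\<xi> (j - 1))" if "g 0 = g (2 * pi)" "j \<in> {1..N}" for g :: "real \<Rightarrow> real^2" and j
    using that P by (auto simp: prev_node_def is_partition_def)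
  have wrap_n: "g (\<xi> (next_node N j - 1)) = g (\<xi> j)" if "g 0 = g (2 * pi)" "j \<in> {1..N}" for g :: "real \<Rightarrow> real^2" and j
    using that P by (auto simp: next_node_def is_partition_def)
  have tau_per: "tau t 0 = tau t (2 * pi)" "Z t 0 = Z t (2 * pi)" if "t \<in> {0..T}" for t
    using per[OF that] by (simp_all add: tau_def Z_def)
  \<comment> \<open>A family of moduli is selected for each time separately, as \<open>rho\<close>
    enters only through bounds at fixed times.\<close>
  define W where "W t = (SOME w. (\<forall>j\<in>{1..N}. 0 \<le> w j \<and> w j \<le> 2 * G \<and> (\<forall>s\<in>(cell \<xi> j). \<forall>s'\<in>(cell \<xi> j). norm (Y t s - Y t s') \<le> w j))
     \<and> (\<Sum>j=1..N. (w j)^2) \<le> h * G^2)" for t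
  have WW: "(\<forall>j\<in>{1..N}. 0 \<le> W t j \<and> W t j \<le> 2 * G \<and> (\<forall>s\<in>(cell \<xi> j). \<forall>s'\<in>(cell \<xi> j). norm (Y t s - Y t s') \<le> W t j))
     \<and> (\<Sum>j=1..N. (W t j)^2) \<le> h * G^2" if "t \<in> {0..T}" for t
    unfolding W_def h_def by (rule someI_ex[OF exists_osc[OF that P]])
  have W: "0 \<le> W t j" "W t j \<le> 2 * G" "\<And>s s'. s \<in> (cell \<xi> j) ==> s' \<in> (cell \<xi> j) ==> norm (Y t s - Y t s') \<le> W t j"
    if "t \<in> {0..T}" "j \<in> {1..N}" for t j using WW[OF that(1)] that(2) by blast+
  have Wsum: "(\<Sum>j=1..N. (W t j)^2) \<le> h * G^2" if "t \<in> {0..T}" for t using WW[OF that] by blast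
  define rho where "rho j t = 7 * G ^ 6 * (h^2 + h * W t j)" for j t
  define XX where "XX j t = X t (\<xi> j)" for j t
  have edgeX: "edge (\<lambda>k. XX k t) j = X t (\<xi> j) - X t (\<xi> (j - 1))" if "j \<in> {1..N}" "t \<in> {0..T}" for j t
    unfolding edge_def XX_def using wrap[of "X t", OF per(1)[OF that(2)] that(1)] by simp
  have step: "\<xi> j - \<xi> (j - 1) = mesh_step \<xi> j" for j by (simp add: mesh_step_def)
  have stepb: "0 < mesh_step \<xi> j" "mesh_step \<xi> j \<le> h" "cp * h \<le> mesh_step \<xi> j" if "j \<in> {1..N}" for j
    using mb(2,3)[OF that] partition_step_pos[OF P that] by (auto simp: mesh_step_def)
  have smallj: "2 * G ^ 4 * (mesh_step \<xi> j)^2 \<le> 2 * G ^ 4 * h^2" if "j \<in> {1..N}" for j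
    using stepb[OF that] G0 by (intro mult_left_mono power_mono) auto
  have hh: "2 * G ^ 4 * h \<le> 1" using hs(1) G0 by (simp add: field_simps)
  have cons: "mesh_step \<xi> j / (2 * G) \<le> norm (X t (\<xi> j) - X t (\<xi> (j - 1)))" (is "?c1")
    "norm (X t (\<xi> j) - X t (\<xi> (j - 1))) \<le> G * mesh_step \<xi> j" (is "?c2")
    "norm (X t (\<xi> j) - X t (\<xi> (j - 1))) \<le> integral (cell \<xi> j) (\<lambda>s. norm (Y t s))" (is "?c3")
    "integral (cell \<xi> j) (\<lambda>s. norm (Y t s)) - norm (X t (\<xi> j) - X t (\<xi> (j - 1)))
      \<le> 2 * G ^ 4 * (mesh_step \<xi> j)^2 * integral (cell \<xi> j) (\<lambda>s. norm (Y t s))" (is "?c4")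
    "norm (tau t (\<xi> j) - (X t (\<xi> j) - X t (\<xi> (j - 1))) /\<^sub>R norm (X t (\<xi> j) - X t (\<xi> (j - 1)))
        - (norm (X t (\<xi> j) - X t (\<xi> (j - 1))) / 2) *\<^sub>R Z t (\<xi> j)) \<le> rho j t" (is "?c5")
    "norm ((X t (\<xi> j) - X t (\<xi> (j - 1))) /\<^sub>R norm (X t (\<xi> j) - X t (\<xi> (j - 1))) - tau t (\<xi> (j - 1))
        - (norm (X t (\<xi> j) - X t (\<xi> (j - 1))) / 2) *\<^sub>R Z t (\<xi> (j - 1))) \<le> rho j t" (is "?c6")
    "\<And>p. p \<in> (cell \<xi> j) ==> norm ((X t (\<xi> j) - X t (\<xi> (j - 1))) - mesh_step \<xi> j *\<^sub>R Y t p) \<le> mesh_step \<xi> j * W t j"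
    if j: "j \<in> {1..N}" and t: "t \<in> {0..T}" for j t
  proof -
    note sub = partition_cell_subset[OF P j]
    have a1: "\<xi> (j - 1) < \<xi> j" by (rule partition_step_pos[OF P j])
    have a2: "\<xi> j - \<xi> (j - 1) \<le> 1" using stepb[OF j] hs(2) unfolding step by linarith
    have a3: "2 * G ^ 4 * (\<xi> j - \<xi> (j - 1))^2 \<le> 1 / 2"
    proof -
      have "2 * G ^ 4 * h^2 = (2 * G ^ 4 * h) * h" by (simp add: power2_eq_square)
      also have "\<dots> \<le> 1 * (1 / (2 * G ^ 4))" using hh hs h0 by (intro mult_mono) auto
      also have "\<dots> \<le> 1 / 2" using P1[of 4] by (simp add: divide_simps)
      finally show ?thesis using smallj[OF j] unfolding step by linarith
    qed
    have bb: "7 * G ^ 6 * ((mesh_step \<xi> j)^2 + mesh_step \<xi> j * W t j) \<le> rho j t"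
      unfolding rho_def using stepb[OF j] W(1)[OF t j] G0 by (intro mult_left_mono add_mono power_mono mult_right_mono) auto
    note I = interval_consistency[OF a1 a2 G a3, where X = "X t" and Y = "Y t" and tau = "tau t" and Z = "Z t" and om = "W t j"]
    have h1: "(X t has_vector_derivative Y t s) (at s within (cell \<xi> j))" if "s \<in> (cell \<xi> j)" for s
      using X_space[OF t cell[OF j that]] sub by (rule has_vector_derivative_within_subset)
    have h2: "continuous_on (cell \<xi> j) (Y t)" using Y_cont_slice[OF t] sub by (rule continuous_on_subset)
    have h3: "(tau t has_vector_derivative norm (Y t s) *\<^sub>R Z t s) (at s within (cell \<xi> j))" if "s \<in> (cell \<xi> j)" for s
      using tau_deriv[OF t cell[OF j that]] sub by (rule has_vector_derivative_within_subset)
    note I' = I[OF h1 h2 conjunct1[OF Y_bound[OF t cell[OF j]]] conjunct2[OF Y_bound[OF t cell[OF j]]] tau_def h3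
        Z_bound[OF t cell[OF j]] Z_lip[OF t cell[OF j] cell[OF j]] W(3)[OF t j], unfolded step]
    show ?c1 by (rule I'(1))
    show ?c2 by (rule I'(2))
    show ?c3 by (rule I'(3))
    show ?c4 by (rule I'(4))
    show ?c5 by (rule order_trans[OF I'(5) bb])
    show ?c6 by (rule order_trans[OF I'(6) bb])
    show "norm ((X t (\<xi> j) - X t (\<xi> (j - 1))) - mesh_step \<xi> j *\<^sub>R Y t p) \<le> mesh_step \<xi> j * W t j" if "p \<in> (cell \<xi> j)" for p
      by (rule I'(7)[rotated -1, OF that])
  qed
  have res: thesis if
    R: "\<And>x v. (\<And>j. j \<in> {1..N} ==> x j 0 = XX j 0) ==>
    (\<And>j t. j \<in> {1..N} ==> t \<in> {0..T} ==> (x j has_vector_derivative v j t) (at t within {0..T})) ==>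
    (\<And>j t. j \<in> {1..N} ==> t \<in> {0..T} ==> v j t = flow_field f (perim (\<lambda>k. x k t)) (\<lambda>k. x k t) j) ==>
    (\<And>j. j \<in> {1..N} ==> continuous_on {0..T} (v j)) ==>
    (\<And>j t. j \<in> {1..N} ==> t \<in> {0..T} ==> edge (\<lambda>k. x k t) j \<noteq> 0) ==>
    (\<And>t. t \<in> {0..T} ==> (\<Sum>j=1..N. (norm (edge (\<lambda>k. XX k t) j - edge (\<lambda>k. x k t) j))^2) \<le> 18 * B^2 * E * h ^ 3) ==>
    integral {0..T} (\<lambda>t. \<Sum>j=1..N. (norm (V t (\<xi> j) - v j t))^2) \<le> 4 * B * E * h ==> thesis"
  proof (rule semidiscrete_error[where X = XX and V = "\<lambda>j t. V t (\<xi> j)" and tt = "\<lambda>j t. tau t (\<xi> j)" and rho = rho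
        and Lp = len and f = f and B = B and M = M and T = T and h = h and C = "6000000 * B ^ 17" and E = E,
        OF f _ _ _ B1(2) h0 hs(2) _ refl E])
    show "M \<le> B"
    proof -
      have "G \<le> G ^ 14" using G by (simp add: self_le_power)
      then show ?thesis using MG G0 unfolding B by linarith
    qed
    show "0 \<le> T" using T by simp
    show "{1..N} \<noteq> {}" using partition_pos[OF P] by auto
    show "real (card {1..N}) * h \<le> B"
    proof -
      have "real N * h \<le> 2 * pi / cp" by (rule mb(5))
      also have "\<dots> = 2 * pi * (1 / cp)" by simp
      also have "\<dots> \<le> 7 * G" using cp pi_approx by (intro mult_mono) auto
      also have "\<dots> \<le> B" using pw[of 1 14] P1[of 14] by (simp add: B)
      finally show ?thesis by simp
    qed
    show "h * E < (1 / (19200 * B ^ 9))^2" using small by (simp add: h_def)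
    fix t assume t: "t \<in> {0..T}"
    show "0 < len t" by (rule len_bounds[OF t])
    have GB: "G \<le> B" using pw[of 1 14] P1[of 14] by (simp add: B)
    show "\<bar>f (len t)\<bar> \<le> B" using f_bound[OF t] GB by (simp add: len_def)
    have Ic: "(\<lambda>s. norm (Y t s)) integrable_on \<I>" by (intro integrable_continuous_real continuous_intros Y_cont_slice t)
    \<comment> \<open>Arc minus chord is summed over the cells. The relative error is
      \<open>2 * G^4 * h^2\<close>, and one factor \<open>h\<close> is spent to cancel the
      constant.\<close>
    show "\<bar>len t - perim (\<lambda>k. XX k t)\<bar> \<le> B * h"
    proof -
      have "len t - perim (\<lambda>k. XX k t)
         = (\<Sum>j=1..N. integral (cell \<xi> j) (\<lambda>s. norm (Y t s)) - norm (X t (\<xi> j) - X t (\<xi> (j - 1))))"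
        unfolding len_def integral_partition[OF P Ic] sum_subtractf using t by (simp add: edgeX)
      moreover have "\<dots> \<ge> 0" using cons(3)[OF _ t] by (intro sum_nonneg) simp
      moreover have "\<dots> \<le> (\<Sum>j=1..N. 2 * G ^ 4 * h^2 * integral (cell \<xi> j) (\<lambda>s. norm (Y t s)))"
      proof (rule sum_mono)
        fix j assume j: "j \<in> {1..N}"
        show "integral (cell \<xi> j) (\<lambda>s. norm (Y t s)) - norm (X t (\<xi> j) - X t (\<xi> (j - 1)))
           \<le> 2 * G ^ 4 * h^2 * integral (cell \<xi> j) (\<lambda>s. norm (Y t s))"
          using cons(3)[OF j t] by (intro order_trans[OF cons(4)[OF j t] mult_right_mono[OF smallj[OF j]]]) (rule order_trans[OF norm_ge_zero])
      qed
      moreover have "\<dots> = 2 * G ^ 4 * h^2 * len t" unfolding len_def integral_partition[OF P Ic] by (simp add: sum_distrib_left)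
      moreover have "\<dots> \<le> B * h"
      proof -
        have "2 * G ^ 4 * h^2 * len t = (2 * G ^ 4 * h) * (h * len t)" by (simp add: power2_eq_square)
        also have "\<dots> \<le> 1 * (h * (7 * G))" using hh h0 G0 len_bounds[OF t] by (intro mult_mono) auto
        also have "\<dots> = 7 * G * h" by simp
        also have "\<dots> \<le> B * h" using pw[of 1 14] P1[of 14] h0 by (intro mult_right_mono) (auto simp: B)
        finally show ?thesis .
      qed
      ultimately show ?thesis by linarith
    qed
    show "(\<Sum>j=1..N. (rho j t)^2) \<le> B * h ^ 3"
    proof -
      have "(\<Sum>j=1..N. (rho j t)^2) \<le> (\<Sum>j=1..N. 98 * G ^ 12 * (h ^ 4 + h^2 * (W t j)^2))"
      proof (rule sum_mono)
        fix j
        have "(rho j t)^2 = 49 * G ^ 12 * (h^2 + h * W t j)^2" unfolding rho_def by (simp add: power_mult_distrib power_mult[symmetric])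
        also have "\<dots> \<le> 49 * G ^ 12 * (2 * ((h^2)^2 + (h * W t j)^2))" using G0 by (intro mult_left_mono square_add2_le) auto
        finally show "(rho j t)^2 \<le> 98 * G ^ 12 * (h ^ 4 + h^2 * (W t j)^2)" by (simp add: power_mult_distrib power_mult[symmetric] algebra_simps)
      qed
      also have "\<dots> = 98 * G ^ 12 * (real N * h ^ 4 + h^2 * (\<Sum>j=1..N. (W t j)^2))"
        by (simp add: sum_distrib_left[symmetric] sum.distrib)
      also have "\<dots> \<le> 98 * G ^ 12 * ((7 * G) * h ^ 3 + h^2 * (h * G^2))"
      proof (intro mult_left_mono add_mono Wsum[OF t])
        have "real N * h \<le> 7 * G"
        proof -
          have "real N * h \<le> 2 * pi / cp" by (rule mb(5))
          also have "\<dots> = 2 * pi * (1 / cp)" by simp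
          also have "\<dots> \<le> 7 * G" using cp pi_approx by (intro mult_mono) auto
          finally show ?thesis .
        qed
        from mult_right_mono[OF this, of "h ^ 3"] show "real N * h ^ 4 \<le> 7 * G * h ^ 3" using h0 by (simp add: eval_nat_numeral mult_ac)
      qed (use G0 in auto)
      also have "\<dots> = (686 * G ^ 13 + 98 * G ^ 14) * h ^ 3" by (simp add: algebra_simps eval_nat_numeral)
      also have "\<dots> \<le> B * h ^ 3" using pw[of 13 14] h0 by (intro mult_right_mono) (auto simp: B)
      finally show ?thesis .
    qed
    fix j assume j: "j \<in> {1..N}"
    note nj = nxJ[OF j]
    show "(XX j has_vector_derivative V t (\<xi> j)) (at t within {0..T})" unfolding XX_def by (rule X_time[OF t nodes(1)[OF j]])
    show "norm (tau t (\<xi> j)) = 1" by (rule norm_tau[OF t nodes(1)[OF j]])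
    show "V t (\<xi> j) \<bullet> tau t (\<xi> j) = 0" using V_normal[OF t nodes(1)[OF j]] by (simp add: tau_def)
    show "norm (V t (\<xi> j)) \<le> B" using V_bound[OF t nodes(1)[OF j]] GB by linarith
    show "norm (V t (\<xi> j) - V t (\<xi> (prev_node N j))) \<le> B * h"
    proof -
      have "norm (V t (\<xi> j) - V t (\<xi> (prev_node N j))) = norm (V t (\<xi> j) - V t (\<xi> (j - 1)))"
        using wrap[of "V t", OF per(3)[OF t] j] by simp
      also have "\<dots> \<le> G * \<bar>\<xi> j - \<xi> (j - 1)\<bar>" by (rule V_lip[OF t nodes(1,2)[OF j]])
      also have "\<dots> \<le> B * h"
      proof (intro mult_mono GB)
        show "\<bar>\<xi> j - \<xi> (j - 1)\<bar> \<le> h" using stepb[OF j] unfolding step by simp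
      qed (use GB G0 in auto)
      finally show ?thesis .
    qed
    show "h / B \<le> norm (edge (\<lambda>k. XX k t) j)"
    proof -
      have "1 \<le> cp * G" using cp by (simp add: field_simps)
      then have "h \<le> G * (cp * h)" using h0 mult_right_mono[of 1 "cp * G" h] by (simp add: mult_ac)
      also have "\<dots> \<le> G * mesh_step \<xi> j" using stepb(3)[OF j] G0 by (intro mult_left_mono) auto
      finally have "h / (2 * G^2) \<le> mesh_step \<xi> j / (2 * G)" using G0 by (simp add: field_simps power2_eq_square)
      moreover have "h / B \<le> h / (2 * G^2)" using pw[of 2 14] P1[of 2] h0 G0 by (intro divide_left_mono) (auto simp: B)
      ultimately show ?thesis using cons(1)[OF j t] edgeX[OF j t] by simp
    qed
    show "norm (edge (\<lambda>k. XX k t) j) \<le> B * h"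
    proof -
      have "norm (edge (\<lambda>k. XX k t) j) \<le> G * mesh_step \<xi> j" using cons(2)[OF j t] edgeX[OF j t] by simp
      also have "\<dots> \<le> B * h" using stepb[OF j] GB G0 by (intro mult_mono) auto
      finally show ?thesis .
    qed
    have hW: "0 \<le> h * W t i" if "i \<in> {1..N}" for i using W(1)[OF t that] h0 by simp
    have rl: "h * W t i + G * h^2 \<le> rho i t" if "i \<in> {1..N}" for i
    proof -
      have "1 * (h * W t i) \<le> 7 * G ^ 6 * (h * W t i)" using hW[OF that] P1[of 6] by (intro mult_right_mono) auto
      moreover have "G * h^2 \<le> 7 * G ^ 6 * h^2" using pw[of 1 6] P1[of 6] by (intro mult_right_mono) auto
      ultimately show ?thesis unfolding rho_def by (simp add: distrib_left)
    qed
    show "h^2 \<le> rho j t"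
    proof -
      have "1 * h^2 \<le> G * h^2" using G by (intro mult_right_mono) auto
      then show ?thesis using rl[OF j] hW[OF j] by linarith
    qed
    show "rho j t \<le> B * h"
    proof -
      have "rho j t = 7 * G ^ 6 * ((h + W t j) * h)" by (simp add: rho_def power2_eq_square algebra_simps)
      also have "\<dots> \<le> 7 * G ^ 6 * ((3 * G) * h)" using W(2)[OF t j] hs(2) h0 G by (intro mult_left_mono mult_right_mono) auto
      also have "\<dots> = 21 * G ^ 7 * h" by (simp add: eval_nat_numeral)
      also have "\<dots> \<le> B * h" using pw[of 7 14] P1[of 14] h0 by (intro mult_right_mono) (auto simp: B)
      finally show ?thesis .
    qed
    show "norm (tau t (\<xi> j) - edge (\<lambda>k. XX k t) j /\<^sub>R norm (edge (\<lambda>k. XX k t) j)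
         - (norm (edge (\<lambda>k. XX k t) j) / 2) *\<^sub>R (V t (\<xi> j) + f (len t) *\<^sub>R perp (tau t (\<xi> j)))) \<le> rho j t"
      using cons(5)[OF j t] unfolding edgeX[OF j t] by (simp add: Z_def)
    show "norm (edge (\<lambda>k. XX k t) j /\<^sub>R norm (edge (\<lambda>k. XX k t) j) - tau t (\<xi> (prev_node N j))
         - (norm (edge (\<lambda>k. XX k t) j) / 2) *\<^sub>R (V t (\<xi> (prev_node N j)) + f (len t) *\<^sub>R perp (tau t (\<xi> (prev_node N j))))) \<le> rho j t"
      using cons(6)[OF j t] unfolding edgeX[OF j t]
      by (simp add: Z_def wrap[of "V t", OF per(3)[OF t] j] wrap[of "tau t", OF tau_per(1)[OF t] j])
    \<comment> \<open>Both edges at node \<open>j\<close> are compared with multiples of the same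
      vector \<open>Y t (\<xi> j)\<close>. Besides the two oscillations there remains the difference
      of neighbouring mesh steps, which the mesh condition bounds by
      \<open>cP * h^2\<close>.\<close>
    show "\<bar>norm (edge (\<lambda>k. XX k t) (next_node N j)) - norm (edge (\<lambda>k. XX k t) j)\<bar> \<le> rho j t + rho (next_node N j) t"
    proof -
      let ?n = "next_node N j"
      define D1 where "D1 = X t (\<xi> j) - X t (\<xi> (j - 1))"
      define D2 where "D2 = X t (\<xi> ?n) - X t (\<xi> (?n - 1))"
      define y where "y = Y t (\<xi> j)"
      have "norm (D1 - mesh_step \<xi> j *\<^sub>R y) \<le> mesh_step \<xi> j * W t j"
        unfolding D1_def y_def by (rule cons(7)[OF j t nodes(3)[OF j]])
      moreover have "mesh_step \<xi> j * W t j \<le> h * W t j" using stepb[OF j] W(1)[OF t j] by (intro mult_right_mono) auto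
      ultimately have a: "norm (D1 - mesh_step \<xi> j *\<^sub>R y) \<le> h * W t j" by linarith
      have "norm (D2 - mesh_step \<xi> ?n *\<^sub>R Y t (\<xi> (?n - 1))) \<le> mesh_step \<xi> ?n * W t ?n"
        unfolding D2_def by (rule cons(7)[OF nj t nodes(4)[OF nj]])
      moreover have "Y t (\<xi> (?n - 1)) = y" unfolding y_def by (rule wrap_n[of "Y t", OF per(2)[OF t] j])
      moreover have "mesh_step \<xi> ?n * W t ?n \<le> h * W t ?n" using stepb[OF nj] W(1)[OF t nj] by (intro mult_right_mono) auto
      ultimately have b: "norm (D2 - mesh_step \<xi> ?n *\<^sub>R y) \<le> h * W t ?n" by simp
      have "norm ((mesh_step \<xi> ?n - mesh_step \<xi> j) *\<^sub>R y) \<le> (cP * h^2) * G"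
        unfolding norm_scaleR using mb(4)[OF j] Y_bound[OF t nodes(1)[OF j]] unfolding y_def
        by (intro mult_mono) (auto intro: order_trans[OF abs_ge_zero])
      also have "\<dots> \<le> (G * h^2) * G" using cP G0 by (intro mult_right_mono) auto
      finally have c: "norm ((mesh_step \<xi> ?n - mesh_step \<xi> j) *\<^sub>R y) \<le> G^2 * h^2" by (simp add: power2_eq_square mult_ac)
      have "D2 - D1 = (D2 - mesh_step \<xi> ?n *\<^sub>R y) - (D1 - mesh_step \<xi> j *\<^sub>R y) + (mesh_step \<xi> ?n - mesh_step \<xi> j) *\<^sub>R y"
        by (simp add: algebra_simps)
      then have d: "norm (D2 - D1) \<le> h * W t ?n + h * W t j + G^2 * h^2"
        by (simp only:) (intro norm_triangle_mono norm_triangle_le_diff add_mono a b c)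
      have e: "h * W t ?n + h * W t j + G^2 * h^2 \<le> rho j t + rho ?n t"
      proof -
        have "1 * (h * W t i) \<le> 7 * G ^ 6 * (h * W t i)" if "i \<in> {1..N}" for i using hW[OF that] P1[of 6] by (intro mult_right_mono) auto
        from this[OF j] this[OF nj] have "h * W t ?n + h * W t j \<le> 7 * G ^ 6 * (h * W t ?n) + 7 * G ^ 6 * (h * W t j)" by linarith
        moreover have "G^2 * h^2 \<le> 7 * G ^ 6 * h^2" using pw[of 2 6] P1[of 6] by (intro mult_right_mono) auto
        moreover have "0 \<le> 7 * G ^ 6 * h^2" using G0 by simp
        ultimately show ?thesis unfolding rho_def distrib_left by linarith
      qed
      have "\<bar>norm D2 - norm D1\<bar> \<le> norm (D2 - D1)" by (rule norm_triangle_ineq3)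
      then show ?thesis using d e unfolding edgeX[OF j t] edgeX[OF nj t] D1_def[symmetric] D2_def[symmetric] by linarith
    qed
  next
    fix j assume j: "j \<in> {1..N}"
    show "continuous_on {0..T} (\<lambda>t. V t (\<xi> j))" by (rule V_cont_slice[OF nodes(1)[OF j]])
  qed (rule R)
  show thesis
  proof (rule res)
    fix x v
    assume a: "\<And>j. j \<in> {1..N} ==> x j 0 = XX j 0"
    "\<And>j t. j \<in> {1..N} ==> t \<in> {0..T} ==> (x j has_vector_derivative v j t) (at t within {0..T})"
    "\<And>j t. j \<in> {1..N} ==> t \<in> {0..T} ==> v j t = flow_field f (perim (\<lambda>k. x k t)) (\<lambda>k. x k t) j"
    "\<And>j. j \<in> {1..N} ==> continuous_on {0..T} (v j)"
    "\<And>j t. j \<in> {1..N} ==> t \<in> {0..T} ==> edge (\<lambda>k. x k t) j \<noteq> 0"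
    "\<And>t. t \<in> {0..T} ==> (\<Sum>j=1..N. (norm (edge (\<lambda>k. XX k t) j - edge (\<lambda>k. x k t) j))^2) \<le> 18 * B^2 * E * h ^ 3"
    "integral {0..T} (\<lambda>t. \<Sum>j=1..N. (norm (V t (\<xi> j) - v j t))^2) \<le> 4 * B * E * h"
    show thesis
    proof (rule that[of x v])
      show "(\<Sum>j=1..N. (norm ((X t (\<xi> j) - X t (\<xi> (j - 1))) - (x j t - x (prev_node N j) t)))^2)
        \<le> 18 * B^2 * E * (mesh_size N \<xi>) ^ 3" if t: "t \<in> {0..T}" for t
      proof -
        have "(\<Sum>j=1..N. (norm (edge (\<lambda>k. XX k t) j - edge (\<lambda>k. x k t) j))^2)
          = (\<Sum>j=1..N. (norm ((X t (\<xi> j) - X t (\<xi> (j - 1))) - (x j t - x (prev_node N j) t)))^2)"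
          using edgeX[OF _ t] by (intro sum.cong refl) (simp add: edge_def[of "\<lambda>k. x k t"])
        then show ?thesis using a(6)[OF t] by (simp add: h_def)
      qed
      show "x j t \<noteq> x (prev_node N j) t" if "j \<in> {1..N}" "t \<in> {0..T}" for j t using a(5)[OF that] by (simp add: edge_def)
    qed (use a in \<open>auto simp: XX_def h_def edge_def\<close>)
  qed
qed

end

section \<open>The finite element scheme as a system for the vertices\<close>

lemma integrable_circle_iff: "integrable circle g \<longleftrightarrow> g absolutely_integrable_on \<I>"
  for g :: "real \<Rightarrow> 'a::euclidean_space" by (simp add: integrable_restrict_space set_integrable_def)

lemma LINT_circle_eq: "g absolutely_integrable_on \<I> ==> (LINT s|circle. g s) = integral \<I> g"
  for g :: "real \<Rightarrow> 'a::euclidean_space" by (rule lebesgue_integral_eq_integral) (auto simp: integrable_circle_iff)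

lemma hat_props:
  assumes "is_partition N \<xi>" "j \<in> {1..N}"
  shows "pw_linear N \<xi> (hat N \<xi> j)" "\<And>i. i \<in> {1..N} ==> hat N \<xi> j (\<xi> i) = (if i = j then 1 else 0)"
  using theI'[OF ex1_hat[OF assms]] unfolding hat_def by auto

lemma pw_linear_sum_scaleR:
  fixes c :: "nat \<Rightarrow> 'a::real_normed_vector" and u :: "nat \<Rightarrow> real \<Rightarrow> real"
  assumes "finite J" "\<And>j. j \<in> J ==> pw_linear N \<xi> (u j)"
  shows "pw_linear N \<xi> (\<lambda>s. \<Sum>j\<in>J. u j s *\<^sub>R c j)"
  unfolding pw_linear_def
proof (intro conjI ballI)
  show "continuous_on UNIV (\<lambda>s. \<Sum>j\<in>J. u j s *\<^sub>R c j)"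
    using assms(2) by (intro continuous_on_sum continuous_intros) (auto simp: pw_linear_def)
  show "periodic (\<lambda>s. \<Sum>j\<in>J. u j s *\<^sub>R c j)" using assms(2) by (auto simp: pw_linear_def periodic_def)
  fix k assume k: "k \<in> {1..N}"
  have "\<forall>j. \<exists>ab. j \<in> J \<longrightarrow> (\<forall>s\<in>(cell \<xi> k). u j s = fst ab + s *\<^sub>R snd ab)"
  proof
    fix j
    show "\<exists>ab. j \<in> J \<longrightarrow> (\<forall>s\<in>(cell \<xi> k). u j s = fst ab + s *\<^sub>R snd ab)"
    proof (cases "j \<in> J")
      case True
      then obtain a b where "\<forall>s\<in>(cell \<xi> k). u j s = a + s *\<^sub>R b"
        using assms(2)[OF True] k unfolding pw_linear_def by blast
      then show ?thesis by (intro exI[of _ "(a, b)"]) simp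
    qed simp
  qed
  then obtain ab where ab: "\<And>j s. j \<in> J ==> s \<in> (cell \<xi> k) ==> u j s = fst (ab j) + s *\<^sub>R snd (ab j)"
    by metis
  have "(\<Sum>j\<in>J. u j s *\<^sub>R c j) = (\<Sum>j\<in>J. fst (ab j) *\<^sub>R c j) + s *\<^sub>R (\<Sum>j\<in>J. snd (ab j) *\<^sub>R c j)"
    if "s \<in> (cell \<xi> k)" for s unfolding scaleR_sum_right sum.distrib[symmetric]
    by (intro sum.cong refl) (simp add: ab[OF _ that] algebra_simps)
  then show "\<exists>a b. \<forall>s\<in>(cell \<xi> k). (\<Sum>j\<in>J. u j s *\<^sub>R c j) = a + s *\<^sub>R b" by blast
qed

lemma quadratic_integral:
  fixes a b :: real
  assumes "a < b"
  shows "((\<lambda>s. A + B * ((s - a) / (b - a)) + C * ((s - a) / (b - a))^2) has_integral (b - a) * (A + B / 2 + C / 3)) {a..b}"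
proof -
  define h where "h = b - a"
  have h: "h > 0" using assms by (simp add: h_def)
  define u where "u s = (s - a) / h" for s
  have du: "(u has_real_derivative 1 / h) (at s within S)" for s S unfolding u_def using h by (auto intro!: derivative_eq_intros)
  have uab: "u a = 0" "u b = 1" using h by (simp_all add: u_def h_def)
  define F where "F s = h * (A * u s + B * (u s)^2 / 2 + C * (u s) ^ 3 / 3)" for s
  have "((\<lambda>s. A + B * u s + C * (u s)^2) has_integral F b - F a) {a..b}"
  proof (rule fundamental_theorem_of_calculus)
    fix s
    have "(F has_real_derivative A + B * u s + C * (u s)^2) (at s within {a..b})" unfolding F_def using h
      by (auto intro!: derivative_eq_intros du) (simp add: field_simps)
    then show "(F has_vector_derivative A + B * u s + C * (u s)^2) (at s within {a..b})"
      by (simp add: has_real_derivative_iff_has_vector_derivative)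
  qed (use assms in simp)
  moreover have "F b - F a = h * (A + B / 2 + C / 3)" by (simp add: F_def uab)
  ultimately show ?thesis by (simp add: h_def u_def)
qed

locale mesh =
  fixes N :: nat and \<xi> :: "nat \<Rightarrow> real"
  assumes P: "is_partition N \<xi>"

sublocale mesh \<subseteq> cyclic "{1..N}" "next_node N" "prev_node N"
  by (rule cyclic_nodes)

context mesh
begin

lemma step_pos: "k \<in> {1..N} ==> \<xi> (k - 1) < \<xi> k"
  by (rule partition_step_pos[OF P])

lemma node_wrap:
  assumes "periodic v" "k \<in> {1..N}"
  shows "v (\<xi> (k - 1)) = v (\<xi> (prev_node N k))"
  using assms P unfolding periodic_def prev_node_def is_partition_def by (auto dest: spec[of _ 0])

lemma pw_linear_on_cell:
  fixes v :: "real \<Rightarrow> 'a::real_normed_vector"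
  assumes v: "pw_linear N \<xi> v" and k: "k \<in> {1..N}" and s: "s \<in> (cell \<xi> k)"
  shows "v s = v (\<xi> (prev_node N k)) + ((s - \<xi> (k - 1)) / (\<xi> k - \<xi> (k - 1))) *\<^sub>R (v (\<xi> k) - v (\<xi> (prev_node N k)))"
proof -
  obtain a b where ab: "\<forall>s\<in>(cell \<xi> k). v s = a + s *\<^sub>R b" using v k unfolding pw_linear_def by blast
  have w: "v (\<xi> (k - 1)) = v (\<xi> (prev_node N k))" using v k by (intro node_wrap) (auto simp: pw_linear_def)
  have 1: "v (\<xi> (k - 1)) = a + \<xi> (k - 1) *\<^sub>R b" "v (\<xi> k) = a + \<xi> k *\<^sub>R b" "v s = a + s *\<^sub>R b"
    using ab s step_pos[OF k] by auto
  have "v (\<xi> k) - v (\<xi> (k - 1)) = (\<xi> k - \<xi> (k - 1)) *\<^sub>R b" using 1 by (simp add: scaleR_diff_left)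
  then have "((s - \<xi> (k - 1)) / (\<xi> k - \<xi> (k - 1))) *\<^sub>R (v (\<xi> k) - v (\<xi> (k - 1))) = (s - \<xi> (k - 1)) *\<^sub>R b"
    using step_pos[OF k] by simp
  then show ?thesis using 1 unfolding w[symmetric] by (simp add: algebra_simps)
qed

lemma pw_linear_has_derivative:
  fixes v :: "real \<Rightarrow> 'a::real_normed_vector"
  assumes v: "pw_linear N \<xi> v" and k: "k \<in> {1..N}" and s: "s \<in> {\<xi> (k - 1)<..<\<xi> k}"
  shows "(v has_vector_derivative (v (\<xi> k) - v (\<xi> (prev_node N k))) /\<^sub>R (\<xi> k - \<xi> (k - 1))) (at s)"
proof (rule has_vector_derivative_transform_within_open[OF _ open_greaterThanLessThan s])
  let ?d = "v (\<xi> k) - v (\<xi> (prev_node N k))" and ?h = "\<xi> k - \<xi> (k - 1)"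
  have "((\<lambda>s. v (\<xi> (prev_node N k)) + ((s - \<xi> (k - 1)) * inverse ?h) *\<^sub>R ?d) has_vector_derivative (1 * inverse ?h) *\<^sub>R ?d) (at s)"
    by (auto intro!: derivative_eq_intros)
  then show "((\<lambda>s. v (\<xi> (prev_node N k)) + ((s - \<xi> (k - 1)) / ?h) *\<^sub>R ?d) has_vector_derivative ?d /\<^sub>R ?h) (at s)"
    by (simp add: divide_inverse)
  show "v (\<xi> (prev_node N k)) + ((y - \<xi> (k - 1)) / ?h) *\<^sub>R ?d = v y" if "y \<in> {\<xi> (k - 1)<..<\<xi> k}" for y
    using pw_linear_on_cell[OF v k, of y] that by simp
qed

lemma dxi_on_cell:
  assumes v: "pw_linear N \<xi> v" and k: "k \<in> {1..N}" and s: "s \<in> {\<xi> (k - 1)<..<\<xi> k}"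
  shows "dxi v s = (v (\<xi> k) - v (\<xi> (prev_node N k))) /\<^sub>R (\<xi> k - \<xi> (k - 1))"
  by (rule vector_derivative_at[OF pw_linear_has_derivative[OF assms]])

lemma mesh_fun_on_cell:
  assumes k: "k \<in> {1..N}" and s: "s \<in> {\<xi> (k - 1)<..<\<xi> k}"
  shows "mesh_fun N \<xi> s = \<xi> k - \<xi> (k - 1)"
proof -
  have "s \<notin> (cell \<xi> j)" if j: "j \<in> {1..N}" "j \<noteq> k" for j
  proof (cases "j < k")
    case True
    then have "\<xi> j \<le> \<xi> (k - 1)" using k by (intro partition_mono[OF P]) auto
    then show ?thesis using s by auto
  next
    case False
    then have "\<xi> k \<le> \<xi> (j - 1)" using j by (intro partition_mono[OF P]) auto
    then show ?thesis using s by auto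
  qed
  then have "mesh_fun N \<xi> s = (\<Sum>j=1..N. if j = k then mesh_step \<xi> k else 0)"
    unfolding mesh_fun_def using s by (intro sum.cong refl) (auto simp: indicator_def)
  then show ?thesis using k by (simp add: mesh_step_def)
qed

text \<open>The integrand is prescribed only inside the cells, because derivatives of finite element
  functions in general do not exist at the nodes; these are negligible for the integral.\<close>

lemma piecewise_integral:
  fixes g :: "real \<Rightarrow> 'a::euclidean_space" and G :: "nat \<Rightarrow> real \<Rightarrow> 'a"
  assumes G: "\<And>k. k \<in> {1..N} ==> continuous_on (cell \<xi> k) (G k)"
    and g: "\<And>k s. k \<in> {1..N} ==> s \<in> {\<xi> (k - 1)<..<\<xi> k} ==> g s = G k s"
  shows "g absolutely_integrable_on \<I>"
    and "(LINT s|circle. g s) = (\<Sum>k=1..N. integral (cell \<xi> k) (G k))"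
proof -
  have neg: "negligible {\<xi> (k - 1), \<xi> k}" for k by simp
  have eq: "g s = G k s" if "k \<in> {1..N}" "s \<in> (cell \<xi> k) - {\<xi> (k - 1), \<xi> k}" for k s using that by (intro g) auto
  have cell: "g absolutely_integrable_on (cell \<xi> k)" if k: "k \<in> {1..N}" for k
    by (rule absolutely_integrable_spike[OF absolutely_integrable_continuous_real[OF G[OF k]] neg[of k]]) (rule eq[OF k])
  have "m \<le> N ==> g absolutely_integrable_on {0..\<xi> m}" for m
  proof (induction m)
    case 0
    have "\<xi> 0 = 0" using P by (simp add: is_partition_def)
    moreover have "g absolutely_integrable_on {0..0}"
      by (rule absolutely_integrable_spike[OF absolutely_integrable_zero, where S = "{0}"]) auto
    ultimately show ?case by simp
  next
    case (Suc m)
    have 0: "0 \<le> \<xi> m" using partition_mono[OF P, of 0 m] P Suc.prems by (simp add: is_partition_def)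
    have 1: "\<xi> m \<le> \<xi> (Suc m)" using partition_mono[OF P, of m "Suc m"] Suc.prems by simp
    show ?case
    proof (rule absolutely_integrable_on_combine[where c = "\<xi> m"])
      show "g absolutely_integrable_on {0..\<xi> m}" using Suc by simp
      show "g absolutely_integrable_on {\<xi> m..\<xi> (Suc m)}" using cell[of "Suc m"] Suc.prems by simp
    qed (fact 0 1)+
  qed
  from this[of N] show ai: "g absolutely_integrable_on \<I>" using P by (simp add: is_partition_def)
  have "(LINT s|circle. g s) = integral \<I> g" by (rule LINT_circle_eq[OF ai])
  also have "\<dots> = (\<Sum>k=1..N. integral (cell \<xi> k) g)"
    by (rule integral_partition[OF P]) (rule set_lebesgue_integral_eq_integral(1)[OF ai])
  also have "\<dots> = (\<Sum>k=1..N. integral (cell \<xi> k) (G k))"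
  proof (rule sum.cong[OF refl])
    fix k assume k: "k \<in> {1..N}"
    show "integral (cell \<xi> k) g = integral (cell \<xi> k) (G k)" by (rule integral_spike[OF neg[of k]]) (rule eq[OF k, symmetric])
  qed
  finally show "(LINT s|circle. g s) = (\<Sum>k=1..N. integral (cell \<xi> k) (G k))" .
qed

lemma LINT_cells_const:
  fixes g :: "real \<Rightarrow> real"
  assumes g: "\<And>k s. k \<in> {1..N} ==> s \<in> {\<xi> (k - 1)<..<\<xi> k} ==> g s = A k"
  shows "(LINT s|circle. g s) = (\<Sum>k=1..N. (\<xi> k - \<xi> (k - 1)) * A k)"
  using piecewise_integral(2)[of "\<lambda>k s. A k" g] g step_pos less_imp_le[OF step_pos] by (auto intro!: sum.cong)

lemma LINT_cells_quadratic:
  fixes g :: "real \<Rightarrow> real"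
  assumes g: "\<And>k s. k \<in> {1..N} ==> s \<in> {\<xi> (k - 1)<..<\<xi> k} ==>
      g s = A k + B k * ((s - \<xi> (k - 1)) / (\<xi> k - \<xi> (k - 1))) + C k * ((s - \<xi> (k - 1)) / (\<xi> k - \<xi> (k - 1)))^2"
  shows "(LINT s|circle. g s) = (\<Sum>k=1..N. (\<xi> k - \<xi> (k - 1)) * (A k + B k / 2 + C k / 3))"
proof -
  let ?G = "\<lambda>k s. A k + B k * ((s - \<xi> (k - 1)) / (\<xi> k - \<xi> (k - 1))) + C k * ((s - \<xi> (k - 1)) / (\<xi> k - \<xi> (k - 1)))^2"
  have "(LINT s|circle. g s) = (\<Sum>k=1..N. integral (cell \<xi> k) (?G k))"
  proof (rule piecewise_integral(2))
    show "continuous_on (cell \<xi> k) (?G k)" for k unfolding divide_inverse by (intro continuous_intros)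
  qed (rule g)
  also have "\<dots> = (\<Sum>k=1..N. (\<xi> k - \<xi> (k - 1)) * (A k + B k / 2 + C k / 3))"
    by (intro sum.cong refl integral_unique quadratic_integral step_pos)
  finally show ?thesis .
qed

text \<open>Left side of the equation of node \<open>k\<close>: the coefficient of the nodal value
  of the test function in the weak form.\<close>

definition residual :: "real \<Rightarrow> (nat \<Rightarrow> real^2) \<Rightarrow> (nat \<Rightarrow> real^2) \<Rightarrow> nat \<Rightarrow> real^2" where
  "residual F c z k = ((norm (edge c k) + norm (edge c (next_node N k))) / 2) *\<^sub>R z k
     + edge c k /\<^sub>R norm (edge c k) - edge c (next_node N k) /\<^sub>R norm (edge c (next_node N k))
     + (F / 2) *\<^sub>R perp (edge c k + edge c (next_node N k))"

text \<open>The term with \<open>h^2/6\<close> turns the consistent mass matrix into the lumped one, so that the weak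
  form decouples into one vector equation per node.\<close>

lemma weak_form_eq_residual:
  fixes x z v :: "real \<Rightarrow> real^2"
  assumes x: "pw_linear N \<xi> x" and z: "pw_linear N \<xi> z" and v: "pw_linear N \<xi> v"
    and c: "\<And>j. j \<in> {1..N} ==> x (\<xi> j) = c j" and w: "\<And>j. j \<in> {1..N} ==> z (\<xi> j) = w j"
  shows "(LINT s|circle. speed x s * (z s \<bullet> v s))
        + (LINT s|circle. tangent x s \<bullet> dxi v s)
        + (LINT s|circle. (mesh_fun N \<xi> s)^2 * speed x s / 6 * (dxi z s \<bullet> dxi v s))
        + (LINT s|circle. F * (perp (dxi x s) \<bullet> v s))
      = (\<Sum>k=1..N. residual F c w k \<bullet> v (\<xi> k))"
proof -
  define h where "h k = \<xi> k - \<xi> (k - 1)" for k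
  have h: "h k > 0" if "k \<in> {1..N}" for k using step_pos[OF that] by (simp add: h_def)
  define d where "d k = edge c k" for k
  define vp where "vp k = v (\<xi> (prev_node N k))" for k
  define vk where "vk k = v (\<xi> k)" for k
  define zp where "zp k = w (prev_node N k)" for k
  have dx: "dxi x s = d k /\<^sub>R h k" if "k \<in> {1..N}" "s \<in> {\<xi> (k - 1)<..<\<xi> k}" for k s
    using dxi_on_cell[OF x that] c[OF that(1)] c[OF pvJ[OF that(1)]] by (simp add: d_def edge_def h_def)
  have dz: "dxi z s = (w k - zp k) /\<^sub>R h k" if "k \<in> {1..N}" "s \<in> {\<xi> (k - 1)<..<\<xi> k}" for k s
    using dxi_on_cell[OF z that] w[OF that(1)] w[OF pvJ[OF that(1)]] by (simp add: zp_def h_def)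
  have dv: "dxi v s = (vk k - vp k) /\<^sub>R h k" if "k \<in> {1..N}" "s \<in> {\<xi> (k - 1)<..<\<xi> k}" for k s
    using dxi_on_cell[OF v that] by (simp add: vk_def vp_def h_def)
  have sp: "speed x s = norm (d k) / h k" if "k \<in> {1..N}" "s \<in> {\<xi> (k - 1)<..<\<xi> k}" for k s
    using h[OF that(1)] by (simp add: speed_def dx[OF that] divide_inverse mult.commute)
  have tg: "tangent x s = d k /\<^sub>R norm (d k)" if "k \<in> {1..N}" "s \<in> {\<xi> (k - 1)<..<\<xi> k}" for k s
    using h[OF that(1)] by (simp add: tangent_def dx[OF that])
  have zs: "z s = zp k + ((s - \<xi> (k - 1)) / h k) *\<^sub>R (w k - zp k)" if "k \<in> {1..N}" "s \<in> {\<xi> (k - 1)<..<\<xi> k}" for k s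
    using pw_linear_on_cell[OF z that(1), of s] that w[OF that(1)] w[OF pvJ[OF that(1)]] by (simp add: zp_def h_def)
  have vs: "v s = vp k + ((s - \<xi> (k - 1)) / h k) *\<^sub>R (vk k - vp k)" if "k \<in> {1..N}" "s \<in> {\<xi> (k - 1)<..<\<xi> k}" for k s
    using pw_linear_on_cell[OF v that(1), of s] that by (simp add: vp_def vk_def h_def)
  define n where "n k = norm (d k)" for k
  have I1: "(LINT s|circle. speed x s * (z s \<bullet> v s)) = (\<Sum>k=1..N. (\<xi> k - \<xi> (k - 1)) *
      ((n k / h k) * (zp k \<bullet> vp k) + (n k / h k) * (zp k \<bullet> (vk k - vp k) + (w k - zp k) \<bullet> vp k) / 2
        + (n k / h k) * ((w k - zp k) \<bullet> (vk k - vp k)) / 3))" by (rule LINT_cells_quadratic)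
      (unfold h_def[symmetric], simp add: sp zs vs n_def inner_add_left inner_add_right power2_eq_square distrib_left mult_ac)
  have I2: "(LINT s|circle. tangent x s \<bullet> dxi v s) = (\<Sum>k=1..N. (\<xi> k - \<xi> (k - 1)) * ((d k /\<^sub>R norm (d k)) \<bullet> ((vk k - vp k) /\<^sub>R h k)))"
    by (rule LINT_cells_const) (simp only: tg dv)
  have I3: "(LINT s|circle. (mesh_fun N \<xi> s)^2 * speed x s / 6 * (dxi z s \<bullet> dxi v s))
     = (\<Sum>k=1..N. (\<xi> k - \<xi> (k - 1)) * ((h k)^2 * (n k / h k) / 6 * (((w k - zp k) /\<^sub>R h k) \<bullet> ((vk k - vp k) /\<^sub>R h k))))"
    by (rule LINT_cells_const) (simp only: sp dv dz mesh_fun_on_cell h_def n_def)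
  have I4: "(LINT s|circle. F * (perp (dxi x s) \<bullet> v s)) = (\<Sum>k=1..N. (\<xi> k - \<xi> (k - 1)) *
      (F * (perp (d k /\<^sub>R h k) \<bullet> vp k) + F * (perp (d k /\<^sub>R h k) \<bullet> (vk k - vp k)) / 2 + 0 / 3))"
    by (rule LINT_cells_quadratic)
      (unfold h_def[symmetric], simp add: dx vs inner_add_right distrib_left)
  \<comment> \<open>\<open>R1\<close> and \<open>R2\<close> are the contributions of cell
    \<open>k\<close> to its end node and to its start node. \<open>shift\<close> later re-indexes
    the second, so that the two coefficients of one nodal value meet.\<close>
  define R1 where "R1 k = (n k / 2) *\<^sub>R w k + d k /\<^sub>R n k + (F / 2) *\<^sub>R perp (d k)" for k
  define R2 where "R2 k = (n k / 2) *\<^sub>R zp k - d k /\<^sub>R n k + (F / 2) *\<^sub>R perp (d k)" for k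
  \<comment> \<open>On one cell the mass term is \<open>n k / 6\<close> times the matrix with rows
    (2, 1) and (1, 2), and the additional term is \<open>n k / 6\<close> times the one with rows (1,
    -1) and (-1, 1). Their sum is \<open>n k / 2\<close> times the identity.\<close>
  have cellsum: "(\<xi> k - \<xi> (k - 1)) *
      ((n k / h k) * (zp k \<bullet> vp k) + (n k / h k) * (zp k \<bullet> (vk k - vp k) + (w k - zp k) \<bullet> vp k) / 2
        + (n k / h k) * ((w k - zp k) \<bullet> (vk k - vp k)) / 3)
     + (\<xi> k - \<xi> (k - 1)) * ((d k /\<^sub>R norm (d k)) \<bullet> ((vk k - vp k) /\<^sub>R h k))
     + (\<xi> k - \<xi> (k - 1)) * ((h k)^2 * (n k / h k) / 6 * (((w k - zp k) /\<^sub>R h k) \<bullet> ((vk k - vp k) /\<^sub>R h k)))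
     + (\<xi> k - \<xi> (k - 1)) * (F * (perp (d k /\<^sub>R h k) \<bullet> vp k) + F * (perp (d k /\<^sub>R h k) \<bullet> (vk k - vp k)) / 2 + 0 / 3)
     = R1 k \<bullet> vk k + R2 k \<bullet> vp k" if k: "k \<in> {1..N}" for k
  proof -
    define zz where "zz = zp k \<bullet> vp k"
    define zv where "zv = zp k \<bullet> vk k"
    define wv where "wv = w k \<bullet> vk k"
    define wp where "wp = w k \<bullet> vp k"
    define tv where "tv = (d k /\<^sub>R n k) \<bullet> vk k"
    define tp where "tp = (d k /\<^sub>R n k) \<bullet> vp k"
    define pv where "pv = perp (d k) \<bullet> vk k"
    define pp where "pp = perp (d k) \<bullet> vp k"
    define H where "H = h k"
    have H: "H > 0" using h[OF k] by (simp add: H_def)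
    have e1: "zp k \<bullet> (vk k - vp k) = zv - zz" "(w k - zp k) \<bullet> vp k = wp - zz" "(w k - zp k) \<bullet> (vk k - vp k) = wv - wp - zv + zz"
      by (simp_all add: zz_def zv_def wv_def wp_def inner_diff_left inner_diff_right)
    have e2: "(d k /\<^sub>R norm (d k)) \<bullet> ((vk k - vp k) /\<^sub>R h k) = (tv - tp) / H"
      by (simp add: tv_def tp_def inner_diff_right n_def H_def divide_inverse algebra_simps)
    have e3: "((w k - zp k) /\<^sub>R h k) \<bullet> ((vk k - vp k) /\<^sub>R h k) = (wv - wp - zv + zz) / H^2"
      using e1(3) by (simp add: H_def divide_inverse power2_eq_square mult_ac)
    have e4: "perp (d k /\<^sub>R h k) \<bullet> vp k = pp / H" "perp (d k /\<^sub>R h k) \<bullet> (vk k - vp k) = (pv - pp) / H"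
      by (simp_all add: perp_scaleR pv_def pp_def H_def divide_inverse inner_diff_right algebra_simps)
    have e5: "R1 k \<bullet> vk k = n k / 2 * wv + tv + F / 2 * pv" "R2 k \<bullet> vp k = n k / 2 * zz - tp + F / 2 * pp"
      by (simp_all add: R1_def R2_def wv_def zz_def tv_def tp_def pv_def pp_def inner_add_left inner_diff_left)
    show ?thesis unfolding e2 e3 e4 unfolding e1 e5 unfolding h_def[of k, symmetric] zz_def[symmetric] H_def[symmetric] using H
      by (simp add: field_simps power2_eq_square)
  qed
  have "(\<Sum>k=1..N. R2 k \<bullet> vp k) = (\<Sum>k=1..N. R2 (next_node N k) \<bullet> vp (next_node N k))" by (rule sum_nx[symmetric])
  also have "\<dots> = (\<Sum>k=1..N. R2 (next_node N k) \<bullet> vk k)" by (intro sum.cong refl) (simp add: vp_def vk_def pvnx)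
  finally have shift: "(\<Sum>k=1..N. R2 k \<bullet> vp k) = (\<Sum>k=1..N. R2 (next_node N k) \<bullet> vk k)" .
  have res: "R1 k + R2 (next_node N k) = residual F c w k" if "k \<in> {1..N}" for k using pvnx[OF that]
    by (simp add: R1_def R2_def residual_def d_def n_def zp_def perp_add algebra_simps add_divide_distrib)
  have "(LINT s|circle. speed x s * (z s \<bullet> v s))
        + (LINT s|circle. tangent x s \<bullet> dxi v s)
        + (LINT s|circle. (mesh_fun N \<xi> s)^2 * speed x s / 6 * (dxi z s \<bullet> dxi v s))
        + (LINT s|circle. F * (perp (dxi x s) \<bullet> v s)) = (\<Sum>k=1..N. R1 k \<bullet> vk k + R2 k \<bullet> vp k)"
    unfolding I1 I2 I3 I4 sum.distrib[symmetric] by (rule sum.cong[OF refl]) (rule cellsum)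
  also have "\<dots> = (\<Sum>k=1..N. (R1 k + R2 (next_node N k)) \<bullet> vk k)" by (simp only: sum.distrib shift inner_add_left)
  also have "\<dots> = (\<Sum>k=1..N. residual F c w k \<bullet> v (\<xi> k))" by (rule sum.cong[OF refl]) (simp only: res vk_def)
  finally show ?thesis .
qed

lemma residual_zero_iff:
  assumes "k \<in> {1..N}" "edge c k \<noteq> 0"
  shows "residual F c z k = 0 \<longleftrightarrow> z k = (edge c (next_node N k) /\<^sub>R norm (edge c (next_node N k)) - edge c k /\<^sub>R norm (edge c k)
      - (F / 2) *\<^sub>R perp (edge c k + edge c (next_node N k))) /\<^sub>R ((norm (edge c k) + norm (edge c (next_node N k))) / 2)"
    (is "_ \<longleftrightarrow> z k = ?W /\<^sub>R ?m")
proof -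
  have "norm (edge c k) + norm (edge c (next_node N k)) > 0" using assms(2) by (simp add: add_pos_nonneg)
  then have "?m > 0" by (rule half_gt_zero)
  then have m: "?m \<noteq> 0" by (rule less_imp_neq[symmetric])
  have "residual F c z k = ?m *\<^sub>R z k - ?W" by (simp add: residual_def)
  moreover have "?m *\<^sub>R z k = ?W \<longleftrightarrow> z k = ?W /\<^sub>R ?m" by (rule divideR_right[OF m, symmetric])
  ultimately show ?thesis by (simp only: right_minus_eq)
qed

definition lift :: "(nat \<Rightarrow> real^2) \<Rightarrow> real \<Rightarrow> real^2" where
  "lift c s = (\<Sum>j=1..N. hat N \<xi> j s *\<^sub>R c j)"

lemma pw_linear_lift: "pw_linear N \<xi> (lift c)"
  unfolding lift_def using hat_props(1)[OF P] by (intro pw_linear_sum_scaleR) auto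

lemma lift_node: assumes "i \<in> {1..N}" shows "lift c (\<xi> i) = c i"
proof -
  have "lift c (\<xi> i) = (\<Sum>j=1..N. (if j = i then c j else 0))"
    unfolding lift_def using hat_props(2)[OF P _ assms] by (intro sum.cong refl) auto
  then show ?thesis using assms by simp
qed

lemma lift_prev: assumes "i \<in> {1..N}" shows "lift c (\<xi> (i - 1)) = c (prev_node N i)"
  using node_wrap[OF _ assms, of "lift c"] pw_linear_lift[of c] lift_node[OF pvJ[OF assms]] by (simp add: pw_linear_def)

lemma polygon_length_lift: "polygon_length N \<xi> (lift c) = perim c"
  unfolding polygon_length_def by (intro sum.cong refl) (simp only: lift_node lift_prev edge_def)

text \<open>A single nodal equation is isolated by the finite element function whose value at that
  node is the residual itself and which vanishes at all other nodes.\<close>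

lemma weak_form_iff:
  "(\<forall>v\<in>V\<^sub>h N \<xi>. (LINT s|circle. speed (lift c) s * (lift z s \<bullet> v s))
        + (LINT s|circle. tangent (lift c) s \<bullet> dxi v s)
        + (LINT s|circle. (mesh_fun N \<xi> s)^2 * speed (lift c) s / 6 * (dxi (lift z) s \<bullet> dxi v s))
        + (LINT s|circle. F * (perp (dxi (lift c) s) \<bullet> v s)) = 0)
   \<longleftrightarrow> (\<forall>k\<in>{1..N}. residual F c z k = 0)"
proof -
  have e: "(LINT s|circle. speed (lift c) s * (lift z s \<bullet> v s))
        + (LINT s|circle. tangent (lift c) s \<bullet> dxi v s)
        + (LINT s|circle. (mesh_fun N \<xi> s)^2 * speed (lift c) s / 6 * (dxi (lift z) s \<bullet> dxi v s))
        + (LINT s|circle. F * (perp (dxi (lift c) s) \<bullet> v s)) = (\<Sum>k=1..N. residual F c z k \<bullet> v (\<xi> k))"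
    if "v \<in> V\<^sub>h N \<xi>" for v using that by (intro weak_form_eq_residual pw_linear_lift lift_node) (auto simp: V\<^sub>h_def)
  show ?thesis
  proof
    assume A: "\<forall>v\<in>V\<^sub>h N \<xi>. (LINT s|circle. speed (lift c) s * (lift z s \<bullet> v s))
        + (LINT s|circle. tangent (lift c) s \<bullet> dxi v s)
        + (LINT s|circle. (mesh_fun N \<xi> s)^2 * speed (lift c) s / 6 * (dxi (lift z) s \<bullet> dxi v s))
        + (LINT s|circle. F * (perp (dxi (lift c) s) \<bullet> v s)) = 0"
    show "\<forall>k\<in>{1..N}. residual F c z k = 0"
    proof
      fix k assume k: "k \<in> {1..N}"
      define v where "v = lift (\<lambda>j. if j = k then residual F c z k else 0)"
      have v: "v \<in> V\<^sub>h N \<xi>" unfolding V\<^sub>h_def v_def using pw_linear_lift by simp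
      have "0 = (\<Sum>j=1..N. residual F c z j \<bullet> v (\<xi> j))" using A e[OF v] v by simp
      also have "\<dots> = (\<Sum>j=1..N. if j = k then residual F c z k \<bullet> residual F c z k else 0)"
        by (intro sum.cong refl) (simp add: v_def lift_node)
      also have "\<dots> = residual F c z k \<bullet> residual F c z k" using k by simp
      finally show "residual F c z k = 0" by simp
    qed
  next
    assume "\<forall>k\<in>{1..N}. residual F c z k = 0"
    then show "\<forall>v\<in>V\<^sub>h N \<xi>. (LINT s|circle. speed (lift c) s * (lift z s \<bullet> v s))
        + (LINT s|circle. tangent (lift c) s \<bullet> dxi v s)
        + (LINT s|circle. (mesh_fun N \<xi> s)^2 * speed (lift c) s / 6 * (dxi (lift z) s \<bullet> dxi v s))
        + (LINT s|circle. F * (perp (dxi (lift c) s) \<bullet> v s)) = 0" using e by simp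
  qed
qed

lemma dt_lift:
  assumes T: "0 < T" and x: "\<And>t s. t \<in> {0..T} ==> x t s = lift (\<lambda>j. c j t) s"
    and c: "\<And>j. j \<in> {1..N} ==> (c j has_vector_derivative c' j) (at t within {0..T})" and t: "t \<in> {0..T}"
  shows "dt T x t = lift c'"
proof
  fix s
  have "((\<lambda>r. lift (\<lambda>j. c j r) s) has_vector_derivative lift c' s) (at t within {0..T})" unfolding lift_def
    by (intro has_vector_derivative_sum bounded_linear.has_vector_derivative[OF bounded_linear_scaleR_right] c) auto
  then have "((\<lambda>r. x r s) has_vector_derivative lift c' s) (at t within {0..T})"
    by (rule has_vector_derivative_transform[OF t, rotated]) (simp add: x)
  then show "dt T x t s = lift c' s" unfolding dt_def using T t by (intro vector_derivative_within_closed_interval) auto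
qed

text \<open>Bridge between functions on the circle and vertices: it transfers the existence obtained
  in \<open>nodal_error\<close> to the weak formulation, and the uniqueness of
  \<open>flow_field_unique\<close> back from it.\<close>

theorem semidiscrete_solution_iff:
  assumes T: "0 < T"
  shows "semidiscrete_solution f T N \<xi> X0 x \<longleftrightarrow>
    (\<exists>c. (\<forall>t\<in>{0..T}. \<forall>s. x t s = lift (\<lambda>j. c j t) s) \<and>
      (\<forall>t\<in>{0..T}. \<forall>j\<in>{1..N}. edge (\<lambda>k. c k t) j \<noteq> 0) \<and>
      (\<forall>j\<in>{1..N}. c j 0 = X0 (\<xi> j)) \<and>
      (\<forall>t\<in>{0..T}. \<forall>j\<in>{1..N}. (c j has_vector_derivative
         flow_field f (perim (\<lambda>k. c k t)) (\<lambda>k. c k t) j) (at t within {0..T})))"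
    (is "?L \<longleftrightarrow> (\<exists>c. ?A c \<and> ?B c \<and> ?C c \<and> ?D c)")
proof
  assume L: ?L
  note L = L[unfolded semidiscrete_solution_def]
  note L1 = conjunct1[OF L] and L2 = conjunct1[OF conjunct2[OF L]] and x0 = conjunct1[OF conjunct2[OF conjunct2[OF L]]]
    and weak = bspec[OF conjunct2[OF conjunct2[OF conjunct2[OF L]]]]
  note ne = bspec[OF bspec[OF L2]]
  from L1 obtain c where c: "\<forall>j\<in>{1..N}. c j differentiable_on {0..T}"
    and cx: "\<forall>t\<in>{0..T}. \<forall>s. x t s = (\<Sum>j=1..N. hat N \<xi> j s *\<^sub>R c j t)" by (elim exE conjE)
  have x: "x t s = lift (\<lambda>j. c j t) s" if "t \<in> {0..T}" for t s using bspec[OF cx that] by (simp only: lift_def)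
  have xl: "x t = lift (\<lambda>j. c j t)" if "t \<in> {0..T}" for t using x[OF that] by blast
  have B: "edge (\<lambda>k. c k t) j \<noteq> 0" if "t \<in> {0..T}" "j \<in> {1..N}" for t j
    using ne[OF that] unfolding xl[OF that(1)] lift_node[OF that(2)] lift_prev[OF that(2)] by (simp add: edge_def)
  have C: "c j 0 = X0 (\<xi> j)" if "j \<in> {1..N}" for j
  proof -
    have "c j 0 = x 0 (\<xi> j)" using xl[of 0] T lift_node[OF that, of "\<lambda>j. c j 0"] by simp
    also have "\<dots> = lift (\<lambda>j. X0 (\<xi> j)) (\<xi> j)" unfolding x0 by (simp add: interpolate_def lift_def)
    finally show ?thesis using lift_node[OF that] by simp
  qed
  have D: "(c j has_vector_derivative flow_field f (perim (\<lambda>k. c k t)) (\<lambda>k. c k t) j) (at t within {0..T})"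
    if t: "t \<in> {0..T}" and j: "j \<in> {1..N}" for t j
  proof -
    define c' where "c' i = vector_derivative (c i) (at t within {0..T})" for i
    have c': "(c i has_vector_derivative c' i) (at t within {0..T})" if "i \<in> {1..N}" for i
      using c that t unfolding c'_def differentiable_on_def by (auto simp: vector_derivative_works[symmetric])
    have dtl: "dt T x t = lift c'" by (rule dt_lift[OF T x c' t])
    have "\<forall>k\<in>{1..N}. residual (f (perim (\<lambda>k. c k t))) (\<lambda>k. c k t) c' k = 0" unfolding weak_form_iff[symmetric]
      using weak[OF t] unfolding dtl unfolding xl[OF t] polygon_length_lift .
    then have "residual (f (perim (\<lambda>k. c k t))) (\<lambda>k. c k t) c' j = 0" using j by blast
    then have "c' j = flow_field f (perim (\<lambda>k. c k t)) (\<lambda>k. c k t) j"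
      unfolding residual_zero_iff[OF j B[OF t j]] flow_field_def .
    then show ?thesis using c'[OF j] by simp
  qed
  show "\<exists>c. ?A c \<and> ?B c \<and> ?C c \<and> ?D c" using x B C D by blast
next
  assume "\<exists>c. ?A c \<and> ?B c \<and> ?C c \<and> ?D c"
  then obtain c where x: "\<And>t s. t \<in> {0..T} ==> x t s = lift (\<lambda>j. c j t) s"
    and B: "\<And>t j. t \<in> {0..T} ==> j \<in> {1..N} ==> edge (\<lambda>k. c k t) j \<noteq> 0"
    and C: "\<And>j. j \<in> {1..N} ==> c j 0 = X0 (\<xi> j)"
    and D: "\<And>t j. t \<in> {0..T} ==> j \<in> {1..N} ==> (c j has_vector_derivative
         flow_field f (perim (\<lambda>k. c k t)) (\<lambda>k. c k t) j) (at t within {0..T})" by blast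
  have xl: "x t = lift (\<lambda>j. c j t)" if "t \<in> {0..T}" for t using x[OF that] by blast
  show ?L unfolding semidiscrete_solution_def
  proof (intro conjI)
    show "\<exists>c. (\<forall>j\<in>{1..N}. c j differentiable_on {0..T}) \<and> (\<forall>t\<in>{0..T}. \<forall>s. x t s = (\<Sum>j = 1..N. hat N \<xi> j s *\<^sub>R c j t))"
    proof (intro exI[of _ c] conjI ballI allI)
      show "c j differentiable_on {0..T}" if "j \<in> {1..N}" for j
        unfolding differentiable_on_def by (intro ballI differentiableI_vector[OF D[OF _ that]])
      show "x t s = (\<Sum>j = 1..N. hat N \<xi> j s *\<^sub>R c j t)" if "t \<in> {0..T}" for t s using x[OF that] by (simp add: lift_def)
    qed
    show "\<forall>t\<in>{0..T}. \<forall>j\<in>{1..N}. x t (\<xi> (j - 1)) \<noteq> x t (\<xi> j)"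
    proof (intro ballI)
      fix t j assume t: "t \<in> {0..T}" and j: "j \<in> {1..N}"
      show "x t (\<xi> (j - 1)) \<noteq> x t (\<xi> j)"
        using B[OF t j] unfolding xl[OF t] lift_node[OF j] lift_prev[OF j] by (auto simp: edge_def)
    qed
    show "x 0 = interpolate N \<xi> X0"
    proof
      fix s
      have "x 0 s = lift (\<lambda>j. c j 0) s" using x[of 0] T by simp
      also have "\<dots> = interpolate N \<xi> X0 s" unfolding lift_def interpolate_def by (intro sum.cong refl) (simp add: C)
      finally show "x 0 s = interpolate N \<xi> X0 s" .
    qed
    show "\<forall>t\<in>{0..T}. \<forall>v\<in>V\<^sub>h N \<xi>.
        (LINT s|circle. speed (x t) s * (dt T x t s \<bullet> v s))
        + (LINT s|circle. tangent (x t) s \<bullet> dxi v s)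
        + (LINT s|circle. (mesh_fun N \<xi> s)^2 * speed (x t) s / 6 * (dxi (dt T x t) s \<bullet> dxi v s))
        + (LINT s|circle. f (polygon_length N \<xi> (x t)) * (perp (dxi (x t) s) \<bullet> v s)) = 0"
    proof
      fix t assume t: "t \<in> {0..T}"
      define c' where "c' j = flow_field f (perim (\<lambda>k. c k t)) (\<lambda>k. c k t) j" for j
      have c': "(c j has_vector_derivative c' j) (at t within {0..T})" if "j \<in> {1..N}" for j using D[OF t that] by (simp add: c'_def)
      have dtl: "dt T x t = lift c'" by (rule dt_lift[OF T x c' t])
      have "\<forall>k\<in>{1..N}. residual (f (perim (\<lambda>k. c k t))) (\<lambda>k. c k t) c' k = 0"
      proof
        fix k assume k: "k \<in> {1..N}"
        show "residual (f (perim (\<lambda>k. c k t))) (\<lambda>k. c k t) c' k = 0"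
          unfolding residual_zero_iff[OF k B[OF t k]] by (simp add: c'_def flow_field_def)
      qed
      then show "\<forall>v\<in>V\<^sub>h N \<xi>.
        (LINT s|circle. speed (x t) s * (dt T x t s \<bullet> v s))
        + (LINT s|circle. tangent (x t) s \<bullet> dxi v s)
        + (LINT s|circle. (mesh_fun N \<xi> s)^2 * speed (x t) s / 6 * (dxi (dt T x t) s \<bullet> dxi v s))
        + (LINT s|circle. f (polygon_length N \<xi> (x t)) * (perp (dxi (x t) s) \<bullet> v s)) = 0"
        unfolding weak_form_iff[symmetric] dtl unfolding xl[OF t] polygon_length_lift .
    qed
  qed
qed

end

section \<open>Weak derivatives on the circle\<close>

inductive_set generated_algebra :: "(real \<Rightarrow> real) set \<Rightarrow> (real \<Rightarrow> real) set" for A where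
  base: "u \<in> A ==> u \<in> generated_algebra A"
| const: "(\<lambda>_. c) \<in> generated_algebra A"
| add: "u \<in> generated_algebra A ==> v \<in> generated_algebra A ==> (\<lambda>s. u s + v s) \<in> generated_algebra A"
| mult: "u \<in> generated_algebra A ==> v \<in> generated_algebra A ==> (\<lambda>s. u s * v s) \<in> generated_algebra A"

text \<open>If every generator has its derivative in the algebra, the sum and product rules keep all
  iterated derivatives there. Smoothness is thereby reduced to differentiating each generator
  once.\<close>

lemma smooth_generated_algebra:
  assumes A: "\<And>u. u \<in> A ==> \<exists>u'\<in>generated_algebra A. \<forall>s. (u has_real_derivative u' s) (at s)"
    and u: "u \<in> generated_algebra A"
  shows "smooth u"
proof -
  have der: "\<exists>u'\<in>generated_algebra A. \<forall>s. (u has_real_derivative u' s) (at s)" if "u \<in> generated_algebra A" for u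
    using that
  proof induction
    case (base u)
    then show ?case by (rule A)
  next
    case (const c)
    show ?case by (rule bexI[of _ "\<lambda>_. 0"]) (auto intro: generated_algebra.const)
  next
    case (add u v)
    then obtain u' v' where "u' \<in> generated_algebra A" "v' \<in> generated_algebra A"
      "\<And>s. (u has_real_derivative u' s) (at s)" "\<And>s. (v has_real_derivative v' s) (at s)" by blast
    then show ?case by (intro bexI[of _ "\<lambda>s. u' s + v' s"]) (auto intro: generated_algebra.add DERIV_add)
  next
    case (mult u v)
    then obtain u' v' where uv: "u' \<in> generated_algebra A" "v' \<in> generated_algebra A"
      "\<And>s. (u has_real_derivative u' s) (at s)" "\<And>s. (v has_real_derivative v' s) (at s)" by blast
    have "((\<lambda>s. u s * v s) has_real_derivative u' s * v s + v' s * u s) (at s)" for s by (rule DERIV_mult[OF uv(3,4)])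
    then show ?case using uv mult
      by (intro bexI[of _ "\<lambda>s. u' s * v s + v' s * u s"]) (auto intro: generated_algebra.add generated_algebra.mult)
  qed
  have "(deriv ^^ n) u \<in> generated_algebra A" for n
  proof (induction n)
    case (Suc n)
    then obtain u' where "u' \<in> generated_algebra A" "\<And>s. ((deriv ^^ n) u has_real_derivative u' s) (at s)" using der by blast
    moreover from this have "deriv ((deriv ^^ n) u) = u'" by (auto simp: fun_eq_iff DERIV_imp_deriv)
    ultimately show ?case by simp
  qed (simp add: u)
  then have "\<exists>d. ((deriv ^^ n) u has_real_derivative d) (at s)" for n s using der by blast
  then show ?thesis unfolding smooth_def differentiable_on_def by (simp add: real_differentiable_def)
qed

lemma smooth_integral:
  assumes "smooth u" and "\<And>s. (U has_real_derivative u s) (at s)"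
  shows "smooth U"
  unfolding smooth_def
proof
  fix n
  have d: "deriv U = u" using assms(2) by (auto simp: fun_eq_iff DERIV_imp_deriv)
  show "(deriv ^^ n) U differentiable_on UNIV"
  proof (cases n)
    case 0
    then show ?thesis using assms(2) by (auto simp: differentiable_on_def real_differentiable_def)
  next
    case (Suc m)
    then have "(deriv ^^ n) U = (deriv ^^ m) u" by (simp only: funpow_Suc_right o_apply d)
    then show ?thesis using assms(1) by (simp add: smooth_def)
  qed
qed

text \<open>A smooth step whose derivative is the polynomial \<open>y * (1 - y)\<close> in the
  function itself, as membership in a generated algebra requires.\<close>

definition logistic :: "real \<Rightarrow> real" where
  "logistic y = 1 / (1 + exp (- y))"

lemma logistic_bounds: "0 \<le> logistic y" "logistic y \<le> 1"
proof -
  have "1 + exp (- y) \<ge> 1" by simp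
  then show "0 \<le> logistic y" "logistic y \<le> 1" unfolding logistic_def by (auto simp: divide_le_eq_1 add_pos_pos)
qed

lemma logistic_has_derivative: "(logistic has_real_derivative logistic y * (1 - logistic y)) (at y)"
proof -
  have p: "1 + exp (- y) \<noteq> 0" using add_pos_pos[OF zero_less_one exp_gt_zero[of "-y"]] by simp
  have "((\<lambda>y. 1 / (1 + exp (- y))) has_real_derivative exp (- y) / ((1 + exp (- y)) * (1 + exp (- y)))) (at y)"
    by (auto intro!: derivative_eq_intros simp: p)
  moreover have "exp (- y) / ((1 + exp (- y)) * (1 + exp (- y))) = logistic y * (1 - logistic y)"
    unfolding logistic_def using p by (simp add: field_simps)
  ultimately show ?thesis by (simp add: logistic_def[abs_def])
qed

lemma logistic_limit:
  assumes "y \<noteq> 0"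
  shows "(\<lambda>n. logistic (real n * y)) \<longlonglongrightarrow> (if y > 0 then 1 else 0)"
proof (cases "y > 0")
  case True
  have "(\<lambda>n. exp (- y) ^ n) \<longlonglongrightarrow> 0" using True by (intro LIMSEQ_realpow_zero) auto
  from tendsto_divide[OF tendsto_const[of 1] tendsto_add[OF tendsto_const[of 1] this]]
  have "(\<lambda>n. 1 / (1 + exp (- y) ^ n)) \<longlonglongrightarrow> 1" by simp
  then show ?thesis using True by (simp add: logistic_def flip: exp_of_nat_mult)
next
  case False
  then have y: "y < 0" using assms by simp
  have "(\<lambda>n. exp y ^ n) \<longlonglongrightarrow> 0" using y by (intro LIMSEQ_realpow_zero) auto
  then have lim: "(\<lambda>n. exp (real n * y)) \<longlonglongrightarrow> 0" by (simp add: exp_of_nat_mult)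
  have "logistic z \<le> exp z" for z
  proof -
    have "1 / (1 + exp (- z)) \<le> 1 / exp (- z)" by (intro divide_left_mono) (auto intro!: mult_pos_pos add_pos_pos)
    moreover have "1 / exp (- z) = exp z" by (simp add: exp_minus divide_inverse)
    ultimately show ?thesis by (simp only: logistic_def)
  qed
  then have up: "logistic (real n * y) \<le> exp (real n * y)" for n .
  have "(\<lambda>n. logistic (real n * y)) \<longlonglongrightarrow> 0"
    by (rule tendsto_sandwich[OF _ _ tendsto_const lim]) (simp_all add: up logistic_bounds)
  then show ?thesis using False by simp
qed

lemma smooth_periodic_logistic:
  "smooth (\<lambda>s. logistic (k * (cos (s - a) - c)))" "periodic (\<lambda>s. logistic (k * (cos (s - a) - c)))"
proof -
  let ?u = "\<lambda>s. logistic (k * (cos (s - a) - c))"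
  define A where "A = {sin, cos, ?u}"
  have b: "sin \<in> generated_algebra A" "cos \<in> generated_algebra A" "?u \<in> generated_algebra A"
    by (auto intro: generated_algebra.base simp: A_def)
  show "smooth ?u"
  proof (rule smooth_generated_algebra[OF _ b(3)])
    fix u assume "u \<in> A"
    then consider "u = sin" | "u = cos" | "u = ?u" by (auto simp: A_def)
    then show "\<exists>u'\<in>generated_algebra A. \<forall>s. (u has_real_derivative u' s) (at s)"
    proof cases
      case 1
      then show ?thesis using b(2) DERIV_sin by (intro bexI[of _ cos]) auto
    next
      case 2
      have "(\<lambda>s. (-1) * sin s) \<in> generated_algebra A" by (intro generated_algebra.mult generated_algebra.const b)
      then show ?thesis using 2 DERIV_cos by (intro bexI[of _ "\<lambda>s. (-1) * sin s"]) auto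
    next
      case 3
      let ?v = "\<lambda>s. ?u s * (1 + (-1) * ?u s) * ((- k) * (sin s * cos a + (- sin a) * cos s))"
      have "?v \<in> generated_algebra A" by (intro generated_algebra.mult generated_algebra.add generated_algebra.const b)
      moreover have "(?u has_real_derivative ?v s) (at s)" for s
      proof -
        have "((\<lambda>s. k * (cos (s - a) - c)) has_real_derivative k * (- sin (s - a))) (at s)" by (auto intro!: derivative_eq_intros)
        from DERIV_chain2[OF logistic_has_derivative this] show ?thesis by (rule DERIV_cong) (simp add: sin_diff algebra_simps)
      qed
      ultimately show ?thesis unfolding 3 by (intro bexI[of _ ?v] allI)
    qed
  qed
  show "periodic ?u" unfolding periodic_def
  proof
    fix s
    have "cos (s + 2 * pi - a) = cos (s - a)"
    proof -
      have "s + 2 * pi - a = (s - a) + 2 * pi" by simp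
      then show ?thesis by (simp only: cos_periodic)
    qed
    then show "?u (s + 2 * pi) = ?u s" by simp
  qed
qed

text \<open>The distance of \<open>s\<close> from the midpoint stays below \<open>2 * pi\<close>
  minus the half length. The cosine, though not monotone beyond \<open>pi\<close>, therefore still
  separates the arc from its complement after reflection at \<open>pi\<close>.\<close>

lemma arc_interval:
  assumes "0 \<le> p" "p \<le> q" "q \<le> 2 * pi" "0 < s" "s < 2 * pi" "s \<noteq> p" "s \<noteq> q"
  shows "s \<in> {p..q} ==> cos (s - (p + q) / 2) > cos ((q - p) / 2)"
    "s \<notin> {p..q} ==> cos (s - (p + q) / 2) < cos ((q - p) / 2)"
proof -
  define x where "x = \<bar>s - (p + q) / 2\<bar>"
  define w where "w = (q - p) / 2"
  have cx: "cos (s - (p + q) / 2) = cos x" by (simp add: x_def)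
  have w: "0 \<le> w" "w \<le> pi" using assms by (auto simp: w_def)
  show "cos (s - (p + q) / 2) > cos ((q - p) / 2)" if "s \<in> {p..q}"
  proof -
    have "x < w" "0 \<le> x" using that assms unfolding x_def w_def by (auto simp: abs_if field_simps)
    then show ?thesis unfolding cx w_def[symmetric] using w by (intro cos_monotone_0_pi) auto
  qed
  show "cos (s - (p + q) / 2) < cos ((q - p) / 2)" if "s \<notin> {p..q}"
  proof -
    have xw: "w < x" using that assms unfolding x_def w_def by (auto simp: abs_if field_simps)
    have x2: "x < 2 * pi - w" using that assms unfolding x_def w_def by (auto simp: abs_if field_simps)
    show ?thesis
    proof (cases "x \<le> pi")
      case True
      then show ?thesis unfolding cx w_def[symmetric] using w xw by (intro cos_monotone_0_pi) auto
    next
      case False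
      have "cos x = cos (2 * pi - x)" by (simp add: cos_diff)
      moreover have "cos (2 * pi - x) < cos w" using False w x2 by (intro cos_monotone_0_pi) auto
      ultimately show ?thesis unfolding cx w_def[symmetric] by simp
    qed
  qed
qed

text \<open>Henstock's lemma bounds, over a fine tagged division, the total deviation between the
  terms of the Riemann sum of \<open>u\<close> and the integrals over the pieces. Those integrals
  vanish, so the Riemann sums of \<open>norm (u s)\<close> tend to 0.\<close>

lemma zero_on_subintervals_imp_AE_zero:
  fixes u :: "real \<Rightarrow> 'a::euclidean_space"
  assumes ai: "u absolutely_integrable_on {a..b}"
    and z: "\<And>p q. a \<le> p ==> p \<le> q ==> q \<le> b ==> integral {p..q} u = 0"
  shows "AE s in lebesgue_on {a..b}. u s = 0"
proof -
  have int: "u integrable_on cbox a b" using set_lebesgue_integral_eq_integral(1)[OF ai] by simp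
  have "((\<lambda>s. norm (u s)) has_integral 0) (cbox a b)" unfolding has_integral
  proof (intro allI impI)
    fix e :: real assume "e > 0"
    then obtain g where g: "gauge g" "\<And>p. p tagged_partial_division_of (cbox a b) ==> g fine p ==>
        sum (\<lambda>(x,k). norm (Henstock_Kurzweil_Integration.content k *\<^sub>R u x - integral k u)) p < e"
      using Henstock_lemma[OF int] by blast
    show "\<exists>g. gauge g \<and> (\<forall>D. D tagged_division_of cbox a b \<and> g fine D \<longrightarrow>
        norm ((\<Sum>(x, k)\<in>D. Henstock_Kurzweil_Integration.content k *\<^sub>R norm (u x)) - 0) < e)"
    proof (intro exI conjI allI impI)
      fix D assume D: "D tagged_division_of cbox a b \<and> g fine D"
      have "(\<Sum>(x, k)\<in>D. Henstock_Kurzweil_Integration.content k *\<^sub>R norm (u x)) = sum (\<lambda>(x,k). norm (Henstock_Kurzweil_Integration.content k *\<^sub>R u x - integral k u)) D"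
      proof (intro sum.cong refl, clarify)
        fix x k assume xk: "(x, k) \<in> D"
        from D xk obtain p q where k: "k = cbox p q" using tagged_division_ofD(4) by blast
        have "k \<subseteq> cbox a b" "x \<in> k" using D xk tagged_division_ofD by blast+
        then have "a \<le> p" "p \<le> q" "q \<le> b" unfolding k by auto
        then have "integral k u = 0" unfolding k using z by simp
        then show "Henstock_Kurzweil_Integration.content k *\<^sub>R norm (u x) = norm (Henstock_Kurzweil_Integration.content k *\<^sub>R u x - integral k u)"
          by simp
      qed
      also have "\<dots> < e" using D by (intro g(2)) (auto simp: tagged_division_of_def)
      finally have "(\<Sum>(x, k)\<in>D. Henstock_Kurzweil_Integration.content k *\<^sub>R norm (u x)) < e" .
      moreover have "(\<Sum>(x, k)\<in>D. Henstock_Kurzweil_Integration.content k *\<^sub>R norm (u x)) \<ge> 0" by (intro sum_nonneg) (auto simp: case_prod_beta)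
      ultimately show "norm ((\<Sum>(x, k)\<in>D. Henstock_Kurzweil_Integration.content k *\<^sub>R norm (u x)) - 0) < e" by simp
    qed (rule g(1))
  qed
  then have I: "integral {a..b} (\<lambda>s. norm (u s)) = 0" by (simp add: integral_unique)
  have "(\<lambda>s. norm (u s)) absolutely_integrable_on {a..b}" using absolutely_integrable_norm[OF ai] by (simp add: o_def)
  then have i: "integrable (lebesgue_on {a..b}) (\<lambda>s. norm (u s))" by (simp add: integrable_restrict_space set_integrable_def)
  then have "(LINT s|lebesgue_on {a..b}. norm (u s)) = 0" using I by (simp add: lebesgue_integral_eq_integral)
  then have "AE s in lebesgue_on {a..b}. norm (u s) = 0" using integral_nonneg_eq_0_iff_AE[OF i] by simp
  then show ?thesis by simp
qed

lemma continuous_measurable_circle: "continuous_on UNIV \<phi> ==> \<phi> \<in> borel_measurable circle"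
  for \<phi> :: "real \<Rightarrow> 'a::topological_space"
  using borel_measurable_continuous_onI[of \<phi>] by (auto intro!: measurable_restrict_space1 measurable_completion)

text \<open>The logistic functions of \<open>n (cos (s - a) - c)\<close> are smooth periodic test functions converging
  to the indicator of an arc.\<close>

lemma fundamental_lemma_circle:
  fixes u :: "real \<Rightarrow> real^2"
  assumes u: "integrable circle u"
    and z: "\<And>\<phi>. smooth \<phi> ==> periodic \<phi> ==> (LINT s|circle. \<phi> s *\<^sub>R u s) = 0"
  shows "AE s in circle. u s = 0"
proof (rule zero_on_subintervals_imp_AE_zero)
  show ai: "u absolutely_integrable_on \<I>" using u by (simp add: integrable_circle_iff)
  fix p q :: real assume pq: "0 \<le> p" "p \<le> q" "q \<le> 2 * pi"
  define a where "a = (p + q) / 2"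
  define c where "c = cos ((q - p) / 2)"
  have ind: "indicator {p..q} \<in> borel_measurable circle" for p q :: real
    by (intro measurable_restrict_space1 measurable_completion) simp
  have lc: "continuous_on UNIV (\<lambda>s. logistic (k * (cos (s - a) - c)))" for k
  proof -
    have "1 + exp (- y) \<noteq> 0" for y :: real using add_pos_pos[OF zero_less_one exp_gt_zero[of "-y"]] by simp
    then show ?thesis unfolding logistic_def by (intro continuous_intros) auto
  qed
  have "(\<lambda>n. LINT s|circle. logistic (real n * (cos (s - a) - c)) *\<^sub>R u s) \<longlonglongrightarrow> (LINT s|circle. indicator {p..q} s *\<^sub>R u s)"
  proof (rule integral_dominated_convergence[where w = "\<lambda>s. norm (u s)"])
    show "(\<lambda>s. indicator {p..q} s *\<^sub>R u s) \<in> borel_measurable circle"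
      using u ind[of p q] by (intro borel_measurable_scaleR) auto
    show "(\<lambda>s. logistic (real n * (cos (s - a) - c)) *\<^sub>R u s) \<in> borel_measurable circle" for n
      by (intro borel_measurable_scaleR continuous_measurable_circle[OF lc] borel_measurable_integrable[OF u])
    show "integrable circle (\<lambda>s. norm (u s))" using u by simp
    have ne: "AE s in circle. s \<notin> {p, q, 0, 2 * pi}"
      by (rule AE_I'[of "\<I> \<inter> {p, q, 0, 2 * pi}"]) (auto simp: null_sets_restrict_space negligible_iff_null_sets[symmetric])
    show "AE s in circle. (\<lambda>n. logistic (real n * (cos (s - a) - c)) *\<^sub>R u s) \<longlonglongrightarrow> indicator {p..q} s *\<^sub>R u s"
      using ne
    proof (rule AE_mp, intro AE_I2 impI)
      fix s assume s: "s \<in> space circle" "s \<notin> {p, q, 0, 2 * pi}"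
      then have s': "0 < s" "s < 2 * pi" "s \<noteq> p" "s \<noteq> q" by auto
      note arc = arc_interval[OF pq s', folded a_def c_def]
      have ne0: "cos (s - a) - c \<noteq> 0" and ie: "(if cos (s - a) - c > 0 then 1 else 0) = (indicator {p..q} s :: real)"
        using arc by (cases "s \<in> {p..q}"; simp add: indicator_def)+
      then have "(\<lambda>n. logistic (real n * (cos (s - a) - c))) \<longlonglongrightarrow> indicator {p..q} s"
        using logistic_limit[OF ne0] by (simp only: ie)
      then show "(\<lambda>n. logistic (real n * (cos (s - a) - c)) *\<^sub>R u s) \<longlonglongrightarrow> indicator {p..q} s *\<^sub>R u s"
        by (intro tendsto_scaleR tendsto_const)
    qed
    show "AE s in circle. norm (logistic (real n * (cos (s - a) - c)) *\<^sub>R u s) \<le> norm (u s)" for n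
      using logistic_bounds by (intro AE_I2) (simp add: mult_left_le_one_le)
  qed
  moreover have "(LINT s|circle. logistic (real n * (cos (s - a) - c)) *\<^sub>R u s) = 0" for n by (rule z[OF smooth_periodic_logistic])
  ultimately have "(\<lambda>n. 0) \<longlonglongrightarrow> (LINT s|circle. indicator {p..q} s *\<^sub>R u s)" by simp
  then have "(LINT s|circle. indicator {p..q} s *\<^sub>R u s) = 0" by (rule LIMSEQ_unique[OF _ tendsto_const])
  moreover have "(LINT s|circle. indicator {p..q} s *\<^sub>R u s) = integral {p..q} u"
  proof -
    have sub: "{p..q} \<subseteq> \<I>" using pq by auto
    have "(\<lambda>s. indicator {p..q} s *\<^sub>R u s) absolutely_integrable_on \<I>" unfolding integrable_circle_iff[symmetric]
      by (rule Bochner_Integration.integrable_bound[OF u borel_measurable_scaleR[OF ind borel_measurable_integrable[OF u]]])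
        (auto simp: indicator_def)
    then have "(LINT s|circle. indicator {p..q} s *\<^sub>R u s) = integral \<I> (\<lambda>s. indicator {p..q} s *\<^sub>R u s)"
      by (rule LINT_circle_eq)
    also have "\<dots> = integral \<I> (\<lambda>s. if s \<in> {p..q} then u s else 0)"
      by (intro arg_cong[where f = "integral \<I>"]) (auto simp: fun_eq_iff)
    also have "\<dots> = integral {p..q} u" using sub by (simp only: Henstock_Kurzweil_Integration.integral_restrict_Int Int_absorb2)
    finally show ?thesis .
  qed
  ultimately show "integral {p..q} u = 0" by simp
qed

section \<open>Square integrable functions and integration by parts on the circle\<close>

lemma AE_circle_interior: "AE s in circle. s \<in> {0<..<2 * pi}"
  by (rule AE_I'[of "\<I> \<inter> {0, 2 * pi}"]) (auto simp: null_sets_restrict_space negligible_iff_null_sets[symmetric])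

lemma finite_measure_circle: "finite_measure circle"
  by (rule finite_measure_lebesgue_on) auto

lemma smooth_deriv: "smooth \<phi> ==> smooth (deriv \<phi>)"
  unfolding smooth_def
proof
  fix n assume "\<forall>n. (deriv ^^ n) \<phi> differentiable_on UNIV"
  then have "(deriv ^^ Suc n) \<phi> differentiable_on UNIV" by blast
  then show "(deriv ^^ n) (deriv \<phi>) differentiable_on UNIV" by (simp only: funpow_Suc_right o_apply)
qed

lemma smooth_has_deriv: "smooth \<phi> ==> (\<phi> has_real_derivative deriv \<phi> s) (at s)"
proof -
  assume "smooth \<phi>"
  then have "(deriv ^^ 0) \<phi> differentiable_on UNIV" unfolding smooth_def by blast
  then have "\<exists>D. (\<phi> has_real_derivative D) (at s)" by (simp add: differentiable_on_def real_differentiable_def)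
  then show ?thesis by (auto simp: DERIV_deriv_iff_has_field_derivative)
qed

lemma smooth_continuous: "smooth \<phi> ==> continuous_on UNIV \<phi>"
  using smooth_has_deriv DERIV_isCont continuous_at_imp_continuous_on by blast

lemma integrable_bounded_scaleR_circle:
  fixes u :: "real \<Rightarrow> 'a::euclidean_space"
  assumes u: "integrable circle u" and \<phi>: "continuous_on UNIV \<phi>"
  shows "integrable circle (\<lambda>s. \<phi> s *\<^sub>R u s)"
proof -
  obtain B where B: "\<forall>s\<in>\<I>. \<bar>\<phi> s\<bar> \<le> B"
    using compact_continuous_image[OF continuous_on_subset[OF \<phi> subset_UNIV] compact_Icc, of 0 "2 * pi"]
    by (auto dest!: compact_imp_bounded simp: bounded_iff)
  show ?thesis
  proof (rule Bochner_Integration.integrable_bound)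
    show "integrable circle (\<lambda>s. B *\<^sub>R norm (u s))" using u by simp
    show "(\<lambda>s. \<phi> s *\<^sub>R u s) \<in> borel_measurable circle"
      by (intro borel_measurable_scaleR continuous_measurable_circle[OF \<phi>] borel_measurable_integrable[OF u])
    show "AE s in circle. norm (\<phi> s *\<^sub>R u s) \<le> norm (B *\<^sub>R norm (u s))"
    proof (rule AE_I2)
      fix s assume "s \<in> space circle"
      then have "\<bar>\<phi> s\<bar> \<le> \<bar>B\<bar>" using bspec[OF B, of s] by simp
      then show "norm (\<phi> s *\<^sub>R u s) \<le> norm (B *\<^sub>R norm (u s))" by (simp add: abs_mult mult_right_mono)
    qed
  qed
qed

lemma L2_integrable: "L2 u ==> integrable circle u"
proof -
  assume u: "L2 u"
  interpret finite_measure circle by (rule finite_measure_circle)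
  show ?thesis
  proof (rule Bochner_Integration.integrable_bound)
    show "integrable circle (\<lambda>s. 1 + (norm (u s))^2)" using u by (simp add: L2_def)
    show "AE s in circle. norm (u s) \<le> norm (1 + (norm (u s))^2)"
    proof (rule AE_I2)
      fix s
      have "0 \<le> (norm (u s) - 1)^2" by simp
      then have "2 * norm (u s) \<le> 1 + (norm (u s))^2" by (simp add: power2_eq_square algebra_simps)
      then have "norm (u s) \<le> 1 + (norm (u s))^2" using norm_ge_zero[of "u s"] zero_le_power2[of "norm (u s)"] by linarith
      then show "norm (u s) \<le> norm (1 + (norm (u s))^2)" by simp
    qed
  qed (use u in \<open>simp add: L2_def\<close>)
qed

lemma L2_norm_squared: "(L2_norm u)^2 = (LINT s|circle. (norm (u s))^2)"
  unfolding L2_norm_def by (simp add: integral_nonneg_AE)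

lemma L2_norm_nonneg: "0 \<le> L2_norm u"
  by (simp add: L2_norm_def integral_nonneg_AE)

lemma L2_diff: assumes "L2 u" "L2 v" shows "L2 (\<lambda>s. u s - v s)"
  unfolding L2_def
proof
  show m [measurable]: "(\<lambda>s. u s - v s) \<in> borel_measurable circle" using assms unfolding L2_def by (intro borel_measurable_diff) auto
  show "integrable circle (\<lambda>s. (norm (u s - v s))^2)"
  proof (rule Bochner_Integration.integrable_bound)
    show "integrable circle (\<lambda>s. 2 * ((norm (u s))^2 + (norm (v s))^2))" using assms by (simp add: L2_def)
    show "(\<lambda>s. (norm (u s - v s))^2) \<in> borel_measurable circle" by measurable
    show "AE s in circle. norm ((norm (u s - v s))^2) \<le> norm (2 * ((norm (u s))^2 + (norm (v s))^2))"
    proof (rule AE_I2)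
      fix s
      have "(norm (u s - v s))^2 \<le> (norm (u s) + norm (v s))^2" by (intro power_mono norm_triangle_ineq4) simp
      also have "\<dots> \<le> 2 * ((norm (u s))^2 + (norm (v s))^2)" by (rule square_add2_le)
      finally show "norm ((norm (u s - v s))^2) \<le> norm (2 * ((norm (u s))^2 + (norm (v s))^2))" by simp
    qed
  qed
qed

lemma L2_continuous: "continuous_on UNIV u ==> L2 u" for u :: "real \<Rightarrow> real^2"
proof -
  assume u: "continuous_on UNIV u"
  have "(\<lambda>s. (norm (u s))^2) absolutely_integrable_on \<I>"
    by (intro absolutely_integrable_continuous_real continuous_intros continuous_on_subset[OF u]) auto
  then show ?thesis unfolding L2_def integrable_circle_iff using continuous_measurable_circle[OF u] by blast
qed

text \<open>Fubini's theorem on the triangle \<open>r \<le> s\<close>: only \<open>\<phi>\<close> is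
  differentiated, whereas the primitive of the merely integrable \<open>g\<close> is treated as an
  iterated integral.\<close>

lemma integral_by_parts_circle:
  fixes g :: "real \<Rightarrow> real^2"
  assumes g: "integrable circle g" and \<phi>: "\<And>s. (\<phi> has_real_derivative \<phi>' s) (at s)" and c: "continuous_on UNIV \<phi>'"
  shows "(LINT s|circle. \<phi>' s *\<^sub>R integral {0..s} g) = \<phi> (2 * pi) *\<^sub>R integral \<I> g - (LINT s|circle. \<phi> s *\<^sub>R g s)"
proof -
  interpret finite_measure circle by (rule finite_measure_circle)
  interpret P: pair_sigma_finite circle circle by (simp add: pair_sigma_finite_def sigma_finite_measure_axioms)
  have ai: "g absolutely_integrable_on \<I>" using g by (simp add: integrable_circle_iff)
  have [measurable]: "g \<in> borel_measurable circle" using g by simp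
  have [measurable]: "\<phi>' \<in> borel_measurable circle" by (rule continuous_measurable_circle[OF c])
  have [measurable]: "(\<lambda>s. s) \<in> borel_measurable circle" by (rule continuous_measurable_circle) (rule continuous_on_id)
  have f1: "integrable (circle \<Otimes>\<^sub>M circle) (\<lambda>p. \<phi>' (fst p) *\<^sub>R g (snd p))"
  proof (rule P.Fubini_integrable)
    show "(\<lambda>p. \<phi>' (fst p) *\<^sub>R g (snd p)) \<in> borel_measurable (circle \<Otimes>\<^sub>M circle)" by measurable
    have "integrable circle \<phi>'"
      unfolding integrable_circle_iff by (intro absolutely_integrable_continuous_real continuous_on_subset[OF c]) auto
    then show "integrable circle (\<lambda>x. LINT y|circle. norm (\<phi>' (fst (x, y)) *\<^sub>R g (snd (x, y))))" by simp
    show "AE x in circle. integrable circle (\<lambda>y. \<phi>' (fst (x, y)) *\<^sub>R g (snd (x, y)))" using g by simp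
  qed
  define f where "f s r = (if r \<le> s then \<phi>' s *\<^sub>R g r else 0)" for s r :: real
  have f2: "integrable (circle \<Otimes>\<^sub>M circle) (case_prod f)"
  proof (rule Bochner_Integration.integrable_bound[OF f1])
    show "case_prod f \<in> borel_measurable (circle \<Otimes>\<^sub>M circle)" unfolding f_def by measurable
    show "AE p in circle \<Otimes>\<^sub>M circle. norm (case_prod f p) \<le> norm (\<phi>' (fst p) *\<^sub>R g (snd p))"
      by (intro AE_I2) (auto simp: f_def split: prod.split)
  qed
  have i1: "(LINT r|circle. f s r) = \<phi>' s *\<^sub>R integral {0..s} g" if s: "s \<in> space circle" for s
  proof -
    have sub: "{0..s} \<subseteq> \<I>" using s by auto
    have "(LINT r|circle. f s r) = (LINT r|circle. \<phi>' s *\<^sub>R (if r \<in> {0..s} then g r else 0))"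
      by (rule Bochner_Integration.integral_cong[OF refl]) (auto simp: f_def)
    also have "\<dots> = \<phi>' s *\<^sub>R (LINT r|circle. (if r \<in> {0..s} then g r else 0))" by simp
    also have "(LINT r|circle. (if r \<in> {0..s} then g r else 0)) = integral\<^sup>L (lebesgue_on {0..s}) g"
      using sub by (intro Lebesgue_Measure.integral_restrict) auto
    also have "\<dots> = integral {0..s} g"
    proof (rule lebesgue_integral_eq_integral)
      have "g absolutely_integrable_on {0..s}" by (rule absolutely_integrable_on_subinterval[OF ai]) (use sub in auto)
      then show "integrable (lebesgue_on {0..s}) g" by (simp add: integrable_restrict_space set_integrable_def)
    qed simp
    finally show ?thesis .
  qed
  have i2: "(LINT s|circle. f s r) = (\<phi> (2 * pi) - \<phi> r) *\<^sub>R g r" if r: "r \<in> space circle" for r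
  proof -
    have sub: "{r..2 * pi} \<subseteq> \<I>" using r by auto
    have "(LINT s|circle. f s r) = (LINT s|circle. (if s \<in> {r..2 * pi} then \<phi>' s else 0) *\<^sub>R g r)"
      by (rule Bochner_Integration.integral_cong[OF refl]) (auto simp: f_def)
    also have "\<dots> = (LINT s|circle. (if s \<in> {r..2 * pi} then \<phi>' s else 0)) *\<^sub>R g r"
    proof (rule integral_scaleR_left)
      show "integrable circle (\<lambda>s. if s \<in> {r..2 * pi} then \<phi>' s else 0)"
      proof (rule Bochner_Integration.integrable_bound)
        show "integrable circle \<phi>'"
          unfolding integrable_circle_iff by (intro absolutely_integrable_continuous_real continuous_on_subset[OF c]) auto
        show "(\<lambda>s. if s \<in> {r..2 * pi} then \<phi>' s else 0) \<in> borel_measurable circle" by measurable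
      qed auto
    qed
    also have "(LINT s|circle. (if s \<in> {r..2 * pi} then \<phi>' s else 0)) = integral\<^sup>L (lebesgue_on {r..2 * pi}) \<phi>'"
      using sub by (intro Lebesgue_Measure.integral_restrict) auto
    also have "\<dots> = integral {r..2 * pi} \<phi>'"
      by (intro lebesgue_integral_eq_integral continuous_imp_integrable_real continuous_on_subset[OF c]) auto
    also have "\<dots> = \<phi> (2 * pi) - \<phi> r" using r \<phi> by (intro integral_unique fundamental_theorem_of_calculus)
        (auto simp: has_real_derivative_iff_has_vector_derivative[symmetric] intro: has_field_derivative_at_within)
    finally show ?thesis .
  qed
  have \<phi>c: "continuous_on UNIV \<phi>" using \<phi> DERIV_isCont continuous_at_imp_continuous_on by blast
  have "(LINT s|circle. \<phi>' s *\<^sub>R integral {0..s} g) = (LINT s|circle. LINT r|circle. f s r)"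
    by (rule Bochner_Integration.integral_cong[OF refl]) (simp add: i1)
  also have "\<dots> = (LINT r|circle. LINT s|circle. f s r)" by (rule P.Fubini_integral[OF f2, symmetric])
  also have "\<dots> = (LINT r|circle. (\<phi> (2 * pi) - \<phi> r) *\<^sub>R g r)"
    by (rule Bochner_Integration.integral_cong[OF refl]) (simp add: i2)
  also have "\<dots> = (LINT r|circle. \<phi> (2 * pi) *\<^sub>R g r - \<phi> r *\<^sub>R g r)" by (simp add: scaleR_diff_left)
  also have "\<dots> = (LINT r|circle. \<phi> (2 * pi) *\<^sub>R g r) - (LINT r|circle. \<phi> r *\<^sub>R g r)"
    by (rule Bochner_Integration.integral_diff) (use g integrable_bounded_scaleR_circle[OF g \<phi>c] in auto)
  also have "(LINT r|circle. \<phi> (2 * pi) *\<^sub>R g r) = \<phi> (2 * pi) *\<^sub>R integral \<I> g"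
    by (simp add: LINT_circle_eq[OF ai])
  finally show ?thesis .
qed

lemma smooth_const: "smooth (\<lambda>_. c)"
  by (rule smooth_generated_algebra[of "{}"]) (auto intro: generated_algebra.const)

lemma smooth_shift:
  assumes "smooth \<psi>" shows "smooth (\<lambda>s. \<psi> s - m)"
  unfolding smooth_def
proof
  fix n
  have d: "deriv (\<lambda>s. \<psi> s - m) = deriv \<psi>"
  proof
    fix s
    have "((\<lambda>s. \<psi> s - m) has_real_derivative deriv \<psi> s - 0) (at s)"
      by (intro DERIV_diff smooth_has_deriv assms DERIV_const)
    then show "deriv (\<lambda>s. \<psi> s - m) s = deriv \<psi> s" by (simp add: DERIV_imp_deriv)
  qed
  show "(deriv ^^ n) (\<lambda>s. \<psi> s - m) differentiable_on UNIV"
  proof (cases n)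
    case 0
    have "\<psi> differentiable_on UNIV" using assms[unfolded smooth_def, rule_format, of 0] by simp
    then show ?thesis using 0 by (simp add: differentiable_on_diff)
  next
    case (Suc k)
    then have "(deriv ^^ n) (\<lambda>s. \<psi> s - m) = (deriv ^^ n) \<psi>" by (simp only: funpow_Suc_right o_apply d)
    then show ?thesis using assms by (simp add: smooth_def)
  qed
qed

lemma antiderivative_real:
  assumes "continuous_on UNIV (\<psi> :: real \<Rightarrow> real)"
  shows "\<exists>\<Phi>. \<forall>s. (\<Phi> has_real_derivative \<psi> s) (at s)"
proof -
  have "\<exists>F. \<forall>x. - \<infinity> < ereal x \<longrightarrow> ereal x < \<infinity> \<longrightarrow> (F has_vector_derivative \<psi> x) (at x)"
    using assms by (intro einterval_antiderivative) (auto simp: continuous_on_eq_continuous_at)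
  then show ?thesis by (auto simp: has_real_derivative_iff_has_vector_derivative)
qed

text \<open>The increment of a primitive over one period is constant and equals the integral of
  \<open>\<psi>\<close>, so mean zero is what makes it periodic.\<close>

lemma periodic_smooth_primitive:
  assumes \<psi>: "smooth \<psi>" "periodic \<psi>" and z: "integral \<I> \<psi> = 0"
  obtains \<Phi> where "smooth \<Phi>" "periodic \<Phi>" "deriv \<Phi> = \<psi>"
proof -
  obtain \<Phi> where \<Phi>: "\<And>s. (\<Phi> has_real_derivative \<psi> s) (at s)"
    using antiderivative_real[OF smooth_continuous[OF \<psi>(1)]] by blast
  have "\<Phi> (s + 2 * pi) - \<Phi> s = \<Phi> (0 + 2 * pi) - \<Phi> 0" for s
  proof (rule DERIV_isconst_all[where f = "\<lambda>s. \<Phi> (s + 2 * pi) - \<Phi> s"])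
    show "\<forall>x. ((\<lambda>s. \<Phi> (s + 2 * pi) - \<Phi> s) has_real_derivative 0) (at x)"
    proof
      fix x
      have "((\<lambda>s. \<Phi> (s + 2 * pi)) has_real_derivative \<psi> (x + 2 * pi)) (at x)"
        using \<Phi>[of "x + 2 * pi"] by (simp add: DERIV_shift)
      from DERIV_diff[OF this \<Phi>[of x]] show "((\<lambda>s. \<Phi> (s + 2 * pi) - \<Phi> s) has_real_derivative 0) (at x)"
        using \<psi>(2) by (simp add: periodic_def)
    qed
  qed
  moreover have "\<Phi> (2 * pi) - \<Phi> 0 = integral \<I> \<psi>"
    using \<Phi> by (intro integral_unique[symmetric] fundamental_theorem_of_calculus)
      (auto simp: has_real_derivative_iff_has_vector_derivative[symmetric] intro: has_field_derivative_at_within)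
  ultimately have "periodic \<Phi>" using z by (simp add: periodic_def)
  moreover have "deriv \<Phi> = \<psi>" using \<Phi> by (auto simp: fun_eq_iff DERIV_imp_deriv)
  ultimately show ?thesis using that smooth_integral[OF \<psi>(1) \<Phi>] by blast
qed

lemma indefinite_integral_continuous_circle:
  fixes g :: "real \<Rightarrow> real^2"
  assumes "integrable circle g"
  shows "continuous_on \<I> (\<lambda>s. integral {0..s} g)"
  using assms set_lebesgue_integral_eq_integral(1) unfolding integrable_circle_iff by (intro indefinite_integral_continuous_1) blast

lemma integrable_circle_continuous: "continuous_on \<I> u ==> integrable circle u" for u :: "real \<Rightarrow> 'a::euclidean_space"
  unfolding integrable_circle_iff by (rule absolutely_integrable_continuous_real)

text \<open>The lemma of du Bois-Reymond: \<open>u\<close> minus the primitive of \<open>g\<close>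
  is orthogonal to all derivatives of test functions, that is, to all test functions of mean zero,
  and is therefore constant. The test function 1 shows that \<open>g\<close> has integral 0, as
  periodicity of the primitive demands.\<close>

lemma weak_deriv_imp_primitive:
  assumes u: "integrable circle u" and g: "integrable circle g" and w: "is_weak_deriv u g"
  obtains c where "AE s in circle. u s = c + integral {0..s} g" "integral \<I> g = 0"
proof -
  have ai: "g absolutely_integrable_on \<I>" using g by (simp add: integrable_circle_iff)
  have "(LINT s|circle. deriv (\<lambda>_. 1) s *\<^sub>R u s) = - (LINT s|circle. 1 *\<^sub>R g s)"
    using w[unfolded is_weak_deriv_def, rule_format, of "\<lambda>_. 1"] smooth_const by (simp add: periodic_def)
  moreover have "deriv (\<lambda>_. 1) s = (0::real)" for s :: real by (rule DERIV_imp_deriv) simp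
  ultimately have z: "integral \<I> g = 0" by (simp add: LINT_circle_eq[OF ai])
  define G where "G s = integral {0..s} g" for s
  have Gi: "integrable circle G" unfolding G_def by (rule integrable_circle_continuous[OF indefinite_integral_continuous_circle[OF g]])
  define v where "v s = u s - G s" for s
  have vi: "integrable circle v" unfolding v_def by (intro Bochner_Integration.integrable_diff u Gi)
  have van: "(LINT s|circle. deriv \<phi> s *\<^sub>R v s) = 0" if \<phi>: "smooth \<phi>" "periodic \<phi>" for \<phi>
  proof -
    note dc = smooth_continuous[OF smooth_deriv[OF \<phi>(1)]]
    have "(LINT s|circle. deriv \<phi> s *\<^sub>R v s) = (LINT s|circle. deriv \<phi> s *\<^sub>R u s - deriv \<phi> s *\<^sub>R G s)"
      by (simp add: v_def scaleR_diff_right)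
    also have "\<dots> = (LINT s|circle. deriv \<phi> s *\<^sub>R u s) - (LINT s|circle. deriv \<phi> s *\<^sub>R G s)"
      by (rule Bochner_Integration.integral_diff) (intro integrable_bounded_scaleR_circle u Gi dc)+
    also have "(LINT s|circle. deriv \<phi> s *\<^sub>R u s) = - (LINT s|circle. \<phi> s *\<^sub>R g s)"
      using w \<phi> by (simp add: is_weak_deriv_def)
    also have "(LINT s|circle. deriv \<phi> s *\<^sub>R G s) = - (LINT s|circle. \<phi> s *\<^sub>R g s)"
      unfolding G_def integral_by_parts_circle[OF g smooth_has_deriv[OF \<phi>(1)] dc] z by simp
    finally show ?thesis by simp
  qed
  \<comment> \<open>The mean of \<open>v\<close>, the only candidate for the constant.\<close>
  define c where "c = (1 / (2 * pi)) *\<^sub>R (LINT s|circle. v s)"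
  have "AE s in circle. v s - c = 0"
  proof (rule fundamental_lemma_circle)
    show ci: "integrable circle (\<lambda>s. v s - c)"
      by (intro Bochner_Integration.integrable_diff vi integrable_circle_continuous continuous_intros)
    fix \<psi> :: "real \<Rightarrow> real" assume \<psi>: "smooth \<psi>" "periodic \<psi>"
    note pc = smooth_continuous[OF \<psi>(1)]
    \<comment> \<open>After subtraction of its mean, \<open>\<psi>\<close> is the derivative of a
      periodic test function, so \<open>van\<close> applies to it.\<close>
    define m where "m = integral \<I> \<psi> / (2 * pi)"
    have pint: "\<psi> integrable_on \<I>" by (intro integrable_continuous_real continuous_on_subset[OF pc]) auto
    have "integral \<I> (\<lambda>s. \<psi> s - m) = integral \<I> \<psi> - integral \<I> (\<lambda>s. m)"
      by (rule Henstock_Kurzweil_Integration.integral_diff) (use pint in auto)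
    then have "integral \<I> (\<lambda>s. \<psi> s - m) = 0" by (simp add: m_def)
    then obtain \<Phi> where \<Phi>: "smooth \<Phi>" "periodic \<Phi>" "deriv \<Phi> = (\<lambda>s. \<psi> s - m)"
      using periodic_smooth_primitive[OF smooth_shift[OF \<psi>(1), of m]] \<psi>(2) by (auto simp: periodic_def)
    have pv: "integrable circle (\<lambda>s. \<psi> s *\<^sub>R v s)" by (rule integrable_bounded_scaleR_circle[OF vi pc])
    have "0 = (LINT s|circle. (\<psi> s - m) *\<^sub>R v s)" using van[OF \<Phi>(1,2)] \<Phi>(3) by simp
    also have "\<dots> = (LINT s|circle. \<psi> s *\<^sub>R v s - m *\<^sub>R v s)" by (simp add: scaleR_diff_left)
    also have "\<dots> = (LINT s|circle. \<psi> s *\<^sub>R v s) - m *\<^sub>R (LINT s|circle. v s)"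
      using vi pv by (subst Bochner_Integration.integral_diff) auto
    finally have 1: "(LINT s|circle. \<psi> s *\<^sub>R v s) = m *\<^sub>R (LINT s|circle. v s)" by simp
    have "(LINT s|circle. \<psi> s *\<^sub>R (v s - c)) = (LINT s|circle. \<psi> s *\<^sub>R v s - \<psi> s *\<^sub>R c)" by (simp add: scaleR_diff_right)
    also have "\<dots> = (LINT s|circle. \<psi> s *\<^sub>R v s) - (LINT s|circle. \<psi> s *\<^sub>R c)"
      by (rule Bochner_Integration.integral_diff[OF pv])
        (intro integrable_circle_continuous continuous_intros continuous_on_subset[OF pc], simp)
    also have "(LINT s|circle. \<psi> s *\<^sub>R c) = (LINT s|circle. \<psi> s) *\<^sub>R c"
      by (rule integral_scaleR_left) (intro integrable_circle_continuous continuous_on_subset[OF pc], simp)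
    also have "(LINT s|circle. \<psi> s) = 2 * pi * m"
      unfolding m_def by (subst LINT_circle_eq) (auto intro!: absolutely_integrable_continuous_real continuous_on_subset[OF pc])
    finally show "(LINT s|circle. \<psi> s *\<^sub>R (v s - c)) = 0" unfolding 1 by (simp add: c_def)
  qed
  then have "AE s in circle. u s = c + integral {0..s} g" by (rule AE_mp) (intro AE_I2 impI, simp add: v_def G_def algebra_simps)
  then show ?thesis using that z by blast
qed

lemma primitive_imp_weak_deriv:
  assumes g: "integrable circle g" and u: "AE s in circle. u s = c + integral {0..s} g" and z: "integral \<I> g = 0"
    and um: "u \<in> borel_measurable circle"
  shows "is_weak_deriv u g"
  unfolding is_weak_deriv_def
proof (intro allI impI)
  fix \<phi> assume \<phi>: "smooth \<phi> \<and> periodic \<phi>"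
  note dc = smooth_continuous[OF smooth_deriv[OF conjunct1[OF \<phi>]]]
  have Gi: "integrable circle (\<lambda>s. integral {0..s} g)" by (rule integrable_circle_continuous[OF indefinite_integral_continuous_circle[OF g]])
  have "(LINT s|circle. deriv \<phi> s *\<^sub>R u s) = (LINT s|circle. deriv \<phi> s *\<^sub>R c + deriv \<phi> s *\<^sub>R integral {0..s} g)"
  proof (rule integral_cong_AE)
    show "AE s in circle. deriv \<phi> s *\<^sub>R u s = deriv \<phi> s *\<^sub>R c + deriv \<phi> s *\<^sub>R integral {0..s} g"
      using u by (rule AE_mp) (intro AE_I2 impI, simp add: scaleR_add_right)
    show "(\<lambda>s. deriv \<phi> s *\<^sub>R u s) \<in> borel_measurable circle"
      by (intro borel_measurable_scaleR continuous_measurable_circle[OF dc] um)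
    show "(\<lambda>s. deriv \<phi> s *\<^sub>R c + deriv \<phi> s *\<^sub>R integral {0..s} g) \<in> borel_measurable circle"
      by (intro borel_measurable_add borel_measurable_scaleR continuous_measurable_circle[OF dc] borel_measurable_const borel_measurable_integrable[OF Gi])
  qed
  also have "\<dots> = (LINT s|circle. deriv \<phi> s *\<^sub>R c) + (LINT s|circle. deriv \<phi> s *\<^sub>R integral {0..s} g)"
    by (rule Bochner_Integration.integral_add)
      (intro integrable_circle_continuous continuous_intros continuous_on_subset[OF dc], simp, rule integrable_bounded_scaleR_circle[OF Gi dc])
  also have "(LINT s|circle. deriv \<phi> s *\<^sub>R c) = (LINT s|circle. deriv \<phi> s) *\<^sub>R c"
    by (rule integral_scaleR_left) (intro integrable_circle_continuous continuous_on_subset[OF dc], simp)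
  also have "(LINT s|circle. deriv \<phi> s) = 0"
  proof -
    have "(LINT s|circle. deriv \<phi> s) = integral \<I> (deriv \<phi>)"
      by (intro LINT_circle_eq absolutely_integrable_continuous_real continuous_on_subset[OF dc]) auto
    also have "\<dots> = \<phi> (2 * pi) - \<phi> 0"
      using smooth_has_deriv[OF conjunct1[OF \<phi>]] by (intro integral_unique fundamental_theorem_of_calculus)
        (auto simp: has_real_derivative_iff_has_vector_derivative[symmetric] intro: has_field_derivative_at_within)
    also have "\<dots> = 0" using conjunct2[OF \<phi>, unfolded periodic_def, rule_format, of 0] by simp
    finally show ?thesis .
  qed
  finally show "(LINT s|circle. deriv \<phi> s *\<^sub>R u s) = - (LINT s|circle. \<phi> s *\<^sub>R g s)"
    unfolding integral_by_parts_circle[OF g smooth_has_deriv[OF conjunct1[OF \<phi>]] dc] z by simp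
qed

lemma weak_deriv_unique:
  assumes "integrable circle g" "integrable circle g'" "is_weak_deriv u g" "is_weak_deriv u g'"
  shows "AE s in circle. g s = g' s"
proof -
  have "AE s in circle. g s - g' s = 0"
  proof (rule fundamental_lemma_circle)
    show "integrable circle (\<lambda>s. g s - g' s)" using assms by simp
    fix \<phi> assume \<phi>: "smooth \<phi>" "periodic \<phi>"
    note c = smooth_continuous[OF \<phi>(1)]
    have "(LINT s|circle. \<phi> s *\<^sub>R (g s - g' s)) = (LINT s|circle. \<phi> s *\<^sub>R g s) - (LINT s|circle. \<phi> s *\<^sub>R g' s)"
      unfolding scaleR_diff_right by (rule Bochner_Integration.integral_diff) (intro integrable_bounded_scaleR_circle assms c)+
    also have "\<dots> = 0" using assms(3)[unfolded is_weak_deriv_def, rule_format, OF conjI[OF \<phi>]]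
        assms(4)[unfolded is_weak_deriv_def, rule_format, OF conjI[OF \<phi>]] by simp
    finally show "(LINT s|circle. \<phi> s *\<^sub>R (g s - g' s)) = 0" .
  qed
  then show ?thesis by simp
qed

lemma H1_weak_deriv: "H1 u ==> L2 (weak_deriv u)" "H1 u ==> is_weak_deriv u (weak_deriv u)"
  using someI_ex[of "\<lambda>g. L2 g \<and> is_weak_deriv u g"] unfolding H1_def weak_deriv_def by auto

lemma H1_primitive:
  assumes "H1 u"
  obtains c where "AE s in circle. u s = c + integral {0..s} (weak_deriv u)" "integral \<I> (weak_deriv u) = 0"
proof -
  have u: "integrable circle u" using assms L2_integrable by (simp add: H1_def)
  show thesis by (rule weak_deriv_imp_primitive[OF u L2_integrable[OF H1_weak_deriv(1)[OF assms]] H1_weak_deriv(2)[OF assms]])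
      (rule that)
qed

section \<open>Identities almost everywhere, and Hoelder bounds for primitives\<close>

lemma AE_lebesgue_on_dense:
  assumes "a < (b::real)" and "AE s in lebesgue_on {a..b}. Q s" and "s \<in> {a..b}" and "e > 0"
  obtains r where "r \<in> {a..b}" "Q r" "\<bar>r - s\<bar> < e"
proof -
  define l where "l = max a (s - e / 2)"
  define k where "k = min b (s + e / 2)"
  have lk: "l < k" "{l..k} \<subseteq> {a..b}" using assms by (auto simp: l_def k_def)
  obtain Nn where Nn: "Nn \<in> null_sets (lebesgue_on {a..b})" "{s \<in> space (lebesgue_on {a..b}). \<not> Q s} \<subseteq> Nn"
    using assms(2) by (auto simp: eventually_ae_filter)
  then have neg: "negligible Nn" by (simp add: null_sets_restrict_space negligible_iff_null_sets)
  have "\<not> {l..k} \<subseteq> Nn"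
  proof
    assume "{l..k} \<subseteq> Nn"
    then have "negligible (cbox l k)" using neg negligible_subset by auto
    then have "box l k = {}" unfolding negligible_interval .
    then show False using lk(1) by (simp add: box_real)
  qed
  then obtain r where r: "r \<in> {l..k}" "r \<notin> Nn" by blast
  then have "r \<in> {a..b}" using lk by blast
  then have "Q r" using r(2) Nn(2) by auto
  moreover have "\<bar>r - s\<bar> < e" using r(1) assms(4) by (auto simp: l_def k_def)
  ultimately show ?thesis using that \<open>r \<in> {a..b}\<close> by blast
qed

lemma AE_eq_continuous:
  fixes u v :: "real \<Rightarrow> 'a::real_normed_vector"
  assumes "a < b" "continuous_on {a..b} u" "continuous_on {a..b} v" "AE s in lebesgue_on {a..b}. u s = v s" "s \<in> {a..b}"
  shows "u s = v s"
proof (rule ccontr)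
  assume ne: "u s \<noteq> v s"
  have "continuous_on {a..b} (\<lambda>s. u s - v s)" using assms by (intro continuous_intros)
  then obtain d where d: "d > 0" "\<And>r. r \<in> {a..b} ==> dist r s < d ==> dist (u r - v r) (u s - v s) < norm (u s - v s)"
  proof -
    have "norm (u s - v s) > 0" using ne by simp
    with \<open>continuous_on {a..b} (\<lambda>s. u s - v s)\<close> assms(5) show ?thesis unfolding continuous_on_iff using that by blast
  qed
  obtain r where "r \<in> {a..b}" "u r = v r" "\<bar>r - s\<bar> < d" using AE_lebesgue_on_dense[OF assms(1,4,5) d(1)] by blast
  then show False using d(2)[of r] by (simp add: dist_norm norm_minus_commute)
qed

text \<open>The nonnegative integral of the squared distance between \<open>g\<close> and its mean
  \<open>m\<close> is expanded.\<close>

lemma integral_square_le: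
  fixes g :: "real \<Rightarrow> real^2"
  assumes "a < b" and g: "g integrable_on {a..b}" and g2: "(\<lambda>s. (norm (g s))^2) integrable_on {a..b}"
  shows "(norm (integral {a..b} g))^2 \<le> (b - a) * integral {a..b} (\<lambda>s. (norm (g s))^2)"
proof -
  define I where "I = integral {a..b} g"
  define m where "m = I /\<^sub>R (b - a)"
  have hg: "(g has_integral I) {a..b}" unfolding I_def by (rule integrable_integral[OF g])
  have im: "((\<lambda>s. g s \<bullet> m) has_integral I \<bullet> m) {a..b}"
    using has_integral_linear[OF hg bounded_linear_inner_left[of m]] by (simp add: o_def)
  have "((\<lambda>s. (norm (g s))^2 - 2 * (g s \<bullet> m) + (norm m)^2) has_integral
     integral {a..b} (\<lambda>s. (norm (g s))^2) - 2 * (I \<bullet> m) + (b - a) *\<^sub>R (norm m)^2) {a..b}"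
    using assms(1) has_integral_const_real[of "(norm m)^2" a b]
    by (intro has_integral_add has_integral_diff integrable_integral[OF g2] has_integral_mult_right im) simp
  moreover have "0 \<le> (norm (g s))^2 - 2 * (g s \<bullet> m) + (norm m)^2" for s
  proof -
    have "(norm (g s - m))^2 = (norm (g s))^2 - 2 * (g s \<bullet> m) + (norm m)^2"
      by (simp add: power2_norm_eq_inner inner_diff_left inner_diff_right inner_commute)
    then show ?thesis by (metis zero_le_power2)
  qed
  ultimately have "0 \<le> integral {a..b} (\<lambda>s. (norm (g s))^2) - 2 * (I \<bullet> m) + (b - a) *\<^sub>R (norm m)^2"
    by (rule has_integral_nonneg)
  moreover have "I = (b - a) *\<^sub>R m" using assms(1) by (simp add: m_def)
  ultimately have "(b - a) * (norm m)^2 \<le> integral {a..b} (\<lambda>s. (norm (g s))^2)" by (simp add: power2_norm_eq_inner)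
  then have "(b - a) * ((b - a) * (norm m)^2) \<le> (b - a) * integral {a..b} (\<lambda>s. (norm (g s))^2)"
    using assms(1) by (intro mult_left_mono) auto
  moreover have "(norm I)^2 = (b - a) * ((b - a) * (norm m)^2)"
    unfolding \<open>I = (b - a) *\<^sub>R m\<close> by (simp add: power_mult_distrib power2_eq_square)
  ultimately show ?thesis by (simp add: I_def)
qed

lemma L2_integrable_on:
  assumes "L2 g" "{a..b} \<subseteq> \<I>"
  shows "g integrable_on {a..b}" "(\<lambda>s. (norm (g s))^2) integrable_on {a..b}"
proof -
  have ai: "g absolutely_integrable_on \<I>" using L2_integrable[OF assms(1)] by (simp add: integrable_circle_iff)
  have bi: "(\<lambda>s. (norm (g s))^2) absolutely_integrable_on \<I>" using assms(1) by (simp add: L2_def integrable_circle_iff)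
  show "g integrable_on {a..b}" "(\<lambda>s. (norm (g s))^2) integrable_on {a..b}"
    using integrable_on_subinterval[OF set_lebesgue_integral_eq_integral(1)[OF ai]]
      integrable_on_subinterval[OF set_lebesgue_integral_eq_integral(1)[OF bi]] assms(2) by auto
qed

lemma L2_norm_sq_integral: "L2 g ==> (L2_norm g)^2 = integral \<I> (\<lambda>s. (norm (g s))^2)"
  unfolding L2_norm_squared by (rule LINT_circle_eq) (simp add: L2_def integrable_circle_iff)

lemma integral_diff_from_zero:
  fixes g :: "real \<Rightarrow> real^2"
  assumes "g integrable_on \<I>" "0 \<le> r" "r \<le> s" "s \<le> 2 * pi"
  shows "integral {0..s} g - integral {0..r} g = integral {r..s} g"
proof -
  have "integral {0..r} g + integral {r..s} g = integral {0..s} g"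
    using assms by (intro Henstock_Kurzweil_Integration.integral_combine) (auto intro: integrable_on_subinterval)
  then show ?thesis by (simp add: algebra_simps)
qed

text \<open>The Cauchy-Schwarz inequality on the interval between \<open>r\<close> and
  \<open>s\<close>, which gives the exponent one half.\<close>

lemma primitive_holder:
  assumes g: "L2 g" and rs: "r \<in> \<I>" "s \<in> \<I>"
  shows "norm (integral {0..s} g - integral {0..r} g) \<le> L2_norm g * sqrt \<bar>s - r\<bar>"
proof -
  have main: "norm (integral {0..s} g - integral {0..r} g) \<le> L2_norm g * sqrt \<bar>s - r\<bar>" if "r < s" "r \<in> \<I>" "s \<in> \<I>" for r s
  proof -
    have sub: "{r..s} \<subseteq> \<I>" using that by auto
    have "(norm (integral {r..s} g))^2 \<le> (s - r) * integral {r..s} (\<lambda>s. (norm (g s))^2)"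
      by (rule integral_square_le[OF that(1) L2_integrable_on[OF g sub]])
    also have "\<dots> \<le> (s - r) * (L2_norm g)^2" unfolding L2_norm_sq_integral[OF g] using that sub L2_integrable_on(2)[OF g]
      by (intro mult_left_mono integral_subset_le) auto
    also have "\<dots> = (L2_norm g * sqrt \<bar>s - r\<bar>)^2" using that(1) by (simp add: power_mult_distrib mult.commute)
    finally have "norm (integral {r..s} g) \<le> L2_norm g * sqrt \<bar>s - r\<bar>" by (rule power2_le_imp_le) (simp add: L2_norm_nonneg)
    then show ?thesis using integral_diff_from_zero[OF L2_integrable_on(1)[OF g order_refl]] that by simp
  qed
  consider "r < s" | "r = s" | "s < r" by linarith
  then show ?thesis
  proof cases
    case 1 then show ?thesis by (rule main[OF _ rs])
  next
    case 2 then show ?thesis by (simp add: L2_norm_nonneg)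
  next
    case 3 then show ?thesis using main[OF _ rs(2,1)] by (simp add: norm_minus_commute abs_minus_commute)
  qed
qed

text \<open>\<open>u s\<close> is compared with \<open>u r\<close> by the Hoelder bound, and the
  squared inequality is averaged over \<open>r\<close> in the period. The factor 4 is the square
  root of 16, which dominates \<open>4 * pi\<close>.\<close>

lemma primitive_sup_bound:
  assumes g: "L2 g" and u: "\<And>s. s \<in> \<I> ==> u s = c + integral {0..s} g" and s: "s \<in> \<I>"
  shows "norm (u s) \<le> 4 * (L2_norm u + L2_norm g)"
proof -
  have uc: "continuous_on \<I> u"
    using continuous_on_add[OF continuous_on_const indefinite_integral_continuous_circle[OF L2_integrable[OF g]], of c]
    by (rule continuous_on_eq) (simp add: u)
  have u2c: "continuous_on \<I> (\<lambda>r. (norm (u r))^2)" by (intro continuous_intros uc)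
  have n2: "(L2_norm u)^2 = integral \<I> (\<lambda>r. (norm (u r))^2)"
    unfolding L2_norm_squared by (rule LINT_circle_eq) (rule absolutely_integrable_continuous_real[OF u2c])
  have pw: "(norm (u s))^2 \<le> 2 * (norm (u r))^2 + 4 * pi * (L2_norm g)^2" if r: "r \<in> \<I>" for r
  proof -
    have "u s - u r = integral {0..s} g - integral {0..r} g" unfolding u[OF s] u[OF r] by simp
    then have "norm (u s - u r) \<le> L2_norm g * sqrt \<bar>s - r\<bar>" using primitive_holder[OF g r s] by (simp only:)
    also have "\<dots> \<le> L2_norm g * sqrt (2 * pi)" using r s by (intro mult_left_mono L2_norm_nonneg) auto
    finally have a: "norm (u s) \<le> norm (u r) + L2_norm g * sqrt (2 * pi)" using norm_triangle_sub[of "u s" "u r"] by linarith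
    have "(norm (u s))^2 \<le> (norm (u r) + L2_norm g * sqrt (2 * pi))^2" using a by (rule power_mono) simp
    also have "\<dots> \<le> 2 * ((norm (u r))^2 + (L2_norm g * sqrt (2 * pi))^2)" by (rule square_add2_le)
    also have "(L2_norm g * sqrt (2 * pi))^2 = 2 * pi * (L2_norm g)^2" by (simp add: power_mult_distrib)
    finally show ?thesis by simp
  qed
  have "((\<lambda>r. (norm (u s))^2) has_integral (2 * pi) *\<^sub>R (norm (u s))^2) \<I>"
    using has_integral_const_real[of "(norm (u s))^2" 0 "2 * pi"] by simp
  moreover have "((\<lambda>r. 2 * (norm (u r))^2 + 4 * pi * (L2_norm g)^2) has_integral 2 * (L2_norm u)^2 + (2 * pi) *\<^sub>R (4 * pi * (L2_norm g)^2)) \<I>"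
    unfolding n2 using has_integral_const_real[of "4 * pi * (L2_norm g)^2" 0 "2 * pi"]
    by (intro has_integral_add has_integral_mult_right integrable_integral integrable_continuous_real u2c) simp
  ultimately have "(2 * pi) *\<^sub>R (norm (u s))^2 \<le> 2 * (L2_norm u)^2 + (2 * pi) *\<^sub>R (4 * pi * (L2_norm g)^2)"
    by (rule has_integral_le) (rule pw)
  then have "2 * pi * (norm (u s))^2 \<le> 2 * pi * ((L2_norm u)^2 / pi + 4 * pi * (L2_norm g)^2)" by (simp add: distrib_left)
  then have "(norm (u s))^2 \<le> (L2_norm u)^2 / pi + 4 * pi * (L2_norm g)^2" by simp
  also have "\<dots> \<le> 16 * (L2_norm u)^2 + 16 * (L2_norm g)^2"
  proof (intro add_mono mult_right_mono)
    have "(L2_norm u)^2 / pi \<le> (L2_norm u)^2 / 1" using pi_ge_two by (intro divide_left_mono) auto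
    then show "(L2_norm u)^2 / pi \<le> 16 * (L2_norm u)^2" using zero_le_power2[of "L2_norm u"] by linarith
    show "4 * pi \<le> 16" using pi_less_4 by simp
  qed simp
  also have "\<dots> \<le> (4 * (L2_norm u + L2_norm g))^2"
    using L2_norm_nonneg[of u] L2_norm_nonneg[of g] by (simp add: power2_eq_square algebra_simps)
  finally show ?thesis by (rule power2_le_imp_le) (use L2_norm_nonneg[of u] L2_norm_nonneg[of g] in simp)
qed

section \<open>Weak derivatives in time\<close>

text \<open>Polynomials in \<open>1 / t\<close> times \<open>exp (- (1 / t))\<close>, extended by 0
  to the left. The family is closed under differentiation: \<open>p\<close> becomes
  \<open>y^2 * (p - p')\<close> in the variable \<open>y = 1 / t\<close>.\<close>

definition flat_exp :: "real poly \<Rightarrow> real \<Rightarrow> real" where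
  "flat_exp p t = (if t > 0 then poly p (1 / t) * exp (- (1 / t)) else 0)"

lemma flat_exp_limit: "(flat_exp p \<longlongrightarrow> 0) (at_right 0)"
proof -
  have "((\<lambda>y. \<Sum>i\<le>degree p. coeff p i * (y ^ i / exp y)) \<longlongrightarrow> (\<Sum>i\<le>degree p. coeff p i * 0)) at_top"
    by (intro tendsto_sum tendsto_mult tendsto_const tendsto_power_div_exp_0)
  then have "((\<lambda>y. \<Sum>i\<le>degree p. coeff p i * (y ^ i / exp y)) \<longlongrightarrow> 0) at_top" by simp
  then have "((\<lambda>t. \<Sum>i\<le>degree p. coeff p i * (inverse t ^ i / exp (inverse t))) \<longlongrightarrow> 0) (at_right 0)"
    by (rule filterlim_compose[OF _ filterlim_inverse_at_top_right])
  moreover have "eventually (\<lambda>t. (\<Sum>i\<le>degree p. coeff p i * (inverse t ^ i / exp (inverse t))) = flat_exp p t) (at_right (0::real))"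
    using eventually_at_right_less[of 0]
  proof eventually_elim
    case (elim t)
    have "(\<Sum>i\<le>degree p. coeff p i * (inverse t ^ i / exp (inverse t))) = (\<Sum>i\<le>degree p. coeff p i * inverse t ^ i) * exp (- inverse t)"
      by (simp add: sum_distrib_right exp_minus divide_inverse mult.assoc)
    then show ?case using elim by (simp add: flat_exp_def poly_altdef inverse_eq_divide)
  qed
  ultimately show ?thesis by (simp add: tendsto_cong)
qed

lemma flat_exp_has_derivative:
  "(flat_exp p has_real_derivative flat_exp (monom 1 2 * (p - pderiv p)) t) (at t)"
proof -
  consider "t > 0" | "t < 0" | "t = 0" by linarith
  then show ?thesis
  proof cases
    case 1
    have "((\<lambda>t. poly p (1 / t) * exp (- (1 / t))) has_real_derivative
        (poly (pderiv p) (1 / t) * (- 1 / (t * t))) * exp (- (1 / t)) + exp (- (1 / t)) * (1 / (t * t)) * poly p (1 / t)) (at t)"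
    proof (rule DERIV_mult)
      have d: "((\<lambda>t. 1 / t) has_real_derivative - 1 / (t * t)) (at t)" using 1 by (auto intro!: derivative_eq_intros)
      show "((\<lambda>t. poly p (1 / t)) has_real_derivative poly (pderiv p) (1 / t) * (- 1 / (t * t))) (at t)"
        by (rule DERIV_chain2[OF poly_DERIV d])
      show "((\<lambda>t. exp (- (1 / t))) has_real_derivative exp (- (1 / t)) * (1 / (t * t))) (at t)"
        using DERIV_chain2[OF DERIV_exp DERIV_minus[OF d]] by simp
    qed
    moreover have "(poly (pderiv p) (1 / t) * (- 1 / (t * t))) * exp (- (1 / t)) + exp (- (1 / t)) * (1 / (t * t)) * poly p (1 / t)
        = flat_exp (monom 1 2 * (p - pderiv p)) t" using 1 by (simp add: flat_exp_def poly_monom power2_eq_square field_simps)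
    ultimately have "((\<lambda>t. poly p (1 / t) * exp (- (1 / t))) has_real_derivative flat_exp (monom 1 2 * (p - pderiv p)) t) (at t)" by simp
    then show ?thesis
      by (rule has_field_derivative_transform_within_open[of _ _ _ "{0<..}"]) (use 1 in \<open>auto simp: flat_exp_def\<close>)
  next
    case 2
    have "((\<lambda>t. 0) has_real_derivative flat_exp (monom 1 2 * (p - pderiv p)) t) (at t)" using 2 by (simp add: flat_exp_def)
    then show ?thesis
      by (rule has_field_derivative_transform_within_open[of _ _ _ "{..<0}"]) (use 2 in \<open>auto simp: flat_exp_def\<close>)
  next
    case 3
    \<comment> \<open>To the right of 0 the difference quotient is again in the family, with
      \<open>p\<close> multiplied by its variable, so \<open>flat_exp_limit\<close> applies.\<close>
    have "((\<lambda>y. (flat_exp p y - flat_exp p 0) / (y - 0)) \<longlongrightarrow> 0) (at_right 0)"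
      using flat_exp_limit[of "monom 1 1 * p"] by (rule Lim_transform_eventually) (auto simp: eventually_at_filter flat_exp_def poly_monom)
    moreover have "((\<lambda>y. (flat_exp p y - flat_exp p 0) / (y - 0)) \<longlongrightarrow> 0) (at_left 0)"
      by (rule Lim_transform_eventually[OF tendsto_const]) (auto simp: eventually_at_filter flat_exp_def)
    ultimately have "((\<lambda>y. (flat_exp p y - flat_exp p 0) / (y - 0)) \<longlongrightarrow> 0) (at 0)"
      by (intro filterlim_split_at_real)
    then show ?thesis using 3 by (simp add: has_field_derivative_iff flat_exp_def)
  qed
qed

text \<open>\<open>S\<close> is the normalized primitive of the bump \<open>b\<close>, a product of
  two flat exponentials facing each other. Affine changes of the argument are included among the
  generators because rescaled and shifted copies of \<open>S\<close> serve as cutoffs.\<close>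

lemma smooth_transition:
  "\<exists>S s :: real \<Rightarrow> real. (\<forall>t. (S has_real_derivative s t) (at t)) \<and> (\<forall>t. 0 \<le> s t) \<and> (\<forall>t. t \<notin> {0..1} \<longrightarrow> s t = 0)
     \<and> (\<forall>t\<le>0. S t = 0) \<and> (\<forall>t\<ge>1. S t = 1) \<and> continuous_on UNIV s \<and> (\<forall>k m. smooth (\<lambda>t. S (k * t + m)))"
proof -
  define A where "A = {\<lambda>t. flat_exp p (k * t + m) | p k m. True}"
  define b where "b t = flat_exp 1 t * flat_exp 1 (1 - t)" for t
  have A: "\<exists>u'\<in>generated_algebra A. \<forall>s. (u has_real_derivative u' s) (at s)" if uA: "u \<in> A" for u
  proof -
    obtain p k m where u: "u = (\<lambda>t. flat_exp p (k * t + m))" using uA by (auto simp: A_def)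
    define u' where "u' = (\<lambda>t. k * flat_exp (monom 1 2 * (p - pderiv p)) (k * t + m))"
    have "u' \<in> generated_algebra A" unfolding u'_def
      by (intro generated_algebra.mult generated_algebra.const generated_algebra.base) (auto simp: A_def)
    moreover have "(u has_real_derivative u' s) (at s)" for s
    proof -
      have "((\<lambda>t. k * t + m) has_real_derivative k) (at s)" by (auto intro!: derivative_eq_intros)
      from DERIV_chain2[OF flat_exp_has_derivative this] show ?thesis by (simp add: u u'_def mult.commute)
    qed
    ultimately show ?thesis by blast
  qed
  have bsm: "smooth (\<lambda>t. c * b (k * t + m))" for c k m
  proof (rule smooth_generated_algebra[of A])
    show "\<exists>u'\<in>generated_algebra A. \<forall>s. (u has_real_derivative u' s) (at s)" if "u \<in> A" for u by (rule A[OF that])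
    have "(\<lambda>t. flat_exp 1 (k * t + m)) \<in> A" by (auto simp: A_def)
    moreover have "(\<lambda>t. flat_exp 1 (1 - (k * t + m))) \<in> A"
    proof -
      have "(\<lambda>t. flat_exp 1 (1 - (k * t + m))) = (\<lambda>t. flat_exp 1 ((- k) * t + (1 - m)))" by (simp add: algebra_simps)
      then show ?thesis unfolding A_def by blast
    qed
    ultimately show "(\<lambda>t. c * b (k * t + m)) \<in> generated_algebra A" unfolding b_def
      by (intro generated_algebra.mult generated_algebra.const generated_algebra.base)
  qed
  have bc: "continuous_on UNIV b" using smooth_continuous[OF bsm[of 1 1 0]] by simp
  have b0: "0 \<le> b t" for t by (simp add: b_def flat_exp_def)
  have bz: "b t = 0" if "t \<notin> {0..1}" for t using that by (auto simp: b_def flat_exp_def)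
  obtain \<Phi> where \<Phi>: "\<And>t. (\<Phi> has_real_derivative b t) (at t)" using antiderivative_real[OF bc] by blast
  define c where "c = \<Phi> 1 - \<Phi> 0"
  have "\<Phi> 0 < \<Phi> 1"
  proof (rule DERIV_pos_imp_increasing_open[of 0 1 \<Phi>])
    show "\<exists>y. (\<Phi> has_real_derivative y) (at x) \<and> 0 < y" if "0 < x" "x < 1" for x
      using that \<Phi>[of x] by (intro exI[of _ "b x"]) (simp add: b_def flat_exp_def)
    show "continuous_on {0..1} \<Phi>" using \<Phi> DERIV_isCont by (intro continuous_at_imp_continuous_on) blast
  qed simp
  then have c: "c > 0" by (simp add: c_def)
  define S where "S t = (\<Phi> t - \<Phi> 0) / c" for t
  define s where "s t = b t / c" for t
  have S: "(S has_real_derivative s t) (at t)" for t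
    unfolding S_def s_def using DERIV_cdivide[OF DERIV_diff[OF \<Phi>[of t] DERIV_const[of "\<Phi> 0"]], of c] by simp
  have const: "\<Phi> t = \<Phi> r" if "t \<le> r" and bx: "\<And>x. t < x ==> x < r ==> b x = 0" for t r
  proof (cases "t = r")
    case False
    have "\<Phi> r = \<Phi> t"
    proof (rule DERIV_isconst_end[of t r \<Phi>])
      show "continuous_on {t..r} \<Phi>" using \<Phi> DERIV_isCont by (intro continuous_at_imp_continuous_on) blast
      show "(\<Phi> has_real_derivative 0) (at x)" if "t < x" "x < r" for x using \<Phi>[of x] bx[OF that] by simp
    qed (use that False in simp)
    then show ?thesis by simp
  qed simp
  have "smooth (\<lambda>t. S (k * t + m))" for k m
  proof (rule smooth_integral[OF bsm[of "k / c" k m]])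
    fix t
    have "((\<lambda>t. k * t + m) has_real_derivative k) (at t)" by (auto intro!: derivative_eq_intros)
    from DERIV_chain2[OF S this] show "((\<lambda>t. S (k * t + m)) has_real_derivative k / c * b (k * t + m)) (at t)"
      by (simp add: s_def mult.commute)
  qed
  moreover have "S t = 0" if "t \<le> 0" for t using const[of t 0] bz that by (simp add: S_def)
  moreover have "S t = 1" if "1 \<le> t" for t using const[of 1 t] bz that c by (simp add: S_def c_def)
  moreover have "continuous_on UNIV s" unfolding s_def using c by (intro continuous_intros bc) auto
  moreover have "0 \<le> s t" for t using b0 c by (simp add: s_def)
  moreover have "s t = 0" if "t \<notin> {0..1}" for t using bz[OF that] by (simp add: s_def)
  ultimately show ?thesis using S by blast
qed

section \<open>From weak time derivatives to increments\<close>

lemma smooth_diff: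
  assumes "smooth u" "smooth v" shows "smooth (\<lambda>t. u t - v t)"
proof -
  have d: "(deriv ^^ n) (\<lambda>t. u t - v t) = (\<lambda>t. (deriv ^^ n) u t - (deriv ^^ n) v t)" for n
  proof (induction n)
    case (Suc n)
    have "((\<lambda>t. (deriv ^^ n) u t - (deriv ^^ n) v t) has_real_derivative (deriv ^^ Suc n) u t - (deriv ^^ Suc n) v t) (at t)" for t
      using assms unfolding smooth_def differentiable_on_def by (auto intro!: DERIV_diff simp: DERIV_deriv_iff_real_differentiable)
    then show ?case by (simp add: Suc fun_eq_iff DERIV_imp_deriv)
  qed simp
  show ?thesis using assms unfolding smooth_def d by (auto intro: differentiable_on_diff)
qed

lemma continuous_lebesgue_on_integral:
  fixes u :: "real \<Rightarrow> 'a::euclidean_space"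
  assumes "continuous_on {a..b} u"
  shows "integrable (lebesgue_on {a..b}) u" "(LINT t|lebesgue_on {a..b}. u t) = integral {a..b} u"
proof -
  have "u absolutely_integrable_on {a..b}" by (rule absolutely_integrable_continuous_real[OF assms])
  then show "integrable (lebesgue_on {a..b}) u" by (simp add: absolutely_integrable_imp_integrable)
  then show "(LINT t|lebesgue_on {a..b}. u t) = integral {a..b} u" by (rule lebesgue_integral_eq_integral) auto
qed

text \<open>The kernel has mass 1 and is supported in \<open>[p, p + 1 / n]\<close>, to the right of
  \<open>p\<close> and, for large \<open>n\<close>, inside the time interval.\<close>

lemma mollify_continuous:
  fixes H :: "real \<Rightarrow> real^2"
  assumes H: "continuous_on {0..T} H" and p: "0 < p" "p < T"
    and S: "\<And>t. (S has_real_derivative s t) (at t)" "\<And>t. 0 \<le> s t" "\<And>t. t \<notin> {0..1} ==> s t = 0"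
      "\<And>t. t \<le> 0 ==> S t = 0" "\<And>t. t \<ge> 1 ==> S t = 1" "continuous_on UNIV s"
  shows "(\<lambda>n. integral {0..T} (\<lambda>t. (real n * s (real n * t + - (real n * p))) *\<^sub>R H t)) \<longlonglongrightarrow> H p"
proof (rule LIMSEQ_I)
  fix e :: real assume e: "0 < e"
  obtain d where d: "d > 0" "\<And>t. t \<in> {0..T} ==> dist t p < d ==> dist (H t) (H p) < e / 2"
    using H p e unfolding continuous_on_iff by (metis atLeastAtMost_iff less_eq_real_def half_gt_zero)
  define d' where "d' = min d (T - p)"
  have d': "d' > 0" "d' \<le> d" "d' \<le> T - p" using d p by (auto simp: d'_def)
  obtain n0 :: nat where n0: "1 / d' < n0" using reals_Archimedean2 by blast
  show "\<exists>no. \<forall>n\<ge>no. norm (integral {0..T} (\<lambda>t. (real n * s (real n * t + - (real n * p))) *\<^sub>R H t) - H p) < e"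
  proof (intro exI allI impI)
    fix n assume n: "n0 \<le> n"
    define k where "k t = real n * s (real n * t + - (real n * p))" for t
    have nn: "1 / d' < real n" using n0 n by (rule_tac less_le_trans) auto
    moreover have "0 < 1 / d'" using d'(1) by simp
    ultimately have n1: "real n > 0" by linarith
    have "1 / real n < d'" using nn n1 d'(1) by (simp add: field_simps)
    note n1 = this n1
    have kc: "continuous_on X k" for X unfolding k_def by (intro continuous_intros continuous_on_compose2[OF S(6)]) auto
    have "(k has_integral S (real n * T + - (real n * p)) - S (real n * 0 + - (real n * p))) {0..T}"
    proof (rule fundamental_theorem_of_calculus)
      fix t
      have "((\<lambda>t. real n * t + - (real n * p)) has_real_derivative real n) (at t)" by (auto intro!: derivative_eq_intros)
      from DERIV_chain2[OF S(1) this]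
      show "((\<lambda>t. S (real n * t + - (real n * p))) has_vector_derivative k t) (at t within {0..T})"
        by (simp add: k_def mult.commute has_real_derivative_iff_has_vector_derivative has_vector_derivative_at_within)
    qed (use p in simp)
    moreover have "real n * T + - (real n * p) \<ge> 1"
    proof -
      have "1 / real n \<le> T - p" using n1 d'(3) by linarith
      then show ?thesis using n1 by (simp add: field_simps)
    qed
    ultimately have k1: "(k has_integral 1) {0..T}"
      using S(4)[of "real n * 0 + - (real n * p)"] S(5)[of "real n * T + - (real n * p)"] n1 p by simp
    have kp: "0 \<le> k t" for t using S(2) by (simp add: k_def)
    have i1: "(\<lambda>t. k t *\<^sub>R (H t - H p)) integrable_on {0..T}" and i2: "(\<lambda>t. k t *\<^sub>R H t) integrable_on {0..T}"
      by (intro integrable_continuous_real continuous_intros kc H)+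
    have "((\<lambda>t. k t *\<^sub>R H p) has_integral 1 *\<^sub>R H p) {0..T}" by (rule has_integral_scaleR_left[OF k1])
    then have "integral {0..T} (\<lambda>t. k t *\<^sub>R H t) - H p = integral {0..T} (\<lambda>t. k t *\<^sub>R H t - k t *\<^sub>R H p)"
      using i2 by (subst Henstock_Kurzweil_Integration.integral_diff) (auto simp: integral_unique has_integral_integrable)
    also have "norm \<dots> \<le> integral {0..T} (\<lambda>t. k t * (e / 2))"
    proof (rule integral_norm_bound_integral)
      show "(\<lambda>t. k t *\<^sub>R H t - k t *\<^sub>R H p) integrable_on {0..T}" using i1 by (simp add: scaleR_diff_right)
      show "(\<lambda>t. k t * (e / 2)) integrable_on {0..T}" by (intro integrable_continuous_real continuous_intros kc)
      fix t assume t: "t \<in> {0..T}"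
      show "norm (k t *\<^sub>R H t - k t *\<^sub>R H p) \<le> k t * (e / 2)"
      proof (cases "real n * t + - (real n * p) \<in> {0..1}")
        case True
        then have "0 \<le> real n * (t - p)" "real n * (t - p) \<le> 1" by (auto simp: algebra_simps)
        then have "0 \<le> t - p" "t - p \<le> 1 / real n" using n1 by (auto simp: zero_le_mult_iff field_simps)
        then have "dist t p < d" using n1 d' by (simp add: dist_real_def)
        then have "norm (H t - H p) \<le> e / 2" using d(2)[OF t] by (simp add: dist_norm)
        then have "k t * norm (H t - H p) \<le> k t * (e / 2)" by (rule mult_left_mono[OF _ kp])
        then show ?thesis using kp by (simp add: scaleR_diff_right[symmetric])
      next
        case False
        then have "k t = 0" using S(3) by (simp add: k_def)
        then show ?thesis by simp
      qed
    qed
    also have "\<dots> = e / 2" using integral_unique[OF has_integral_mult_left[OF k1, of "e / 2"]] by simp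
    finally show "norm (integral {0..T} (\<lambda>t. (real n * s (real n * t + - (real n * p))) *\<^sub>R H t) - H p) < e"
      using e unfolding k_def by linarith
  qed
qed

text \<open>Testing with smooth cut-offs of \<open>{p..q}\<close> turns the weak time derivative into an increment.\<close>

lemma weak_derivative_increment:
  fixes H W :: "real \<Rightarrow> real^2"
  assumes H: "continuous_on {0..T} H" and W: "integrable (lebesgue_on {0..T}) W"
    and id: "\<And>\<phi>. smooth \<phi> ==> \<exists>a b. 0 < a \<and> b < T \<and> (\<forall>t. t \<notin> {a..b} \<longrightarrow> \<phi> t = 0) ==>
      (LINT t|lebesgue_on {0..T}. deriv \<phi> t *\<^sub>R H t) = - (LINT t|lebesgue_on {0..T}. \<phi> t *\<^sub>R W t)"
    and pq: "0 < p" "p < q" "q < T"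
  shows "H q - H p = (LINT t|lebesgue_on {0..T}. indicator {p..q} t *\<^sub>R W t)"
proof -
  obtain S s :: "real \<Rightarrow> real" where S: "\<And>t. (S has_real_derivative s t) (at t)" "\<And>t. 0 \<le> s t" "\<And>t. t \<notin> {0..1} ==> s t = 0"
      "\<And>t. t \<le> 0 ==> S t = 0" "\<And>t. t \<ge> 1 ==> S t = 1" "continuous_on UNIV s" "\<And>k m. smooth (\<lambda>t. S (k * t + m))"
    using smooth_transition by blast
  have Smono: "S a \<le> S b" if "a \<le> b" for a b by (rule DERIV_nonneg_imp_nondecreasing[OF that]) (use S(1,2) in blast)
  have S01: "0 \<le> S t" "S t \<le> 1" for t
    using Smono[of t 0] Smono[of t "max t 1"] Smono[of "min t 0" t] S(4)[of "min t 0"] S(5)[of "max t 1"] by auto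
  \<comment> \<open>The cutoff rises just after \<open>p\<close> and falls just after
    \<open>q\<close>, each time within \<open>1 / n\<close>; its derivative is the difference of two
    kernels concentrating at \<open>p\<close> and at \<open>q\<close>.\<close>
  define \<phi> where "\<phi> n t = S (real n * t + - (real n * p)) - S (real n * t + - (real n * q))" for n t
  define k where "k n p t = real n * s (real n * t + - (real n * p))" for n p t
  have d\<phi>: "(\<phi> n has_real_derivative k n p t - k n q t) (at t)" for n t
  proof -
    have l: "((\<lambda>t. real n * t + - (real n * p)) has_real_derivative real n) (at t)" for p by (auto intro!: derivative_eq_intros)
    show ?thesis unfolding \<phi>_def k_def
      using DERIV_diff[OF DERIV_chain2[OF S(1) l[of p]] DERIV_chain2[OF S(1) l[of q]]] by (simp add: mult.commute)
  qed
  have kc: "continuous_on X (k n p)" for X n p unfolding k_def by (intro continuous_intros continuous_on_compose2[OF S(6)]) auto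
  have sm: "smooth (\<phi> n)" for n
  proof -
    have "smooth (\<lambda>t. S (real n * t + - (real n * p)))" "smooth (\<lambda>t. S (real n * t + - (real n * q)))" by (rule S(7))+
    then show ?thesis unfolding \<phi>_def by (rule smooth_diff)
  qed
  obtain n0 :: nat where n0: "1 / (T - q) < n0" using reals_Archimedean2 by blast
  have supp: "\<phi> n t = 0" if n: "n > n0" and t: "t \<notin> {p..q + 1 / real n}" for n t
  proof -
    have nn: "real n > 0" using n by simp
    show ?thesis
    proof (cases "t < p")
      case True
      then have "real n * (t - p) \<le> 0" "real n * (t - q) \<le> 0" using nn pq by (auto intro!: mult_nonneg_nonpos)
      then show ?thesis by (simp add: \<phi>_def S(4) algebra_simps)
    next
      case False
      then have "1 / real n \<le> t - q" using t by auto
      then have "1 \<le> real n * (t - q)" using nn by (simp add: field_simps)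
      moreover have "real n * (t - q) \<le> real n * (t - p)" using nn pq by simp
      ultimately show ?thesis by (simp add: \<phi>_def S(5) algebra_simps)
    qed
  qed
  have lim1: "(\<lambda>n. integral {0..T} (\<lambda>t. k n p t *\<^sub>R H t) - integral {0..T} (\<lambda>t. k n q t *\<^sub>R H t)) \<longlonglongrightarrow> H p - H q"
    unfolding k_def using pq by (intro tendsto_diff mollify_continuous[OF H _ _ S(1-6)]) auto
  have "(\<lambda>n. LINT t|lebesgue_on {0..T}. \<phi> n t *\<^sub>R W t) \<longlonglongrightarrow> (LINT t|lebesgue_on {0..T}. indicator {p..q} t *\<^sub>R W t)"
  proof (rule integral_dominated_convergence[where w = "\<lambda>t. norm (W t)"])
    have [measurable]: "W \<in> borel_measurable (lebesgue_on {0..T})" using W by simp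
    have "indicator {p..q} \<in> borel_measurable (lebesgue_on {0..T})" by (intro measurable_restrict_space1 measurable_completion) simp
    then show "(\<lambda>t. indicator {p..q} t *\<^sub>R W t) \<in> borel_measurable (lebesgue_on {0..T})" by measurable
    have "\<phi> n \<in> borel_measurable (lebesgue_on {0..T})" for n using borel_measurable_continuous_onI[OF smooth_continuous[OF sm]]
      by (intro measurable_restrict_space1 measurable_completion) simp
    then show "(\<lambda>t. \<phi> n t *\<^sub>R W t) \<in> borel_measurable (lebesgue_on {0..T})" for n by measurable
    show "integrable (lebesgue_on {0..T}) (\<lambda>t. norm (W t))" using W by simp
    show "AE t in lebesgue_on {0..T}. norm (\<phi> n t *\<^sub>R W t) \<le> norm (W t)" for n
    proof (rule AE_I2)
      fix t
      have "\<bar>\<phi> n t\<bar> \<le> 1" using S01[of "real n * t + - (real n * p)"] S01[of "real n * t + - (real n * q)"] by (simp add: \<phi>_def abs_le_iff)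
      then show "norm (\<phi> n t *\<^sub>R W t) \<le> norm (W t)" by (simp add: mult_left_le_one_le)
    qed
    have ne: "AE t in lebesgue_on {0..T}. t \<notin> {p, q}"
      by (rule AE_I'[of "{0..T} \<inter> {p, q}"]) (auto simp: null_sets_restrict_space negligible_iff_null_sets[symmetric])
    show "AE t in lebesgue_on {0..T}. (\<lambda>n. \<phi> n t *\<^sub>R W t) \<longlonglongrightarrow> indicator {p..q} t *\<^sub>R W t"
      using ne
    proof (rule AE_mp, intro AE_I2 impI)
      fix t assume t: "t \<notin> {p, q}"
      have st: "(\<lambda>n. S (real n * t + - (real n * p))) \<longlonglongrightarrow> (if t > p then 1 else 0)" if "t \<noteq> p" for p
      proof (rule tendsto_eventually)
        obtain m :: nat where m: "1 / \<bar>t - p\<bar> < m" using reals_Archimedean2 by blast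
        show "\<forall>\<^sub>F n in sequentially. S (real n * t + - (real n * p)) = (if t > p then 1 else 0)"
          using eventually_ge_at_top[of m]
        proof eventually_elim
          case (elim n)
          have e: "real n * t + - (real n * p) = real n * (t - p)" by (simp add: algebra_simps)
          show ?case
          proof (cases "t > p")
            case True
            have "1 < real m * (t - p)" using m True by (simp add: field_simps)
            also have "\<dots> \<le> real n * (t - p)" using elim True by (intro mult_right_mono) auto
            finally show ?thesis using True unfolding e by (simp add: S(5))
          next
            case False
            then have "real n * (t - p) \<le> 0" by (intro mult_nonneg_nonpos) auto
            then show ?thesis using False unfolding e by (simp add: S(4))
          qed
        qed
      qed
      have "(\<lambda>n. \<phi> n t) \<longlonglongrightarrow> (if t > p then 1 else 0) - (if t > q then 1 else 0)"
        unfolding \<phi>_def using t by (intro tendsto_diff st) auto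
      moreover have "(if t > p then 1 else 0) - (if t > q then 1 else 0) = (indicator {p..q} t :: real)"
        using t pq by (auto simp: indicator_def)
      ultimately show "(\<lambda>n. \<phi> n t *\<^sub>R W t) \<longlonglongrightarrow> indicator {p..q} t *\<^sub>R W t" by (intro tendsto_scaleR tendsto_const) simp
    qed
  qed
  then have "(\<lambda>n. - (LINT t|lebesgue_on {0..T}. \<phi> n t *\<^sub>R W t)) \<longlonglongrightarrow> - (LINT t|lebesgue_on {0..T}. indicator {p..q} t *\<^sub>R W t)"
    by (rule tendsto_minus)
  moreover have "eventually (\<lambda>n. - (LINT t|lebesgue_on {0..T}. \<phi> n t *\<^sub>R W t) = integral {0..T} (\<lambda>t. k n p t *\<^sub>R H t) - integral {0..T} (\<lambda>t. k n q t *\<^sub>R H t)) sequentially"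
    using eventually_gt_at_top[of n0]
  proof eventually_elim
    case (elim n)
    have dn: "deriv (\<phi> n) = (\<lambda>t. k n p t - k n q t)" using d\<phi> by (auto simp: fun_eq_iff DERIV_imp_deriv)
    have "1 / (T - q) < real n" using n0 elim by simp
    then have "1 / real n < T - q" using pq elim by (simp add: field_simps)
    then have "q + 1 / real n < T" by simp
    then have "\<exists>a b. 0 < a \<and> b < T \<and> (\<forall>t. t \<notin> {a..b} \<longrightarrow> \<phi> n t = 0)" using supp[OF elim] pq by blast
    note id[OF sm this]
    moreover have "(LINT t|lebesgue_on {0..T}. deriv (\<phi> n) t *\<^sub>R H t) = integral {0..T} (\<lambda>t. (k n p t - k n q t) *\<^sub>R H t)"
      unfolding dn by (intro continuous_lebesgue_on_integral continuous_intros kc H)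
    moreover have "\<dots> = integral {0..T} (\<lambda>t. k n p t *\<^sub>R H t) - integral {0..T} (\<lambda>t. k n q t *\<^sub>R H t)"
      unfolding scaleR_diff_left by (intro Henstock_Kurzweil_Integration.integral_diff integrable_continuous_real continuous_intros kc H)
    ultimately show ?case by simp
  qed
  ultimately have "(\<lambda>n. integral {0..T} (\<lambda>t. k n p t *\<^sub>R H t) - integral {0..T} (\<lambda>t. k n q t *\<^sub>R H t)) \<longlonglongrightarrow> - (LINT t|lebesgue_on {0..T}. indicator {p..q} t *\<^sub>R W t)"
    by (rule Lim_transform_eventually)
  from LIMSEQ_unique[OF lim1 this] show ?thesis by (simp add: algebra_simps minus_equation_iff)
qed

section \<open>Regularity of the flow\<close>

lemma AE_lebesgue_on_negligible:
  assumes "AE r in lebesgue_on {a..b::real}. Q r"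
  obtains S where "negligible S" "\<And>r. r \<in> {a..b} - S ==> Q r"
proof -
  obtain S where S: "S \<in> null_sets (lebesgue_on {a..b})" "{r \<in> space (lebesgue_on {a..b}). \<not> Q r} \<subseteq> S"
    using assms by (auto simp: eventually_ae_filter)
  then have "negligible S" by (simp add: null_sets_restrict_space negligible_iff_null_sets)
  then show thesis using S(2) that by fastforce
qed

lemma integral_cong_AE_lebesgue_on:
  fixes g k :: "real \<Rightarrow> 'a::euclidean_space"
  assumes "AE r in lebesgue_on {a..b}. g r = k r" "{p..q} \<subseteq> {a..b}"
  shows "integral {p..q} g = integral {p..q} k"
proof -
  obtain S where "negligible S" "\<And>r. r \<in> {a..b} - S ==> g r = k r" using AE_lebesgue_on_negligible[OF assms(1)] by blast
  then show ?thesis using assms(2) by (intro integral_spike[of S]) auto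
qed

text \<open>Transfer of bounds from almost every time to every time: a set of full measure is dense,
  and \<open>\<phi>\<close> is continuous.\<close>

lemma dense_le:
  assumes "0 < (T::real)" and c: "continuous_on {0..T} \<phi>" and Q: "AE t in lebesgue_on {0..T}. Q t"
    and le: "\<And>t. t \<in> {0..T} ==> Q t ==> \<phi> t \<le> (c::real)" and t: "t \<in> {0..T}"
  shows "\<phi> t \<le> c"
proof (rule field_le_epsilon)
  fix e :: real assume "0 < e"
  then obtain d where d: "d > 0" "\<And>r. r \<in> {0..T} ==> dist r t < d ==> dist (\<phi> r) (\<phi> t) < e"
    using c t unfolding continuous_on_iff by blast
  obtain r where r: "r \<in> {0..T}" "Q r" "\<bar>r - t\<bar> < d" by (rule AE_lebesgue_on_dense[OF assms(1) Q t d(1)])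
  have "\<bar>\<phi> r - \<phi> t\<bar> < e" using d(2)[OF r(1)] r(3) by (simp add: dist_real_def)
  then show "\<phi> t \<le> c + e" using le[OF r(1,2)] by linarith
qed

definition H1_repr :: "(real \<Rightarrow> real^2) \<Rightarrow> real^2 \<Rightarrow> (real \<Rightarrow> real^2) \<Rightarrow> bool" where
  "H1_repr u c v \<longleftrightarrow> (\<forall>s. v s = c + integral {0..s} (weak_deriv u)) \<and> (AE s in circle. u s = v s) \<and> v 0 = v (2 * pi) \<and>
    continuous_on \<I> v \<and> (\<forall>s\<in>\<I>. norm (v s) \<le> 4 * (L2_norm u + L2_norm (weak_deriv u)))"

lemma H1_continuous_repr:
  assumes "H1 u"
  shows "\<exists>c v. H1_repr u c v"
proof -
  obtain c where c: "AE s in circle. u s = c + integral {0..s} (weak_deriv u)" "integral \<I> (weak_deriv u) = 0"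
    by (rule H1_primitive[OF assms])
  note g = H1_weak_deriv(1)[OF assms]
  define v where "v s = c + integral {0..s} (weak_deriv u)" for s
  have vc: "continuous_on \<I> v" unfolding v_def by (intro continuous_intros indefinite_integral_continuous_circle L2_integrable[OF g])
  have ae: "AE s in circle. u s = v s" using c(1) by (simp add: v_def)
  have n: "L2_norm v = L2_norm u" unfolding L2_norm_def
  proof (intro arg_cong[where f = sqrt] integral_cong_AE)
    show "(\<lambda>s. (norm (v s))^2) \<in> borel_measurable circle"
      by (intro borel_measurable_integrable integrable_circle_continuous continuous_intros vc)
    show "(\<lambda>s. (norm (u s))^2) \<in> borel_measurable circle" using assms by (auto simp: H1_def L2_def)
    show "AE s in circle. (norm (v s))^2 = (norm (u s))^2" using ae by (rule AE_mp) (intro AE_I2 impI, simp)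
  qed
  have b: "norm (v s) \<le> 4 * (L2_norm u + L2_norm (weak_deriv u))" if "s \<in> \<I>" for s
    using primitive_sup_bound[OF g v_def that] by (simp only: n)
  have "v 0 = v (2 * pi)" using c(2) by (simp add: v_def)
  then have "H1_repr u c v" unfolding H1_repr_def using ae vc b v_def by blast
  then show ?thesis by blast
qed

text \<open>\<open>v\<close> is the continuously differentiable representative of \<open>u\<close>,
  \<open>y\<close> its derivative, \<open>k\<close> the second weak derivative and \<open>c\<close>
  the value of \<open>y\<close> at 0. The bound \<open>8 * K\<close> is the one of
  \<open>primitive_sup_bound\<close> with both norms at most \<open>K\<close>.\<close>

definition H2_repr :: "(real \<Rightarrow> real^2) \<Rightarrow> real \<Rightarrow> (real \<Rightarrow> real^2) \<Rightarrow> (real \<Rightarrow> real^2) \<Rightarrow> (real \<Rightarrow> real^2) \<Rightarrow> real^2 \<Rightarrow> bool" where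
  "H2_repr u K v y k c \<longleftrightarrow> (AE s in circle. u s = v s) \<and> continuous_on \<I> v \<and> continuous_on \<I> y \<and>
    (\<forall>s\<in>\<I>. (v has_vector_derivative y s) (at s within \<I>)) \<and>
    v 0 = v (2 * pi) \<and> y 0 = y (2 * pi) \<and> L2 k \<and> L2_norm k \<le> K \<and> (\<forall>s. y s = c + integral {0..s} k) \<and>
    (\<forall>s\<in>\<I>. norm (v s) \<le> 8 * K) \<and> (\<forall>s\<in>\<I>. norm (y s) \<le> 8 * K)"

lemma H2_continuous_repr:
  assumes u: "H2 u" and K: "H2_norm u \<le> K"
  shows "\<exists>v y k c. H2_repr u K v y k c"
proof -
  have h1: "H1 u" "H1 (weak_deriv u)" using u by (auto simp: H2_def)
  define k where "k = weak_deriv (weak_deriv u)"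
  have le: "L2_norm u \<le> K" "L2_norm (weak_deriv u) \<le> K" "L2_norm k \<le> K"
    using order_trans[OF real_le_rsqrt K[unfolded H2_norm_def]] by (auto simp: k_def)
  obtain c v where cv: "H1_repr u c v" using H1_continuous_repr[OF h1(1)] by blast
  obtain c' y where cy: "H1_repr (weak_deriv u) c' y" using H1_continuous_repr[OF h1(2)] by blast
  have v: "v s = c + integral {0..s} (weak_deriv u)" "AE s in circle. u s = v s" "v 0 = v (2 * pi)"
    "continuous_on \<I> v" "\<forall>s\<in>\<I>. norm (v s) \<le> 4 * (L2_norm u + L2_norm (weak_deriv u))" for s
    using cv unfolding H1_repr_def by blast+
  have y: "y s = c' + integral {0..s} k" "AE s in circle. weak_deriv u s = y s" "y 0 = y (2 * pi)"
    "continuous_on \<I> y" "\<forall>s\<in>\<I>. norm (y s) \<le> 4 * (L2_norm (weak_deriv u) + L2_norm k)" for s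
    using cy unfolding H1_repr_def k_def[symmetric] by blast+
  have v': "v s = c + integral {0..s} y" if "s \<in> \<I>" for s
    unfolding v(1) using that by (subst integral_cong_AE_lebesgue_on[OF y(2)]) auto
  have d: "(v has_vector_derivative y s) (at s within \<I>)" if "s \<in> \<I>" for s
  proof -
    have "((\<lambda>s. c + integral {0..s} y) has_vector_derivative 0 + y s) (at s within \<I>)"
      by (intro has_vector_derivative_add has_vector_derivative_const integral_has_vector_derivative y(4) that)
    then have "((\<lambda>s. c + integral {0..s} y) has_vector_derivative y s) (at s within \<I>)" by simp
    from has_vector_derivative_transform[OF that _ this] v' show ?thesis by simp
  qed
  have k: "L2 k" unfolding k_def by (rule H1_weak_deriv(1)[OF h1(2)])
  have le2: "4 * (L2_norm u + L2_norm (weak_deriv u)) \<le> 8 * K" "4 * (L2_norm (weak_deriv u) + L2_norm k) \<le> 8 * K"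
    using le by simp_all
  have b1: "norm (v s) \<le> 8 * K" if "s \<in> \<I>" for s by (rule order_trans[OF bspec[OF v(5) that] le2(1)])
  have b2: "norm (y s) \<le> 8 * K" if "s \<in> \<I>" for s by (rule order_trans[OF bspec[OF y(5) that] le2(2)])
  have "H2_repr u K v y k c'" unfolding H2_repr_def by (intro conjI ballI allI v(2,3,4) y(3,4) d k le(3) b1 b2) (rule y(1) | assumption)+
  then show ?thesis by blast
qed

text \<open>The Cauchy-Schwarz inequality in each cell costs one factor of the cell length; the
  integrals of the squared norm of \<open>k\<close> over the cells then add up. This is why
  oscillations are controlled in the square sum.\<close>

lemma primitive_osc:
  assumes k: "L2 k" and y: "\<And>s. y s = c + integral {0..s} k" and P: "is_partition N \<xi>"
    and s: "\<And>j. j \<in> {1..N} ==> s j \<in> (cell \<xi> j) \<and> s' j \<in> (cell \<xi> j)"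
  shows "(\<Sum>j=1..N. (norm (y (s j) - y (s' j)))^2) \<le> mesh_size N \<xi> * (L2_norm k)^2"
proof -
  have "(norm (y (s j) - y (s' j)))^2 \<le> mesh_size N \<xi> * integral (cell \<xi> j) (\<lambda>s. (norm (k s))^2)" if j: "j \<in> {1..N}" for j
  proof -
    note sub = partition_cell_subset[OF P j]
    have ms: "\<xi> j - \<xi> (j - 1) \<le> mesh_size N \<xi>" unfolding mesh_size_def using j by (auto simp: mesh_step_def intro!: Max_ge)
    have main: "(norm (y q - y p))^2 \<le> mesh_size N \<xi> * integral (cell \<xi> j) (\<lambda>s. (norm (k s))^2)"
      if pq: "p < q" "p \<in> (cell \<xi> j)" "q \<in> (cell \<xi> j)" for p q
    proof -
      have sub2: "{p..q} \<subseteq> (cell \<xi> j)" "{p..q} \<subseteq> \<I>" using pq sub by auto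
      have "p \<in> \<I>" "q \<in> \<I>" using sub2(2) pq(1) by auto
      then have "y q - y p = integral {p..q} k" unfolding y
        using integral_diff_from_zero[OF L2_integrable_on(1)[OF k order_refl], of p q] pq(1) by simp
      then have "(norm (y q - y p))^2 \<le> (q - p) * integral {p..q} (\<lambda>s. (norm (k s))^2)"
        using integral_square_le[OF pq(1) L2_integrable_on[OF k sub2(2)]] by simp
      also have "\<dots> \<le> mesh_size N \<xi> * integral (cell \<xi> j) (\<lambda>s. (norm (k s))^2)"
        using pq ms by (intro mult_mono integral_subset_le sub2 L2_integrable_on[OF k] sub integral_nonneg) auto
      finally show ?thesis .
    qed
    have "0 \<le> integral (cell \<xi> j) (\<lambda>s. (norm (k s))^2)" by (intro integral_nonneg L2_integrable_on[OF k sub]) simp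
    moreover have "0 \<le> mesh_size N \<xi>" using ms partition_mono[OF P, of "j - 1" j] j by simp
    ultimately have "0 \<le> mesh_size N \<xi> * integral (cell \<xi> j) (\<lambda>s. (norm (k s))^2)" by simp
    then show ?thesis using main[of "s j" "s' j"] main[of "s' j" "s j"] s[OF j]
      by (cases "s j" "s' j" rule: linorder_cases) (simp_all add: norm_minus_commute)
  qed
  then have "(\<Sum>j=1..N. (norm (y (s j) - y (s' j)))^2) \<le> (\<Sum>j=1..N. mesh_size N \<xi> * integral (cell \<xi> j) (\<lambda>s. (norm (k s))^2))"
    by (rule sum_mono)
  also have "\<dots> = mesh_size N \<xi> * (L2_norm k)^2"
    unfolding L2_norm_sq_integral[OF k] integral_partition[OF P L2_integrable_on(2)[OF k order_refl]] sum_distrib_left ..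
  finally show ?thesis .
qed

text \<open>On the segment between \<open>s\<close> and \<open>s'\<close> the map sending
  \<open>x\<close> to \<open>v x - x *\<^sub>R y s\<close> has derivative \<open>y x - y s\<close>,
  which the Hoelder condition bounds uniformly.\<close>

lemma holder_expansion:
  fixes v :: "real \<Rightarrow> real^2"
  assumes d: "\<And>s. s \<in> {a..b} ==> (v has_vector_derivative y s) (at s within {a..b})"
    and h: "\<And>r s. r \<in> {a..b} ==> s \<in> {a..b} ==> norm (y s - y r) \<le> C * sqrt \<bar>s - r\<bar>" and C: "0 \<le> C"
    and s: "s \<in> {a..b}" "s' \<in> {a..b}"
  shows "norm (v s' - v s - (s' - s) *\<^sub>R y s) \<le> C * (\<bar>s' - s\<bar> * sqrt \<bar>s' - s\<bar>)"
proof -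
  define J where "J = {min s s'..max s s'}"
  have J: "J \<subseteq> {a..b}" using s by (auto simp: J_def)
  have "norm ((v s' - s' *\<^sub>R y s) - (v s - s *\<^sub>R y s)) \<le> (C * sqrt \<bar>s' - s\<bar>) * \<bar>s' - s\<bar>"
  proof (rule vector_derivative_bound[of J "\<lambda>x. v x - x *\<^sub>R y s" "\<lambda>x. y x - y s"])
    show "convex J" by (simp add: J_def)
    fix x assume x: "x \<in> J"
    have "((\<lambda>x. v x - x *\<^sub>R y s) has_vector_derivative y x - (1 *\<^sub>R y s)) (at x within J)"
    proof (intro has_vector_derivative_diff)
      show "(v has_vector_derivative y x) (at x within J)" using has_vector_derivative_within_subset[OF d J] x J by blast
      show "((\<lambda>x. x *\<^sub>R y s) has_vector_derivative 1 *\<^sub>R y s) (at x within J)"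
        by (auto intro!: derivative_eq_intros simp: has_vector_derivative_def)
    qed
    then show "((\<lambda>x. v x - x *\<^sub>R y s) has_vector_derivative y x - y s) (at x within J)" by simp
    have "norm (y x - y s) \<le> C * sqrt \<bar>x - s\<bar>" using h x J s by blast
    also have "\<dots> \<le> C * sqrt \<bar>s' - s\<bar>" using x C by (intro mult_left_mono) (auto simp: J_def)
    finally show "norm (y x - y s) \<le> C * sqrt \<bar>s' - s\<bar>" .
  qed (auto simp: J_def)
  then show ?thesis by (simp add: algebra_simps)
qed

text \<open>A Hoelder modulus of the space derivative that is uniform in time makes the derivative inherit
  the joint continuity of the function, via difference quotients.\<close>

lemma extend_derivative:
  fixes R r :: "real \<Rightarrow> real \<Rightarrow> real^2"
  assumes T: "0 < T" and R: "continuous_on ({0..T} \<times> \<I>) (\<lambda>(t, s). R t s)"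
    and Q: "AE t in lebesgue_on {0..T}. Q t" and C: "0 \<le> C"
    and ex: "\<And>t s s'. t \<in> {0..T} ==> Q t ==> s \<in> \<I> ==> s' \<in> \<I> ==>
      norm (R t s' - R t s - (s' - s) *\<^sub>R r t s) \<le> C * (\<bar>s' - s\<bar> * sqrt \<bar>s' - s\<bar>)"
  obtains r' where "continuous_on ({0..T} \<times> \<I>) (\<lambda>(t, s). r' t s)"
    "\<And>t s. t \<in> {0..T} ==> s \<in> \<I> ==> (R t has_vector_derivative r' t s) (at s within \<I>)"
    "\<And>t s. t \<in> {0..T} ==> Q t ==> s \<in> \<I> ==> r' t s = r t s"
proof -
  define I where "I = \<I>"
  define D where "D = {t \<in> {0..T}. Q t}"
  have clD: "closure D = {0..T}"
  proof
    show "closure D \<subseteq> {0..T}" by (rule closure_minimal) (auto simp: D_def)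
    show "{0..T} \<subseteq> closure D"
    proof
      fix t assume t: "t \<in> {0..T}"
      show "t \<in> closure D" unfolding closure_approachable
      proof (intro allI impI)
        fix e :: real assume "e > 0"
        then obtain x where "x \<in> {0..T}" "Q x" "\<bar>x - t\<bar> < e" using AE_lebesgue_on_dense[OF T Q t] by blast
        then show "\<exists>x\<in>D. dist x t < e" by (auto simp: D_def dist_real_def)
      qed
    qed
  qed
  have clI: "closure I = I" by (simp add: I_def)
  have Ruc: "uniformly_continuous_on ({0..T} \<times> I) (\<lambda>(t, s). R t s)"
    unfolding I_def by (rule compact_uniformly_continuous[OF R]) (intro compact_Times compact_Icc)
  \<comment> \<open>Adding the expansions around the two points cancels \<open>R\<close> and leaves
    the increment of \<open>r\<close>: the expansion by itself implies a Hoelder bound for the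
    derivative.\<close>
  have r_s: "norm (r t s' - r t s) \<le> 2 * C * sqrt \<bar>s' - s\<bar>" if "t \<in> D" "s \<in> I" "s' \<in> I" for t s s'
  proof (cases "s = s'")
    case False
    then have p: "0 < \<bar>s' - s\<bar>" by simp
    have "(s' - s) *\<^sub>R (r t s' - r t s) = (R t s' - R t s - (s' - s) *\<^sub>R r t s) + (R t s - R t s' - (s - s') *\<^sub>R r t s')"
      by (simp add: algebra_simps)
    also have "norm \<dots> \<le> C * (\<bar>s' - s\<bar> * sqrt \<bar>s' - s\<bar>) + C * (\<bar>s - s'\<bar> * sqrt \<bar>s - s'\<bar>)"
      using that by (intro norm_triangle_mono ex) (auto simp: D_def I_def)
    finally have "\<bar>s' - s\<bar> * norm (r t s' - r t s) \<le> \<bar>s' - s\<bar> * (2 * C * sqrt \<bar>s' - s\<bar>)"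
      by (simp add: abs_minus_commute[of s s'] mult.left_commute mult.assoc)
    then show ?thesis using p by (simp only: mult_le_cancel_left_pos)
  qed simp
  have uc: "uniformly_continuous_on (D \<times> I) (\<lambda>(t, s). r t s)" unfolding uniformly_continuous_on_def
  proof (intro allI impI)
    fix e :: real assume e: "e > 0"
    \<comment> \<open>Step width of the difference quotient: its error \<open>C * sqrt d\<close> is
      at most \<open>e / 16\<close>. Only afterwards is \<open>\<eta>\<close> chosen, so that
      \<open>R\<close> changes in time by less than \<open>d * (e / 16)\<close>, which is still
      small after division by the step.\<close>
    define d where "d = min 1 ((e / (16 * (C + 1)))^2)"
    have d: "0 < d" "d \<le> 1" using e C by (auto simp: d_def)
    have "sqrt d \<le> sqrt ((e / (16 * (C + 1)))^2)" unfolding d_def by (intro real_sqrt_le_mono) simp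
    also have "\<dots> = e / (16 * (C + 1))" using e C by simp
    finally have "(C + 1) * sqrt d \<le> e / 16" using C by (simp add: field_simps)
    moreover have "0 \<le> sqrt d" using d by simp
    ultimately have Cd: "C * sqrt d \<le> e / 16" unfolding distrib_right by linarith
    obtain \<eta> where \<eta>: "\<eta> > 0" "\<And>x x'. x \<in> {0..T} \<times> I ==> x' \<in> {0..T} \<times> I ==> dist x' x < \<eta> ==>
        dist ((\<lambda>(t, s). R t s) x') ((\<lambda>(t, s). R t s) x) < d * (e / 16)"
    proof -
      have "d * (e / 16) > 0" using e d by simp
      from Ruc[unfolded uniformly_continuous_on_def, rule_format, OF this] show ?thesis using that by blast
    qed
    have time: "norm (r t' s - r t s) \<le> e / 4" if t: "t \<in> D" "t' \<in> D" "dist t' t < \<eta>" and s: "s \<in> I" for t t' s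
    proof -
      \<comment> \<open>The step is directed away from the nearer end, and \<open>d \<le> 1\<close>
        keeps it inside the period.\<close>
      define s' where "s' = (if s \<le> pi then s + d else s - d)"
      have s': "s' \<in> I" "\<bar>s' - s\<bar> = d" using s d pi_ge_two by (auto simp: s'_def I_def)
      have close: "norm (R t' z - R t z) \<le> d * (e / 16)" if "z \<in> I" for z
      proof -
        have "dist (t', z) (t, z) < \<eta>" using t(3) by (simp add: dist_Pair_Pair)
        then have "dist ((\<lambda>(t, s). R t s) (t', z)) ((\<lambda>(t, s). R t s) (t, z)) < d * (e / 16)"
          using t that by (intro \<eta>(2)) (auto simp: D_def)
        then show ?thesis by (simp add: dist_norm)
      qed
      have "(s' - s) *\<^sub>R (r t' s - r t s) = ((R t' s' - R t s') - (R t' s - R t s))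
          - ((R t' s' - R t' s - (s' - s) *\<^sub>R r t' s) - (R t s' - R t s - (s' - s) *\<^sub>R r t s))" by (simp add: algebra_simps)
      also have "norm \<dots> \<le> (d * (e / 16) + d * (e / 16)) + (C * (\<bar>s' - s\<bar> * sqrt \<bar>s' - s\<bar>) + C * (\<bar>s' - s\<bar> * sqrt \<bar>s' - s\<bar>))"
      proof -
        have n4: "norm ((a - b) - (c - d)) \<le> (norm a + norm b) + (norm c + norm d)" for a b c d :: "real^2"
          using norm_triangle_ineq4[of "a - b" "c - d"] norm_triangle_ineq4[of a b] norm_triangle_ineq4[of c d] by linarith
        show ?thesis using t s s'(1) by (intro order_trans[OF n4] add_mono ex close) (auto simp: D_def I_def)
      qed
      finally have "d * norm (r t' s - r t s) \<le> d * (2 * (e / 16) + 2 * (C * sqrt d))"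
        unfolding s'(2) norm_scaleR by (simp add: algebra_simps)
      then have "norm (r t' s - r t s) \<le> 2 * (e / 16) + 2 * (C * sqrt d)" using d by simp
      then show ?thesis using Cd by simp
    qed
    show "\<exists>\<delta>>0. \<forall>x\<in>D \<times> I. \<forall>x'\<in>D \<times> I. dist x' x < \<delta> \<longrightarrow> dist ((\<lambda>(t, s). r t s) x') ((\<lambda>(t, s). r t s) x) < e"
    proof (intro exI[of _ "min \<eta> d"] conjI ballI impI)
      fix x x' assume x: "x \<in> D \<times> I" "x' \<in> D \<times> I" "dist x' x < min \<eta> d"
      obtain t s t' s' where eq: "x = (t, s)" "x' = (t', s')" by fastforce
      have dd: "dist t' t < \<eta>" "\<bar>s' - s\<bar> \<le> d"
        using x(3) dist_fst_le[of x' x] dist_snd_le[of x' x] by (auto simp: eq dist_real_def)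
      have "norm (r t' s' - r t' s) \<le> 2 * C * sqrt \<bar>s' - s\<bar>" using x eq by (intro r_s) auto
      also have "\<dots> \<le> 2 * C * sqrt d" using dd C by (intro mult_left_mono) auto
      finally have "norm (r t' s' - r t' s) \<le> e / 8" using Cd by simp
      moreover have "norm (r t' s - r t s) \<le> e / 4" using x eq dd by (intro time) auto
      ultimately have "norm (r t' s' - r t s) < e" using norm_triangle_ineq[of "r t' s' - r t' s" "r t' s - r t s"] e by simp
      then show "dist ((\<lambda>(t, s). r t s) x') ((\<lambda>(t, s). r t s) x) < e" by (simp add: eq dist_norm)
    qed (use \<eta> d in simp)
  qed
  obtain g where g: "uniformly_continuous_on (closure (D \<times> I)) g" "\<And>x. x \<in> D \<times> I ==> (\<lambda>(t, s). r t s) x = g x"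
    by (rule uniformly_continuous_on_extension_on_closure[OF uc]) (rule that, assumption+)
  have gc: "continuous_on ({0..T} \<times> I) g" using uniformly_continuous_imp_continuous[OF g(1)] by (simp add: closure_Times clD clI)
  define r' where "r' t s = g (t, s)" for t s
  have r'c: "continuous_on ({0..T} \<times> I) (\<lambda>(t, s). r' t s)" using gc by (simp add: r'_def case_prod_beta)
  have r'r: "r' t s = r t s" if "t \<in> D" "s \<in> I" for t s using g(2)[of "(t, s)"] that by (simp add: r'_def)
  have slice: "continuous_on {0..T} (\<lambda>t. u t s)" if "continuous_on ({0..T} \<times> I) (\<lambda>(t, s). u t s)" "s \<in> I"
    for u :: "real \<Rightarrow> real \<Rightarrow> real^2" and s
  proof -
    have "continuous_on {0..T} (\<lambda>t. (\<lambda>(t, s). u t s) (t, s))"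
      by (rule continuous_on_compose2[OF that(1)]) (use that(2) in \<open>auto intro!: continuous_intros\<close>)
    then show ?thesis by simp
  qed
  have ex': "norm (R t s' - R t s - (s' - s) *\<^sub>R r' t s) \<le> C * (\<bar>s' - s\<bar> * sqrt \<bar>s' - s\<bar>)"
    if t: "t \<in> {0..T}" and s: "s \<in> I" "s' \<in> I" for t s s'
  proof (rule dense_le[OF T _ Q _ t])
    show "continuous_on {0..T} (\<lambda>t. norm (R t s' - R t s - (s' - s) *\<^sub>R r' t s))"
      by (intro continuous_intros slice[OF R[folded I_def]] slice[OF r'c] s)
    fix t assume "t \<in> {0..T}" "Q t"
    then show "norm (R t s' - R t s - (s' - s) *\<^sub>R r' t s) \<le> C * (\<bar>s' - s\<bar> * sqrt \<bar>s' - s\<bar>)"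
      using ex[of t s s'] s r'r by (simp add: D_def I_def)
  qed
  have der: "(R t has_vector_derivative r' t s) (at s within I)" if t: "t \<in> {0..T}" and s: "s \<in> I" for t s
    unfolding has_vector_derivative_def has_derivative_within_alt
  proof (intro conjI allI impI bounded_linear_scaleR_left)
    fix e :: real assume e: "e > 0"
    show "\<exists>d>0. \<forall>z\<in>I. norm (z - s) < d \<longrightarrow> norm (R t z - R t s - (z - s) *\<^sub>R r' t s) \<le> e * norm (z - s)"
    proof (intro exI[of _ "(e / (C + 1))^2"] conjI ballI impI)
      fix z assume z: "z \<in> I" "norm (z - s) < (e / (C + 1))^2"
      then have "sqrt \<bar>z - s\<bar> \<le> sqrt ((e / (C + 1))^2)" by (intro real_sqrt_le_mono) simp
      also have "\<dots> = e / (C + 1)" using e C by simp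
      finally have "(C + 1) * sqrt \<bar>z - s\<bar> \<le> e" using C by (simp add: field_simps)
      moreover have "0 \<le> sqrt \<bar>z - s\<bar>" by simp
      ultimately have "C * sqrt \<bar>z - s\<bar> \<le> e" unfolding distrib_right by linarith
      then have "(C * sqrt \<bar>z - s\<bar>) * \<bar>z - s\<bar> \<le> e * \<bar>z - s\<bar>" by (rule mult_right_mono) simp
      then show "norm (R t z - R t s - (z - s) *\<^sub>R r' t s) \<le> e * norm (z - s)" using ex'[OF t s z(1)] by (simp add: algebra_simps)
    qed (use e C in simp)
  qed
  show thesis by (rule that[of r']) (use r'c der r'r in \<open>auto simp: I_def D_def\<close>)
qed

section \<open>Evaluation of integrals with values in H2 by functionals\<close>

lemma L2_norm_le_H2_norm: "L2_norm u \<le> H2_norm u"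
  unfolding H2_norm_def by (rule real_le_rsqrt) simp

text \<open>Integration over \<open>[0, b]\<close> is a bounded functional for the H2 norm, with
  constant 3 since \<open>sqrt (2 * pi) \<le> 3\<close>. These functionals carry H2-valued integrals
  into the plane, and together, for all \<open>b\<close>, they determine a continuous
  function.\<close>

lemma circle_functional_bound:
  assumes "L2 u" "L2 v" "b \<in> \<I>"
  shows "norm (integral {0..b} u - integral {0..b} v) \<le> 3 * H2_norm (\<lambda>s. u s - v s)"
proof -
  have sub: "{0..b} \<subseteq> \<I>" using assms(3) by auto
  have "integral {0..b} u - integral {0..b} v = integral {0..b} (\<lambda>s. u s - v s)"
    by (intro Henstock_Kurzweil_Integration.integral_diff[symmetric] L2_integrable_on assms sub)
  also have "norm \<dots> \<le> L2_norm (\<lambda>s. u s - v s) * sqrt b"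
    using primitive_holder[OF L2_diff[OF assms(1,2)], of 0 b] assms(3) by simp
  also have "\<dots> \<le> H2_norm (\<lambda>s. u s - v s) * 3"
  proof (intro mult_mono L2_norm_le_H2_norm)
    have "sqrt b \<le> sqrt (3^2)" using assms(3) pi_less_4 by (intro real_sqrt_le_mono) simp
    then show "sqrt b \<le> 3" by simp
    show "0 \<le> H2_norm (\<lambda>s. u s - v s)" by (simp add: H2_norm_def)
  qed (use assms(3) in simp)
  finally show ?thesis by simp
qed

lemma H2_imp_L2: "H2 u ==> L2 u"
  by (simp add: H2_def H1_def)

lemma H2_simple_functional:
  assumes \<sigma>: "H2_simple T \<sigma>" and b: "b \<in> \<I>"
  shows "integrable (lebesgue_on {0..T}) (\<lambda>t. integral {0..b} (\<sigma> t))"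
    and "(LINT t|lebesgue_on {0..T}. integral {0..b} (\<sigma> t)) = integral {0..b} (H2_simple_integral T \<sigma>)"
proof -
  define W where "W = \<sigma> ` {0..T}"
  define A where "A w = {t \<in> {0..T}. \<sigma> t = w}" for w
  have W: "finite W" "\<And>w. w \<in> W ==> L2 w" using \<sigma> by (auto simp: W_def H2_simple_def intro: H2_imp_L2)
  have A: "A w \<in> sets lebesgue" "A w \<subseteq> {0..T}" for w using \<sigma> by (auto simp: A_def H2_simple_def)
  have As: "A w \<in> sets (lebesgue_on {0..T})" for w using A by (auto simp: sets_restrict_space_iff)
  have fin: "emeasure (lebesgue_on {0..T}) (A w) < \<infinity>" for w
    using finite_measure.emeasure_finite[OF finite_measure_lebesgue_on, of "{0..T}" "A w"] by (simp add: less_top[symmetric])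
  have eq: "integral {0..b} (\<sigma> t) = (\<Sum>w\<in>W. indicator (A w) t *\<^sub>R integral {0..b} w)" if "t \<in> space (lebesgue_on {0..T})" for t
  proof -
    have "(\<Sum>w\<in>W. indicator (A w) t *\<^sub>R integral {0..b} w) = (\<Sum>w\<in>W. if w = \<sigma> t then integral {0..b} w else 0)"
      using that by (intro sum.cong) (auto simp: A_def indicator_def)
    then show ?thesis using W(1) that by (simp add: W_def)
  qed
  have i: "has_bochner_integral (lebesgue_on {0..T}) (\<lambda>t. \<Sum>w\<in>W. indicator (A w) t *\<^sub>R integral {0..b} w)
      (\<Sum>w\<in>W. measure (lebesgue_on {0..T}) (A w) *\<^sub>R integral {0..b} w)"
    by (intro has_bochner_integral_sum has_bochner_integral_indicator As fin)
  then have i': "has_bochner_integral (lebesgue_on {0..T}) (\<lambda>t. integral {0..b} (\<sigma> t))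
      (\<Sum>w\<in>W. measure (lebesgue_on {0..T}) (A w) *\<^sub>R integral {0..b} w)"
    by (rule has_bochner_integral_cong[THEN iffD2, rotated 3]) (simp_all add: eq)
  show "integrable (lebesgue_on {0..T}) (\<lambda>t. integral {0..b} (\<sigma> t))" using i' by (auto intro: integrable.intros)
  have "(\<Sum>w\<in>W. measure (lebesgue_on {0..T}) (A w) *\<^sub>R integral {0..b} w) = (\<Sum>w\<in>W. integral {0..b} (\<lambda>s. measure lebesgue (A w) *\<^sub>R w s))"
    using A by (intro sum.cong) (simp_all add: measure_restrict_space)
  also have "\<dots> = integral {0..b} (H2_simple_integral T \<sigma>)"
    unfolding H2_simple_integral_def W_def[symmetric] A_def[symmetric] using b
    by (intro Henstock_Kurzweil_Integration.integral_sum[symmetric] W(1) integrable_cmul L2_integrable_on W(2)) auto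
  finally show "(LINT t|lebesgue_on {0..T}. integral {0..b} (\<sigma> t)) = integral {0..b} (H2_simple_integral T \<sigma>)"
    using has_bochner_integral_integral_eq[OF i'] by simp
qed

lemma H2_simple_integral_L2:
  assumes "H2_simple T \<sigma>"
  shows "L2 (H2_simple_integral T \<sigma>)"
proof -
  have L: "finite W ==> (\<And>w. w \<in> W ==> L2 w) ==> L2 (\<lambda>s. \<Sum>w\<in>W. a w *\<^sub>R w s)" for W and a :: "(real \<Rightarrow> real^2) \<Rightarrow> real"
  proof (induction rule: finite_induct)
    case empty
    show ?case using L2_continuous[OF continuous_on_const[of _ "0 :: real^2"]] by simp
  next
    case (insert w W)
    have sc: "L2 u ==> L2 (\<lambda>s. c *\<^sub>R u s)" for u c by (auto simp: L2_def power_mult_distrib)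
    have "L2 (\<lambda>s. (\<Sum>w\<in>W. a w *\<^sub>R w s) - (- a w) *\<^sub>R w s)" using insert by (intro L2_diff sc) auto
    then show ?case using insert(1,2) by (simp add: add.commute)
  qed
  show ?thesis unfolding H2_simple_integral_def
  proof (rule L)
    show "finite (\<sigma> ` {0..T})" using assms by (simp add: H2_simple_def)
    show "L2 w" if "w \<in> \<sigma> ` {0..T}" for w using assms that by (auto simp: H2_simple_def intro: H2_imp_L2)
  qed
qed

lemma H2_measurable_functional:
  assumes u: "H2_measurable T u" and b: "b \<in> \<I>"
  shows "(\<lambda>t. integral {0..b} (u t)) \<in> borel_measurable (lebesgue_on {0..T})"
proof -
  obtain \<sigma> where \<sigma>: "\<And>n. H2_simple T (\<sigma> n)" "AE t in lebesgue_on {0..T}. (\<lambda>n. H2_norm (\<lambda>s. u t s - \<sigma> n t s)) \<longlonglongrightarrow> 0"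
    using u by (auto simp: H2_measurable_def)
  obtain S where S: "negligible S" "\<And>t. t \<in> {0..T} - S ==> (\<lambda>n. H2_norm (\<lambda>s. u t s - \<sigma> n t s)) \<longlonglongrightarrow> 0"
    using AE_lebesgue_on_negligible[OF \<sigma>(2)] by blast
  have "(\<lambda>t. integral {0..b} (u t)) measurable_on {0..T}"
  proof (rule measurable_on_limit[OF _ S(1)])
    show "(\<lambda>t. integral {0..b} (\<sigma> n t)) measurable_on {0..T}" for n
      using borel_measurable_integrable[OF H2_simple_functional(1)[OF \<sigma>(1) b]] by (simp add: measurable_on_iff_borel_measurable)
    fix t assume t: "t \<in> {0..T} - S"
    have "(\<lambda>n. integral {0..b} (\<sigma> n t) - integral {0..b} (u t)) \<longlonglongrightarrow> 0"
    proof (rule Lim_null_comparison)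
      show "\<forall>\<^sub>F n in sequentially. norm (integral {0..b} (\<sigma> n t) - integral {0..b} (u t)) \<le> 3 * H2_norm (\<lambda>s. u t s - \<sigma> n t s)"
      proof (intro always_eventually allI)
        fix n
        have "L2 (u t)" "L2 (\<sigma> n t)" using u \<sigma>(1)[of n] t by (auto simp: H2_measurable_def H2_simple_def intro: H2_imp_L2)
        from circle_functional_bound[OF this b]
        show "norm (integral {0..b} (\<sigma> n t) - integral {0..b} (u t)) \<le> 3 * H2_norm (\<lambda>s. u t s - \<sigma> n t s)"
          by (simp add: norm_minus_commute)
      qed
      show "(\<lambda>n. 3 * H2_norm (\<lambda>s. u t s - \<sigma> n t s)) \<longlonglongrightarrow> 0" using tendsto_mult_right_zero[OF S(2)[OF t]] by simp
    qed
    then show "(\<lambda>n. integral {0..b} (\<sigma> n t)) \<longlonglongrightarrow> integral {0..b} (u t)" by (simp add: LIM_zero_iff)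
  qed
  then show ?thesis by (simp add: measurable_on_iff_borel_measurable)
qed

text \<open>For simple functions the functional commutes with the integral. In the limit, the left
  side converges because the functional values converge in L1 in time, the right side because the
  simple integrals converge in the H2 norm.\<close>

lemma has_H2_integral_functional:
  assumes i: "has_H2_integral T u v" and b: "b \<in> \<I>"
  shows "(LINT t|lebesgue_on {0..T}. integral {0..b} (u t)) = integral {0..b} v"
proof -
  let ?L = "lebesgue_on {0..T}"
  obtain \<sigma> where \<sigma>: "\<And>n. H2_simple T (\<sigma> n)" "(\<lambda>n. \<integral>\<^sup>+t. ennreal (H2_norm (\<lambda>s. u t s - \<sigma> n t s)) \<partial>?L) \<longlonglongrightarrow> 0"
    "(\<lambda>n. H2_norm (\<lambda>s. H2_simple_integral T (\<sigma> n) s - v s)) \<longlonglongrightarrow> 0"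
    using i by (auto simp: has_H2_integral_def)
  have u: "H2_measurable T u" and v: "L2 v" using i by (auto simp: has_H2_integral_def intro: H2_imp_L2)
  note m [measurable] = H2_measurable_functional[OF u b]
  note si = H2_simple_functional[OF \<sigma>(1) b]
  have le: "norm (integral {0..b} (\<sigma> n t) - integral {0..b} (u t)) \<le> 3 * H2_norm (\<lambda>s. u t s - \<sigma> n t s)"
    if "t \<in> space ?L" for n t
  proof -
    have "L2 (u t)" "L2 (\<sigma> n t)" using u \<sigma>(1)[of n] that by (auto simp: H2_measurable_def H2_simple_def intro: H2_imp_L2)
    from circle_functional_bound[OF this b] show ?thesis by (simp add: norm_minus_commute)
  qed
  have lim: "(\<lambda>n. \<integral>\<^sup>+t. norm (integral {0..b} (\<sigma> n t) - integral {0..b} (u t)) \<partial>?L) \<longlonglongrightarrow> 0"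
  proof (rule tendsto_sandwich[OF _ _ tendsto_const])
    have "(\<lambda>n. 3 * (\<integral>\<^sup>+t. ennreal (H2_norm (\<lambda>s. u t s - \<sigma> n t s)) \<partial>?L)) \<longlonglongrightarrow> 3 * 0"
      by (intro ennreal_tendsto_cmult \<sigma>(2)) simp
    then show "(\<lambda>n. 3 * (\<integral>\<^sup>+t. ennreal (H2_norm (\<lambda>s. u t s - \<sigma> n t s)) \<partial>?L)) \<longlonglongrightarrow> 0" by simp
    show "\<forall>\<^sub>F n in sequentially. (\<integral>\<^sup>+t. norm (integral {0..b} (\<sigma> n t) - integral {0..b} (u t)) \<partial>?L)
        \<le> 3 * (\<integral>\<^sup>+t. ennreal (H2_norm (\<lambda>s. u t s - \<sigma> n t s)) \<partial>?L)"
    proof (intro always_eventually allI)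
      fix n
      have hm: "(\<lambda>t. ennreal (norm (integral {0..b} (\<sigma> n t) - integral {0..b} (u t)) / 3)) \<in> borel_measurable ?L"
        using borel_measurable_integrable[OF si(1)[of n]] by measurable
      have "(\<integral>\<^sup>+t. norm (integral {0..b} (\<sigma> n t) - integral {0..b} (u t)) \<partial>?L)
          = (\<integral>\<^sup>+t. 3 * ennreal (norm (integral {0..b} (\<sigma> n t) - integral {0..b} (u t)) / 3) \<partial>?L)"
        by (intro nn_integral_cong) (simp add: ennreal_mult[symmetric] flip: ennreal_numeral)
      also have "\<dots> = 3 * (\<integral>\<^sup>+t. ennreal (norm (integral {0..b} (\<sigma> n t) - integral {0..b} (u t)) / 3) \<partial>?L)"
        by (rule nn_integral_cmult[OF hm])
      also have "\<dots> \<le> 3 * (\<integral>\<^sup>+t. ennreal (H2_norm (\<lambda>s. u t s - \<sigma> n t s)) \<partial>?L)"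
        using le by (intro mult_left_mono nn_integral_mono ennreal_leI) (auto simp: field_simps)
      finally show "(\<integral>\<^sup>+t. norm (integral {0..b} (\<sigma> n t) - integral {0..b} (u t)) \<partial>?L)
        \<le> 3 * (\<integral>\<^sup>+t. ennreal (H2_norm (\<lambda>s. u t s - \<sigma> n t s)) \<partial>?L)" .
    qed
  qed simp
  \<comment> \<open>Integrability is inherited from a single simple function at L1 distance less
    than 1.\<close>
  have int: "integrable ?L (\<lambda>t. integral {0..b} (u t))"
  proof -
    have "\<forall>\<^sub>F n in sequentially. (\<integral>\<^sup>+t. norm (integral {0..b} (\<sigma> n t) - integral {0..b} (u t)) \<partial>?L) < 1"
      using order_tendstoD(2)[OF lim, of 1] by simp
    then obtain n where n: "(\<integral>\<^sup>+t. norm (integral {0..b} (\<sigma> n t) - integral {0..b} (u t)) \<partial>?L) < 1"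
      by (auto simp: eventually_sequentially)
    have "integrable ?L (\<lambda>t. integral {0..b} (\<sigma> n t) - integral {0..b} (u t))"
    proof (rule integrableI_bounded)
      show "(\<lambda>t. integral {0..b} (\<sigma> n t) - integral {0..b} (u t)) \<in> borel_measurable ?L"
        using borel_measurable_integrable[OF si(1)[of n]] by measurable
      show "(\<integral>\<^sup>+t. norm (integral {0..b} (\<sigma> n t) - integral {0..b} (u t)) \<partial>?L) < \<infinity>"
        using n by (rule order_less_trans) simp
    qed
    from Bochner_Integration.integrable_diff[OF si(1)[of n] this] show ?thesis by simp
  qed
  have a: "(\<lambda>n. LINT t|?L. integral {0..b} (\<sigma> n t)) \<longlonglongrightarrow> (LINT t|?L. integral {0..b} (u t))"
    by (rule tendsto_L1_int[OF si(1) int lim])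
  have "(\<lambda>n. integral {0..b} (H2_simple_integral T (\<sigma> n)) - integral {0..b} v) \<longlonglongrightarrow> 0"
  proof (rule Lim_null_comparison)
    show "\<forall>\<^sub>F n in sequentially. norm (integral {0..b} (H2_simple_integral T (\<sigma> n)) - integral {0..b} v)
        \<le> 3 * H2_norm (\<lambda>s. H2_simple_integral T (\<sigma> n) s - v s)"
      by (intro always_eventually allI circle_functional_bound H2_simple_integral_L2 \<sigma>(1) v b)
    show "(\<lambda>n. 3 * H2_norm (\<lambda>s. H2_simple_integral T (\<sigma> n) s - v s)) \<longlonglongrightarrow> 0" using tendsto_mult_right_zero[OF \<sigma>(3)] by simp
  qed
  then have "(\<lambda>n. LINT t|?L. integral {0..b} (\<sigma> n t)) \<longlonglongrightarrow> integral {0..b} v" by (simp add: LIM_zero_iff si(2))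
  from LIMSEQ_unique[OF a this] show ?thesis .
qed

section \<open>The time derivative in the classical sense\<close>

lemma continuous_slices:
  assumes "continuous_on (A \<times> B) (\<lambda>(t, s). u t s)"
  shows "t \<in> A ==> continuous_on B (\<lambda>s. u t s)" "s \<in> B ==> continuous_on A (\<lambda>t. u t s)"
proof -
  show "continuous_on B (\<lambda>s. u t s)" if "t \<in> A"
  proof -
    have "continuous_on B (\<lambda>s. (\<lambda>(t, s). u t s) (t, s))"
      by (rule continuous_on_compose2[OF assms]) (use that in \<open>auto intro!: continuous_intros\<close>)
    then show ?thesis by simp
  qed
  show "continuous_on A (\<lambda>t. u t s)" if "s \<in> B"
  proof -
    have "continuous_on A (\<lambda>t. (\<lambda>(t, s). u t s) (t, s))"
      by (rule continuous_on_compose2[OF assms]) (use that in \<open>auto intro!: continuous_intros\<close>)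
    then show ?thesis by simp
  qed
qed

lemma continuous_partial_integral:
  fixes u :: "real \<Rightarrow> real \<Rightarrow> 'a::banach"
  assumes "continuous_on (A \<times> {p..q}) (\<lambda>(t, s). u t s)"
  shows "continuous_on A (\<lambda>t. integral {p..q} (u t))"
  using integral_continuous_on_param[of A p q u] assms by simp

lemma LINT_indicator_interval:
  fixes U :: "real \<Rightarrow> real^2"
  assumes U: "continuous_on {0..T} U" and pq: "0 \<le> p" "q \<le> T"
  shows "(LINT t|lebesgue_on {0..T}. indicator {p..q} t *\<^sub>R U t) = integral {p..q} U"
proof -
  have Ui: "integrable (lebesgue_on {0..T}) U" by (rule continuous_lebesgue_on_integral(1)[OF U])
  have ind: "indicator {p..q} \<in> borel_measurable (lebesgue_on {0..T})" by (intro measurable_restrict_space1 measurable_completion) simp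
  have "integrable (lebesgue_on {0..T}) (\<lambda>t. indicator {p..q} t *\<^sub>R U t)"
    by (rule Bochner_Integration.integrable_bound[OF Ui borel_measurable_scaleR[OF ind borel_measurable_integrable[OF Ui]]])
      (auto simp: indicator_def)
  then have "(LINT t|lebesgue_on {0..T}. indicator {p..q} t *\<^sub>R U t) = integral {0..T} (\<lambda>t. indicator {p..q} t *\<^sub>R U t)"
    by (rule lebesgue_integral_eq_integral) simp
  also have "\<dots> = integral {0..T} (\<lambda>t. if t \<in> {p..q} then U t else 0)"
    by (intro arg_cong[where f = "integral {0..T}"]) (auto simp: fun_eq_iff)
  also have "\<dots> = integral ({p..q} \<inter> {0..T}) U" by (rule Henstock_Kurzweil_Integration.integral_restrict_Int)
  also have "{p..q} \<inter> {0..T} = {p..q}" using pq by auto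
  finally show ?thesis .
qed

text \<open>The weak identity is unfolded in three stages: the functionals turn it into increments
  between interior times for the integrals over \<open>[0, b]\<close>; comparison of these integrals
  gives the increments at a fixed \<open>s\<close>; continuity adds the two ends of the time
  interval.\<close>

lemma time_derivative_classical:
  assumes T: "0 < T" and X: "continuous_on ({0..T} \<times> \<I>) (\<lambda>(t, s). X t s)"
    and w: "H2_measurable T w" "is_weak_time_deriv T X w" and V: "continuous_on ({0..T} \<times> \<I>) (\<lambda>(t, s). V t s)"
    and ae: "AE t in lebesgue_on {0..T}. AE s in circle. w t s = V t s" and t: "t \<in> {0..T}" and s: "s \<in> \<I>"
  shows "((\<lambda>t. X t s) has_vector_derivative V t s) (at t within {0..T})"
proof -
  have inc: "integral {0..b} (X q) - integral {0..b} (X p) = integral {p..q} (\<lambda>t. integral {0..b} (V t))"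
    if pq: "0 < p" "p < q" "q < T" and b: "b \<in> \<I>" for p q b
  proof -
    let ?W = "\<lambda>t. integral {0..b} (w t)" and ?U = "\<lambda>t. integral {0..b} (V t)"
    have sub: "{0..T} \<times> {0..b} \<subseteq> {0..T} \<times> \<I>" "{0..b} \<subseteq> \<I>" using b by auto
    have Hc: "continuous_on {0..T} (\<lambda>t. integral {0..b} (X t))" and Uc: "continuous_on {0..T} ?U"
      by (intro continuous_partial_integral continuous_on_subset[OF _ sub(1)] X V)+
    have Wae: "AE t in lebesgue_on {0..T}. ?U t = ?W t"
      using ae by (rule AE_mp) (intro AE_I2 impI, rule integral_cong_AE_lebesgue_on[OF _ sub(2), symmetric])
    note Wm = H2_measurable_functional[OF w(1) b]
    have Wi: "integrable (lebesgue_on {0..T}) ?W" by (rule integrable_cong_AE_imp[OF continuous_lebesgue_on_integral(1)[OF Uc] Wm Wae])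
    have "integral {0..b} (X q) - integral {0..b} (X p) = (LINT t|lebesgue_on {0..T}. indicator {p..q} t *\<^sub>R ?W t)"
    proof (rule weak_derivative_increment[OF Hc Wi _ pq])
      fix \<phi> assume \<phi>: "smooth \<phi>" "\<exists>a b. 0 < a \<and> b < T \<and> (\<forall>t. t \<notin> {a..b} \<longrightarrow> \<phi> t = 0)"
      obtain v where v: "has_H2_integral T (\<lambda>t s. deriv \<phi> t *\<^sub>R X t s) v" "has_H2_integral T (\<lambda>t s. - (\<phi> t *\<^sub>R w t s)) v"
        using w(2) \<phi> unfolding is_weak_time_deriv_def by blast
      from has_H2_integral_functional[OF v(1) b] has_H2_integral_functional[OF v(2) b]
      show "(LINT t|lebesgue_on {0..T}. deriv \<phi> t *\<^sub>R integral {0..b} (X t)) = - (LINT t|lebesgue_on {0..T}. \<phi> t *\<^sub>R ?W t)"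
        by simp
    qed
    also have "\<dots> = (LINT t|lebesgue_on {0..T}. indicator {p..q} t *\<^sub>R ?U t)"
    proof (rule integral_cong_AE)
      have ind [measurable]: "indicator {p..q} \<in> borel_measurable (lebesgue_on {0..T})"
        by (intro measurable_restrict_space1 measurable_completion) simp
      note [measurable] = Wm borel_measurable_integrable[OF continuous_lebesgue_on_integral(1)[OF Uc]]
      show "(\<lambda>t. indicator {p..q} t *\<^sub>R ?W t) \<in> borel_measurable (lebesgue_on {0..T})"
        "(\<lambda>t. indicator {p..q} t *\<^sub>R ?U t) \<in> borel_measurable (lebesgue_on {0..T})" by measurable
      show "AE t in lebesgue_on {0..T}. indicator {p..q} t *\<^sub>R ?W t = indicator {p..q} t *\<^sub>R ?U t"
        using Wae by (rule AE_mp) (intro AE_I2 impI, simp)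
    qed
    also have "\<dots> = integral {p..q} ?U" by (rule LINT_indicator_interval[OF Uc]) (use pq in auto)
    finally show ?thesis .
  qed
  \<comment> \<open>The defect \<open>g\<close> is continuous in \<open>s\<close> and its integral
    over \<open>[0, b]\<close> vanishes for every \<open>b\<close>; differentiating in
    \<open>b\<close> gives \<open>g s = 0\<close>.\<close>
  have pt: "X q s - X p s = integral {p..q} (\<lambda>t. V t s)" if pq: "0 < p" "p < q" "q < T" for p q
  proof -
    define g where "g s = X q s - X p s - integral {p..q} (\<lambda>t. V t s)" for s
    have swapV: "continuous_on (\<I> \<times> {p..q}) (\<lambda>(s, t). V t s)"
    proof -
      have "continuous_on (\<I> \<times> {p..q}) (\<lambda>x. (\<lambda>(t, s). V t s) (snd x, fst x))"
        by (rule continuous_on_compose2[OF V]) (use pq in \<open>auto intro!: continuous_intros\<close>)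
      then show ?thesis by (simp add: case_prod_beta)
    qed
    have Ic: "continuous_on \<I> (\<lambda>s. integral {p..q} (\<lambda>t. V t s))" by (rule continuous_partial_integral[OF swapV])
    have Xc: "continuous_on \<I> (X r)" if "r \<in> {0..T}" for r by (rule continuous_slices(1)[OF X that])
    have gc: "continuous_on \<I> g" unfolding g_def using pq by (intro continuous_intros Xc Ic) auto
    have z: "integral {0..b} g = 0" if b: "b \<in> \<I>" for b
    proof -
      have sub: "{0..b} \<subseteq> \<I>" using b by auto
      have Vc: "continuous_on (cbox (p, 0) (q, b)) (\<lambda>(x, y). V x y)"
        unfolding cbox_Pair_eq by (rule continuous_on_subset[OF V]) (use pq b in auto)
      have "integral {0..b} g = integral {0..b} (X q) - integral {0..b} (X p) - integral {0..b} (\<lambda>s. integral {p..q} (\<lambda>t. V t s))"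
        unfolding g_def using pq by (simp add: Henstock_Kurzweil_Integration.integral_diff integrable_diff integrable_continuous_real
            continuous_on_subset[OF Xc sub] continuous_on_subset[OF Ic sub])
      then show ?thesis using inc[OF pq b] integral_swap_continuous[OF Vc] by simp
    qed
    have "((\<lambda>b. integral {0..b} g) has_vector_derivative g s) (at s within \<I>)" by (rule integral_has_vector_derivative[OF gc s])
    moreover have "((\<lambda>b. integral {0..b} g) has_vector_derivative 0) (at s within \<I>)"
      by (rule has_vector_derivative_transform[OF s z has_vector_derivative_const])
    ultimately have "g s = 0" using vector_derivative_unique_within_closed_interval[of 0 "2 * pi" s] s by simp
    then show ?thesis by (simp add: g_def)
  qed
  have Xs: "continuous_on {0..T} (\<lambda>t. X t s)" and Vs: "continuous_on {0..T} (\<lambda>t. V t s)"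
    by (rule continuous_slices(2)[OF X s] continuous_slices(2)[OF V s])+
  define \<psi> where "\<psi> t = X t s - integral {0..t} (\<lambda>r. V r s)" for t
  have \<psi>c: "continuous_on {0..T} \<psi>" unfolding \<psi>_def
    by (intro continuous_intros Xs indefinite_integral_continuous_1 integrable_continuous_real Vs)
  have step: "\<psi> q = \<psi> p" if "0 < p" "p < q" "q < T" for p q
  proof -
    have "integral {0..p} (\<lambda>r. V r s) + integral {p..q} (\<lambda>r. V r s) = integral {0..q} (\<lambda>r. V r s)"
      using that by (intro Henstock_Kurzweil_Integration.integral_combine integrable_continuous_real continuous_on_subset[OF Vs]) auto
    then show ?thesis using pt[OF that] by (simp add: \<psi>_def algebra_simps)
  qed
  have \<psi>: "\<psi> r = \<psi> (T / 2)" if "r \<in> {0..T}" for r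
  proof (rule continuous_constant_on_closure[of "{0<..<T}"])
    show "continuous_on (closure {0<..<T}) \<psi>" using \<psi>c T by simp
    show "\<psi> x = \<psi> (T / 2)" if "x \<in> {0<..<T}" for x
      using step[of x "T / 2"] step[of "T / 2" x] that T by (cases x "T / 2" rule: linorder_cases) auto
  qed (use that T in simp)
  have "((\<lambda>t. \<psi> (T / 2) + integral {0..t} (\<lambda>r. V r s)) has_vector_derivative 0 + V t s) (at t within {0..T})"
    by (intro has_vector_derivative_add has_vector_derivative_const integral_has_vector_derivative Vs t)
  then have d: "((\<lambda>t. \<psi> (T / 2) + integral {0..t} (\<lambda>r. V r s)) has_vector_derivative V t s) (at t within {0..T})" by simp
  have "X r s = \<psi> (T / 2) + integral {0..r} (\<lambda>r. V r s)" if "r \<in> {0..T}" for r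
    using \<psi>[OF that] unfolding \<psi>_def by (simp add: diff_eq_eq)
  from has_vector_derivative_transform[OF t this d] show ?thesis .
qed

lemma H2_repr_continuous:
  assumes "H2 u" "H2_norm u \<le> K" and c: "continuous_on \<I> u"
  shows "\<exists>y k c. H2_repr u K u y k c"
proof -
  obtain v y k c where r: "H2_repr u K v y k c" using H2_continuous_repr[OF assms(1,2)] by blast
  have eq: "u s = v s" if "s \<in> \<I>" for s by (rule AE_eq_continuous[OF _ c _ _ that]) (use r in \<open>auto simp: H2_repr_def\<close>)
  have "(u has_vector_derivative y s) (at s within \<I>)" if "s \<in> \<I>" for s
    using has_vector_derivative_transform[OF that eq] r that by (auto simp: H2_repr_def)
  moreover note r' = r[unfolded H2_repr_def]
  moreover have "u 0 = u (2 * pi)" using r' eq[of 0] eq[of "2 * pi"] by simp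
  moreover have "\<forall>s\<in>\<I>. norm (u s) \<le> 8 * K" using r' eq by simp
  ultimately have "H2_repr u K u y k c" unfolding H2_repr_def using c by blast
  then show ?thesis by blast
qed

lemma H2_repr_holder:
  assumes "H2_repr u K v y k c" "r \<in> \<I>" "s \<in> \<I>"
  shows "norm (y s - y r) \<le> K * sqrt \<bar>s - r\<bar>"
proof -
  have k: "L2 k" "L2_norm k \<le> K" "y s - y r = integral {0..s} k - integral {0..r} k" using assms(1) by (auto simp: H2_repr_def)
  have "norm (y s - y r) \<le> L2_norm k * sqrt \<bar>s - r\<bar>" unfolding k(3) by (rule primitive_holder[OF k(1) assms(2,3)])
  also have "\<dots> \<le> K * sqrt \<bar>s - r\<bar>" using k(2) by (intro mult_right_mono) auto
  finally show ?thesis .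
qed

text \<open>Solved for the weak derivative of the tangent, the flow equation shows that it coincides
  almost everywhere with the continuous function \<open>r\<close>. The tangent is then a primitive
  of \<open>r\<close> and classically differentiable.\<close>

lemma tangent_equation:
  assumes y: "continuous_on \<I> y" "\<And>s. s \<in> \<I> ==> C \<le> norm (y s)" and C: "0 < C"
    and dx: "\<And>s. s \<in> {0<..<2 * pi} ==> dxi x s = y s"
    and H: "H1 (tangent x)" and V: "continuous_on \<I> V" "AE s in circle. w s = V s"
    and eq: "AE s in circle. w s = (1 / speed x s) *\<^sub>R weak_deriv (tangent x) s - a *\<^sub>R perp (tangent x s)"
    and s: "s \<in> \<I>"
  shows "((\<lambda>s. y s /\<^sub>R norm (y s)) has_vector_derivative norm (y s) *\<^sub>R (V s + a *\<^sub>R perp (y s /\<^sub>R norm (y s)))) (at s within \<I>)"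
proof -
  define tau where "tau s = y s /\<^sub>R norm (y s)" for s
  define r where "r s = norm (y s) *\<^sub>R (V s + a *\<^sub>R perp (tau s))" for s
  have y0: "norm (y s) \<noteq> 0" if "s \<in> \<I>" for s using y(2)[OF that] C by linarith
  have tc: "continuous_on \<I> tau" unfolding tau_def using y0 by (intro continuous_intros y(1)) auto
  have rc: "continuous_on \<I> r" unfolding r_def
    by (intro continuous_intros y(1) V(1) bounded_linear.continuous_on[OF bounded_linear_perp] tc)
  note int = AE_circle_interior
  obtain c v where "H1_repr (tangent x) c v" using H1_continuous_repr[OF H] by blast
  then have v: "v s = c + integral {0..s} (weak_deriv (tangent x))" "AE s in circle. tangent x s = v s" "continuous_on \<I> v" for s
    unfolding H1_repr_def by blast+
  have tv: "tau s = v s" if "s \<in> \<I>" for s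
  proof (rule AE_eq_continuous[OF _ tc v(3) _ that])
    show "AE s in circle. tau s = v s" using int v(2) by eventually_elim (simp add: tangent_def tau_def dx)
  qed simp
  have wr: "AE s in circle. weak_deriv (tangent x) s = r s" using int V(2) eq
  proof eventually_elim
    case (elim s)
    have n: "norm (y s) \<noteq> 0" using y0 elim(1) by simp
    have "(1 / norm (y s)) *\<^sub>R weak_deriv (tangent x) s - a *\<^sub>R perp (tau s) = V s"
      using elim by (simp add: speed_def tangent_def dx tau_def)
    then have "V s + a *\<^sub>R perp (tau s) = (1 / norm (y s)) *\<^sub>R weak_deriv (tangent x) s" by (simp add: diff_eq_eq)
    then show ?case using n by (simp add: r_def)
  qed
  have te: "tau s = c + integral {0..s} r" if "s \<in> \<I>" for s
    unfolding tv[OF that] v(1) using that by (subst integral_cong_AE_lebesgue_on[OF wr]) auto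
  have "((\<lambda>s. c + integral {0..s} r) has_vector_derivative 0 + r s) (at s within \<I>)"
    by (intro has_vector_derivative_add has_vector_derivative_const integral_has_vector_derivative rc s)
  from has_vector_derivative_transform[OF s te this]
  have "(tau has_vector_derivative 0 + r s) (at s within \<I>)" .
  then show ?thesis by (simp add: tau_def[abs_def] r_def)
qed

text \<open>Meant for the speed, which is known to agree with the continuous \<open>k\<close> only
  in the interior of the period; measurability of \<open>g\<close> is itself obtained from this
  agreement.\<close>

lemma LINT_circle_cong:
  fixes g k :: "real \<Rightarrow> real"
  assumes k: "continuous_on \<I> k" and eq: "\<And>s. s \<in> {0<..<2 * pi} ==> g s = k s"
  shows "(LINT s|circle. g s) = integral \<I> k"
proof -
  have km: "k \<in> borel_measurable circle" by (rule borel_measurable_integrable[OF integrable_circle_continuous[OF k]])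
  have "g measurable_on \<I>"
  proof (rule measurable_on_limit[of "\<lambda>_. k" _ "{0, 2 * pi}"])
    show "k measurable_on \<I>" using km by (simp add: measurable_on_iff_borel_measurable)
    show "(\<lambda>n. k x) \<longlonglongrightarrow> g x" if "x \<in> \<I> - {0, 2 * pi}" for x using eq[of x] that by simp
  qed simp
  then have gm: "g \<in> borel_measurable circle" by (simp add: measurable_on_iff_borel_measurable)
  from AE_circle_interior have "AE s in circle. g s = k s" by eventually_elim (rule eq)
  then have "(LINT s|circle. g s) = (LINT s|circle. k s)" by (rule integral_cong_AE[OF gm km])
  also have "\<dots> = integral \<I> k" by (rule continuous_lebesgue_on_integral(2)[OF k])
  finally show ?thesis .
qed

text \<open>The derivative relative to the closed period is identified with \<open>dxi\<close> at
  interior points only; the bounds reach the endpoints through continuity of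
  \<open>y\<close>.\<close>

lemma derivative_bounds_closure:
  assumes d: "\<And>s. s \<in> \<I> ==> (x has_vector_derivative y s) (at s within \<I>)"
    and y: "continuous_on \<I> y" and b: "\<And>s. C \<le> norm (dxi x s) \<and> norm (dxi x s) \<le> D"
  shows "\<And>s. s \<in> {0<..<2 * pi} ==> dxi x s = y s" "\<And>s. s \<in> \<I> ==> C \<le> norm (y s) \<and> norm (y s) \<le> D"
proof -
  show dx: "dxi x s = y s" if "s \<in> {0<..<2 * pi}" for s
  proof -
    have "at s within \<I> = at s" using that by (intro at_within_interior) simp
    then show ?thesis using d[of s] that by (intro vector_derivative_at) simp
  qed
  show "C \<le> norm (y s) \<and> norm (y s) \<le> D" if "s \<in> \<I>" for s
  proof
    have c: "continuous_on (closure {0<..<2 * pi}) (\<lambda>s. norm (y s))" using y pi_gt_zero by (simp add: continuous_on_norm)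
    have s: "s \<in> closure {0<..<2 * pi}" using that by simp
    show "C \<le> norm (y s)" by (rule continuous_ge_on_closure[OF c s]) (use b in \<open>simp flip: dx\<close>)
    show "norm (y s) \<le> D" by (rule continuous_le_on_closure[OF c s]) (use b in \<open>simp flip: dx\<close>)
  qed
qed

text \<open>The norm bound and the flow equation hold at almost every time, namely where
  \<open>Q\<close> does. At these times representatives with uniform Hoelder bounds exist.
  \<open>extend_derivative\<close> is applied first to \<open>X\<close> and then to the unit
  tangent, and the remaining properties pass to all times by \<open>dense_le\<close>.\<close>

theorem flow_solution_regular:
  assumes f: "M-lipschitz_on {0<..} f" and T: "0 < T" and C: "0 < C1"
    and sol: "flow_solution f T X0 X" and nrm: "W1inf_H2_norm T X = ereal K"
    and dxb: "\<And>t s. t \<in> {0..T} ==> C1 \<le> norm (dxi (X t) s) \<and> norm (dxi (X t) s) \<le> C2"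
    and G: "1 \<le> G" "M \<le> G" "C2 \<le> G" "1 / C1 \<le> G" "8 * K \<le> G" "\<bar>f 1\<bar> + M * (1 + 2 * pi * C2) \<le> G"
  shows "\<exists>Y V. regular_flow f T M G X Y V \<and> (\<forall>t\<in>{0..T}. L2 (time_deriv T X t)) \<and>
    (AE t in lebesgue_on {0..T}. AE s in circle. time_deriv T X t s = V t s)"
proof -
  define I where "I = \<I>"
  define w where "w = time_deriv T X"
  define F where "F = \<bar>f 1\<bar> + M * (1 + 2 * pi * C2)"
  have M0: "0 \<le> M" using f by (rule lipschitz_on_nonneg)
  have "\<exists>w. Linf_H2 T w \<and> is_weak_time_deriv T X w" using sol by (simp add: flow_solution_def W1inf_H2_def)
  from someI_ex[OF this] have w: "Linf_H2 T w" "is_weak_time_deriv T X w" by (simp_all add: w_def time_deriv_def)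
  have wm: "H2_measurable T w" using w(1) by (simp add: Linf_H2_def)
  have XH: "H2 (X t)" if "t \<in> {0..T}" for t using sol that by (auto simp: flow_solution_def W1inf_H2_def Linf_H2_def H2_measurable_def)
  have wH: "H2 (w t)" if "t \<in> {0..T}" for t using wm that by (auto simp: H2_measurable_def)
  have Xc: "continuous_on ({0..T} \<times> I) (\<lambda>(t, s). X t s)"
    using sol by (auto simp: flow_solution_def intro: continuous_on_subset)
  have Xper: "X t 0 = X t (2 * pi)" if "t \<in> {0..T}" for t using sol that unfolding flow_solution_def periodic_def by (metis add_0)
  define Q where "Q t \<longleftrightarrow> H2_norm (X t) + H2_norm (w t) \<le> K \<and> H1 (tangent (X t)) \<and>
     (AE s in circle. w t s = (1 / speed (X t) s) *\<^sub>R weak_deriv (tangent (X t)) s - f (perimeter (X t)) *\<^sub>R perp (tangent (X t) s))" for t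
  have Q: "AE t in lebesgue_on {0..T}. Q t"
  proof -
    have "AE t in lebesgue_on {0..T}. ereal (H2_norm (X t) + H2_norm (w t)) \<le> ereal K"
      using esssup_AE[of "\<lambda>t. ereal (H2_norm (X t) + H2_norm (w t))" "lebesgue_on {0..T}"]
      unfolding nrm[unfolded W1inf_H2_norm_def, folded w_def] .
    moreover have "AE t in lebesgue_on {0..T}. H1 (tangent (X t)) \<and>
        (AE s in circle. w t s = (1 / speed (X t) s) *\<^sub>R weak_deriv (tangent (X t)) s - f (perimeter (X t)) *\<^sub>R perp (tangent (X t) s))"
      using sol by (simp add: flow_solution_def w_def)
    ultimately show ?thesis by eventually_elim (simp add: Q_def)
  qed
  have Hn: "0 \<le> H2_norm u" for u by (simp add: H2_norm_def)
  have QX: "H2_norm (X t) \<le> K" and Qw: "H2_norm (w t) \<le> K" if "Q t" for t using that Hn[of "X t"] Hn[of "w t"] by (auto simp: Q_def)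
  have K: "0 \<le> K"
  proof (rule AE_lebesgue_on_dense[OF T Q, of 0 1])
    show "0 \<le> K" if "Q t" for t using Hn[of "X t"] QX[OF that] by simp
  qed (use T in simp_all)
  have "\<forall>t. \<exists>y. t \<in> {0..T} \<and> Q t \<longrightarrow> (\<exists>k c. H2_repr (X t) K (X t) y k c)"
    using H2_repr_continuous[OF XH QX continuous_slices(1)[OF Xc, unfolded I_def]] by blast
  from choice[OF this] obtain Y0 where Y0: "\<And>t. t \<in> {0..T} ==> Q t ==> \<exists>k c. H2_repr (X t) K (X t) (Y0 t) k c" by blast
  have "\<forall>t. \<exists>v. t \<in> {0..T} \<and> Q t \<longrightarrow> (\<exists>y k c. H2_repr (w t) K v y k c)"
    using H2_continuous_repr[OF wH Qw] by blast
  from choice[OF this] obtain V0 where V0: "\<And>t. t \<in> {0..T} ==> Q t ==> \<exists>y k c. H2_repr (w t) K (V0 t) y k c" by blast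
  have Yh: "norm (Y0 t s - Y0 t r) \<le> K * sqrt \<bar>s - r\<bar>" if "t \<in> {0..T}" "Q t" "r \<in> I" "s \<in> I" for t r s
    using Y0[OF that(1,2)] H2_repr_holder that(3,4) unfolding I_def by blast
  have Yex: "norm (X t s' - X t s - (s' - s) *\<^sub>R Y0 t s) \<le> K * (\<bar>s' - s\<bar> * sqrt \<bar>s' - s\<bar>)"
    if "t \<in> {0..T}" "Q t" "s \<in> \<I>" "s' \<in> \<I>" for t s s'
    by (rule holder_expansion[OF _ Yh[OF that(1,2), unfolded I_def] K that(3,4)])
      (use Y0[OF that(1,2)] in \<open>auto simp: H2_repr_def\<close>)
  obtain Y where Y: "continuous_on ({0..T} \<times> I) (\<lambda>(t, s). Y t s)"
    "\<And>t s. t \<in> {0..T} ==> s \<in> I ==> (X t has_vector_derivative Y t s) (at s within I)"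
    "\<And>t s. t \<in> {0..T} ==> Q t ==> s \<in> I ==> Y t s = Y0 t s"
  proof (rule extend_derivative[OF T Xc[unfolded I_def] Q K Yex], goal_cases)
    case (5 r')
    show ?case by (rule that[of r', unfolded I_def]) (rule 5; assumption)+
  qed
  have Ys: "continuous_on I (Y t)" if "t \<in> {0..T}" for t by (rule continuous_slices(1)[OF Y(1) that])
  have dx: "dxi (X t) s = Y t s" if "t \<in> {0..T}" "s \<in> {0<..<2 * pi}" for t s
    by (rule derivative_bounds_closure(1)[OF _ Ys[OF that(1), unfolded I_def] dxb[OF that(1)] that(2)])
      (use Y(2)[OF that(1)] in \<open>simp add: I_def\<close>)
  have "C1 \<le> norm (Y t s) \<and> norm (Y t s) \<le> C2" if "t \<in> {0..T}" "s \<in> I" for t s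
    by (rule derivative_bounds_closure(2)[OF _ Ys[OF that(1), unfolded I_def] dxb[OF that(1)] that(2)[unfolded I_def]])
      (use Y(2)[OF that(1)] in \<open>simp add: I_def\<close>)
  then have Yb: "C1 \<le> norm (Y t s)" "norm (Y t s) \<le> C2" if "t \<in> {0..T}" "s \<in> I" for t s using that by simp_all
  define L where "L t = integral I (\<lambda>s. norm (Y t s))" for t
  have per: "perimeter (X t) = L t" if "t \<in> {0..T}" for t unfolding perimeter_def L_def I_def
    by (rule LINT_circle_cong) (use Ys[OF that] dx[OF that] in \<open>auto simp: I_def speed_def intro: continuous_on_norm\<close>)
  have Lb: "0 < L t" "L t \<le> 2 * pi * C2" if t: "t \<in> {0..T}" for t
  proof -
    have i: "((\<lambda>s. norm (Y t s)) has_integral L t) \<I>"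
      unfolding L_def I_def using Ys[OF t] by (intro integrable_integral integrable_continuous_real continuous_on_norm) (simp add: I_def)
    have c: "((\<lambda>s. a) has_integral 2 * pi * a) \<I>" for a :: real using has_integral_const_real[of a 0 "2 * pi"] by simp
    have "2 * pi * C1 \<le> L t" using has_integral_le[OF c i] Yb(1)[OF t] by (simp add: I_def)
    moreover have "0 < 2 * pi * C1" using C by simp
    ultimately show "0 < L t" by linarith
    show "L t \<le> 2 * pi * C2" using has_integral_le[OF i c] Yb(2)[OF t] by (simp add: I_def)
  qed
  have fb: "\<bar>f (L t)\<bar> \<le> F" if t: "t \<in> {0..T}" for t
  proof -
    have "dist (f (L t)) (f 1) \<le> M * dist (L t) 1" using Lb[OF t] by (intro lipschitz_onD[OF f]) auto
    also have "\<dots> \<le> M * (1 + 2 * pi * C2)" using Lb[OF t] M0 by (intro mult_left_mono) (auto simp: dist_real_def)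
    finally show ?thesis by (simp add: F_def dist_real_def)
  qed
  have F0: "0 \<le> F" using fb[of 0] T by force
  have Lc: "continuous_on {0..T} L"
  proof -
    have "continuous_on ({0..T} \<times> I) (\<lambda>(t, s). norm (Y t s))" using continuous_on_norm[OF Y(1)] by (simp add: case_prod_beta)
    from continuous_partial_integral[OF this[unfolded I_def]] show ?thesis by (simp add: L_def[abs_def] I_def)
  qed
  have fLc: "continuous_on {0..T} (\<lambda>t. f (L t))"
    by (rule continuous_on_compose2[OF lipschitz_on_continuous_on[OF f] Lc]) (use Lb in auto)
  define tau where "tau t s = Y t s /\<^sub>R norm (Y t s)" for t s
  have Yc': "continuous_on ({0..T} \<times> I) (\<lambda>p. Y (fst p) (snd p))" using Y(1) by (simp add: case_prod_beta)
  have Y0': "norm (Y t s) \<noteq> 0" if "t \<in> {0..T}" "s \<in> I" for t s using Yb(1)[OF that] C by linarith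
  have tauc': "continuous_on ({0..T} \<times> I) (\<lambda>p. tau (fst p) (snd p))" unfolding tau_def
    using Y0' by (intro continuous_intros Yc') auto
  have n1: "norm (tau t s) = 1" if "t \<in> {0..T}" "s \<in> I" for t s using Y0'[OF that] by (simp add: tau_def)
  define Z where "Z t s = V0 t s + f (L t) *\<^sub>R perp (tau t s)" for t s
  \<comment> \<open>At times with \<open>Q\<close> the flow equation makes \<open>r0\<close> the
    derivative of the tangent. It contains the representative \<open>V0\<close> of the time
    derivative, whose Lipschitz bound in space is provided by its H2 norm.\<close>
  define r0 where "r0 t s = norm (Y t s) *\<^sub>R Z t s" for t s
  have V0b: "norm (V0 t s) \<le> 8 * K" if "t \<in> {0..T}" "Q t" "s \<in> I" for t s
    using V0[OF that(1,2)] that(3) by (auto simp: H2_repr_def I_def)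
  have V0l: "norm (V0 t s' - V0 t s) \<le> 8 * K * \<bar>s' - s\<bar>" if tQ: "t \<in> {0..T}" "Q t" and s: "s \<in> I" "s' \<in> I" for t s s'
  proof -
    obtain y k c where "H2_repr (w t) K (V0 t) y k c" using V0[OF tQ] by blast
    then show ?thesis using s by (intro vector_derivative_bound[of I "V0 t" y]) (auto simp: H2_repr_def I_def)
  qed
  have td0: "(tau t has_vector_derivative r0 t s) (at s within I)" if tQ: "t \<in> {0..T}" "Q t" and s: "s \<in> I" for t s
  proof -
    obtain y k c where v: "H2_repr (w t) K (V0 t) y k c" using V0[OF tQ] by blast
    have "((\<lambda>s. Y t s /\<^sub>R norm (Y t s)) has_vector_derivative
        norm (Y t s) *\<^sub>R (V0 t s + f (L t) *\<^sub>R perp (Y t s /\<^sub>R norm (Y t s)))) (at s within \<I>)"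
    proof (rule tangent_equation[where x = "X t" and w = "w t" and C = C1])
      show "AE s in circle. w t s = (1 / speed (X t) s) *\<^sub>R weak_deriv (tangent (X t)) s - f (L t) *\<^sub>R perp (tangent (X t) s)"
        using tQ(2) unfolding Q_def per[OF tQ(1)] by blast
    qed (use v tQ Ys[OF tQ(1)] Yb(1)[OF tQ(1)] C dx[OF tQ(1)] s in \<open>auto simp: H2_repr_def I_def Q_def\<close>)
    then show ?thesis by (simp add: tau_def[abs_def] r0_def Z_def I_def)
  qed
  define B1 where "B1 = 8 * K + F"
  define B2 where "B2 = C2 * B1"
  define B3 where "B3 = 8 * K + F * B2"
  have B1: "0 \<le> B1" using K F0 by (simp add: B1_def)
  have C2: "0 \<le> C2" using order_trans[OF norm_ge_zero conjunct2[OF dxb[of 0 0]]] T by simp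
  have B2: "0 \<le> B2" "0 \<le> B3" using B1 C2 K F0 by (simp_all add: B2_def B3_def)
  have Zb: "norm (Z t s) \<le> B1" if "t \<in> {0..T}" "Q t" "s \<in> I" for t s
  proof -
    have "norm (f (L t) *\<^sub>R perp (tau t s)) \<le> F" using fb[OF that(1)] n1[OF that(1,3)] by (simp add: norm_perp)
    then show ?thesis unfolding Z_def B1_def by (intro norm_triangle_mono V0b that)
  qed
  have tl: "norm (tau t s' - tau t s) \<le> B2 * \<bar>s' - s\<bar>" if "t \<in> {0..T}" "Q t" "s \<in> I" "s' \<in> I" for t s s'
  proof (rule vector_derivative_bound[of I, OF _ td0[OF that(1,2)] _ that(4,3)])
    show "norm (r0 t x) \<le> B2" if "x \<in> I" for x
      unfolding r0_def B2_def using Yb(2) Zb \<open>t \<in> {0..T}\<close> \<open>Q t\<close> that C2 by (auto intro: mult_mono)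
  qed (simp_all add: I_def)
  have r0h: "norm (r0 t s' - r0 t s) \<le> (3 * C2 * B3 + K * B1) * sqrt \<bar>s' - s\<bar>"
    if tQ: "t \<in> {0..T}" "Q t" and s: "s \<in> I" "s' \<in> I" for t s s'
  proof -
    have "Z t s' - Z t s = (V0 t s' - V0 t s) + f (L t) *\<^sub>R perp (tau t s' - tau t s)"
      by (simp add: Z_def perp_diff scaleR_diff_right)
    also have "norm \<dots> \<le> 8 * K * \<bar>s' - s\<bar> + F * (B2 * \<bar>s' - s\<bar>)" using V0l[OF tQ s] fb[OF tQ(1)] tl[OF tQ s] F0
      by (intro norm_triangle_mono) (auto simp: norm_perp intro: mult_mono)
    also have "\<dots> = B3 * \<bar>s' - s\<bar>" by (simp add: B3_def algebra_simps)
    \<comment> \<open>The Lipschitz bound is weakened to exponent one half, the exponent of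
      \<open>extend_derivative\<close>; distances within the period are below 9.\<close>
    also have "\<dots> \<le> B3 * (3 * sqrt \<bar>s' - s\<bar>)"
    proof (rule mult_left_mono[OF _ B2(2)])
      have "\<bar>s' - s\<bar> \<le> 3^2" using s pi_less_4 by (auto simp: I_def)
      then have "sqrt \<bar>s' - s\<bar> \<le> 3" by (intro real_le_lsqrt) auto
      then have "sqrt \<bar>s' - s\<bar> * sqrt \<bar>s' - s\<bar> \<le> 3 * sqrt \<bar>s' - s\<bar>" by (rule mult_right_mono) simp
      then show "\<bar>s' - s\<bar> \<le> 3 * sqrt \<bar>s' - s\<bar>" by simp
    qed
    finally have z: "norm (Z t s' - Z t s) \<le> 3 * B3 * sqrt \<bar>s' - s\<bar>" by simp
    have y: "\<bar>norm (Y t s') - norm (Y t s)\<bar> \<le> K * sqrt \<bar>s' - s\<bar>"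
      using norm_triangle_ineq3[of "Y t s'" "Y t s"] Yh[OF tQ s] Y(3)[OF tQ] s by simp
    have "r0 t s' - r0 t s = norm (Y t s') *\<^sub>R (Z t s' - Z t s) + (norm (Y t s') - norm (Y t s)) *\<^sub>R Z t s"
      by (simp add: r0_def algebra_simps)
    also have "norm \<dots> \<le> C2 * (3 * B3 * sqrt \<bar>s' - s\<bar>) + (K * sqrt \<bar>s' - s\<bar>) * B1"
      using z y Yb(2)[OF tQ(1) s(2)] Zb[OF tQ s(1)] C2 K by (intro norm_triangle_mono) (auto intro!: mult_mono)
    finally show ?thesis by (simp add: algebra_simps)
  qed
  have C'0: "0 \<le> 3 * C2 * B3 + K * B1" using C2 B2 K B1 by simp
  have tex: "norm (tau t s' - tau t s - (s' - s) *\<^sub>R r0 t s) \<le> (3 * C2 * B3 + K * B1) * (\<bar>s' - s\<bar> * sqrt \<bar>s' - s\<bar>)"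
    if "t \<in> {0..T}" "Q t" "s \<in> \<I>" "s' \<in> \<I>" for t s s'
    by (rule holder_expansion[OF td0[OF that(1,2), unfolded I_def] r0h[OF that(1,2), unfolded I_def] C'0 that(3,4)])
  have tauc: "continuous_on ({0..T} \<times> \<I>) (\<lambda>(t, s). tau t s)" using tauc' by (simp add: case_prod_beta I_def)
  obtain r where r: "continuous_on ({0..T} \<times> I) (\<lambda>(t, s). r t s)"
    "\<And>t s. t \<in> {0..T} ==> s \<in> I ==> (tau t has_vector_derivative r t s) (at s within I)"
    "\<And>t s. t \<in> {0..T} ==> Q t ==> s \<in> I ==> r t s = r0 t s"
  proof (rule extend_derivative[OF T tauc Q C'0 tex], goal_cases)
    case (5 r')
    show ?case by (rule that[of r', unfolded I_def]) (rule 5; assumption)+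
  qed
  \<comment> \<open>The function space gives no continuity in time of the time derivative. Its
    continuous version is obtained by solving the flow equation for it, since the derivative
    \<open>r\<close> of the tangent is jointly continuous.\<close>
  define V where "V t s = r t s /\<^sub>R norm (Y t s) - f (L t) *\<^sub>R perp (tau t s)" for t s
  have VV0: "V t s = V0 t s" if "t \<in> {0..T}" "Q t" "s \<in> I" for t s
    using Y0'[OF that(1,3)] by (simp add: V_def r(3)[OF that] r0_def Z_def)
  have rc': "continuous_on ({0..T} \<times> I) (\<lambda>p. r (fst p) (snd p))" using r(1) by (simp add: case_prod_beta)
  have "continuous_on ({0..T} \<times> I) (\<lambda>p. V (fst p) (snd p))" unfolding V_def
    using Y0' by (intro continuous_intros rc' Yc' bounded_linear.continuous_on[OF bounded_linear_perp] tauc'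
        continuous_on_compose2[OF fLc]) auto
  then have Vc: "continuous_on ({0..T} \<times> I) (\<lambda>(t, s). V t s)" by (simp add: case_prod_beta)
  have ae: "AE t in lebesgue_on {0..T}. AE s in circle. w t s = V t s"
  proof -
    have "AE t in lebesgue_on {0..T}. t \<in> {0..T}" by (rule AE_I2) simp
    with Q show ?thesis
    proof eventually_elim
      case (elim t)
      obtain y k c where "H2_repr (w t) K (V0 t) y k c" using V0[OF elim(2,1)] by blast
      then have "AE s in circle. w t s = V0 t s" by (simp add: H2_repr_def)
      moreover have "AE s in circle. s \<in> I" by (rule AE_I2) (simp add: I_def)
      ultimately show ?case by eventually_elim (simp add: VV0[OF elim(2,1)])
    qed
  qed
  have F: "F \<le> G" using G(6) by (simp add: F_def)
  have Vs: "continuous_on {0..T} (\<lambda>t. V t s)" "continuous_on {0..T} (\<lambda>t. Y t s)" if "s \<in> I" for s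
    by (rule continuous_slices(2)[OF Vc that] continuous_slices(2)[OF Y(1) that])+
  have I0: "0 \<in> I" "2 * pi \<in> I" by (simp_all add: I_def)
  have Yper: "Y t 0 = Y t (2 * pi)" if t: "t \<in> {0..T}" for t
  proof -
    have "norm (Y t 0 - Y t (2 * pi)) \<le> 0"
    proof (rule dense_le[OF T _ Q _ t])
      show "continuous_on {0..T} (\<lambda>t. norm (Y t 0 - Y t (2 * pi)))" by (intro continuous_intros Vs I0)
      show "norm (Y t 0 - Y t (2 * pi)) \<le> 0" if "t \<in> {0..T}" "Q t" for t
        using Y0[OF that] Y(3)[OF that I0(1)] Y(3)[OF that I0(2)] by (auto simp: H2_repr_def)
    qed
    then show ?thesis by simp
  qed
  have "regular_flow f T M G X Y V"
  proof (rule regular_flow.intro)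
    show "M-lipschitz_on {0<..} f" "M \<le> G" "0 < T" "1 \<le> G" by (rule f G T)+
    fix t s assume t: "t \<in> {0..T}" and s: "s \<in> \<I>"
    note sI = s[folded I_def]
    show "(X t has_vector_derivative Y t s) (at s within \<I>)" using Y(2)[OF t sI] by (simp add: I_def)
    show "((\<lambda>t. X t s) has_vector_derivative V t s) (at t within {0..T})"
      by (rule time_derivative_classical[OF T Xc[unfolded I_def] wm w(2) Vc[unfolded I_def] ae t s])
    have "1 / G \<le> C1" using G(1,4) C by (simp add: field_simps)
    then show "1 / G \<le> norm (Y t s) \<and> norm (Y t s) \<le> G" using Yb[OF t sI] G(3) by linarith
    show Vb: "norm (V t s) \<le> G"
    proof (rule dense_le[OF T _ Q _ t])
      show "continuous_on {0..T} (\<lambda>t. norm (V t s))" by (intro continuous_intros Vs sI)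
      show "norm (V t s) \<le> G" if "t \<in> {0..T}" "Q t" for t using V0b[OF that sI] VV0[OF that sI] G(5) by simp
    qed
    have Zr: "norm (Y t s) *\<^sub>R (V t s + f (L t) *\<^sub>R perp (tau t s)) = r t s" using Y0'[OF t sI] by (simp add: V_def)
    then show "((\<lambda>s. Y t s /\<^sub>R norm (Y t s)) has_vector_derivative norm (Y t s) *\<^sub>R
          (V t s + f (integral \<I> (\<lambda>s. norm (Y t s))) *\<^sub>R perp (Y t s /\<^sub>R norm (Y t s)))) (at s within \<I>)"
      using r(2)[OF t sI] by (simp add: tau_def[abs_def] L_def I_def)
    \<comment> \<open>Differentiating the constant \<open>tau \<bullet> tau\<close> shows that the
      curvature vector is normal; so is the forcing term, and hence the velocity.\<close>
    have "((\<lambda>s. tau t s \<bullet> tau t s) has_vector_derivative tau t s \<bullet> r t s + r t s \<bullet> tau t s) (at s within I)"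
      by (rule bounded_bilinear.has_vector_derivative[OF bounded_bilinear_inner r(2)[OF t sI] r(2)[OF t sI]])
    moreover have "((\<lambda>s. tau t s \<bullet> tau t s) has_vector_derivative 0) (at s within I)"
      by (rule has_vector_derivative_transform[OF sI _ has_vector_derivative_const[of 1]])
        (use n1[OF t] in \<open>simp add: dot_square_norm\<close>)
    ultimately have "tau t s \<bullet> r t s + r t s \<bullet> tau t s = 0"
      using vector_derivative_unique_within_closed_interval[of 0 "2 * pi" s] s by (simp add: I_def)
    then have "r t s \<bullet> tau t s = 0" by (simp add: inner_commute)
    then have "(V t s + f (L t) *\<^sub>R perp (tau t s)) \<bullet> tau t s = 0" using Y0'[OF t sI] unfolding Zr[symmetric] by simp
    moreover have "perp (tau t s) \<bullet> tau t s = 0" by (rule inner_perp(2))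
    ultimately have "V t s \<bullet> tau t s = 0" by (simp add: inner_add_left)
    then show "V t s \<bullet> Y t s = 0" using Y0'[OF t sI] by (simp add: tau_def)
    fix s' assume "s' \<in> \<I>"
    then have s'I: "s' \<in> I" by (simp add: I_def)
    show "norm (V t s - V t s') \<le> G * \<bar>s - s'\<bar>"
    proof (rule dense_le[OF T _ Q _ t])
      show "continuous_on {0..T} (\<lambda>t. norm (V t s - V t s'))" by (intro continuous_intros Vs sI s'I)
      show "norm (V t s - V t s') \<le> G * \<bar>s - s'\<bar>" if "t \<in> {0..T}" "Q t" for t
        using order_trans[OF V0l[OF that s'I sI] mult_right_mono[OF G(5)]] VV0[OF that] sI s'I by simp
    qed
  next
    show "continuous_on ({0..T} \<times> \<I>) (\<lambda>(t, s). Y t s)" "continuous_on ({0..T} \<times> \<I>) (\<lambda>(t, s). V t s)"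
      using Y(1) Vc by (simp_all add: I_def)
    fix t assume t: "t \<in> {0..T}"
    show "\<bar>f (integral \<I> (\<lambda>s. norm (Y t s)))\<bar> \<le> G" using fb[OF t] F by (simp add: L_def I_def)
    show "X t 0 = X t (2 * pi)" "Y t 0 = Y t (2 * pi)" by (rule Xper[OF t] Yper[OF t])+
    have "r t 0 = r t (2 * pi)"
    proof -
      have "norm (r t 0 - r t (2 * pi)) \<le> 0"
      proof (rule dense_le[OF T _ Q _ t])
        show "continuous_on {0..T} (\<lambda>t. norm (r t 0 - r t (2 * pi)))" by (intro continuous_intros continuous_slices(2)[OF r(1)] I0)
        fix t assume tQ: "t \<in> {0..T}" "Q t"
        have "V0 t 0 = V0 t (2 * pi)" using V0[OF tQ] by (auto simp: H2_repr_def)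
        then show "norm (r t 0 - r t (2 * pi)) \<le> 0"
          using r(3)[OF tQ I0(1)] r(3)[OF tQ I0(2)] Yper[OF tQ(1)] by (simp add: r0_def Z_def tau_def)
      qed
      then show ?thesis by simp
    qed
    then show "V t 0 = V t (2 * pi)" by (simp add: V_def Yper[OF t] tau_def)
    fix N \<xi> s s' assume P: "is_partition N \<xi>"
      and ss: "\<And>j. j \<in> {1..N} ==> s j \<in> (cell \<xi> j) \<and> s' j \<in> (cell \<xi> j)"
    have inI: "s j \<in> I" "s' j \<in> I" if "j \<in> {1..N}" for j
      using ss[OF that] partition_cell_subset[OF P that] unfolding I_def by blast+
    show "(\<Sum>j=1..N. (norm (Y t (s j) - Y t (s' j)))^2) \<le> mesh_size N \<xi> * G^2"
    proof (rule dense_le[OF T _ Q _ t])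
      show "continuous_on {0..T} (\<lambda>t. \<Sum>j=1..N. (norm (Y t (s j) - Y t (s' j)))^2)" by (intro continuous_intros Vs inI)
      fix t assume tQ: "t \<in> {0..T}" "Q t"
      obtain k c where "H2_repr (X t) K (X t) (Y0 t) k c" using Y0[OF tQ] by blast
      then have k: "L2 k" "L2_norm k \<le> K" "\<And>s. Y0 t s = c + integral {0..s} k" by (auto simp: H2_repr_def)
      have "(\<Sum>j=1..N. (norm (Y t (s j) - Y t (s' j)))^2) = (\<Sum>j=1..N. (norm (Y0 t (s j) - Y0 t (s' j)))^2)"
        using Y(3)[OF tQ] inI by (intro sum.cong) auto
      also have "\<dots> \<le> mesh_size N \<xi> * (L2_norm k)^2" by (rule primitive_osc[OF k(1,3) P ss])
      also have "\<dots> \<le> mesh_size N \<xi> * G^2"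
      proof (intro mult_left_mono power_mono L2_norm_nonneg)
        show "L2_norm k \<le> G" using k(2) G(5) K by linarith
        have "1 \<in> {1..N}" using P by (cases N) (auto simp: is_partition_def)
        note this[THEN imageI, of "mesh_step \<xi>"] partition_step_pos[OF P this]
        then have "0 < mesh_step \<xi> 1" "mesh_step \<xi> 1 \<le> mesh_size N \<xi>"
          unfolding mesh_size_def by (simp add: mesh_step_def, intro Max_ge finite_imageI finite_atLeastAtMost)
        then show "0 \<le> mesh_size N \<xi>" by simp
      qed
      finally show "(\<Sum>j=1..N. (norm (Y t (s j) - Y t (s' j)))^2) \<le> mesh_size N \<xi> * G^2" .
    qed
  qed
  moreover have "L2 (time_deriv T X t)" if "t \<in> {0..T}" for t using H2_imp_L2[OF wH[OF that]] by (simp add: w_def)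
  ultimately show ?thesis using ae unfolding w_def by blast
qed

section \<open>The error in the Sobolev norms\<close>

context mesh begin

lemma lift_on_cell:
  assumes "k \<in> {1..N}" "s \<in> (cell \<xi> k)"
  shows "lift c s = c (prev_node N k) + ((s - \<xi> (k - 1)) / (\<xi> k - \<xi> (k - 1))) *\<^sub>R (c k - c (prev_node N k))"
  using pw_linear_on_cell[OF pw_linear_lift assms] lift_node[OF assms(1)] lift_node[OF pvJ[OF assms(1)]] by simp

lemma lift_continuous: "continuous_on S (lift c)"
  using pw_linear_lift[of c] continuous_on_subset[OF _ subset_UNIV] by (auto simp: pw_linear_def)

lemma integral_cells_le:
  fixes g :: "real \<Rightarrow> real"
  assumes g: "g absolutely_integrable_on \<I>"
    and b: "\<And>k s. k \<in> {1..N} ==> s \<in> {\<xi> (k - 1)<..<\<xi> k} ==> g s \<le> A k"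
  shows "integral \<I> g \<le> (\<Sum>k=1..N. mesh_step \<xi> k * A k)"
proof -
  have gi: "g integrable_on \<I>" by (rule set_lebesgue_integral_eq_integral(1)[OF g])
  show ?thesis unfolding integral_partition[OF P gi]
  proof (rule sum_mono)
    fix k assume k: "k \<in> {1..N}"
    define g' where "g' s = (if s \<in> {\<xi> (k - 1)<..<\<xi> k} then g s else A k)" for s
    have gk: "(g has_integral integral (cell \<xi> k) g) (cell \<xi> k)"
      using integrable_on_subinterval[OF gi] partition_cell_subset[OF P k] by (intro integrable_integral) blast
    have "(g' has_integral integral (cell \<xi> k) g) (cell \<xi> k)"
      by (rule has_integral_spike_finite[of "{\<xi> (k - 1), \<xi> k}", OF _ _ gk]) (auto simp: g'_def)
    moreover have "((\<lambda>s. A k) has_integral mesh_step \<xi> k * A k) (cell \<xi> k)"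
      using has_integral_const_real[of "A k" "\<xi> (k - 1)" "\<xi> k"] step_pos[OF k] by (simp add: mesh_step_def)
    ultimately show "integral (cell \<xi> k) g \<le> mesh_step \<xi> k * A k"
      by (rule has_integral_le) (use b[OF k] in \<open>simp add: g'_def\<close>)
  qed
qed

text \<open>On a cell the error is a convex combination of increments of \<open>u\<close>, of size
  \<open>G * H\<close>, plus one of the nodal errors at both ends. The factor 6 in front of the sum
  is 3, from squaring three terms, times 2, since every node belongs to two cells.\<close>

lemma L2_lift_error:
  assumes u: "continuous_on \<I> u" "u 0 = u (2 * pi)" and G: "0 \<le> G"
    and l: "\<And>s s'. s \<in> \<I> ==> s' \<in> \<I> ==> norm (u s - u s') \<le> G * \<bar>s - s'\<bar>"
    and H: "0 \<le> H" "\<And>k. k \<in> {1..N} ==> mesh_step \<xi> k \<le> H"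
  shows "integral \<I> (\<lambda>s. (norm (u s - lift c s))^2) \<le> 6 * pi * G^2 * H^2 + 6 * H * (\<Sum>k=1..N. (norm (u (\<xi> k) - c k))^2)"
proof -
  define a where "a k = norm (u (\<xi> k) - c k)" for k
  have node: "u (\<xi> (k - 1)) = u (\<xi> (prev_node N k))" if "k \<in> {1..N}" for k
    using that u(2) P by (auto simp: prev_node_def is_partition_def)
  have "integral \<I> (\<lambda>s. (norm (u s - lift c s))^2)
      \<le> (\<Sum>k=1..N. mesh_step \<xi> k * (3 * ((G * H)^2 + (a (prev_node N k))^2 + (a k)^2)))"
  proof (rule integral_cells_le)
    show "(\<lambda>s. (norm (u s - lift c s))^2) absolutely_integrable_on \<I>"
      by (intro absolutely_integrable_continuous_real continuous_intros u lift_continuous)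
    fix k s assume k: "k \<in> {1..N}" and s: "s \<in> {\<xi> (k - 1)<..<\<xi> k}"
    have s': "s \<in> (cell \<xi> k)" using s by simp
    have sub: "s \<in> \<I>" "\<xi> k \<in> \<I>" "\<xi> (k - 1) \<in> \<I>" using partition_cell_subset[OF P k] s s' step_pos[OF k] by auto
    define h where "h = \<xi> k - \<xi> (k - 1)"
    define \<theta> where "\<theta> = (s - \<xi> (k - 1)) / h"
    have h: "0 < h" "h \<le> H" using step_pos[OF k] H(2)[OF k] by (auto simp: h_def mesh_step_def)
    have \<theta>: "0 \<le> \<theta>" "\<theta> \<le> 1" using s h(1) by (auto simp: \<theta>_def h_def divide_le_eq_1)
    have d: "norm (u s - u (\<xi> k)) \<le> G * H" "norm (u s - u (\<xi> (k - 1))) \<le> G * H"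
    proof -
      have "\<bar>s - \<xi> k\<bar> \<le> H" "\<bar>s - \<xi> (k - 1)\<bar> \<le> H" using s h by (auto simp: h_def)
      then show "norm (u s - u (\<xi> k)) \<le> G * H" "norm (u s - u (\<xi> (k - 1))) \<le> G * H"
        using order_trans[OF l[OF sub(1,2)] mult_left_mono[OF _ G]] order_trans[OF l[OF sub(1,3)] mult_left_mono[OF _ G]] by blast+
    qed
    let ?p = "prev_node N k"
    have "u s - lift c s = ((1 - \<theta>) *\<^sub>R (u s - u (\<xi> (k - 1))) + \<theta> *\<^sub>R (u s - u (\<xi> k)))
        + ((1 - \<theta>) *\<^sub>R (u (\<xi> ?p) - c ?p) + \<theta> *\<^sub>R (u (\<xi> k) - c k))"
      unfolding lift_on_cell[OF k s'] h_def[symmetric] \<theta>_def[symmetric] node[OF k] by (simp add: algebra_simps)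
    also have "norm \<dots> \<le> ((1 - \<theta>) * (G * H) + \<theta> * (G * H)) + (1 * a ?p + 1 * a k)"
    proof (intro norm_triangle_mono)
      show "norm ((1 - \<theta>) *\<^sub>R (u s - u (\<xi> (k - 1)))) \<le> (1 - \<theta>) * (G * H)" "norm (\<theta> *\<^sub>R (u s - u (\<xi> k))) \<le> \<theta> * (G * H)"
        using d \<theta> by (auto intro: mult_left_mono)
      show "norm ((1 - \<theta>) *\<^sub>R (u (\<xi> ?p) - c ?p)) \<le> 1 * a ?p" "norm (\<theta> *\<^sub>R (u (\<xi> k) - c k)) \<le> 1 * a k"
        unfolding a_def norm_scaleR using \<theta> by (intro mult_right_mono; simp)+
    qed
    finally have "norm (u s - lift c s) \<le> G * H + a ?p + a k" by (simp add: algebra_simps)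
    then have "(norm (u s - lift c s))^2 \<le> (G * H + a ?p + a k)^2" by (rule power_mono) simp
    also have "\<dots> \<le> 3 * ((G * H)^2 + (a ?p)^2 + (a k)^2)" by (rule square_add3_le)
    finally show "(norm (u s - lift c s))^2 \<le> 3 * ((G * H)^2 + (a ?p)^2 + (a k)^2)" .
  qed
  also have "\<dots> \<le> (\<Sum>k=1..N. 3 * (G * H)^2 * mesh_step \<xi> k + 3 * H * ((a (prev_node N k))^2 + (a k)^2))"
  proof (rule sum_mono)
    fix k assume k: "k \<in> {1..N}"
    have "mesh_step \<xi> k * (3 * ((a (prev_node N k))^2 + (a k)^2)) \<le> H * (3 * ((a (prev_node N k))^2 + (a k)^2))"
      by (rule mult_right_mono[OF H(2)[OF k]]) simp
    then show "mesh_step \<xi> k * (3 * ((G * H)^2 + (a (prev_node N k))^2 + (a k)^2))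
        \<le> 3 * (G * H)^2 * mesh_step \<xi> k + 3 * H * ((a (prev_node N k))^2 + (a k)^2)" by (simp add: algebra_simps)
  qed
  also have "\<dots> = 3 * (G * H)^2 * (2 * pi) + 3 * H * ((\<Sum>k=1..N. (a (prev_node N k))^2) + (\<Sum>k=1..N. (a k)^2))"
    by (simp only: sum.distrib sum_distrib_left[symmetric] sum_mesh_step[OF P])
  also have "(\<Sum>k=1..N. (a (prev_node N k))^2) = (\<Sum>k=1..N. (a k)^2)" by (rule sum_pv)
  finally show ?thesis by (simp add: a_def power_mult_distrib algebra_simps)
qed

text \<open>In a cell the derivative error is \<open>Y s\<close> minus the mean slope of
  \<open>X\<close>, bounded by the oscillation \<open>w k\<close>, plus the edge error divided by
  the step. The cellwise derivative is recognized as the weak one because it integrates back to the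
  continuous difference, the nodes being finitely many.\<close>

lemma H1_lift_error:
  assumes X: "continuous_on UNIV X" "\<And>s. s \<in> \<I> ==> (X has_vector_derivative Y s) (at s within \<I>)"
    and Y: "continuous_on \<I> Y" and per: "X 0 = X (2 * pi)"
    and w: "\<And>k s s'. k \<in> {1..N} ==> s \<in> (cell \<xi> k) ==> s' \<in> (cell \<xi> k) ==> norm (Y s - Y s') \<le> w k"
    and H: "\<And>k. k \<in> {1..N} ==> mesh_step \<xi> k \<le> H" and m: "0 < m" "\<And>k. k \<in> {1..N} ==> m \<le> mesh_step \<xi> k"
  shows "H1 (\<lambda>s. X s - lift c s)"
    and "(L2_norm (weak_deriv (\<lambda>s. X s - lift c s)))^2 \<le> 2 * H * (\<Sum>k=1..N. (w k)^2)
      + 2 / m * (\<Sum>k=1..N. (norm ((X (\<xi> k) - X (\<xi> (k - 1))) - edge c k))^2)"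
proof -
  define D where "D s = X s - lift c s" for s
  define g where "g s = Y s - dxi (lift c) s" for s
  define e where "e k = edge c k /\<^sub>R (\<xi> k - \<xi> (k - 1))" for k
  have lper: "lift c 0 = lift c (2 * pi)" using pw_linear_lift[of c] unfolding pw_linear_def periodic_def by (metis add_0)
  have gk: "g s = Y s - e k" if "k \<in> {1..N}" "s \<in> {\<xi> (k - 1)<..<\<xi> k}" for k s
    unfolding g_def e_def edge_def dxi_on_cell[OF pw_linear_lift that] lift_node[OF that(1)] lift_node[OF pvJ[OF that(1)]] ..
  have Yk: "continuous_on (cell \<xi> k) Y" if "k \<in> {1..N}" for k by (rule continuous_on_subset[OF Y partition_cell_subset[OF P that]])
  have gi: "g absolutely_integrable_on \<I>"
    by (rule piecewise_integral(1)[of "\<lambda>k s. Y s - e k" g]) (intro continuous_intros Yk, assumption, rule gk)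
  have g2i: "(\<lambda>s. (norm (g s))^2) absolutely_integrable_on \<I>"
    by (rule piecewise_integral(1)[of "\<lambda>k s. (norm (Y s - e k))^2"]) (intro continuous_intros Yk, assumption, simp only: gk)
  have gL2: "L2 g" using gi g2i unfolding L2_def integrable_circle_iff[symmetric] by auto
  have Dc: "continuous_on UNIV D" unfolding D_def by (intro continuous_intros X(1) lift_continuous)
  have prim: "D b = D 0 + integral {0..b} g" if b: "b \<in> \<I>" for b
  proof -
    have "(g has_integral D b - D 0) {0..b}"
    proof (rule fundamental_theorem_of_calculus_strong[of "\<xi> ` {0..N}"])
      fix s assume s: "s \<in> {0..b} - \<xi> ` {0..N}"
      then have "0 \<le> s" "s \<le> 2 * pi" using b by auto
      then obtain k where k: "k \<in> {1..N}" "s \<in> (cell \<xi> k)" by (rule partition_cover[OF P])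
      have "k - 1 \<in> {0..N}" "k \<in> {0..N}" using k(1) by auto
      then have "s \<noteq> \<xi> (k - 1)" "s \<noteq> \<xi> k" using s by blast+
      then have sk: "s \<in> {\<xi> (k - 1)<..<\<xi> k}" using k(2) by auto
      have "s \<in> interior \<I>"
      proof -
        have "\<xi> (k - 1) \<in> \<I>" "\<xi> k \<in> \<I>" using partition_cell_subset[OF P k(1)] step_pos[OF k(1)] by auto
        then show ?thesis using sk by simp
      qed
      then have "at s within \<I> = at s" by (rule at_within_interior)
      then have "(X has_vector_derivative Y s) (at s)" using X(2)[of s] \<open>0 \<le> s\<close> \<open>s \<le> 2 * pi\<close> by simp
      moreover have "(lift c has_vector_derivative dxi (lift c) s) (at s)"
        using pw_linear_has_derivative[OF pw_linear_lift k(1) sk] dxi_on_cell[OF pw_linear_lift k(1) sk] by simp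
      ultimately show "(D has_vector_derivative g s) (at s)" unfolding D_def g_def by (rule has_vector_derivative_diff)
    qed (use b in \<open>auto intro: continuous_on_subset[OF Dc]\<close>)
    then show ?thesis by (simp add: integral_unique)
  qed
  have "is_weak_deriv D g"
  proof (rule primitive_imp_weak_deriv[where c = "D 0"])
    show "integrable circle g" using gi by (simp add: integrable_circle_iff)
    show "AE s in circle. D s = D 0 + integral {0..s} g" by (rule AE_I2, rule prim) simp
    show "integral \<I> g = 0" using prim[of "2 * pi"] per lper by (simp add: D_def)
    show "D \<in> borel_measurable circle" by (rule continuous_measurable_circle[OF Dc])
  qed
  note wd = this
  then have H1D: "H1 D" unfolding H1_def using L2_continuous[OF Dc] gL2 by blast
  then show "H1 (\<lambda>s. X s - lift c s)" by (simp add: D_def[abs_def])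
  have "AE s in circle. weak_deriv D s = g s"
    by (rule weak_deriv_unique[OF L2_integrable[OF H1_weak_deriv(1)[OF H1D]] L2_integrable[OF gL2] H1_weak_deriv(2)[OF H1D] wd])
  then have "(L2_norm (weak_deriv D))^2 = (L2_norm g)^2" unfolding L2_norm_squared using H1_weak_deriv(1)[OF H1D] gL2
    by (intro integral_cong_AE) (auto simp: L2_def)
  also have "\<dots> = integral \<I> (\<lambda>s. (norm (g s))^2)" by (rule L2_norm_sq_integral[OF gL2])
  also have "\<dots> \<le> (\<Sum>k=1..N. mesh_step \<xi> k * (2 * ((w k)^2 + (norm ((X (\<xi> k) - X (\<xi> (k - 1))) - edge c k) / mesh_step \<xi> k)^2)))"
  proof (rule integral_cells_le[OF g2i])
    fix k s assume k: "k \<in> {1..N}" and s: "s \<in> {\<xi> (k - 1)<..<\<xi> k}"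
    define h where "h = \<xi> k - \<xi> (k - 1)"
    have h: "h > 0" using step_pos[OF k] by (simp add: h_def)
    define \<Delta> where "\<Delta> = X (\<xi> k) - X (\<xi> (k - 1))"
    note sub = partition_cell_subset[OF P k]
    have "(Y has_integral \<Delta>) (cell \<xi> k)" unfolding \<Delta>_def
    proof (rule fundamental_theorem_of_calculus)
      show "(X has_vector_derivative Y r) (at r within (cell \<xi> k))" if "r \<in> (cell \<xi> k)" for r
        using has_vector_derivative_within_subset[OF X(2) sub] that sub by blast
    qed (use step_pos[OF k] in simp)
    moreover have "((\<lambda>r. Y s) has_integral h *\<^sub>R Y s) (cell \<xi> k)"
      using has_integral_const_real[of "Y s" "\<xi> (k - 1)" "\<xi> k"] step_pos[OF k] by (simp add: h_def)
    ultimately have "((\<lambda>r. Y s - Y r) has_integral h *\<^sub>R Y s - \<Delta>) (cell \<xi> k)" by (intro has_integral_diff)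
    then have "norm (h *\<^sub>R Y s - \<Delta>) \<le> w k * h" unfolding h_def
    proof (rule has_integral_norm_le)
      show "\<xi> (k - 1) \<le> \<xi> k" using step_pos[OF k] by simp
      show "norm (Y s - Y r) \<le> w k" if "r \<in> (cell \<xi> k)" for r using w[OF k _ that] s by simp
      show "0 \<le> w k" using w[OF k, of s s] s by simp
    qed
    moreover have "h *\<^sub>R (Y s - \<Delta> /\<^sub>R h) = h *\<^sub>R Y s - \<Delta>" using h by (simp add: scaleR_diff_right)
    then have "norm (h *\<^sub>R Y s - \<Delta>) = h * norm (Y s - \<Delta> /\<^sub>R h)" using h by (metis abs_of_pos norm_scaleR)
    ultimately have a: "norm (Y s - \<Delta> /\<^sub>R h) \<le> w k" using h by (simp add: mult.commute)
    have "g s = (Y s - \<Delta> /\<^sub>R h) + (\<Delta> - edge c k) /\<^sub>R h" using gk[OF k s] by (simp add: e_def h_def scaleR_diff_right)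
    also have "norm \<dots> \<le> w k + norm (\<Delta> - edge c k) / h" using h
      by (intro norm_triangle_mono a) (simp add: divide_inverse mult.commute)
    finally have "(norm (g s))^2 \<le> (w k + norm (\<Delta> - edge c k) / h)^2" by (rule power_mono) simp
    also have "\<dots> \<le> 2 * ((w k)^2 + (norm (\<Delta> - edge c k) / h)^2)" by (rule square_add2_le)
    finally show "(norm (g s))^2 \<le> 2 * ((w k)^2 + (norm ((X (\<xi> k) - X (\<xi> (k - 1))) - edge c k) / mesh_step \<xi> k)^2)"
      by (simp add: \<Delta>_def h_def mesh_step_def)
  qed
  also have "\<dots> \<le> (\<Sum>k=1..N. 2 * H * (w k)^2 + 2 / m * (norm ((X (\<xi> k) - X (\<xi> (k - 1))) - edge c k))^2)"
  proof (rule sum_mono)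
    fix k assume k: "k \<in> {1..N}"
    define h where "h = mesh_step \<xi> k"
    define n where "n = norm ((X (\<xi> k) - X (\<xi> (k - 1))) - edge c k)"
    have h: "0 < h" "h \<le> H" "m \<le> h" using m H k by (force simp: h_def)+
    have "h * (w k)^2 \<le> H * (w k)^2" using h by (intro mult_right_mono) auto
    moreover have "n^2 / h \<le> n^2 / m" using h m(1) by (intro divide_left_mono) auto
    moreover have "h * (n / h)^2 = n^2 / h" using h by (simp add: power2_eq_square)
    ultimately show "mesh_step \<xi> k * (2 * ((w k)^2 + (norm ((X (\<xi> k) - X (\<xi> (k - 1))) - edge c k) / mesh_step \<xi> k)^2))
        \<le> 2 * H * (w k)^2 + 2 / m * (norm ((X (\<xi> k) - X (\<xi> (k - 1))) - edge c k))^2"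
      unfolding h_def[symmetric] n_def[symmetric] by (simp add: distrib_left)
  qed
  finally show "(L2_norm (weak_deriv (\<lambda>s. X s - lift c s)))^2 \<le> 2 * H * (\<Sum>k=1..N. (w k)^2)
      + 2 / m * (\<Sum>k=1..N. (norm ((X (\<xi> k) - X (\<xi> (k - 1))) - edge c k))^2)"
    by (simp add: D_def[abs_def] sum.distrib sum_distrib_left)
qed

end

section \<open>Assembly of the error estimate\<close>

lemma increment_square_le:
  fixes e v :: "real \<Rightarrow> real^2"
  assumes e: "\<And>t. t \<in> {0..T} ==> (e has_vector_derivative v t) (at t within {0..T})" and v: "continuous_on {0..T} v"
    and e0: "e 0 = 0" and t: "t \<in> {0..T}"
  shows "(norm (e t))^2 \<le> T * integral {0..T} (\<lambda>t. (norm (v t))^2)"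
proof (cases "t = 0")
  case False
  then have t0: "0 < t" "t \<le> T" using t by auto
  have sub: "{0..t} \<subseteq> {0..T}" using t0 by auto
  have "(v has_integral e t - e 0) {0..t}"
  proof (rule fundamental_theorem_of_calculus)
    show "(e has_vector_derivative v x) (at x within {0..t})" if "x \<in> {0..t}" for x
      using has_vector_derivative_within_subset[OF e sub] that sub by blast
  qed (use t0 in simp)
  then have "e t = integral {0..t} v" by (simp add: e0 integral_unique)
  moreover have i: "(\<lambda>t. (norm (v t))^2) integrable_on {0..T}" "(\<lambda>t. (norm (v t))^2) integrable_on {0..t}" "v integrable_on {0..t}"
    by (intro integrable_continuous_real continuous_intros continuous_on_subset[OF v] sub order_refl)+
  ultimately have "(norm (e t))^2 \<le> t * integral {0..t} (\<lambda>t. (norm (v t))^2)" using integral_square_le[OF t0(1) i(3,2)] by simp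
  also have "\<dots> \<le> T * integral {0..T} (\<lambda>t. (norm (v t))^2)"
    using t0 by (intro mult_mono integral_subset_le sub i integral_nonneg) auto
  finally show ?thesis .
next
  case True
  then show ?thesis using t by (simp add: e0 integral_nonneg integrable_continuous_real continuous_intros v)
qed

text \<open>The conclusion of the theorem as a predicate in the time derivative \<open>w\<close> and
  the constant \<open>C\<close>, so that it can be folded as a whole.\<close>

definition error_estimate ::
  "(real \<Rightarrow> real) \<Rightarrow> real \<Rightarrow> nat \<Rightarrow> (nat \<Rightarrow> real) \<Rightarrow> (real \<Rightarrow> real^2) \<Rightarrow> (real \<Rightarrow> real \<Rightarrow> real^2) \<Rightarrow> (real \<Rightarrow> real \<Rightarrow> real^2) \<Rightarrow> real \<Rightarrow> bool" where
  "error_estimate f T N \<xi> X0 X w C \<longleftrightarrow> (\<exists>x. semidiscrete_solution f T N \<xi> X0 x \<and>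
     (\<forall>y. semidiscrete_solution f T N \<xi> X0 y \<longrightarrow> (\<forall>t\<in>{0..T}. \<forall>s. y t s = x t s)) \<and>
     (\<forall>t\<in>{0..T}. L2 (\<lambda>s. w t s - dt T x t s) \<and> H1 (\<lambda>s. X t s - x t s)) \<and>
     set_integrable lebesgue {0..T} (\<lambda>t. (L2_norm (\<lambda>s. w t s - dt T x t s))^2) \<and>
     bdd_above ((\<lambda>t. (H1_norm (\<lambda>s. X t s - x t s))^2) ` {0..T}) \<and>
     (LINT t:{0..T}|lebesgue. (L2_norm (\<lambda>s. w t s - dt T x t s))^2) + (SUP t\<in>{0..T}. (H1_norm (\<lambda>s. X t s - x t s))^2)
       \<le> C * (mesh_size N \<xi>)^2)"

text \<open>The first bracket of the constant belongs to the velocity error. In the second, the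
  first two summands come from the L2 norm of the position error and the last two from its
  derivative.\<close>

theorem semidiscrete_estimate:
  fixes cp cP :: real
  assumes reg: "regular_flow f T M G X Y V" and w2: "\<And>t. t \<in> {0..T} ==> L2 (w t)"
    and ae: "AE t in lebesgue_on {0..T}. AE s in circle. w t s = V t s"
    and Xc: "\<And>t. t \<in> {0..T} ==> continuous_on UNIV (X t)" and X0: "X 0 = X0"
    and P: "is_partition N \<xi>" and Rm: "regular_mesh cp cP N \<xi>" and cp: "0 < cp" "1 / cp \<le> G" and cP: "cP \<le> G"
    and B: "B = 784 * G ^ 14" and E: "E = exp (6000000 * B ^ 17 * T)" and small: "mesh_size N \<xi> * E < (1 / (19200 * B ^ 9))^2"
  shows "error_estimate f T N \<xi> X0 X w ((6 * pi * G^2 * T + 24 * B * E) + (6 * pi * G^2 + 24 * B * E * T + 2 * G^2 + 36 * B^2 * E / cp))"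
proof -
  interpret R: regular_flow f T M G X Y V by (rule reg)
  interpret mesh N \<xi> by (rule mesh.intro[OF P])
  define H where "H = mesh_size N \<xi>"
  note mb = mesh_bounds[OF P Rm cp(1), folded H_def]
  have G0: "0 \<le> G" using R.G by simp
  obtain xx v where a: "\<And>j. j \<in> {1..N} ==> xx j 0 = X 0 (\<xi> j)"
    "\<And>j t. j \<in> {1..N} ==> t \<in> {0..T} ==> (xx j has_vector_derivative v j t) (at t within {0..T})"
    "\<And>j t. j \<in> {1..N} ==> t \<in> {0..T} ==> v j t = flow_field f (\<Sum>i=1..N. norm (xx i t - xx (prev_node N i) t)) (\<lambda>k. xx k t) j"
    "\<And>j. j \<in> {1..N} ==> continuous_on {0..T} (v j)"
    "\<And>j t. j \<in> {1..N} ==> t \<in> {0..T} ==> xx j t \<noteq> xx (prev_node N j) t"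
    "\<And>t. t \<in> {0..T} ==> (\<Sum>j=1..N. (norm ((X t (\<xi> j) - X t (\<xi> (j - 1))) - (xx j t - xx (prev_node N j) t)))^2) \<le> 18 * B^2 * E * H ^ 3"
    "integral {0..T} (\<lambda>t. \<Sum>j=1..N. (norm (V t (\<xi> j) - v j t))^2) \<le> 4 * B * E * H"
  proof (rule R.nodal_error[OF P Rm cp cP B E small], goal_cases)
    case (1 x v)
    show ?case by (rule that[of x v]) (unfold H_def, (rule 1; assumption)+)
  qed
  define x where "x t = lift (\<lambda>j. xx j t)" for t
  have ne: "edge (\<lambda>k. xx k t) j \<noteq> 0" if "j \<in> {1..N}" "t \<in> {0..T}" for j t using a(5)[OF that] by (simp add: edge_def)
  have ode: "(xx j has_vector_derivative flow_field f (perim (\<lambda>k. xx k t)) (\<lambda>k. xx k t) j) (at t within {0..T})"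
    if "j \<in> {1..N}" "t \<in> {0..T}" for j t using a(2)[OF that] unfolding a(3)[OF that] edge_def .
  have sol: "semidiscrete_solution f T N \<xi> X0 x"
    unfolding semidiscrete_solution_iff[OF R.T] using ne ode a(1) X0 by (intro exI[of _ xx]) (auto simp: x_def)
  have uniq: "y t s = x t s" if y: "semidiscrete_solution f T N \<xi> X0 y" and t: "t \<in> {0..T}" for y t s
  proof -
    obtain c where c: "\<forall>t\<in>{0..T}. \<forall>s. y t s = lift (\<lambda>j. c j t) s" "\<forall>t\<in>{0..T}. \<forall>j\<in>{1..N}. edge (\<lambda>k. c k t) j \<noteq> 0"
      "\<forall>j\<in>{1..N}. c j 0 = X0 (\<xi> j)" "\<forall>t\<in>{0..T}. \<forall>j\<in>{1..N}. (c j has_vector_derivative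
         flow_field f (perim (\<lambda>k. c k t)) (\<lambda>k. c k t) j) (at t within {0..T})"
      using y unfolding semidiscrete_solution_iff[OF R.T] by blast
    have "c j t = xx j t" if "j \<in> {1..N}" for j
      by (rule flow_field_unique[OF R.f less_imp_le[OF R.T] _ ode _ ne _ that t]) (use c a(1) X0 in simp_all)
    then show ?thesis using c(1) t by (simp add: x_def lift_def)
  qed
  have dtx: "dt T x t = lift (\<lambda>j. v j t)" if t: "t \<in> {0..T}" for t
    by (rule dt_lift[OF R.T _ a(2)[OF _ t] t]) (simp_all add: x_def)
  have XY: "\<And>s. s \<in> \<I> ==> (X t has_vector_derivative Y t s) (at s within \<I>)" if "t \<in> {0..T}" for t
    by (rule R.X_space[OF that])
  have Ynode: "\<xi> j \<in> \<I>" if "j \<in> {1..N}" for j using partition_cell_subset[OF P that] step_pos[OF that] by auto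
  define A where "A t = (\<Sum>j=1..N. (norm (V t (\<xi> j) - v j t))^2)" for t
  have Vn: "continuous_on {0..T} (\<lambda>t. V t (\<xi> j))" if "j \<in> {1..N}" for j
    by (rule continuous_slices(2)[OF R.V_cont Ynode[OF that]])
  have nc: "continuous_on {0..T} (\<lambda>t. (norm (V t (\<xi> j) - v j t))^2)" if "j \<in> {1..N}" for j
    by (intro continuous_intros Vn a(4) that)
  have Ac: "continuous_on {0..T} A" unfolding A_def by (intro continuous_on_sum nc)
  have Ai: "integral {0..T} A \<le> 4 * B * E * H" using a(7) by (simp add: A_def[abs_def])
  have Asum: "integral {0..T} A = (\<Sum>j=1..N. integral {0..T} (\<lambda>t. (norm (V t (\<xi> j) - v j t))^2))"
    unfolding A_def by (intro Henstock_Kurzweil_Integration.integral_sum integrable_continuous_real nc) simp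
  have L2d: "L2 (\<lambda>s. w t s - dt T x t s)" if t: "t \<in> {0..T}" for t
    unfolding dtx[OF t] by (intro L2_diff w2[OF t] L2_continuous lift_continuous)
  \<comment> \<open>The squared velocity error with the continuous \<open>V\<close> in place of
    \<open>w\<close>. It is continuous in time and agrees with the required quantity at almost every
    time, which gives integrability and the value of the integral.\<close>
  define \<Psi> where "\<Psi> t = integral \<I> (\<lambda>s. (norm (V t s - lift (\<lambda>j. v j t) s))^2)" for t
  have \<Psi>c: "continuous_on {0..T} \<Psi>" unfolding \<Psi>_def[abs_def]
  proof (rule continuous_partial_integral)
    have hc: "continuous_on S (hat N \<xi> j)" if "j \<in> {1..N}" for j S
      using hat_props(1)[OF P that] continuous_on_subset[OF _ subset_UNIV] by (auto simp: pw_linear_def)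
    have "continuous_on ({0..T} \<times> \<I>) (\<lambda>p. V (fst p) (snd p))" using R.V_cont by (simp add: case_prod_beta)
    moreover have "continuous_on ({0..T} \<times> \<I>) (\<lambda>p. lift (\<lambda>j. v j (fst p)) (snd p))" unfolding lift_def
      by (intro continuous_on_sum continuous_on_scaleR continuous_on_compose2[OF hc[of _ UNIV]] continuous_on_compose2[OF a(4)] continuous_on_fst continuous_on_snd continuous_on_id) auto
    ultimately have "continuous_on ({0..T} \<times> \<I>) (\<lambda>p. (norm (V (fst p) (snd p) - lift (\<lambda>j. v j (fst p)) (snd p)))^2)"
      by (intro continuous_on_power continuous_on_norm continuous_on_diff)
    then show "continuous_on ({0..T} \<times> \<I>) (\<lambda>(t, s). (norm (V t s - lift (\<lambda>j. v j t) s))^2)" by (simp add: case_prod_beta)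
  qed
  have \<Psi>b: "\<Psi> t \<le> 6 * pi * G^2 * H^2 + 6 * H * A t" if t: "t \<in> {0..T}" for t unfolding \<Psi>_def A_def
    by (rule L2_lift_error[OF continuous_slices(1)[OF R.V_cont t] R.per(3)[OF t] G0 R.V_lip[OF t] less_imp_le[OF mb(1)] mb(2)])
  have \<Psi>i: "integral {0..T} \<Psi> \<le> (6 * pi * G^2 * T + 24 * B * E) * H^2"
  proof -
    have i: "(\<Psi> has_integral integral {0..T} \<Psi>) {0..T}" "(A has_integral integral {0..T} A) {0..T}"
      by (intro integrable_integral integrable_continuous_real \<Psi>c Ac)+
    have c: "((\<lambda>t. 6 * pi * G^2 * H^2) has_integral T * (6 * pi * G^2 * H^2)) {0..T}"
      using has_integral_const_real[of "6 * pi * G^2 * H^2" 0 T] R.T by simp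
    have "integral {0..T} \<Psi> \<le> T * (6 * pi * G^2 * H^2) + 6 * H * integral {0..T} A"
      by (rule has_integral_le[OF i(1) has_integral_add[OF c has_integral_mult_right[OF i(2)]] \<Psi>b])
    also have "6 * H * integral {0..T} A \<le> 6 * H * (4 * B * E * H)" using Ai mb(1) by (intro mult_left_mono) auto
    finally show ?thesis by (simp add: power2_eq_square algebra_simps)
  qed
  have eq\<Psi>: "(L2_norm (\<lambda>s. w t s - dt T x t s))^2 = \<Psi> t" if t: "t \<in> {0..T}" and wV: "AE s in circle. w t s = V t s" for t
  proof -
    have "(L2_norm (\<lambda>s. w t s - dt T x t s))^2 = integral \<I> (\<lambda>s. (norm (w t s - dt T x t s))^2)"
      by (rule L2_norm_sq_integral[OF L2d[OF t]])
    also have "\<dots> = \<Psi> t" unfolding \<Psi>_def dtx[OF t]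
      by (rule integral_cong_AE_lebesgue_on[OF _ order_refl]) (use wV in \<open>eventually_elim, simp\<close>)
    finally show ?thesis .
  qed
  obtain S where S: "negligible S" "\<And>t. t \<in> {0..T} - S ==> AE s in circle. w t s = V t s"
    using AE_lebesgue_on_negligible[OF ae] by blast
  let ?q = "\<lambda>t. (L2_norm (\<lambda>s. w t s - dt T x t s))^2"
  have q\<Psi>: "?q t = \<Psi> t" if "t \<in> {0..T} - S" for t using eq\<Psi> S(2)[OF that] that by simp
  have qi: "?q absolutely_integrable_on {0..T}"
    by (rule absolutely_integrable_spike[OF absolutely_integrable_continuous_real[OF \<Psi>c] S(1) q\<Psi>])
  have "(LINT t:{0..T}|lebesgue. ?q t) = integral {0..T} ?q" by (rule set_lebesgue_integral_eq_integral(2)[OF qi])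
  also have "\<dots> = integral {0..T} \<Psi>" by (rule integral_spike[OF S(1)]) (simp add: q\<Psi>)
  finally have qI: "(LINT t:{0..T}|lebesgue. ?q t) \<le> (6 * pi * G^2 * T + 24 * B * E) * H^2" using \<Psi>i by simp
  define C where "C = 6 * pi * G^2 + 24 * B * E * T + 2 * G^2 + 36 * B^2 * E / cp"
  have h1: "H1 (\<lambda>s. X t s - x t s)" "(H1_norm (\<lambda>s. X t s - x t s))^2 \<le> C * H^2" if t: "t \<in> {0..T}" for t
  proof -
    obtain os where os: "\<forall>j\<in>{1..N}. 0 \<le> os j \<and> os j \<le> 2 * G \<and> (\<forall>s\<in>(cell \<xi> j). \<forall>s'\<in>(cell \<xi> j). norm (Y t s - Y t s') \<le> os j)"
      "(\<Sum>j=1..N. (os j)^2) \<le> H * G^2" using R.exists_osc[OF t P] unfolding H_def by blast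
    have osb: "norm (Y t s - Y t s') \<le> os k" if "k \<in> {1..N}" "s \<in> (cell \<xi> k)" "s' \<in> (cell \<xi> k)" for k s s'
      using os(1) that by blast
    have m: "0 < cp * H" using cp mb(1) by simp
    have H2: "mesh_step \<xi> k \<le> H" "cp * H \<le> mesh_step \<xi> k" if "k \<in> {1..N}" for k by (rule mb(2)[OF that] mb(3)[OF that])+
    note he = H1_lift_error[where c = "\<lambda>j. xx j t", OF Xc[OF t] XY[OF t] R.Y_cont_slice[OF t] R.per(1)[OF t] osb H2(1) m H2(2)]
    show h: "H1 (\<lambda>s. X t s - x t s)" unfolding x_def by (rule he(1))
    have "(L2_norm (weak_deriv (\<lambda>s. X t s - x t s)))^2 \<le> 2 * H * (\<Sum>k=1..N. (os k)^2)
        + 2 / (cp * H) * (\<Sum>k=1..N. (norm ((X t (\<xi> k) - X t (\<xi> (k - 1))) - edge (\<lambda>j. xx j t) k))^2)"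
      unfolding x_def by (rule he(2))
    also have "\<dots> \<le> 2 * H * (H * G^2) + 2 / (cp * H) * (18 * B^2 * E * H ^ 3)"
      using os(2) a(6)[OF t] m mb(1) by (intro add_mono mult_left_mono) (auto simp: edge_def)
    also have "\<dots> = (2 * G^2 + 36 * B^2 * E / cp) * H^2" using cp(1) mb(1) by (simp add: field_simps power2_eq_square power3_eq_cube)
    finally have d: "(L2_norm (weak_deriv (\<lambda>s. X t s - x t s)))^2 \<le> (2 * G^2 + 36 * B^2 * E / cp) * H^2" .
    have Xl: "norm (X t s - X t s') \<le> G * \<bar>s - s'\<bar>" if "s \<in> \<I>" "s' \<in> \<I>" for s s'
      by (rule vector_derivative_bound[OF _ XY[OF t] _ that]) (use R.Y_bound[OF t] in auto)
    \<comment> \<open>The energy sees only edges and not positions; positions are recovered from the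
      vanishing initial error by integrating the velocity error in time.\<close>
    have en: "(norm (X t (\<xi> j) - xx j t))^2 \<le> T * integral {0..T} (\<lambda>t. (norm (V t (\<xi> j) - v j t))^2)" if j: "j \<in> {1..N}" for j
    proof (rule increment_square_le[OF _ _ _ t])
      show "((\<lambda>t. X t (\<xi> j) - xx j t) has_vector_derivative V t (\<xi> j) - v j t) (at t within {0..T})" if "t \<in> {0..T}" for t
        by (intro has_vector_derivative_diff R.X_time Ynode a(2) j that)
    qed (use a(1)[OF j] Vn[OF j] a(4)[OF j] in \<open>auto intro: continuous_on_diff\<close>)
    have "(\<Sum>j=1..N. (norm (X t (\<xi> j) - xx j t))^2) \<le> T * integral {0..T} A"
      unfolding Asum sum_distrib_left by (rule sum_mono[OF en])
    also have "\<dots> \<le> T * (4 * B * E * H)" using Ai R.T by (intro mult_left_mono) auto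
    finally have es: "(\<Sum>j=1..N. (norm (X t (\<xi> j) - xx j t))^2) \<le> T * (4 * B * E * H)" .
    have "(L2_norm (\<lambda>s. X t s - x t s))^2 = integral \<I> (\<lambda>s. (norm (X t s - x t s))^2)"
      using h by (intro L2_norm_sq_integral) (simp add: H1_def)
    also have "\<dots> \<le> 6 * pi * G^2 * H^2 + 6 * H * (\<Sum>j=1..N. (norm (X t (\<xi> j) - xx j t))^2)" unfolding x_def
      by (rule L2_lift_error[OF continuous_on_subset[OF Xc[OF t] subset_UNIV] R.per(1)[OF t] G0 Xl less_imp_le[OF mb(1)] mb(2)])
    also have "\<dots> \<le> 6 * pi * G^2 * H^2 + 6 * H * (T * (4 * B * E * H))" using es mb(1) by (intro add_left_mono mult_left_mono) auto
    finally have l: "(L2_norm (\<lambda>s. X t s - x t s))^2 \<le> (6 * pi * G^2 + 24 * B * E * T) * H^2"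
      by (simp add: power2_eq_square algebra_simps)
    have "(H1_norm (\<lambda>s. X t s - x t s))^2 = (L2_norm (\<lambda>s. X t s - x t s))^2 + (L2_norm (weak_deriv (\<lambda>s. X t s - x t s)))^2"
      by (simp add: H1_norm_def)
    then show "(H1_norm (\<lambda>s. X t s - x t s))^2 \<le> C * H^2" using l d by (simp add: C_def algebra_simps)
  qed
  have bdd: "bdd_above ((\<lambda>t. (H1_norm (\<lambda>s. X t s - x t s))^2) ` {0..T})"
    by (rule bdd_aboveI2[of _ _ "C * H^2"]) (rule h1(2))
  have sup: "(SUP t\<in>{0..T}. (H1_norm (\<lambda>s. X t s - x t s))^2) \<le> C * H^2" by (rule cSUP_least) (use R.T h1(2) in auto)
  show ?thesis unfolding error_estimate_def
  proof (intro exI[of _ x] conjI allI impI ballI)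
    show "semidiscrete_solution f T N \<xi> X0 x" by (rule sol)
    show "y t s = x t s" if "semidiscrete_solution f T N \<xi> X0 y" "t \<in> {0..T}" for y t s by (rule uniq[OF that])
    show "L2 (\<lambda>s. w t s - dt T x t s)" "H1 (\<lambda>s. X t s - x t s)" if "t \<in> {0..T}" for t by (rule L2d[OF that] h1(1)[OF that])+
    show "bdd_above ((\<lambda>t. (H1_norm (\<lambda>s. X t s - x t s))^2) ` {0..T})" by (rule bdd)
    show "set_integrable lebesgue {0..T} ?q" using qi .
    show "(LINT t:{0..T}|lebesgue. ?q t) + (SUP t\<in>{0..T}. (H1_norm (\<lambda>s. X t s - x t s))^2)
       \<le> ((6 * pi * G^2 * T + 24 * B * E) + (6 * pi * G^2 + 24 * B * E * T + 2 * G^2 + 36 * B^2 * E / cp)) * (mesh_size N \<xi>)^2"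
      using add_mono[OF qI sup] unfolding C_def H_def by (simp only: distrib_right[of "6 * pi * G^2 * T + 24 * B * E"])
  qed
qed

theorem theorem4p3:
  fixes f :: "real \<Rightarrow> real" and T c\<^sub>p c\<^sub>P C\<^sub>1 C\<^sub>2 K :: real
  assumes "\<exists>M. M-lipschitz_on {0<..} f"
    and "0 < T" and "0 < c\<^sub>p" and "0 < C\<^sub>1" and "C\<^sub>1 < C\<^sub>2"
  shows "\<exists>h\<^sub>0>0. \<exists>C. \<forall>X0 X N \<xi>.
      flow_solution f T X0 X \<and> W1inf_H2_norm T X = ereal K \<and>
      (\<forall>t\<in>{0..T}. \<forall>s. C\<^sub>1 \<le> norm (dxi (X t) s) \<and> norm (dxi (X t) s) \<le> C\<^sub>2) \<and>
      is_partition N \<xi> \<and> regular_mesh c\<^sub>p c\<^sub>P N \<xi> \<and> mesh_size N \<xi> \<le> h\<^sub>0 \<longrightarrow>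
      (\<exists>x. semidiscrete_solution f T N \<xi> X0 x \<and>
         (\<forall>y. semidiscrete_solution f T N \<xi> X0 y \<longrightarrow> (\<forall>t\<in>{0..T}. \<forall>s. y t s = x t s)) \<and>
         (\<forall>t\<in>{0..T}. L2 (\<lambda>s. time_deriv T X t s - dt T x t s) \<and> H1 (\<lambda>s. X t s - x t s)) \<and>
         set_integrable lebesgue {0..T}
           (\<lambda>t. (L2_norm (\<lambda>s. time_deriv T X t s - dt T x t s))\<^sup>2) \<and>
         bdd_above ((\<lambda>t. (H1_norm (\<lambda>s. X t s - x t s))\<^sup>2) ` {0..T}) \<and>
         (LINT t:{0..T}|lebesgue. (L2_norm (\<lambda>s. time_deriv T X t s - dt T x t s))\<^sup>2)
           + (SUP t\<in>{0..T}. (H1_norm (\<lambda>s. X t s - x t s))\<^sup>2)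
           \<le> C * (mesh_size N \<xi>)\<^sup>2)"
proof -
  obtain M where f: "M-lipschitz_on {0<..} f" using assms(1) by blast
  \<comment> \<open>\<open>G\<close> depends only on the Lipschitz constant and value of
    \<open>f\<close> and on the constants of the statement. All later constants are built from it,
    \<open>T\<close> and \<open>c\<^sub>p\<close>, so they are uniform in the solution and the
    mesh.\<close>
  define G where "G = Max {1, M, C\<^sub>2, 1 / C\<^sub>1, 8 * K, \<bar>f 1\<bar> + M * (1 + 2 * pi * C\<^sub>2), 1 / c\<^sub>p, c\<^sub>P}"
  have G: "1 \<le> G" "M \<le> G" "C\<^sub>2 \<le> G" "1 / C\<^sub>1 \<le> G" "8 * K \<le> G" "\<bar>f 1\<bar> + M * (1 + 2 * pi * C\<^sub>2) \<le> G"
    and cG: "1 / c\<^sub>p \<le> G" "c\<^sub>P \<le> G" unfolding G_def by (intro Max_ge; simp)+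
  define B where "B = 784 * G ^ 14"
  define E where "E = exp (6000000 * B ^ 17 * T)"
  \<comment> \<open>The factor 2 turns the bound on the mesh size into the strict inequality of
    \<open>small\<close>.\<close>
  define h0 where "h0 = (1 / (19200 * B ^ 9))^2 / (2 * E)"
  have B: "0 < B" using G(1) by (simp add: B_def)
  have E: "0 < E" by (simp add: E_def)
  have h0: "0 < h0" using B E by (simp add: h0_def)
  show ?thesis unfolding error_estimate_def[symmetric]
  proof (rule exI[of _ h0], intro conjI h0, rule exI, intro allI impI, elim conjE)
    fix X0 X N \<xi>
    assume sol: "flow_solution f T X0 X" and nrm: "W1inf_H2_norm T X = ereal K"
      and dxb: "\<forall>t\<in>{0..T}. \<forall>s. C\<^sub>1 \<le> norm (dxi (X t) s) \<and> norm (dxi (X t) s) \<le> C\<^sub>2"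
      and P: "is_partition N \<xi>" and Rm: "regular_mesh c\<^sub>p c\<^sub>P N \<xi>" and h: "mesh_size N \<xi> \<le> h0"
    have dxb': "C\<^sub>1 \<le> norm (dxi (X t) s) \<and> norm (dxi (X t) s) \<le> C\<^sub>2" if "t \<in> {0..T}" for t s
      using dxb that by simp
    have "\<exists>Y V. regular_flow f T M G X Y V \<and> (\<forall>t\<in>{0..T}. L2 (time_deriv T X t)) \<and>
        (AE t in lebesgue_on {0..T}. AE s in circle. time_deriv T X t s = V t s)"
      by (rule flow_solution_regular[OF f assms(2,4) sol nrm dxb' G])
    then obtain Y V where r: "regular_flow f T M G X Y V" "\<forall>t\<in>{0..T}. L2 (time_deriv T X t)"
      "AE t in lebesgue_on {0..T}. AE s in circle. time_deriv T X t s = V t s" by (elim exE conjE)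
    have Xc: "continuous_on UNIV (X t)" if "t \<in> {0..T}" for t
      using sol continuous_slices(1)[of "{0..T}" UNIV X t] that by (simp add: flow_solution_def)
    have X0: "X 0 = X0" using sol by (simp add: flow_solution_def)
    have "mesh_size N \<xi> * E \<le> h0 * E" using h E by simp
    also have "\<dots> = (1 / (19200 * B ^ 9))^2 / 2" using E by (simp add: h0_def)
    also have "\<dots> < (1 / (19200 * B ^ 9))^2" using B by simp
    finally have small: "mesh_size N \<xi> * E < (1 / (19200 * B ^ 9))^2" .
    show "error_estimate f T N \<xi> X0 X (time_deriv T X)
        ((6 * pi * G^2 * T + 24 * B * E) + (6 * pi * G^2 + 24 * B * E * T + 2 * G^2 + 36 * B^2 * E / c\<^sub>p))"
      using r(2) by (intro semidiscrete_estimate[OF r(1) _ r(3) Xc X0 P Rm assms(3) cG B_def E_def small]) simp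
  qed
qed

end
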